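(* There is an algorithm running in time $O(n)$ which takes as input a maximal path-like map $M$ with $n$ vertices and either returns a 3-realizer of $\mathbf{P}_{VEF}(M)$ or certifies that $\dim(\mathbf{P}_{VEF}(M)) = 4$.
   Context: A planar map consists of a finite planar multigraph with a plane drawing; $\mathbf{P}_{VEF}(M)$ is the poset on vertices, edges and faces ordered by incidence/inclusion (vertex below its incident edges and the faces on whose boundary it lies, edge below faces on whose boundary it lies). A 3-realizer of a poset is a family of three linear extensions whose intersection is the poset; the dimension is the minimum size of a realizer. A simple 2-connected outerplanar map has a unique Hamilton cycle; the other edges are chordal edges. The interior dual is the dual graph restricted to the bounded faces. $M$ is path-like if it is a simple 2-connected outerplanar map whose interior dual is a simple path (then the Hamilton cycle bounds the outer face), and maximal path-like if in addition every bounded face is a triangle. *)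

theory Defs
  imports
    "Graph_Theory.Digraph_Component"
    "Graph_Theory.Bidirected_Digraph"
    "HOL-Combinatorics.Orbits"
begin

section \<open>Planar maps\<close>

text \<open>
  A multigraph is a finite bidirected digraph: every edge is a pair of opposite arcs \<open>a\<close> and
  \<open>arev a\<close>. A plane drawing of a connected multigraph is given by its combinatorial map: the
  rotation system \<open>asucc\<close>, sending each arc to the next arc around its tail, subject to Euler's
  formula. A face is identified with the set of arcs traversed by its boundary walk. A drawing in
  the plane, as opposed to the sphere, in addition distinguishes the unbounded face.
\<close>

definition rotation_system ::
  "('v, 'a) pre_digraph \<Rightarrow> ('a \<Rightarrow> 'a) \<Rightarrow> ('a \<Rightarrow> 'a) \<Rightarrow> bool" where
  "rotation_system G arev asucc \<longleftrightarrow>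
     fin_digraph G \<and> bidirected_digraph G arev \<and> asucc permutes arcs G \<and>
     (\<forall>v\<in>verts G. out_arcs G v \<noteq> {} \<longrightarrow> cyclic_on asucc (out_arcs G v))"

definition face_of :: "('a \<Rightarrow> 'a) \<Rightarrow> ('a \<Rightarrow> 'a) \<Rightarrow> 'a \<Rightarrow> 'a set" where
  "face_of arev asucc a = orbit (asucc \<circ> arev) a"

definition face_set ::
  "('v, 'a) pre_digraph \<Rightarrow> ('a \<Rightarrow> 'a) \<Rightarrow> ('a \<Rightarrow> 'a) \<Rightarrow> 'a set set" where
  "face_set G arev asucc = face_of arev asucc ` arcs G"

definition planar_rotation ::
  "('v, 'a) pre_digraph \<Rightarrow> ('a \<Rightarrow> 'a) \<Rightarrow> ('a \<Rightarrow> 'a) \<Rightarrow> bool" where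
  "planar_rotation G arev asucc \<longleftrightarrow>
     rotation_system G arev asucc \<and> connected G \<and>
     card (verts G) + card (face_set G arev asucc) = card (arcs G) div 2 + 2"

record ('v, 'a) pmap =
  underlying :: "('v, 'a) pre_digraph"
  edge_rev :: "'a \<Rightarrow> 'a"
  edge_succ :: "'a \<Rightarrow> 'a"
  outer_face :: "'a set"

definition faces :: "('v, 'a) pmap \<Rightarrow> 'a set set" where
  "faces M = face_set (underlying M) (edge_rev M) (edge_succ M)"

definition planar_map :: "('v, 'a) pmap \<Rightarrow> bool" where
  "planar_map M \<longleftrightarrow>
     planar_rotation (underlying M) (edge_rev M) (edge_succ M) \<and> outer_face M \<in> faces M"

definition bounded_faces :: "('v, 'a) pmap \<Rightarrow> 'a set set" where
  "bounded_faces M = faces M - {outer_face M}"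


section \<open>Path-like maps\<close>

definition simple_map :: "('v, 'a) pmap \<Rightarrow> bool" where
  "simple_map M \<longleftrightarrow> loopfree_digraph (underlying M) \<and> nomulti_digraph (underlying M)"

definition two_connected :: "('v, 'a) pre_digraph \<Rightarrow> bool" where
  "two_connected G \<longleftrightarrow>
     3 \<le> card (verts G) \<and> connected G \<and> (\<forall>v\<in>verts G. connected (G \<restriction> (verts G - {v})))"

text \<open>
  Outerplanarity is a property of the underlying graph: some plane drawing of it, not necessarily
  the given one, has a face incident with all vertices.
\<close>

definition outerplanar :: "('v, 'a) pmap \<Rightarrow> bool" where
  "outerplanar M \<longleftrightarrow>
     (\<exists>asucc. planar_rotation (underlying M) (edge_rev M) asucc \<and>
        (\<exists>f\<in>face_set (underlying M) (edge_rev M) asucc. tail (underlying M) ` f = verts (underlying M)))"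

definition dual_graph :: "('v, 'a) pmap \<Rightarrow> ('a set, 'a) pre_digraph" where
  "dual_graph M =
     \<lparr> verts = faces M,
       arcs = arcs (underlying M),
       tail = face_of (edge_rev M) (edge_succ M),
       head = face_of (edge_rev M) (edge_succ M) \<circ> edge_rev M \<rparr>"

definition interior_dual :: "('v, 'a) pmap \<Rightarrow> ('a set, 'a) pre_digraph" where
  "interior_dual M = dual_graph M \<restriction> bounded_faces M"

definition is_simple_path :: "('v, 'a) pre_digraph \<Rightarrow> bool" where
  "is_simple_path G \<longleftrightarrow>
     nomulti_digraph G \<and>
     (\<exists>vs. vs \<noteq> [] \<and> distinct vs \<and> set vs = verts G \<and>
        (\<forall>i<length vs. \<forall>j<length vs. vs ! i \<rightarrow>\<^bsub>G\<^esub> vs ! j \<longleftrightarrow> i = Suc j \<or> j = Suc i))"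

definition path_like :: "('v, 'a) pmap \<Rightarrow> bool" where
  "path_like M \<longleftrightarrow>
     planar_map M \<and> simple_map M \<and> two_connected (underlying M) \<and> outerplanar M \<and>
     is_simple_path (interior_dual M)"

definition maximal_path_like :: "('v, 'a) pmap \<Rightarrow> bool" where
  "maximal_path_like M \<longleftrightarrow> path_like M \<and> (\<forall>f\<in>bounded_faces M. card f = 3)"


section \<open>The vertex-edge-face poset and order dimension\<close>

datatype ('v, 'a) cell = Vertex 'v | Edge "'a set" | Face "'a set"

definition cells :: "('v, 'a) pmap \<Rightarrow> ('v, 'a) cell set" where
  "cells M = Vertex ` verts (underlying M) \<union> (\<lambda>a. Edge {a, edge_rev M a}) ` arcs (underlying M)
     \<union> Face ` faces M"

fun below :: "('v, 'a) pmap \<Rightarrow> ('v, 'a) cell \<Rightarrow> ('v, 'a) cell \<Rightarrow> bool" where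
  "below M (Vertex v) (Edge e) \<longleftrightarrow> v \<in> tail (underlying M) ` e"
| "below M (Vertex v) (Face f) \<longleftrightarrow> v \<in> tail (underlying M) ` f"
| "below M (Edge e) (Face f) \<longleftrightarrow> e \<inter> f \<noteq> {}"
| "below M _ _ \<longleftrightarrow> False"

definition P_VEF :: "('v, 'a) pmap \<Rightarrow> ('v, 'a) cell rel" where
  "P_VEF M = {(x, y) \<in> cells M \<times> cells M. x = y \<or> below M x y}"

definition linear_extension :: "'a set \<Rightarrow> 'a rel \<Rightarrow> 'a rel \<Rightarrow> bool" where
  "linear_extension X r L \<longleftrightarrow> linear_order_on X L \<and> r \<subseteq> L"

definition realizer :: "'a set \<Rightarrow> 'a rel \<Rightarrow> 'a rel list \<Rightarrow> bool" where
  "realizer X r Ls \<longleftrightarrow>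
     (\<forall>L\<in>set Ls. linear_extension X r L) \<and> r = {p \<in> X \<times> X. \<forall>L\<in>set Ls. p \<in> L}"

definition order_dim :: "'a set \<Rightarrow> 'a rel \<Rightarrow> nat" where
  "order_dim X r = (LEAST k. \<exists>Ls. length Ls = k \<and> realizer X r Ls)"


section \<open>Random access machines\<close>

text \<open>
  The model of computation is the unit-cost word RAM, with structured control flow. A program refers
  to finitely many registers and finitely many arrays, all named by numbers. In \<open>exec W c s t s'\<close>,
  the program \<open>c\<close> started in \<open>s\<close> stops in \<open>s'\<close> after \<open>t\<close> elementary steps (assignments and tests);
  no value that it computes may reach \<open>W\<close>, so words have \<open>log\<^sub>2 W\<close> bits. Subtraction is truncated.
\<close>

datatype operand =
    Const nat
  | Reg nat
  | Plus nat nat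
  | Minus nat nat
  | Read nat nat

datatype test = Less nat nat | Equal nat nat

datatype com =
    Skip
  | Assign nat operand
  | Write nat nat nat
  | Seq com com
  | Cond test com com
  | While test com

record state =
  regs :: "nat \<Rightarrow> nat"
  mem :: "nat \<Rightarrow> nat \<Rightarrow> nat"

fun val :: "operand \<Rightarrow> state \<Rightarrow> nat" where
  "val (Const k) s = k"
| "val (Reg i) s = regs s i"
| "val (Plus i j) s = regs s i + regs s j"
| "val (Minus i j) s = regs s i - regs s j"
| "val (Read A i) s = mem s A (regs s i)"

fun holds :: "test \<Rightarrow> state \<Rightarrow> bool" where
  "holds (Less i j) s \<longleftrightarrow> regs s i < regs s j"
| "holds (Equal i j) s \<longleftrightarrow> regs s i = regs s j"

inductive exec :: "nat \<Rightarrow> com \<Rightarrow> state \<Rightarrow> nat \<Rightarrow> state \<Rightarrow> bool" for W where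
  skip: "exec W Skip s 0 s"
| assign: "val e s < W \<Longrightarrow> exec W (Assign i e) s 1 (s\<lparr>regs := (regs s)(i := val e s)\<rparr>)"
| store: "exec W (Write A i j) s 1
    (s\<lparr>mem := (mem s)(A := (mem s A)(regs s i := regs s j))\<rparr>)"
| seq: "exec W c1 s t1 s1 \<Longrightarrow> exec W c2 s1 t2 s2 \<Longrightarrow> exec W (Seq c1 c2) s (t1 + t2) s2"
| cond_true: "holds b s \<Longrightarrow> exec W c1 s t s' \<Longrightarrow> exec W (Cond b c1 c2) s (1 + t) s'"
| cond_false: "\<not> holds b s \<Longrightarrow> exec W c2 s t s' \<Longrightarrow> exec W (Cond b c1 c2) s (1 + t) s'"
| while_false: "\<not> holds b s \<Longrightarrow> exec W (While b c) s 1 s"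
| while_true: "holds b s \<Longrightarrow> exec W c s t1 s1 \<Longrightarrow> exec W (While b c) s1 t2 s2 \<Longrightarrow>
    exec W (While b c) s (1 + t1 + t2) s2"

inductive_cases SkipE: "exec W Skip s t s'"
  and AssignE: "exec W (Assign i e) s t s'"
  and WriteE: "exec W (Write A i j) s t s'"
  and SeqE: "exec W (Seq c1 c2) s t s'"
  and CondE: "exec W (Cond b c1 c2) s t s'"
  and WhileE: "exec W (While b c) s t s'"

lemma exec_deterministic:
  "exec W c s t s' \<Longrightarrow> exec W c s u s'' \<Longrightarrow> u = t \<and> s'' = s'"
proof (induction arbitrary: u s'' rule: exec.induct)
  case (skip s)
  from skip.prems show ?case by (rule SkipE) simp
next
  case (assign e s i)
  from assign.prems show ?case by (rule AssignE) simp
next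
  case (store A i j s)
  from store.prems show ?case by (rule WriteE) simp
next
  case (seq c1 s t1 s1 c2 t2 s2)
  from seq.prems show ?case
  proof (rule SeqE)
    fix u1 r u2
    assume u: "u = u1 + u2" and r: "exec W c1 s u1 r" "exec W c2 r u2 s''"
    from seq.IH(1)[OF r(1)] have e: "u1 = t1" "r = s1" by simp_all
    from seq.IH(2)[OF r(2)[unfolded e]] show ?thesis by (simp add: u e)
  qed
next
  case (cond_true b s c1 t s' c2)
  from cond_true.prems cond_true.hyps(1) show ?case
    by (auto elim!: CondE dest: cond_true.IH)
next
  case (cond_false b s c2 t s' c1)
  from cond_false.prems cond_false.hyps(1) show ?case
    by (auto elim!: CondE dest: cond_false.IH)
next
  case (while_false b s c)
  from while_false.prems show ?case
    by (rule WhileE) (simp_all add: while_false.hyps)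
next
  case (while_true b s c t1 s1 t2 s2)
  from while_true.prems show ?case
  proof (rule WhileE)
    assume "\<not> holds b s"
    with while_true.hyps(1) show ?thesis by simp
  next
    fix u1 r u2
    assume u: "u = Suc (u1 + u2)" and r: "exec W c s u1 r" "exec W (While b c) r u2 s''"
    from while_true.IH(1)[OF r(1)] have e: "u1 = t1" "r = s1" by simp_all
    from while_true.IH(2)[OF r(2)[unfolded e]] show ?thesis by (simp add: u e)
  qed
qed


section \<open>Maps as inputs, linear orders as outputs\<close>

text \<open>
  An input map has vertices \<open>0, \<dots>, n - 1\<close> and arcs \<open>0, \<dots>, m - 1\<close>. Registers 0, 1, 2 hold \<open>n\<close>, \<open>m\<close> and
  some arc \<open>r\<close> of the outer face; arrays 0, 1, 2 tabulate the tails, the reversal and the rotation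
  on the arcs. Everything else is zero.
\<close>

definition numbered :: "(nat, nat) pmap \<Rightarrow> bool" where
  "numbered M \<longleftrightarrow>
     verts (underlying M) = {..<card (verts (underlying M))} \<and>
     arcs (underlying M) = {..<card (arcs (underlying M))}"

definition input_state :: "(nat, nat) pmap \<Rightarrow> nat \<Rightarrow> state" where
  "input_state M r =
     (let G = underlying M; table = (\<lambda>f a. if a \<in> arcs G then f a else 0) in
      \<lparr> regs = (\<lambda>_. 0)(0 := card (verts G), 1 := card (arcs G), 2 := r),
        mem = (\<lambda>_ _. 0)(0 := table (tail G), 1 := table (edge_rev M), 2 := table (edge_succ M)) \<rparr>)"

text \<open>
  A cell is output as a pair of numbers, its kind and an identifier: the number of the vertex, or
  of any arc of the edge or of the face boundary. For \<open>i < 3\<close>, the arrays \<open>3 + 2 * i\<close> and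
  \<open>4 + 2 * i\<close> list the kinds and the identifiers of all cells, in increasing order with respect to
  the \<open>i\<close>-th linear order.
\<close>

definition named_cell :: "(nat, nat) pmap \<Rightarrow> nat \<Rightarrow> nat \<Rightarrow> (nat, nat) cell" where
  "named_cell M kind k =
     (if kind = 0 then Vertex k
      else if kind = 1 then Edge {k, edge_rev M k}
      else Face (face_of (edge_rev M) (edge_succ M) k))"

definition list_order :: "'a list \<Rightarrow> 'a rel" where
  "list_order xs = {(xs ! i, xs ! j) | i j. i \<le> j \<and> j < length xs}"

definition output_order :: "(nat, nat) pmap \<Rightarrow> state \<Rightarrow> nat \<Rightarrow> (nat, nat) cell rel" where
  "output_order M s i =
     list_order (map (\<lambda>j. named_cell M (mem s (3 + 2 * i) j) (mem s (4 + 2 * i) j)) [0..<card (cells M)])"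

end

theory Submission
  imports Defs
begin

text \<open>
  The bounded faces form a strip of triangles between two ears \<open>r 0\<close> and \<open>r N\<close>; the outer cycle
  consists of the sides \<open>p 0, \<dots>, p (K - 1)\<close> and \<open>r 0, \<dots>, r N\<close>, and the chords are the steps of a
  lattice path \<open>(J t, I t)\<close>.

  In a realizer with three linear orders, every chord lies above the outer face in one of them. Comparing
  this order for the two chords of an inner triangle shows that the triangles whose chords get different
  orders are exactly those with their apex on one fixed side, that there are at most three of them, and that no
  three of them are consecutive. Hence the dimension is at most 3 only if, with one of the ears as \<open>r 0\<close>,
  \<open>K \<le> 4\<close> and the three triangles with two vertices among the \<open>p j\<close> are not consecutive if \<open>K = 4\<close>.
  Conversely, in this case explicit ranks of the vertices give three orders of the cells, sorted by the
  largest rank of a vertex, where the cells that contain a \<open>p j\<close> with \<open>j mod 3 = k\<close> are moved above the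
  outer face in the \<open>k\<close>-th order. Four orders always suffice.

  The program walks along the outer face, finds the ears, tests the criterion for both of them, computes
  the ranks and sorts the cells with buckets.
\<close>

section \<open>Staircases and keys\<close>

text \<open>The outer face lies above all vertices, so whatever lies above it in some order exceeds
  every vertex there. A chord is not below the outer face, hence it is above it in some order, its
  colour; in that order no vertex can exceed a triangle at the chord. With three orders, an inner
  triangle whose two chords differ in colour leaves exactly one order in which all outside vertices
  must exceed it, and two such triangles cannot share this order: hence the bound three. The upper
  bound reverses this: colouring cells by the indices of their \<open>p\<close>-vertices modulo 3
  makes exactly the triangles with two \<open>p\<close>-vertices bicoloured, and it remains to find
  ranks by which every vertex exceeds every triangle not containing it in an order that does not
  colour the triangle. Exchanging the ears reflects the strip and turns \<open>(K, N)\<close> into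
  \<open>(N - 1, K + 1)\<close>. The lower bound also admits that the bicoloured triangles lie on
  the other side of the strip; this is the same condition for the other ear, which is why both ears
  are tested.\<close>

fun cell_verts :: "('v, 'a) pmap \<Rightarrow> ('v, 'a) cell \<Rightarrow> 'v set" where
  "cell_verts M (Vertex v) = {v}"
| "cell_verts M (Edge e) = tail (underlying M) ` e"
| "cell_verts M (Face f) = tail (underlying M) ` f"

text \<open>\<open>C\<close> holds the vertices whose cells are moved above the outer face, and
  \<open>B\<close> is a common bound for the ranks: a set that meets \<open>C\<close> is lifted to
  \<open>B\<close> whatever its ranks are.\<close>

definition level :: "('v \<Rightarrow> nat) \<Rightarrow> 'v set \<Rightarrow> nat \<Rightarrow> 'v set \<Rightarrow> nat" where
  "level \<rho> C B X = (if X \<inter> C = {} then Max (\<rho> ` X) else B)"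

text \<open>Tripling leaves room for vertex, edge and face of the same level, in this order. The
  outer face sits at \<open>3 * B\<close>, so lifted chords at \<open>3 * B + 1\<close> and lifted
  bounded faces at \<open>3 * B + 2\<close> pass it, while all vertices stay below. Outer edges
  ignore \<open>C\<close>, since they must remain below the outer face.\<close>

fun key :: "('v, 'a) pmap \<Rightarrow> ('v \<Rightarrow> nat) \<Rightarrow> 'v set \<Rightarrow> nat \<Rightarrow> ('v, 'a) cell \<Rightarrow> nat" where
  "key M \<rho> C B (Vertex v) = 3 * \<rho> v"
| "key M \<rho> C B (Edge e) =
    (if e \<inter> outer_face M = {} then 3 * level \<rho> C B (tail (underlying M) ` e) + 1
     else 3 * Max (\<rho> ` tail (underlying M) ` e) + 1)"
| "key M \<rho> C B (Face f) =
    (if f = outer_face M then 3 * B else 3 * level \<rho> C B (tail (underlying M) ` f) + 2)"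

section \<open>Linear orders given by lists sorted by keys\<close>

lemma linear_order_list_order:
  assumes "distinct xs"
  shows "linear_order_on (set xs) (list_order xs)"
proof -
  have nth: "i = j" if "xs ! i = xs ! j" "i < length xs" "j < length xs" for i j
    using that assms nth_eq_iff_index_eq by blast
  have "refl_on (set xs) (list_order xs)"
    unfolding refl_on_def list_order_def by (force simp: in_set_conv_nth)
  moreover have "trans (list_order xs)"
  proof (rule transI)
    fix x y z assume "(x, y) \<in> list_order xs" "(y, z) \<in> list_order xs"
    then obtain i j k l where *: "x = xs ! i" "y = xs ! j" "i \<le> j" "j < length xs"
       "y = xs ! k" "z = xs ! l" "k \<le> l" "l < length xs" unfolding list_order_def by auto
    then have "j = k" using nth[of j k] by auto
    then have "i \<le> l" using * by simp
    then show "(x, z) \<in> list_order xs" using *(1,6,8) unfolding list_order_def by blast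
  qed
  moreover have "antisym (list_order xs)"
  proof (rule antisymI)
    fix x y assume "(x, y) \<in> list_order xs" "(y, x) \<in> list_order xs"
    then obtain i j k l where *: "x = xs ! i" "y = xs ! j" "i \<le> j" "j < length xs"
       "y = xs ! k" "x = xs ! l" "k \<le> l" "l < length xs" unfolding list_order_def by blast
    then have "j = k" "i = l" using nth[of j k] nth[of i l] by auto
    then show "x = y" using * by auto
  qed
  moreover have "total_on (set xs) (list_order xs)"
    unfolding total_on_def list_order_def
    by (smt (verit, best) in_set_conv_nth mem_Collect_eq nat_le_linear)
  moreover have "list_order xs \<subseteq> set xs \<times> set xs"
    unfolding list_order_def by auto
  ultimately show ?thesis
    unfolding linear_order_on_def partial_order_on_def preorder_on_def by auto
qed

lemma list_order_iff_key:
  fixes \<kappa> :: "'c \<Rightarrow> nat"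
  assumes "sorted (map \<kappa> xs)"
  shows "(x, y) \<in> list_order xs \<Longrightarrow> \<kappa> x \<le> \<kappa> y"
    and "x \<in> set xs \<Longrightarrow> y \<in> set xs \<Longrightarrow> \<kappa> x < \<kappa> y \<Longrightarrow> (x, y) \<in> list_order xs"
proof -
  have s: "\<kappa> (xs ! i) \<le> \<kappa> (xs ! j)" if "i \<le> j" "j < length xs" for i j
    using sorted_nth_mono[OF assms, of i j] that by simp
  show "(x, y) \<in> list_order xs \<Longrightarrow> \<kappa> x \<le> \<kappa> y"
    unfolding list_order_def using s by auto
  show "x \<in> set xs \<Longrightarrow> y \<in> set xs \<Longrightarrow> \<kappa> x < \<kappa> y \<Longrightarrow> (x, y) \<in> list_order xs"
    unfolding list_order_def in_set_conv_nth using s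
    by (smt (verit, best) linorder_not_le mem_Collect_eq nat_le_linear)
qed

text \<open>Elements with equal keys may be listed in any order: \<open>mono\<close> and
  \<open>sep\<close> demand strict inequalities, so every relation that matters is decided by the
  keys. A program that sorts by keys is therefore free in how it breaks ties.\<close>

lemma realizer_of_keys:
  fixes \<kappa> :: "nat \<Rightarrow> 'c \<Rightarrow> nat" and xs :: "nat \<Rightarrow> 'c list"
  assumes P: "P \<subseteq> X \<times> X" "\<And>x. x \<in> X \<Longrightarrow> (x, x) \<in> P"
    and mono: "\<And>x y k. (x, y) \<in> P \<Longrightarrow> x \<noteq> y \<Longrightarrow> k < d \<Longrightarrow> \<kappa> k x < \<kappa> k y"
    and sep: "\<And>x y. x \<in> X \<Longrightarrow> y \<in> X \<Longrightarrow> (x, y) \<notin> P \<Longrightarrow> \<exists>k<d. \<kappa> k y < \<kappa> k x"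
    and xs: "\<And>k. k < d \<Longrightarrow> distinct (xs k) \<and> set (xs k) = X \<and> sorted (map (\<kappa> k) (xs k))"
  shows "realizer X P (map (\<lambda>k. list_order (xs k)) [0..<d])"
proof -
  have "linear_extension X P (list_order (xs k))" if "k < d" for k
    unfolding linear_extension_def
  proof
    show "linear_order_on X (list_order (xs k))"
      using linear_order_list_order xs that by metis
    show "P \<subseteq> list_order (xs k)"
    proof (rule subrelI)
      fix x y assume xy: "(x, y) \<in> P"
      show "(x, y) \<in> list_order (xs k)"
      proof (cases "x = y")
        case True
        then have "x \<in> set (xs k)" using xy P(1) xs[OF that] by auto
        then show ?thesis using True unfolding list_order_def in_set_conv_nth by auto
      next
        case False
        then show ?thesis using list_order_iff_key(2)[of "\<kappa> k" "xs k" x y] mono[OF xy False that]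
            xs[OF that] xy P(1) by auto
      qed
    qed
  qed
  moreover have "(x, y) \<in> P" if xy: "x \<in> X" "y \<in> X" "\<forall>k<d. (x, y) \<in> list_order (xs k)" for x y
  proof (rule ccontr)
    assume "(x, y) \<notin> P"
    then obtain k where "k < d" "\<kappa> k y < \<kappa> k x" using sep xy by blast
    then show False using list_order_iff_key(1)[of "\<kappa> k" "xs k" x y] xs[of k] xy(3) by auto
  qed
  moreover have "(x, y) \<in> list_order (xs k)" if "(x, y) \<in> P" "k < d" for x y k
    using calculation(1)[OF that(2)] that(1) unfolding linear_extension_def by blast
  ultimately show ?thesis unfolding realizer_def using P(1) by auto
qed

text \<open>The path \<open>(J t, I t)\<close> walks along rungs that join \<open>p (J t)\<close> to
  \<open>r (I t)\<close>; consecutive rungs span the triangle \<open>tri t\<close>. Rungs 0 and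
  \<open>m\<close> are outer edges, those strictly between are the chords. An \<open>I\<close>-step
  at both ends makes \<open>r 0\<close> and \<open>r N\<close> the tips of the end triangles, so
  \<open>p\<close> collects exactly the vertices strictly between the two ears on one side of the
  outer cycle.\<close>

locale staircase =
  fixes M :: "('v, 'a) pmap" and K N :: nat and J I :: "nat \<Rightarrow> nat" and p r :: "nat \<Rightarrow> 'v"
    and F :: "nat \<Rightarrow> 'a set"
  fixes m :: nat
  defines m_def: "m \<equiv> K + N - 1"
  fixes G :: "('v, 'a) pre_digraph"
  defines G_def: "G \<equiv> underlying M"
  fixes tri :: "nat \<Rightarrow> 'v set"
  defines tri_def: "tri t \<equiv> {p (J t), r (I t), p (J (Suc t)), r (I (Suc t))}"
  assumes K_pos: "0 < K" and N_pos: "0 < N"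
    and path_start: "J 0 = 0" "I 0 = 0" and first_step: "I 1 = 1"
    and path_step: "\<And>t. t < m \<Longrightarrow> J (Suc t) = J t \<and> I (Suc t) = Suc (I t)
          \<or> J (Suc t) = Suc (J t) \<and> I (Suc t) = I t"
    and path_end: "J m = K - 1" "I m = N" and last_step: "I (m - 1) = N - 1"
    and verts_eq: "verts G = p ` {..<K} \<union> r ` {..N}"
    and inj_p: "inj_on p {..<K}" and inj_r: "inj_on r {..N}"
    and p_neq_r: "\<And>j i. j < K \<Longrightarrow> i \<le> N \<Longrightarrow> p j \<noteq> r i"
    and graph: "fin_digraph G" "bidirected_digraph G (edge_rev M)" "nomulti_digraph G"
    and arc_ends: "\<And>a. a \<in> arcs G \<Longrightarrow>
          (\<exists>t\<le>m. {tail G a, head G a} = {p (J t), r (I t)})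
          \<or> (\<exists>j. Suc j < K \<and> {tail G a, head G a} = {p j, p (Suc j)})
          \<or> (\<exists>i<N. {tail G a, head G a} = {r i, r (Suc i)})"
    and rung: "\<And>t. t \<le> m \<Longrightarrow> \<exists>a\<in>arcs G. tail G a = p (J t) \<and> head G a = r (I t)"
    and side_p: "\<And>j. Suc j < K \<Longrightarrow> \<exists>a\<in>arcs G. tail G a = p j \<and> head G a = p (Suc j)"
    and side_r: "\<And>i. i < N \<Longrightarrow> \<exists>a\<in>arcs G. tail G a = r (Suc i) \<and> head G a = r i"
    and faces_eq: "faces M = insert (outer_face M) (F ` {..<m})"
    and F_not_outer: "\<And>t. t < m \<Longrightarrow> F t \<noteq> outer_face M"
    and F_arcs: "\<And>t. t < m \<Longrightarrow> F t \<subseteq> arcs G"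
    and tail_F: "\<And>t. t < m \<Longrightarrow> tail G ` F t = tri t"
    and in_F_iff: "\<And>t a. t < m \<Longrightarrow> a \<in> arcs G \<Longrightarrow>
          a \<in> F t \<or> edge_rev M a \<in> F t \<longleftrightarrow> tail G a \<in> tri t \<and> head G a \<in> tri t"
    and outer_arcs: "outer_face M \<subseteq> arcs G"
    and outer_ends: "\<And>a. a \<in> outer_face M \<Longrightarrow> tail G a = r 0 \<and> head G a = p 0
          \<or> (\<exists>j. Suc j < K \<and> tail G a = p j \<and> head G a = p (Suc j))
          \<or> tail G a = p (K - 1) \<and> head G a = r N
          \<or> (\<exists>i<N. tail G a = r (Suc i) \<and> head G a = r i)"
    and tail_outer: "tail G ` outer_face M = verts G"
    and in_outer_iff: "\<And>a. a \<in> arcs G \<Longrightarrow>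
          a \<in> outer_face M \<or> edge_rev M a \<in> outer_face M \<longleftrightarrow>
          \<not> (\<exists>t. 0 < t \<and> t < m \<and> {tail G a, head G a} = {p (J t), r (I t)})"
begin

lemma m_pos: "0 < m" using K_pos N_pos m_def by simp
lemma Km: "K + N = Suc m" using K_pos m_def by simp

lemma sum_JI: "t \<le> m \<Longrightarrow> J t + I t = t"
proof (induction t)
  case 0 then show ?case using path_start by simp
next
  case (Suc t) then show ?case using path_step[of t] by auto
qed

lemma mono_JI: "s \<le> t \<Longrightarrow> t \<le> m \<Longrightarrow> J s \<le> J t \<and> I s \<le> I t"
proof (induction t)
  case 0 then show ?case by simp
next
  case (Suc t) then show ?case using path_step[of t] by (cases "s = Suc t") auto
qed

lemma J_lt: "t \<le> m \<Longrightarrow> J t < K" using mono_JI[of t m] path_end(1) K_pos by linarith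
lemma I_le: "t \<le> m \<Longrightarrow> I t \<le> N" using mono_JI[of t m] path_end by simp

lemma p_eq_iff [simp]: "i < K \<Longrightarrow> j < K \<Longrightarrow> p i = p j \<longleftrightarrow> i = j"
  using inj_p by (auto dest: inj_onD)
lemma r_eq_iff [simp]: "i \<le> N \<Longrightarrow> j \<le> N \<Longrightarrow> r i = r j \<longleftrightarrow> i = j"
  using inj_r by (auto dest: inj_onD)
lemma r_neq_p: "j < K \<Longrightarrow> i \<le> N \<Longrightarrow> r i \<noteq> p j" using p_neq_r by metis

lemma p_in_tri: "t < m \<Longrightarrow> j < K \<Longrightarrow> p j \<in> tri t \<longleftrightarrow> j = J t \<or> j = J (Suc t)"
  using J_lt[of t] J_lt[of "Suc t"] I_le[of t] I_le[of "Suc t"] p_neq_r unfolding tri_def by auto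
lemma r_in_tri: "t < m \<Longrightarrow> i \<le> N \<Longrightarrow> r i \<in> tri t \<longleftrightarrow> i = I t \<or> i = I (Suc t)"
  using J_lt[of t] J_lt[of "Suc t"] I_le[of t] I_le[of "Suc t"] r_neq_p unfolding tri_def by auto

lemma tri_verts: "t < m \<Longrightarrow> tri t \<subseteq> verts G"
  using J_lt[of t] J_lt[of "Suc t"] I_le[of t] I_le[of "Suc t"] unfolding tri_def verts_eq by auto

text \<open>Containment confines both rungs of \<open>s\<close> to the coordinates of the rungs of
  \<open>t\<close>. As \<open>J t + I t = t\<close>, the first rung gives \<open>t \<le> s\<close>
  and the second one \<open>s \<le> t\<close>.\<close>

lemma tri_subset_eq:
  assumes "s < m" "t < m" "tri s \<subseteq> tri t" shows "s = t"
proof -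
  have *: "J s = J t \<or> J s = J (Suc t)" "I s = I t \<or> I s = I (Suc t)"
    "J (Suc s) = J t \<or> J (Suc s) = J (Suc t)" "I (Suc s) = I t \<or> I (Suc s) = I (Suc t)"
    using assms p_in_tri[of t] r_in_tri[of t] J_lt I_le unfolding tri_def[of s] by auto
  moreover have "J t \<le> J (Suc t)" "I t \<le> I (Suc t)" using mono_JI assms(2) by auto
  ultimately have "J t \<le> J s" "I t \<le> I s" "J (Suc s) \<le> J (Suc t)" "I (Suc s) \<le> I (Suc t)" by auto
  then show ?thesis using sum_JI[of s] sum_JI[of "Suc s"] sum_JI[of t] sum_JI[of "Suc t"] assms by simp
qed

lemma path_first: "J 1 = 0" using path_step[of 0] m_pos path_start first_step by auto
lemma path_last: "J (m - 1) = K - 1" 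
  using path_step[of "m - 1"] m_pos path_end last_step N_pos by auto

text \<open>The case of a \<open>J\<close>-step also records that such a step is never the first or
  the last one, so both its rungs are chords and its \<open>r\<close>-vertex is not an ear.\<close>

lemma tri_cases:
  assumes "t < m"
  obtains (Istep) "J (Suc t) = J t" "I (Suc t) = Suc (I t)" "tri t = {p (J t), r (I t), r (Suc (I t))}"
      "J t < K" "I t < N"
  | (Jstep) "J (Suc t) = Suc (J t)" "I (Suc t) = I t" "tri t = {p (J t), p (Suc (J t)), r (I t)}"
      "Suc (J t) < K" "I t \<le> N" "0 < t" "Suc t < m" "0 < I t" "I t < N"
proof (cases "I (Suc t) = Suc (I t)")
  case True
  then show ?thesis using that(1) path_step[OF assms] J_lt[of t] I_le[of "Suc t"] assms by (auto simp: tri_def)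
next
  case False
  then have *: "J (Suc t) = Suc (J t)" "I (Suc t) = I t" using path_step[OF assms] by auto
  have t0: "0 < t" using * first_step path_start by (cases t) auto
  have tm: "Suc t < m"
  proof (rule ccontr)
    assume "\<not> Suc t < m"
    then have "t = m - 1" "Suc t = m" using assms by auto
    then show False using * last_step path_end N_pos by simp
  qed
  have "1 \<le> I t" using mono_JI[of 1 t] t0 assms first_step by auto
  moreover have "I t \<le> I (m - 1)" using mono_JI[of t "m - 1"] assms by auto
  ultimately have "0 < I t" "I t < N" using last_step N_pos by linarith+
  then show ?thesis using that(2) * J_lt[of "Suc t"] assms t0 tm by (auto simp: tri_def)
qed

definition edge_set :: "'v set \<Rightarrow> bool" where
  "edge_set X \<longleftrightarrow> (\<exists>t\<le>m. X = {p (J t), r (I t)}) \<or> (\<exists>j. Suc j < K \<and> X = {p j, p (Suc j)})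
     \<or> (\<exists>i<N. X = {r i, r (Suc i)})"

definition chord_set :: "'v set \<Rightarrow> bool" where
  "chord_set X \<longleftrightarrow> (\<exists>t. 0 < t \<and> t < m \<and> X = {p (J t), r (I t)})"

text \<open>Discrete intermediate values: the last time at which \<open>J\<close> is at most
  \<open>j\<close> serves for both claims, because the next step, if there is one, has to leave
  \<open>j\<close>.\<close>

lemma J_surj: assumes "j < K" shows "\<exists>t\<le>m. J t = j \<and> (Suc j < K \<longrightarrow> t < m \<and> J (Suc t) = Suc j)"
proof -
  let ?t = "Max {t. t \<le> m \<and> J t \<le> j}"
  have fin: "finite {t. t \<le> m \<and> J t \<le> j}" by simp
  have ne: "{t. t \<le> m \<and> J t \<le> j} \<noteq> {}" using path_start by auto
  have t: "?t \<le> m" "J ?t \<le> j" using Max_in[OF fin ne] by auto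
  show ?thesis
  proof (cases "?t = m")
    case True
    then have "j = K - 1" using t path_end assms by simp
    then show ?thesis using path_end K_pos by (intro exI[of _ m]) auto
  next
    case False
    then have lt: "?t < m" using t by simp
    have "\<not> J (Suc ?t) \<le> j"
    proof
      assume "J (Suc ?t) \<le> j"
      then have "Suc ?t \<in> {t. t \<le> m \<and> J t \<le> j}" using lt by simp
      then show False using Max_ge[OF fin] by fastforce
    qed
    then show ?thesis using path_step[OF lt] t lt by (intro exI[of _ ?t]) auto
  qed
qed

lemma I_surj: assumes "i \<le> N" shows "\<exists>t\<le>m. I t = i \<and> (i < N \<longrightarrow> t < m \<and> I (Suc t) = Suc i)"
proof -
  let ?t = "Max {t. t \<le> m \<and> I t \<le> i}"
  have fin: "finite {t. t \<le> m \<and> I t \<le> i}" by simp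
  have ne: "{t. t \<le> m \<and> I t \<le> i} \<noteq> {}" using path_start by auto
  have t: "?t \<le> m" "I ?t \<le> i" using Max_in[OF fin ne] by auto
  show ?thesis
  proof (cases "?t = m")
    case True
    then have "i = N" using t path_end assms by simp
    then show ?thesis using path_end by (intro exI[of _ m]) auto
  next
    case False
    then have lt: "?t < m" using t by simp
    have "\<not> I (Suc ?t) \<le> i"
    proof
      assume "I (Suc ?t) \<le> i"
      then have "Suc ?t \<in> {t. t \<le> m \<and> I t \<le> i}" using lt by simp
      then show False using Max_ge[OF fin] by fastforce
    qed
    then show ?thesis using path_step[OF lt] t lt by (intro exI[of _ ?t]) auto
  qed
qed

lemma vert_in_tri: assumes "v \<in> verts G" shows "\<exists>t<m. v \<in> tri t"
proof -
  have "\<exists>t\<le>m. v = p (J t) \<or> v = r (I t)"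
    using assms J_surj I_surj unfolding verts_eq by force
  then obtain t where t: "t \<le> m" "v = p (J t) \<or> v = r (I t)" by blast
  then show ?thesis
  proof (cases "t = m")
    case True
    then have "v \<in> tri (m - 1)" using t m_pos unfolding tri_def by auto
    then show ?thesis using m_pos by (intro exI[of _ "m - 1"]) auto
  next
    case False
    then show ?thesis using t unfolding tri_def by (intro exI[of _ t]) auto
  qed
qed

lemma pair_in_tri_edge:
  assumes "t < m" "y \<in> tri t" "z \<in> tri t" "y \<noteq> z" shows "edge_set {y, z}"
  using assms(1)
proof (cases rule: tri_cases)
  case Istep
  have "edge_set {p (J t), r (I t)}" "edge_set {p (J t), r (Suc (I t))}" "edge_set {r (I t), r (Suc (I t))}"
    unfolding edge_set_def using assms(1) Istep by (metis less_imp_le_nat Suc_leI)+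
  then show ?thesis using assms(2-4) unfolding Istep(3) by (auto simp: insert_commute)
next
  case Jstep
  have "edge_set {p (J t), r (I t)}" "edge_set {p (Suc (J t)), r (I t)}" "edge_set {p (J t), p (Suc (J t))}"
    unfolding edge_set_def using assms(1) Jstep by (metis less_imp_le_nat Suc_leI)+
  then show ?thesis using assms(2-4) unfolding Jstep(3) by (auto simp: insert_commute)
qed

lemma edge_set_in_tri:
  assumes "edge_set X" shows "\<exists>t<m. X \<subseteq> tri t"
  using assms unfolding edge_set_def
proof (elim disjE exE conjE)
  fix t assume t: "t \<le> m" "X = {p (J t), r (I t)}"
  show ?thesis
  proof (cases "t = m")
    case True
    then show ?thesis using t m_pos by (intro exI[of _ "m - 1"]) (auto simp: tri_def)
  next
    case False
    then show ?thesis using t by (intro exI[of _ t]) (auto simp: tri_def)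
  qed
next
  fix j assume j: "Suc j < K" "X = {p j, p (Suc j)}"
  then obtain t where "t < m" "J t = j" "J (Suc t) = Suc j" using J_surj[of j] by auto
  then show ?thesis using j by (intro exI[of _ t]) (auto simp: tri_def)
next
  fix i assume i: "i < N" "X = {r i, r (Suc i)}"
  then obtain t where "t < m" "I t = i" "I (Suc t) = Suc i" using I_surj[of i] by auto
  then show ?thesis using i by (intro exI[of _ t]) (auto simp: tri_def)
qed

text \<open>A chord is the exact intersection of the two triangles beside it, so every further
  vertex is missing from one of them. This is what allows a vertex to be separated from a chord by
  means of a triangle.\<close>

lemma chord_set_tri: "0 < t \<Longrightarrow> t < m \<Longrightarrow> tri (t - 1) \<inter> tri t = {p (J t), r (I t)}"
proof -
  assume t: "0 < t" "t < m"
  then have s: "t - 1 < m" "Suc (t - 1) = t" by auto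
  have *: "J (t - 1) + I (t - 1) = t - 1" "J t + I t = t" using sum_JI t s by auto
  have le: "J (t - 1) \<le> J t" "I (t - 1) \<le> I t" "J t \<le> J (Suc t)" "I t \<le> I (Suc t)"
    using mono_JI t by auto
  have bnd: "J (t - 1) < K" "J t < K" "J (Suc t) < K" "I (t - 1) \<le> N" "I t \<le> N" "I (Suc t) \<le> N"
    using J_lt I_le t by auto
  have "p (J (t - 1)) \<in> tri t \<Longrightarrow> J (t - 1) = J t" 
    using p_in_tri[OF t(2), of "J (t - 1)"] bnd le by auto
  moreover have "r (I (t - 1)) \<in> tri t \<Longrightarrow> I (t - 1) = I t"
    using r_in_tri[OF t(2), of "I (t - 1)"] bnd le by auto
  ultimately show ?thesis unfolding tri_def[of "t - 1"] s(2) by (auto simp: tri_def[of t])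
qed

lemma finite_verts: "finite (verts G)" unfolding verts_eq by simp

lemma rev_arc:
  assumes "a \<in> arcs G"
  shows "edge_rev M a \<in> arcs G" "tail G (edge_rev M a) = head G a" "head G (edge_rev M a) = tail G a"
    "edge_rev M (edge_rev M a) = a"
  using assms graph(2) by (auto simp: bidirected_digraph.tail_arev bidirected_digraph.head_arev
      bidirected_digraph.arev_arev bidirected_digraph.arev_in_arcs)

lemma arc_unique: "a \<in> arcs G \<Longrightarrow> b \<in> arcs G \<Longrightarrow> tail G a = tail G b \<Longrightarrow> head G a = head G b \<Longrightarrow> a = b"
  using graph(3) nomulti_digraph.no_multi_arcs[of G a b] by (auto simp: arc_to_ends_def)

lemma edge_unique:
  assumes "a \<in> arcs G" "b \<in> arcs G" "{tail G a, head G a} = {tail G b, head G b}"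
  shows "{a, edge_rev M a} = {b, edge_rev M b}"
proof -
  have "tail G a = tail G b \<and> head G a = head G b \<or> tail G a = head G b \<and> head G a = tail G b"
    using assms(3) by (auto simp: doubleton_eq_iff)
  then have "a = b \<or> a = edge_rev M b" using arc_unique assms rev_arc by metis
  then show ?thesis using rev_arc assms by auto
qed

lemma edge_verts: "a \<in> arcs G \<Longrightarrow> tail G ` {a, edge_rev M a} = {tail G a, head G a}"
  using rev_arc by auto

lemma arc_edge_set: "a \<in> arcs G \<Longrightarrow> edge_set {tail G a, head G a}"
  using arc_ends unfolding edge_set_def by auto

lemma edge_set_card: "edge_set X \<Longrightarrow> \<exists>y z. X = {y, z} \<and> y \<noteq> z"
proof -
  have "Suc j < K \<Longrightarrow> p j \<noteq> p (Suc j)" for j by auto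
  moreover have "i < N \<Longrightarrow> r i \<noteq> r (Suc i)" for i by auto
  moreover have "t \<le> m \<Longrightarrow> p (J t) \<noteq> r (I t)" for t using p_neq_r J_lt I_le by auto
  ultimately show "edge_set X \<Longrightarrow> \<exists>y z. X = {y, z} \<and> y \<noteq> z" unfolding edge_set_def by blast
qed

lemma loop_free: "a \<in> arcs G \<Longrightarrow> tail G a \<noteq> head G a"
  using arc_edge_set edge_set_card by (metis doubleton_eq_iff insert_absorb2)

lemma cells_cases [consumes 1, case_names Vertex Edge Face Outer]:
  assumes "x \<in> cells M"
  obtains v where "v \<in> verts G" "x = Vertex v"
  | a where "a \<in> arcs G" "x = Edge {a, edge_rev M a}"
  | t where "t < m" "x = Face (F t)"
  | "x = Face (outer_face M)"
  using assms unfolding cells_def faces_eq G_def by auto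

lemma edge_cell: "Edge e \<in> cells M \<Longrightarrow> \<exists>a\<in>arcs G. e = {a, edge_rev M a}"
  unfolding cells_def G_def by auto

lemma chordal_iff: "a \<in> arcs G \<Longrightarrow> {a, edge_rev M a} \<inter> outer_face M = {} \<longleftrightarrow> chord_set {tail G a, head G a}"
  using in_outer_iff[of a] unfolding chord_set_def by auto

lemma edge_in_F_iff: "a \<in> arcs G \<Longrightarrow> t < m \<Longrightarrow> {a, edge_rev M a} \<inter> F t \<noteq> {} \<longleftrightarrow> {tail G a, head G a} \<subseteq> tri t"
  using in_F_iff[of t a] by auto

lemma finite_tri: "finite (tri t)" unfolding tri_def by simp


text \<open>Besides the bound \<open>B\<close>, these are the obligations on the ranks.
  \<open>sep_tri\<close> asks for an order in which the triangle is not lifted, because a lifted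
  triangle is above all vertices. \<open>sep_outer\<close> handles an edge whose only triangle
  contains the vertex to be separated. The colour conditions put every triangle on either side of
  the outer face in suitable orders, and every chord above it in one.\<close>

context
  fixes \<rho> :: "nat \<Rightarrow> 'v \<Rightarrow> nat" and C :: "nat \<Rightarrow> 'v set" and B d :: nat
  assumes below_B: "\<And>k v. k < d \<Longrightarrow> v \<in> verts G \<Longrightarrow> \<rho> k v < B"
    and sep_tri: "\<And>t x. t < m \<Longrightarrow> x \<in> verts G \<Longrightarrow> x \<notin> tri t \<Longrightarrow>
          \<exists>k<d. tri t \<inter> C k = {} \<and> (\<forall>y\<in>tri t. \<rho> k y < \<rho> k x)"
    and sep_outer: "\<And>t v. t < m \<Longrightarrow> v \<in> tri t \<Longrightarrow> \<not> chord_set (tri t - {v}) \<Longrightarrow>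
          \<exists>k<d. \<forall>y\<in>tri t - {v}. \<rho> k y < \<rho> k v"
    and coloured: "\<And>t. t < m \<Longrightarrow> (\<exists>k<d. tri t \<inter> C k \<noteq> {}) \<and> (\<exists>k<d. tri t \<inter> C k = {})"
    and coloured_chord: "\<And>X. chord_set X \<Longrightarrow> \<exists>k<d. X \<inter> C k \<noteq> {}"
begin

lemma level_ge: "k < d \<Longrightarrow> X \<subseteq> verts G \<Longrightarrow> v \<in> X \<Longrightarrow> \<rho> k v \<le> level (\<rho> k) (C k) B X"
  unfolding level_def using below_B[of k v] finite_subset[OF _ finite_verts, of X] by auto

lemma level_mono: "k < d \<Longrightarrow> Y \<subseteq> verts G \<Longrightarrow> X \<subseteq> Y \<Longrightarrow> X \<noteq> {} \<Longrightarrow>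
    level (\<rho> k) (C k) B X \<le> level (\<rho> k) (C k) B Y"
proof -
  assume a: "k < d" "Y \<subseteq> verts G" "X \<subseteq> Y" "X \<noteq> {}"
  have fin: "finite Y" "finite X" using finite_subset[OF a(2) finite_verts] finite_subset[OF a(3)] by auto
  have "Max (\<rho> k ` X) \<le> Max (\<rho> k ` Y)" using a fin by (intro Max_mono) auto
  moreover have "Max (\<rho> k ` X) < B" using a fin below_B[OF a(1)] by (subst Max_less_iff) auto
  ultimately show ?thesis using a unfolding level_def by auto
qed

lemma edge_subset_verts: "edge_set X \<Longrightarrow> X \<subseteq> verts G"
  using edge_set_in_tri tri_verts by blast

lemma key_mono:
  assumes xy: "(x, y) \<in> P_VEF M" "x \<noteq> y" and k: "k < d"
  shows "key M (\<rho> k) (C k) B x < key M (\<rho> k) (C k) B y"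
proof -
  have b: "below M x y" "x \<in> cells M" "y \<in> cells M" using xy unfolding P_VEF_def by auto
  have ev: "tail G ` {a, edge_rev M a} \<subseteq> verts G" "tail G ` {a, edge_rev M a} \<noteq> {}"
      "edge_set (tail G ` {a, edge_rev M a})" if "a \<in> arcs G" for a
    using edge_verts[OF that] arc_edge_set[OF that] edge_subset_verts by auto
  from b(3) show ?thesis
  proof (cases rule: cells_cases)
    case (Vertex v) then show ?thesis using b(1) by (cases x) auto
  next
    case (Edge a)
    then obtain v where v: "x = Vertex v" "v \<in> tail G ` {a, edge_rev M a}" using b(1) by (cases x) (auto simp: G_def)
    have "\<rho> k v \<le> Max (\<rho> k ` tail G ` {a, edge_rev M a})" using v(2) by auto
    then show ?thesis using level_ge[OF k ev(1)[OF Edge(1)] v(2)] v(1) Edge by (auto simp: G_def)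
  next
    case (Face t)
    have T: "tail (underlying M) ` F t = tri t" using tail_F[OF Face(1)] by (simp add: G_def)
    have ky: "key M (\<rho> k) (C k) B y = 3 * level (\<rho> k) (C k) B (tri t) + 2"
      using Face F_not_outer[OF Face(1)] by (simp add: T)
    show ?thesis
    proof (cases x)
      case (Vertex v)
      then have "v \<in> tri t" using b(1) Face(2) T by simp
      then show ?thesis using level_ge[OF k tri_verts[OF Face(1)], of v] Vertex ky by simp
    next
      case (Edge e)
      then obtain a where a: "a \<in> arcs G" "e = {a, edge_rev M a}" using b(2) edge_cell by blast
      have "{a, edge_rev M a} \<inter> F t \<noteq> {}" using b(1) Face Edge a by simp
      then have sub: "tail G ` e \<subseteq> tri t" using edge_in_F_iff[OF a(1) Face(1)] edge_verts[OF a(1)] a(2) by simp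
      have "level (\<rho> k) (C k) B (tail G ` e) \<le> level (\<rho> k) (C k) B (tri t)"
        using level_mono[OF k tri_verts[OF Face(1)] sub] a by simp
      moreover have "Max (\<rho> k ` tail G ` e) \<le> level (\<rho> k) (C k) B (tail G ` e)"
        using level_ge[OF k, of "tail G ` e"] ev[OF a(1)] a(2) by (subst Max_le_iff) auto
      ultimately show ?thesis using Edge ky by (simp add: G_def)
    next
      case (Face f) then show ?thesis using b(1) \<open>y = Face (F t)\<close> by simp
    qed
  next
    case Outer
    show ?thesis
    proof (cases x)
      case (Vertex v)
      then have "v \<in> verts G" using b(2) unfolding cells_def G_def by auto
      then show ?thesis using Vertex Outer below_B[OF k] by simp
    next
      case (Edge e)
      then obtain a where a: "a \<in> arcs G" "e = {a, edge_rev M a}" using b(2) edge_cell by blast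
      have "Max (\<rho> k ` tail G ` e) < B" using below_B[OF k] ev[OF a(1)] a(2) by (subst Max_less_iff) auto
      then show ?thesis using Edge Outer b(1) by (simp add: G_def)
    next
      case (Face f) then show ?thesis using b(1) Outer by simp
    qed
  qed
qed

text \<open>If some triangle contains \<open>X\<close> but not \<open>v\<close>, an order in which
  \<open>v\<close> exceeds this triangle works for \<open>X\<close> too. Otherwise \<open>X\<close>
  is not a chord, because the two triangles at a chord have no further common vertex; so
  \<open>X\<close> is the outer edge opposite \<open>v\<close> in its only triangle.\<close>

lemma sep_edge:
  assumes X: "edge_set X" and v: "v \<in> verts G" "v \<notin> X"
  shows "\<exists>k<d. (chord_set X \<longrightarrow> X \<inter> C k = {}) \<and> (\<forall>y\<in>X. \<rho> k y < \<rho> k v)"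
proof (cases "\<exists>t<m. X \<subseteq> tri t \<and> v \<notin> tri t")
  case True
  then show ?thesis using sep_tri v by blast
next
  case False
  obtain t where t: "t < m" "X \<subseteq> tri t" using edge_set_in_tri[OF X] by blast
  then have "v \<in> tri t" using False by blast
  have "\<not> chord_set X"
  proof
    assume "chord_set X"
    then obtain s where s: "0 < s" "s < m" "X = {p (J s), r (I s)}" unfolding chord_set_def by blast
    then have "X = tri (s - 1) \<inter> tri s" "s - 1 < m" using chord_set_tri by auto
    then show False using False v s by blast
  qed
  moreover have "X = tri t - {v}"
  proof -
    have "card (tri t) = 3"
      using t(1) p_neq_r
      by (cases rule: tri_cases) auto
    moreover have "card X = 2" using edge_set_card[OF X] by auto
    ultimately have "card (tri t - {v}) = card X" using \<open>v \<in> tri t\<close> finite_tri by simp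
    then show ?thesis using t v by (intro card_subset_eq) (auto simp: finite_tri)
  qed
  ultimately show ?thesis using sep_outer[OF t(1) \<open>v \<in> tri t\<close>] by simp
qed

lemma key_sep_vertex:
  assumes v: "v \<in> verts G" and y: "y \<in> cells M" "(Vertex v, y) \<notin> P_VEF M"
  shows "\<exists>k<d. key M (\<rho> k) (C k) B y < key M (\<rho> k) (C k) B (Vertex v)"
proof -
  have vc: "Vertex v \<in> cells M" using v unfolding cells_def G_def by auto
  have nb: "\<not> below M (Vertex v) y" "y \<noteq> Vertex v" using y vc unfolding P_VEF_def by auto
  from y(1) show ?thesis
  proof (cases rule: cells_cases)
    case (Vertex u)
    then have uv: "u \<noteq> v" using nb by auto
    obtain t where t: "t < m" "u \<in> tri t" using vert_in_tri Vertex by blast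
    have "\<exists>k<d. \<rho> k u < \<rho> k v"
    proof (cases "v \<in> tri t")
      case False then show ?thesis using sep_tri[OF t(1) v] t(2) by blast
    next
      case True
      \<comment> \<open>If \<open>u\<close> and \<open>v\<close> share the triangle, it suffices
        that \<open>v\<close> exceeds the edge from \<open>u\<close> to the third vertex.\<close>
      have "\<exists>w\<in>tri t. w \<noteq> u \<and> w \<noteq> v"
        using t(1) p_neq_r r_neq_p by (cases rule: tri_cases) auto
      then obtain w where w: "w \<in> tri t" "w \<noteq> u" "w \<noteq> v" by blast
      then have "edge_set {u, w}" using pair_in_tri_edge[OF t] by blast
      then show ?thesis using sep_edge[of "{u, w}" v] w uv v by blast
    qed
    then show ?thesis using Vertex by auto
  next
    case (Edge a)
    have X: "edge_set (tail G ` {a, edge_rev M a})" using arc_edge_set[OF Edge(1)] edge_verts[OF Edge(1)] by simp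
    have "v \<notin> tail G ` {a, edge_rev M a}" using nb(1) Edge by (simp add: G_def)
    then obtain k where k: "k < d" "chord_set (tail G ` {a, edge_rev M a}) \<longrightarrow> tail G ` {a, edge_rev M a} \<inter> C k = {}"
      "\<forall>y\<in>tail G ` {a, edge_rev M a}. \<rho> k y < \<rho> k v" using sep_edge[OF X v] by blast
    have "Max (\<rho> k ` tail G ` {a, edge_rev M a}) < \<rho> k v" using k(3) by (subst Max_less_iff) auto
    moreover have "{a, edge_rev M a} \<inter> outer_face M = {} \<Longrightarrow> tail G ` {a, edge_rev M a} \<inter> C k = {}"
      using k(2) chordal_iff[OF Edge(1)] rev_arc(2)[OF Edge(1)] by auto
    ultimately show ?thesis using k(1) Edge(2) by (intro exI[of _ k]) (auto simp: level_def G_def)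
  next
    case (Face t)
    have T: "tail (underlying M) ` F t = tri t" using tail_F[OF Face(1)] by (simp add: G_def)
    then have "v \<notin> tri t" using nb(1) Face by simp
    then obtain k where k: "k < d" "tri t \<inter> C k = {}" "\<forall>y\<in>tri t. \<rho> k y < \<rho> k v" using sep_tri[OF Face(1) v] by blast
    have "Max (\<rho> k ` tri t) < \<rho> k v" using k(3) by (subst Max_less_iff) (auto simp: finite_tri, simp add: tri_def)
    then show ?thesis using k Face F_not_outer[OF Face(1)] by (intro exI[of _ k]) (auto simp: level_def T)
  next
    case Outer
    then show ?thesis using nb(1) tail_outer v by (simp add: G_def)
  qed
qed

lemma below_verts: "x \<in> cells M \<Longrightarrow> v \<in> cell_verts M x \<Longrightarrow> v \<in> verts G \<and> (Vertex v, x) \<in> P_VEF M"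
proof -
  assume x: "x \<in> cells M" and v: "v \<in> cell_verts M x"
  from x have vv: "v \<in> verts G"
  proof (cases rule: cells_cases)
    case (Edge a) then show ?thesis using v edge_subset_verts[OF arc_edge_set[OF Edge(1)]] rev_arc(2)[OF Edge(1)]
      by (auto simp: G_def)
  next
    case (Face t) then show ?thesis using v tail_F[OF Face(1)] tri_verts[OF Face(1)] by (auto simp: G_def)
  next
    case Outer then show ?thesis using v tail_outer by (auto simp: G_def)
  qed (use v in auto)
  then have "Vertex v \<in> cells M" unfolding cells_def G_def by auto
  then show ?thesis using x v vv unfolding P_VEF_def by (cases x) auto
qed

lemma card_verts: "card (verts G) = K + N + 1"
proof -
  have "p ` {..<K} \<inter> r ` {..N} = {}" using p_neq_r by auto
  then show ?thesis unfolding verts_eq using inj_p inj_r by (simp add: card_Un_disjoint card_image)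
qed

text \<open>If some vertex of \<open>x\<close> is not below \<open>y\<close>, separating this vertex
  suffices, as \<open>x\<close> is at least as high. Otherwise all vertices of \<open>x\<close>
  belong to \<open>y\<close> although \<open>x\<close> is not below \<open>y\<close>. Comparing
  numbers of vertices leaves a chord or a bounded face against the outer face, and the outer face
  against a triangle that contains all vertices; there the colours decide.\<close>

lemma key_sep:
  assumes x: "x \<in> cells M" and y: "y \<in> cells M" "(x, y) \<notin> P_VEF M"
  shows "\<exists>k<d. key M (\<rho> k) (C k) B y < key M (\<rho> k) (C k) B x"
proof (cases "\<exists>v\<in>cell_verts M x. (Vertex v, y) \<notin> P_VEF M")
  case True
  then obtain v where v: "v \<in> cell_verts M x" "(Vertex v, y) \<notin> P_VEF M" by blast
  have vx: "v \<in> verts G" "(Vertex v, x) \<in> P_VEF M" using below_verts[OF x v(1)] by auto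
  obtain k where k: "k < d" "key M (\<rho> k) (C k) B y < key M (\<rho> k) (C k) B (Vertex v)"
    using key_sep_vertex[OF vx(1) y(1) v(2)] by blast
  have "key M (\<rho> k) (C k) B (Vertex v) \<le> key M (\<rho> k) (C k) B x"
    using key_mono[OF vx(2) _ k(1)] by (cases "x = Vertex v") auto
  then show ?thesis using k by auto
next
  case False
  have sub: "cell_verts M x \<subseteq> cell_verts M y"
  proof
    fix v assume "v \<in> cell_verts M x"
    then have "(Vertex v, y) \<in> P_VEF M" using False by blast
    then show "v \<in> cell_verts M y" unfolding P_VEF_def by (cases y) auto
  qed
  have xy: "x \<noteq> y" "\<not> below M x y" using x y unfolding P_VEF_def by auto
  have cx: "card (cell_verts M x) \<le> card (cell_verts M y)"
  proof (rule card_mono[OF _ sub])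
    have "cell_verts M y \<subseteq> verts G" using below_verts[OF y(1)] by blast
    then show "finite (cell_verts M y)" using finite_subset[OF _ finite_verts] by auto
  qed
  have ce: "card (tail (underlying M) ` {a, edge_rev M a}) = 2" if "a \<in> arcs G" for a
    using edge_verts[OF that] loop_free[OF that] by (simp add: G_def)
  have ct: "card (tail (underlying M) ` F t) = 3" if "t < m" for t
  proof -
    have "card (tri t) = 3" using that p_neq_r by (cases rule: tri_cases) auto
    then show ?thesis using tail_F[OF that] by (simp add: G_def)
  qed
  have co: "card (tail (underlying M) ` outer_face M) = K + N + 1"
    using card_verts tail_outer by (simp add: G_def)
  from y(1) show ?thesis
  proof (cases rule: cells_cases)
    case (Vertex u)
    have "card (cell_verts M x) \<le> 1" using cx Vertex by simp
    with x have "\<exists>v. x = Vertex v"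
      by (cases rule: cells_cases) (use ce ct co K_pos N_pos in auto)
    then show ?thesis using sub Vertex xy by auto
  next
    case (Edge a)
    have c2: "card (cell_verts M x) \<le> 2" using cx Edge ce by simp
    from x show ?thesis
    proof (cases rule: cells_cases)
      case (Vertex v)
      then show ?thesis using sub xy Edge by auto
    next
      case (Edge b)
      have "cell_verts M x = cell_verts M y"
      proof (rule card_subset_eq[OF _ sub])
        show "finite (cell_verts M y)" using \<open>y = Edge {a, edge_rev M a}\<close> by simp
        show "card (cell_verts M x) = card (cell_verts M y)"
          using Edge \<open>y = Edge {a, edge_rev M a}\<close> \<open>a \<in> arcs G\<close> ce by simp
      qed
      then have "tail G ` {a, edge_rev M a} = tail G ` {b, edge_rev M b}"
        using Edge \<open>y = Edge {a, edge_rev M a}\<close> by (simp add: G_def)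
      then have "x = y" using edge_unique[of b a] edge_verts Edge \<open>y = Edge {a, edge_rev M a}\<close> \<open>a \<in> arcs G\<close> by simp
      then show ?thesis using xy by simp
    next
      case (Face t) then show ?thesis using c2 ct by simp
    next
      case Outer then show ?thesis using c2 co K_pos N_pos by simp
    qed
  next
    case (Face t)
    have T: "tail (underlying M) ` F t = tri t" using tail_F[OF Face(1)] by (simp add: G_def)
    from x show ?thesis
    proof (cases rule: cells_cases)
      case (Vertex v)
      then show ?thesis using sub xy Face by auto
    next
      case (Edge b)
      have "{tail G b, head G b} \<subseteq> tri t" using sub T Face Edge rev_arc(2)[OF Edge(1)] by (simp add: G_def)
      then show ?thesis using edge_in_F_iff[OF Edge(1) Face(1)] xy Edge Face by simp
    next
      case (Face s)
      then have "tri s \<subseteq> tri t" using sub T \<open>y = Face (F t)\<close> tail_F[OF Face(1)] by (simp add: G_def)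
      then have "s = t" using tri_subset_eq Face \<open>t < m\<close> by blast
      then show ?thesis using Face \<open>y = Face (F t)\<close> xy by simp
    next
      case Outer
      obtain k where k: "k < d" "tri t \<inter> C k = {}" using coloured[OF Face(1)] by blast
      have "Max (\<rho> k ` tri t) < B" using below_B[OF k(1)] tri_verts[OF Face(1)] 
        by (subst Max_less_iff) (auto simp: finite_tri, simp add: tri_def)
      then have "key M (\<rho> k) (C k) B y < key M (\<rho> k) (C k) B x"
        using Face F_not_outer[OF Face(1)] Outer k(2) T by (simp add: level_def)
      then show ?thesis using k by blast
    qed
  next
    case Outer
    from x show ?thesis
    proof (cases rule: cells_cases)
      case (Vertex v)
      then show ?thesis using tail_outer xy Outer by (auto simp: G_def)
    next
      case (Edge b)
      have e: "{b, edge_rev M b} \<inter> outer_face M = {}" using xy(2) Edge Outer by simp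
      then have "chord_set (tail (underlying M) ` {b, edge_rev M b})" 
        using chordal_iff[OF Edge(1)] edge_verts[OF Edge(1)] by (simp add: G_def)
      then obtain k where k: "k < d" "tail (underlying M) ` {b, edge_rev M b} \<inter> C k \<noteq> {}" 
        using coloured_chord by blast
      then have "key M (\<rho> k) (C k) B y < key M (\<rho> k) (C k) B x"
        using Outer Edge e by (simp add: level_def del: image_insert)
      then show ?thesis using k by blast
    next
      case (Face t)
      obtain k where k: "k < d" "tri t \<inter> C k \<noteq> {}" using coloured[OF Face(1)] by blast
      have T: "tail (underlying M) ` F t = tri t" using tail_F[OF Face(1)] by (simp add: G_def)
      have "key M (\<rho> k) (C k) B y < key M (\<rho> k) (C k) B x"
        using Outer Face F_not_outer[OF Face(1)] k(2) T by (simp add: level_def)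
      then show ?thesis using k by blast
    next
      case Outer then show ?thesis using xy \<open>y = Face (outer_face M)\<close> by simp
    qed
  qed
qed

lemma realizer_of_ranks:
  assumes "\<And>k. k < d \<Longrightarrow> distinct (xs k) \<and> set (xs k) = cells M \<and> sorted (map (key M (\<rho> k) (C k) B) (xs k))"
  shows "realizer (cells M) (P_VEF M) (map (\<lambda>k. list_order (xs k)) [0..<d])"
  by (rule realizer_of_keys[where \<kappa> = "\<lambda>k. key M (\<rho> k) (C k) B"])
    (use key_mono key_sep assms in \<open>auto simp: P_VEF_def\<close>)

end

end

section \<open>Explicit ranks for at most four vertices on one side\<close>

definition rank_p :: "nat \<Rightarrow> nat \<Rightarrow> nat \<Rightarrow> nat" where
  "rank_p S k j =
    (if k = 0 then if j = 0 \<or> j = 3 then 3 * S else 0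
     else if k = 1 then if j = 0 then 2 * S else if j = 1 then 3 * S else 0
     else if j = 2 then 3 * S else if j = 3 then 2 * S else 0)"

text \<open>\<open>i1\<close>, \<open>i2\<close>, \<open>i3\<close> are the indices at which the
  fans of \<open>p 0\<close>, \<open>p 1\<close>, \<open>p 2\<close> end, and \<open>S\<close>
  exceeds all differences of indices, so that multiples of \<open>S\<close> separate blocks of
  ranks. For \<open>j < 4\<close>, \<open>rank_p\<close> takes the value \<open>3 * S\<close>
  exactly when \<open>j mod 3 = k\<close>, that is, in the order in which the cells at
  \<open>p j\<close> are lifted anyway. The lowest \<open>r\<close>-vertex is at \<open>i1\<close>
  in order 2, at \<open>i2\<close> in order 0 and at \<open>i3\<close> in order 1. If
  \<open>i1 = i2\<close>, the fan of \<open>p 1\<close> has no triangle; this case needs other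
  offsets in order 0 and another block boundary in order 1.\<close>

definition rank_r :: "nat \<Rightarrow> nat \<Rightarrow> nat \<Rightarrow> nat \<Rightarrow> nat \<Rightarrow> nat \<Rightarrow> nat" where
  "rank_r S i1 i2 i3 k i =
    (if k = 0 then
       if i < i2 then (if i1 = i2 then S else 1) + (i2 - i)
       else if i2 < i then (if i1 = i2 then 1 else S) + (i - i2) else 1
     else if k = 1 then
       if i3 \<le> i then 1 + (i - i3)
       else if (if i1 = i2 then i2 + 1 else i2) \<le> i then S + (i3 - i) else 2 * S + i + 1
     else
       if i \<le> i1 then 1 + (i1 - i) else if i < i2 then S + (i - i1) else 3 * S - i)"

context
  fixes S i1 i2 i3 N :: nat
  assumes order: "1 \<le> i1" "i1 \<le> i2" "i2 \<le> i3" "i1 < i3" "i3 \<le> N + 3" "N + 5 \<le> S"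
begin

text \<open>The three vertices are those of the fan triangle \<open>p j\<close>, \<open>r i\<close>,
  \<open>r (Suc i)\<close>.\<close>

definition exceeds :: "nat \<Rightarrow> nat \<Rightarrow> nat \<Rightarrow> nat \<Rightarrow> bool" where
  "exceeds k j i x \<longleftrightarrow> rank_p S k j < x \<and> rank_r S i1 i2 i3 k i < x \<and> rank_r S i1 i2 i3 k (Suc i) < x"

text \<open>The last hypothesis places the edge from \<open>r i\<close> to \<open>r (Suc i)\<close>
  in the fan of \<open>p j\<close>. The order \<open>j mod 3\<close> lifts the triangle and is
  excluded. Which of the two others works depends on the position of \<open>l\<close> relative to
  the fan and to the turns; the blocks of ranks are arranged so that one of them always
  does.\<close>

lemma fan_sep_r:
  assumes "i < N" "l \<le> N" "l \<noteq> i" "l \<noteq> Suc i"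
    and "j = 0 \<and> i < i1 \<or> j = 1 \<and> i1 \<le> i \<and> i < i2 \<or> j = 2 \<and> i2 \<le> i \<and> i < i3 \<or> j = 3 \<and> i3 \<le> i"
  shows "\<exists>k<3. k \<noteq> j mod 3 \<and> exceeds k j i (rank_r S i1 i2 i3 k l)"
  using assms(5)
proof (elim disjE conjE)
  assume j: "j = 0" "i < i1"
  have "exceeds 1 j i (rank_r S i1 i2 i3 1 l)" if "l > Suc i" "l < i3" "l < (if i1 = i2 then i2 + 1 else i2)"
    using that j order assms(1-4) unfolding exceeds_def rank_p_def rank_r_def by (cases "i1 = i2") auto
  moreover have "exceeds 2 j i (rank_r S i1 i2 i3 2 l)" 
    if "l < i \<or> l \<ge> i3 \<or> l \<ge> (if i1 = i2 then i2 + 1 else i2)"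
    using that j order assms(1-4) unfolding exceeds_def rank_p_def rank_r_def by (cases "i1 = i2") auto
  moreover have "1 \<noteq> j mod 3" "2 \<noteq> j mod 3" using j by auto
  moreover have "(1::nat) < 3" "(2::nat) < 3" by auto
  ultimately show ?thesis using assms(3,4) by (metis linorder_not_le not_less_eq linorder_neqE_nat)
next
  assume j: "j = 1" "i1 \<le> i" "i < i2"
  have "exceeds 0 j i (rank_r S i1 i2 i3 0 l)" if "l < i \<or> i2 < l"
    using that j order assms(1-4) unfolding exceeds_def rank_p_def rank_r_def by (cases "i1 = i2") auto
  moreover have "exceeds 2 j i (rank_r S i1 i2 i3 2 l)" if "Suc i < l" "l \<le> i2"
    using that j order assms(1-4) unfolding exceeds_def rank_p_def rank_r_def by (cases "i1 = i2") auto
  moreover have "0 \<noteq> j mod 3" "2 \<noteq> j mod 3" using j by auto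
  moreover have "(0::nat) < 3" "(2::nat) < 3" by auto
  ultimately show ?thesis using assms(3,4) by (metis linorder_not_le not_less_eq linorder_neqE_nat)
next
  assume j: "j = 2" "i2 \<le> i" "i < i3"
  have "exceeds 1 j i (rank_r S i1 i2 i3 1 l)" if "l < i" "i1 < i2 \<or> i2 < i"
    using that j order assms(1-4) unfolding exceeds_def rank_p_def rank_r_def by (cases "i1 = i2") auto
  moreover have "exceeds 0 j i (rank_r S i1 i2 i3 0 l)" if "Suc i < l \<or> l < i \<and> i = i2 \<and> i1 = i2"
    using that j order assms(1-4) unfolding exceeds_def rank_p_def rank_r_def by (cases "i1 = i2") auto
  moreover have "0 \<noteq> j mod 3" "1 \<noteq> j mod 3" using j by auto
  moreover have "(0::nat) < 3" "(1::nat) < 3" by auto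
  moreover have "l < i \<or> Suc i < l" using assms(3,4) by auto
  moreover have "i1 < i2 \<or> i2 < i \<or> i = i2 \<and> i1 = i2" using order j by auto
  ultimately show ?thesis by metis
next
  assume j: "j = 3" "i3 \<le> i"
  have "exceeds 1 j i (rank_r S i1 i2 i3 1 l)" if "Suc i < l \<or> l < i3"
    using that j order assms(1-4) unfolding exceeds_def rank_p_def rank_r_def by (cases "i1 = i2") auto
  moreover have "exceeds 2 j i (rank_r S i1 i2 i3 2 l)" if "i3 \<le> l" "l < i"
    using that j order assms(1-4) unfolding exceeds_def rank_p_def rank_r_def by (cases "i1 = i2") auto
  moreover have "1 \<noteq> j mod 3" "2 \<noteq> j mod 3" using j by auto
  moreover have "(1::nat) < 3" "(2::nat) < 3" by auto
  moreover have "l < i \<or> Suc i < l" using assms(3,4) by auto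
  ultimately show ?thesis by (metis linorder_not_le)
qed

lemma fan_sep_p:
  assumes "i < N" "j' < 4" "j' \<noteq> j"
    and "j = 0 \<and> i < i1 \<or> j = 1 \<and> i1 \<le> i \<and> i < i2 \<or> j = 2 \<and> i2 \<le> i \<and> i < i3 \<or> j = 3 \<and> i3 \<le> i"
  shows "\<exists>k<3. k \<noteq> j mod 3 \<and> exceeds k j i (rank_p S k j')"
proof -
  have j': "j' = 0 \<or> j' = 1 \<or> j' = 2 \<or> j' = 3" using assms(2) by auto
  have *: "\<exists>k<3. k \<noteq> j mod 3 \<and> exceeds k j i (rank_p S k j')" if "l < 3" "l \<noteq> j mod 3" 
     "exceeds l j i (rank_p S l j')" for l using that by blast
  from assms(4) show ?thesis
  proof (elim disjE conjE)
    assume j: "j = 0" "i < i1"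
    show ?thesis using j' assms(3) j(1) order assms(1) j(2)
      by (elim disjE; intro *[of "if j' = 1 then 1 else 2"]; auto simp: exceeds_def rank_p_def rank_r_def)
  next
    assume j: "j = 1" "i1 \<le> i" "i < i2"
    show ?thesis using j' assms(3) j(1) order assms(1) j(2,3)
      by (elim disjE; intro *[of "if j' = 2 then 2 else 0"]; auto simp: exceeds_def rank_p_def rank_r_def)
  next
    assume j: "j = 2" "i2 \<le> i" "i < i3"
    show ?thesis using j' assms(3) j(1) order assms(1) j(2,3)
      by (elim disjE; intro *[of "if j' = 1 then 1 else 0"]; auto simp: exceeds_def rank_p_def rank_r_def)
  next
    assume j: "j = 3" "i3 \<le> i"
    show ?thesis using j' assms(3) j(1) order assms(1) j(2)
      by (elim disjE; intro *[of "if j' = 2 then 2 else 1"]; auto simp: exceeds_def rank_p_def rank_r_def)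
  qed
qed

text \<open>The triangle at a turn contains \<open>p j\<close> and \<open>p (Suc j)\<close>, which
  have different colours, so a single order is left and has to serve for all outside vertices at
  once. In this order both \<open>p\<close>-vertices have rank 0, and \<open>r i\<close> is the
  lowest \<open>r\<close>-vertex.\<close>

lemma turn_sep:
  assumes "j = 0 \<and> i = i1 \<or> j = 1 \<and> i = i2 \<or> j = 2 \<and> i = i3"
  shows "\<exists>k<3. k \<noteq> j mod 3 \<and> k \<noteq> Suc j mod 3 \<and> 
    rank_p S k j < rank_r S i1 i2 i3 k i \<and> rank_p S k (Suc j) < rank_r S i1 i2 i3 k i \<and>
    (\<forall>l\<le>N. l \<noteq> i \<longrightarrow> rank_r S i1 i2 i3 k i < rank_r S i1 i2 i3 k l) \<and>
    (\<forall>l<4. l \<noteq> j \<longrightarrow> l \<noteq> Suc j \<longrightarrow> rank_r S i1 i2 i3 k i < rank_p S k l)"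
  using assms
proof (elim disjE conjE)
  assume "j = 0" "i = i1"
  then show ?thesis using order unfolding rank_p_def rank_r_def by (intro exI[of _ 2]) auto
next
  assume "j = 1" "i = i2"
  then show ?thesis using order unfolding rank_p_def rank_r_def by (intro exI[of _ 0]) auto
next
  assume "j = 2" "i = i3"
  then show ?thesis using order unfolding rank_p_def rank_r_def by (intro exI[of _ 1]) auto
qed

text \<open>Lifting affects edges and faces only, so in the order \<open>j mod 3\<close> the vertex
  \<open>p j\<close> keeps its own rank \<open>3 * S\<close>, which is above its whole fan.\<close>

lemma fan_apex:
  assumes "i < N"
    and "j = 0 \<and> i < i1 \<or> j = 1 \<and> i1 \<le> i \<and> i < i2 \<or> j = 2 \<and> i2 \<le> i \<and> i < i3 \<or> j = 3 \<and> i3 \<le> i"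
  shows "\<exists>k<3. rank_r S i1 i2 i3 k i < rank_p S k j \<and> rank_r S i1 i2 i3 k (Suc i) < rank_p S k j"
  using assms(2) order assms(1)
  by (elim disjE; intro exI[of _ "j mod 3"]; auto simp: rank_p_def rank_r_def)

text \<open>In order 1 the ranks \<open>2 * S + i + 1\<close> grow with \<open>i\<close>, so that
  \<open>r 1\<close> exceeds \<open>r 0\<close>, and they start beyond the rank \<open>2 * S\<close>
  of \<open>p 0\<close>.\<close>

lemma first_ear: "\<exists>k<3. rank_p S k 0 < rank_r S i1 i2 i3 k 1 \<and> rank_r S i1 i2 i3 k 0 < rank_r S i1 i2 i3 k 1"
  using order unfolding rank_p_def rank_r_def by (intro exI[of _ 1]) auto

text \<open>Here \<open>p j\<close> is the last \<open>p\<close>-vertex, and the turn after its fan,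
  if listed, is imagined at \<open>N + 1\<close>. The order is chosen so that the ranks of the
  \<open>r\<close>-vertices fall towards \<open>r N\<close> and \<open>p j\<close> stays below
  them.\<close>

lemma last_ear:
  assumes "0 < N" "j = 0 \<and> i1 = N + 1 \<or> j = 1 \<and> i1 < N \<and> i2 = N + 1 \<or> j = 2 \<and> i2 < N \<and> i3 = N + 1 \<or> j = 3 \<and> i3 < N"
  shows "\<exists>k<3. rank_p S k j < rank_r S i1 i2 i3 k (N - 1) \<and> rank_r S i1 i2 i3 k N < rank_r S i1 i2 i3 k (N - 1)"
  using assms(2) order assms(1)
  by (elim disjE; intro exI[of _ "if j = 0 then 2 else if j = 1 then 0 else if j = 2 then 1 else 2"];
      simp add: rank_p_def rank_r_def; linarith)

lemma ranks_bounded: "l \<le> N \<Longrightarrow> rank_r S i1 i2 i3 k l < 4 * S" "rank_p S k j < 4 * S"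
  using order unfolding rank_p_def rank_r_def by auto

end

section \<open>Realizers\<close>

context staircase
begin

text \<open>An outer edge of a triangle is either the side opposite the vertex common to its two
  rungs, which is covered by \<open>fan\<close> and \<open>turn\<close>, or one of the end rungs 0
  and \<open>m\<close>. Opposite to the end rungs are \<open>r 1\<close> and
  \<open>r (N - 1)\<close>.\<close>

lemma sep_outerI:
  fixes \<rho> :: "nat \<Rightarrow> 'v \<Rightarrow> nat"
  assumes fan: "\<And>t. t < m \<Longrightarrow> J (Suc t) = J t \<Longrightarrow>
        \<exists>k<d. \<rho> k (r (I t)) < \<rho> k (p (J t)) \<and> \<rho> k (r (Suc (I t))) < \<rho> k (p (J t))"
    and turn: "\<And>t. t < m \<Longrightarrow> J (Suc t) = Suc (J t) \<Longrightarrow>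
        \<exists>k<d. \<rho> k (p (J t)) < \<rho> k (r (I t)) \<and> \<rho> k (p (Suc (J t))) < \<rho> k (r (I t))"
    and ear0: "\<exists>k<d. \<rho> k (p 0) < \<rho> k (r 1) \<and> \<rho> k (r 0) < \<rho> k (r 1)"
    and ear1: "\<exists>k<d. \<rho> k (p (K - 1)) < \<rho> k (r (N - 1)) \<and> \<rho> k (r N) < \<rho> k (r (N - 1))"
    and t: "t < m" "v \<in> tri t" "\<not> chord_set (tri t - {v})"
  shows "\<exists>k<d. \<forall>y\<in>tri t - {v}. \<rho> k y < \<rho> k v"
  using t(1)
proof (cases rule: tri_cases)
  case Istep
  have d: "p (J t) \<noteq> r (I t)" "p (J t) \<noteq> r (Suc (I t))" "r (I t) \<noteq> r (Suc (I t))"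
    using Istep p_neq_r by auto
  consider "v = p (J t)" | "v = r (I t)" | "v = r (Suc (I t))" using t(2) Istep(3) by auto
  then show ?thesis
  proof cases
    case 1
    then show ?thesis using fan[OF t(1) Istep(1)] Istep(3) by auto
  next
    case 2
    then have "tri t - {v} = {p (J (Suc t)), r (I (Suc t))}" using d Istep by auto
    then have "Suc t < m \<Longrightarrow> chord_set (tri t - {v})" unfolding chord_set_def by (intro exI[of _ "Suc t"]) simp
    then have "Suc t = m" using t(1,3) by linarith
    then have "t = m - 1" by simp
    then have "J t = K - 1" "I t = N - 1" "Suc (I t) = N" using path_last last_step N_pos by auto
    then show ?thesis using ear1 2 Istep(3) d by auto
  next
    case 3
    then have "tri t - {v} = {p (J t), r (I t)}" using d Istep by auto
    then have "0 < t \<Longrightarrow> chord_set (tri t - {v})" unfolding chord_set_def using t(1) by (intro exI[of _ t]) simp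
    then have "t = 0" using t(3) by linarith
    then show ?thesis using ear0 3 Istep(3) d path_start by auto
  qed
next
  case Jstep
  have d: "p (J t) \<noteq> r (I t)" "p (Suc (J t)) \<noteq> r (I t)" "p (J t) \<noteq> p (Suc (J t))"
    using Jstep p_neq_r by auto
  consider "v = r (I t)" | "v = p (J t)" | "v = p (Suc (J t))" using t(2) Jstep(3) by auto
  then show ?thesis
  proof cases
    case 1
    then show ?thesis using turn[OF t(1) Jstep(1)] Jstep(3) by auto
  next
    case 2
    then have "tri t - {v} = {p (J (Suc t)), r (I (Suc t))}" using d Jstep by auto
    then have "chord_set (tri t - {v})" unfolding chord_set_def using Jstep(7) by (intro exI[of _ "Suc t"]) simp
    then show ?thesis using t(3) by simp
  next
    case 3
    then have "tri t - {v} = {p (J t), r (I t)}" using d Jstep by auto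
    then have "chord_set (tri t - {v})" unfolding chord_set_def using Jstep(6) t(1) by (intro exI[of _ t]) simp
    then show ?thesis using t(3) by simp
  qed
qed

definition hi :: "nat \<Rightarrow> nat" where
  "hi j = Max (I ` {t. t \<le> m \<and> J t = j})"

lemma hi_turn: assumes "t < m" "J (Suc t) = Suc (J t)" shows "hi (J t) = I t"
  unfolding hi_def
proof (rule Max_eqI)
  fix y assume "y \<in> I ` {s. s \<le> m \<and> J s = J t}"
  then obtain s where s: "s \<le> m" "J s = J t" "y = I s" by auto
  have "s \<le> t"
  proof (rule ccontr)
    assume "\<not> s \<le> t"
    then have "J (Suc t) \<le> J s" using mono_JI[of "Suc t" s] s by auto
    then show False using s assms by simp
  qed
  then show "y \<le> I t" using mono_JI[of s t] s assms by simp
qed (use assms in auto)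

lemma hi_in: assumes "j < K" shows "\<exists>t\<le>m. J t = j \<and> I t = hi j"
proof -
  have "hi j \<in> I ` {t. t \<le> m \<and> J t = j}" unfolding hi_def
    using J_surj[OF assms] by (intro Max_in) auto
  then show ?thesis by auto
qed

lemma hi_ge: "t \<le> m \<Longrightarrow> I t \<le> hi (J t)" unfolding hi_def by (intro Max_ge) auto

text \<open>The index where the fan of \<open>p j\<close> ends; fans that do not exist are imagined to follow after the last rung.\<close>

definition turn :: "nat \<Rightarrow> nat" where
  "turn j = (if Suc j < K then hi j else N + 2 + j - K)"

lemma turn_at: "t < m \<Longrightarrow> J (Suc t) = Suc (J t) \<Longrightarrow> turn (J t) = I t"
  using hi_turn[of t] J_lt[of "Suc t"] unfolding turn_def by simp

lemma hi_less: assumes "Suc j < K" shows "0 < hi j" "hi j < N"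
proof -
  obtain t where t: "t < m" "J t = j" "J (Suc t) = Suc j" using J_surj[of j] assms by auto
  from t(1) show "0 < hi j" "hi j < N" 
    by (cases rule: tri_cases; use t hi_turn[of t] in auto)+
qed

lemma hi_mono: "Suc j < K \<Longrightarrow> hi j \<le> hi (Suc j)"
proof -
  assume "Suc j < K"
  then obtain t where t: "t < m" "J t = j" "J (Suc t) = Suc j" using J_surj[of j] by auto
  then have "hi j = I t" "I t \<le> I (Suc t)" "I (Suc t) \<le> hi (Suc j)"
    using hi_turn[of t] mono_JI[of t "Suc t"] hi_ge[of "Suc t"] by auto
  then show ?thesis by simp
qed

lemma fan_bounds:
  assumes "t < m" "J (Suc t) = J t"
  shows "I t < turn (J t)" "0 < J t \<Longrightarrow> turn (J t - 1) \<le> I t"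
proof -
  have "I (Suc t) = Suc (I t)" using path_step assms by fastforce
  moreover have "I (Suc t) \<le> hi (J (Suc t))" using hi_ge[of "Suc t"] assms by simp
  moreover have "I (Suc t) \<le> N" using I_le assms by simp
  ultimately show "I t < turn (J t)" using assms J_lt[of t] unfolding turn_def by auto
  assume j: "0 < J t"
  have "J t - 1 < K" "Suc (J t - 1) < K" using J_lt[of t] assms j by auto
  then obtain s where s: "s < m" "J s = J t - 1" "J (Suc s) = J t" using J_surj[of "J t - 1"] j by auto
  have "turn (J t - 1) = I s" using turn_at[of s] s j by simp
  moreover have "s \<le> t"
  proof (rule ccontr)
    assume "\<not> s \<le> t"
    then have "J t \<le> J s" using mono_JI[of t s] s by simp
    then show False using s j by simp
  qed
  ultimately show "turn (J t - 1) \<le> I t" using mono_JI[of s t] assms by simp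
qed

text \<open>For \<open>K = 4\<close> the condition on \<open>hi\<close> says that the first and the
  last turn differ, which is the hypothesis \<open>i1 < i3\<close> of the lemmas on ranks. For
  smaller \<open>K\<close> this inequality holds of itself, since the imagined turns increase
  strictly beyond \<open>N\<close>.\<close>

lemma good_realizer:
  fixes \<rho> :: "nat \<Rightarrow> 'v \<Rightarrow> nat"
  assumes K: "K \<le> 4" "K = 4 \<Longrightarrow> \<not> (hi 0 = hi 1 \<and> hi 1 = hi 2)" and S: "N + 5 \<le> S"
    and rp: "\<And>k j. k < 3 \<Longrightarrow> j < K \<Longrightarrow> \<rho> k (p j) = rank_p S k j"
    and rr: "\<And>k i. k < 3 \<Longrightarrow> i \<le> N \<Longrightarrow> \<rho> k (r i) = rank_r S (turn 0) (turn 1) (turn 2) k i"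
    and C: "\<And>k. C k = {p j | j. j < K \<and> j mod 3 = k}"
    and xs: "\<And>k. k < 3 \<Longrightarrow> distinct (xs k) \<and> set (xs k) = cells M \<and> sorted (map (key M (\<rho> k) (C k) (4 * S)) (xs k))"
  shows "realizer (cells M) (P_VEF M) (map (\<lambda>k. list_order (xs k)) [0..<3])"
proof -
  let ?i1 = "turn 0" and ?i2 = "turn 1" and ?i3 = "turn 2"
  have h: "Suc 0 < K \<Longrightarrow> 0 < hi 0 \<and> hi 0 < N \<and> hi 0 \<le> hi 1" "Suc 1 < K \<Longrightarrow> hi 1 < N \<and> hi 1 \<le> hi 2" "Suc 2 < K \<Longrightarrow> hi 2 < N"
    using hi_less[of 0] hi_less[of 1] hi_less[of 2] hi_mono[of 0] hi_mono[of 1] by (auto simp: numeral_2_eq_2)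
  have K4: "K = 1 \<or> K = 2 \<or> K = 3 \<or> K = 4" using K K_pos by auto
  then have ord: "1 \<le> ?i1" "?i1 \<le> ?i2" "?i2 \<le> ?i3" "?i1 < ?i3" "?i3 \<le> N + 3" "N + 5 \<le> S"
    using h K(2) S unfolding turn_def by auto
  have fanc: "J t = 0 \<and> I t < ?i1 \<or> J t = 1 \<and> ?i1 \<le> I t \<and> I t < ?i2 \<or> J t = 2 \<and> ?i2 \<le> I t \<and> I t < ?i3 \<or> J t = 3 \<and> ?i3 \<le> I t"
    if "t < m" "J (Suc t) = J t" for t
  proof -
    have "J t < 4" using J_lt[of t] that K by simp
    then have "J t = 0 \<or> J t = 1 \<or> J t = 2 \<or> J t = 3" by auto
    then show ?thesis using fan_bounds[OF that] by auto
  qed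
  have turnc: "J t = 0 \<and> I t = ?i1 \<or> J t = 1 \<and> I t = ?i2 \<or> J t = 2 \<and> I t = ?i3"
    if "t < m" "J (Suc t) = Suc (J t)" for t
  proof -
    have "J t < 3" using J_lt[of "Suc t"] that K by simp
    then have "J t = 0 \<or> J t = 1 \<or> J t = 2" by auto
    then show ?thesis using turn_at[OF that] by auto
  qed
  have sep: "\<exists>k<3. tri t \<inter> C k = {} \<and> (\<forall>y\<in>tri t. \<rho> k y < \<rho> k x)" if t: "t < m" and x: "x \<in> verts G" "x \<notin> tri t" for t x
    using t
  proof (cases rule: tri_cases)
    case Istep
    have ex: "\<exists>k<3. k \<noteq> J t mod 3 \<and> exceeds S ?i1 ?i2 ?i3 k (J t) (I t) (\<rho> k x)"
    proof (cases "\<exists>l\<le>N. x = r l")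
      case True
      then obtain l where l: "l \<le> N" "x = r l" by blast
      then have "l \<noteq> I t" "l \<noteq> Suc (I t)" using x(2) Istep by auto
      then obtain k where "k < 3" "k \<noteq> J t mod 3" "exceeds S ?i1 ?i2 ?i3 k (J t) (I t) (rank_r S ?i1 ?i2 ?i3 k l)"
        using fan_sep_r[OF ord Istep(5) l(1) _ _ fanc[OF t Istep(1)]] by blast
      then show ?thesis using l rr by (intro exI[of _ k]) simp
    next
      case False
      then obtain l where l: "l < K" "x = p l" using x(1) verts_eq by auto
      then have "l < 4" "l \<noteq> J t" using x(2) Istep K by auto
      then obtain k where "k < 3" "k \<noteq> J t mod 3" "exceeds S ?i1 ?i2 ?i3 k (J t) (I t) (rank_p S k l)"
        using fan_sep_p[OF ord Istep(5) _ _ fanc[OF t Istep(1)]] by blast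
      then show ?thesis using l rp by (intro exI[of _ k]) simp
    qed
    then obtain k where k: "k < 3" "k \<noteq> J t mod 3" "exceeds S ?i1 ?i2 ?i3 k (J t) (I t) (\<rho> k x)" by blast
    have "tri t \<inter> C k = {}" unfolding Istep(3) C using k(2) Istep(4,5) r_neq_p by auto
    moreover have "\<forall>y\<in>tri t. \<rho> k y < \<rho> k x" using k(1,3) Istep(4,5) rp rr unfolding Istep(3) exceeds_def[OF ord] by auto
    ultimately show ?thesis using k(1) by blast
  next
    case Jstep
    obtain k where k: "k < 3" "k \<noteq> J t mod 3" "k \<noteq> Suc (J t) mod 3"
      "rank_p S k (J t) < rank_r S ?i1 ?i2 ?i3 k (I t)" "rank_p S k (Suc (J t)) < rank_r S ?i1 ?i2 ?i3 k (I t)"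
      "\<forall>l\<le>N. l \<noteq> I t \<longrightarrow> rank_r S ?i1 ?i2 ?i3 k (I t) < rank_r S ?i1 ?i2 ?i3 k l"
      "\<forall>l<4. l \<noteq> J t \<longrightarrow> l \<noteq> Suc (J t) \<longrightarrow> rank_r S ?i1 ?i2 ?i3 k (I t) < rank_p S k l"
      using turn_sep[OF ord turnc[OF t Jstep(1)]] by auto
    have "rank_r S ?i1 ?i2 ?i3 k (I t) < \<rho> k x"
    proof (cases "\<exists>l\<le>N. x = r l")
      case True
      then obtain l where l: "l \<le> N" "x = r l" by blast
      then have "l \<noteq> I t" using x(2) Jstep by auto
      then show ?thesis using k(1,6) l rr by auto
    next
      case False
      then obtain l where l: "l < K" "x = p l" using x(1) verts_eq by auto
      then have "l < 4" "l \<noteq> J t" "l \<noteq> Suc (J t)" using x(2) Jstep K by auto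
      then show ?thesis using k(1,7) l rp by auto
    qed
    then have "\<forall>y\<in>tri t. \<rho> k y < \<rho> k x" using k(1,4,5) Jstep(4,5) rp rr unfolding Jstep(3) by auto
    moreover have "tri t \<inter> C k = {}" unfolding Jstep(3) C using k(2,3) Jstep(4,5) r_neq_p by auto
    ultimately show ?thesis using k(1) by blast
  qed
  have colp: "j < K \<Longrightarrow> p j \<in> C k \<longleftrightarrow> k = j mod 3" for j k unfolding C by auto
  show ?thesis
  proof (rule realizer_of_ranks[where B = "4 * S" and \<rho> = \<rho> and C = C])
    show "\<rho> k v < 4 * S" if "k < 3" "v \<in> verts G" for k v
      using that ranks_bounded[OF ord] rp rr unfolding verts_eq by auto
    show "\<exists>k<3. tri t \<inter> C k = {} \<and> (\<forall>y\<in>tri t. \<rho> k y < \<rho> k x)" if "t < m" "x \<in> verts G" "x \<notin> tri t" for t x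
      using sep that by blast
    show "\<exists>k<3. \<forall>y\<in>tri t - {v}. \<rho> k y < \<rho> k v" if "t < m" "v \<in> tri t" "\<not> chord_set (tri t - {v})" for t v
      using _ _ _ _ that
    proof (rule sep_outerI)
      fix t assume t: "t < m" "J (Suc t) = J t"
      then have "J t < K" "I t < N" using J_lt[of t] I_le[of "Suc t"] path_step[of t] by auto
      then show "\<exists>k<3. \<rho> k (r (I t)) < \<rho> k (p (J t)) \<and> \<rho> k (r (Suc (I t))) < \<rho> k (p (J t))"
        using fan_apex[OF ord _ fanc[OF t]] by (force simp: rp rr)
    next
      fix t assume t: "t < m" "J (Suc t) = Suc (J t)"
      then have "J t < K" "Suc (J t) < K" "I t \<le> N" using J_lt[of t] J_lt[of "Suc t"] I_le[of t] by auto
      then show "\<exists>k<3. \<rho> k (p (J t)) < \<rho> k (r (I t)) \<and> \<rho> k (p (Suc (J t))) < \<rho> k (r (I t))"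
        using turn_sep[OF ord turnc[OF t]] by (force simp: rp rr)
    next
      show "\<exists>k<3. \<rho> k (p 0) < \<rho> k (r 1) \<and> \<rho> k (r 0) < \<rho> k (r 1)"
        using first_ear[OF ord] K_pos N_pos by (force simp: rp rr)
    next
      have "K - 1 = 0 \<and> ?i1 = N + 1 \<or> K - 1 = 1 \<and> ?i1 < N \<and> ?i2 = N + 1 \<or> K - 1 = 2 \<and> ?i2 < N \<and> ?i3 = N + 1 \<or> K - 1 = 3 \<and> ?i3 < N"
        using K4 h unfolding turn_def by auto
      from last_ear[OF ord N_pos this] obtain k where k: "k < 3"
          "rank_p S k (K - 1) < rank_r S ?i1 ?i2 ?i3 k (N - 1)"
          "rank_r S ?i1 ?i2 ?i3 k N < rank_r S ?i1 ?i2 ?i3 k (N - 1)" by blast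
      then show "\<exists>k<3. \<rho> k (p (K - 1)) < \<rho> k (r (N - 1)) \<and> \<rho> k (r N) < \<rho> k (r (N - 1))"
        using K_pos by (intro exI[of _ k]) (simp add: rp rr)
    qed
    show "(\<exists>k<3. tri t \<inter> C k \<noteq> {}) \<and> (\<exists>k<3. tri t \<inter> C k = {})" if t: "t < m" for t
    proof
      have "p (J t) \<in> tri t \<inter> C (J t mod 3)" using colp J_lt[of t] t unfolding tri_def by auto
      then show "\<exists>k<3. tri t \<inter> C k \<noteq> {}" by (intro exI[of _ "J t mod 3"]) auto
      show "\<exists>k<3. tri t \<inter> C k = {}"
      \<comment> \<open>A vertex outside the triangle already yields an order that does not colour
        it. If there is none, the triangle is the whole map and has a single
        \<open>p\<close>-vertex, hence a single colour.\<close>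
      proof (cases "verts G \<subseteq> tri t")
        case False then show ?thesis using sep[OF t] by blast
      next
        case True
        have "p j \<in> tri t \<Longrightarrow> j < K \<Longrightarrow> j = J t \<or> j = J (Suc t)" for j using p_in_tri[OF t] by blast
        have "r 0 \<in> tri t" "r N \<in> tri t" using True unfolding verts_eq by auto
        then have "I t = 0 \<and> I (Suc t) = N" using r_in_tri[OF t] N_pos path_step[OF t] by auto
        then have "J (Suc t) = J t" using path_step[OF t] N_pos by auto
        then have "tri t \<inter> C k = {}" if "k \<noteq> J t mod 3" for k
          using that colp t J_lt[of t] I_le[of t] I_le[of "Suc t"] r_neq_p unfolding tri_def C by auto
        moreover have "\<exists>k<3. k \<noteq> J t mod 3" by (intro exI[of _ "if J t mod 3 = 0 then 1 else 0"]) auto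
        ultimately show ?thesis by blast
      qed
    qed
    show "\<exists>k<3. X \<inter> C k \<noteq> {}" if X: "chord_set X" for X
    proof -
      obtain t where t: "t < m" "X = {p (J t), r (I t)}" using X unfolding chord_set_def by blast
      then have "p (J t) \<in> X \<inter> C (J t mod 3)" using colp J_lt[of t] by auto
      then show ?thesis by (intro exI[of _ "J t mod 3"]) auto
    qed
    show "distinct (xs k) \<and> set (xs k) = cells M \<and> sorted (map (key M (\<rho> k) (C k) (4 * S)) (xs k))" if "k < 3" for k
      using xs that by blast
  qed
qed

lemma finite_cells: "finite (cells M)"
proof -
  have "finite (arcs G)" "finite (verts G)" using graph(1) by (auto simp: fin_digraph.finite_arcs fin_digraph.finite_verts)
  then show ?thesis unfolding cells_def faces_eq G_def[symmetric] by auto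
qed

text \<open>Orders 0 and 1 rank a vertex by its first rung and, reversed, by its last one: a vertex
  outside \<open>tri t\<close> is either met after rung \<open>Suc t\<close> or left before rung
  \<open>t\<close>. Orders 2 and 3 take care of \<open>sep_outer\<close> by raising the
  \<open>p\<close>-vertices and the \<open>r\<close>-vertices other than the ears, respectively.
  Order 3 also lifts all chords and triangles above the outer face. The assumption on
  \<open>N\<close> provides an \<open>r\<close>-vertex between the ears.\<close>

lemma dim_le_4:
  assumes "2 \<le> N"
  shows "\<exists>Ls. length Ls = 4 \<and> realizer (cells M) (P_VEF M) Ls"
proof -
  define fj where "fj j = (LEAST t. J t = j)" for j
  define fi where "fi i = (LEAST t. I t = i)" for i
  define gj where "gj j = Max {t. t \<le> m \<and> J t = j}" for j
  define gi where "gi i = Max {t. t \<le> m \<and> I t = i}" for i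
  define onp where "onp P R v = (if v \<in> p ` {..<K} then P (the_inv_into {..<K} p v) else R (the_inv_into {..N} r v) :: nat)" for P R v
  have onp: "j < K \<Longrightarrow> onp P R (p j) = P j" "i \<le> N \<Longrightarrow> onp P R (r i) = R i" for P R j i
    unfolding onp_def using inj_p inj_r r_neq_p by (auto simp: the_inv_into_f_f)
  define \<rho> where "\<rho> k = (if k = 0 then onp fj fi else if k = 1 then onp (\<lambda>j. m - gj j) (\<lambda>i. m - gi i)
     else if k = 2 then onp (\<lambda>_. 1) (\<lambda>_. 0) else onp (\<lambda>_. 0) (\<lambda>i. if 0 < i \<and> i < N then 1 else 0))" for k :: nat
  define C where "C k = (if k = (3::nat) then UNIV else {} :: 'v set)" for k
  have fj: "fj (J t) \<le> t" for t unfolding fj_def by (rule Least_le) simp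
  have fi: "fi (I t) \<le> t" for t unfolding fi_def by (rule Least_le) simp
  have fj': "s < fj j" if "s \<le> m" "j < K" "J s < j" for s j
  proof (rule ccontr)
    assume "\<not> s < fj j"
    moreover have "J (fj j) = j" unfolding fj_def using J_surj[OF that(2)] by (auto intro: LeastI)
    ultimately show False using mono_JI[of "fj j" s] that by simp
  qed
  have fi': "s < fi i" if "s \<le> m" "i \<le> N" "I s < i" for s i
  proof (rule ccontr)
    assume "\<not> s < fi i"
    moreover have "I (fi i) = i" unfolding fi_def using I_surj[OF that(2)] by (auto intro: LeastI)
    ultimately show False using mono_JI[of "fi i" s] that by simp
  qed
  have gj: "t \<le> gj (J t)" if "t \<le> m" for t unfolding gj_def using that by (intro Max_ge) auto
  have gi: "t \<le> gi (I t)" if "t \<le> m" for t unfolding gi_def using that by (intro Max_ge) auto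
  have gj': "gj j < s" if "s \<le> m" "j < J s" "j < K" for s j
  proof -
    have "gj j \<in> {t. t \<le> m \<and> J t = j}" unfolding gj_def using J_surj[OF that(3)] by (intro Max_in) auto
    then show ?thesis using mono_JI[of s "gj j"] that by (cases "gj j < s") auto
  qed
  have gi': "gi i < s" if "s \<le> m" "i < I s" "i \<le> N" for s i
  proof -
    have "gi i \<in> {t. t \<le> m \<and> I t = i}" unfolding gi_def using I_surj[OF that(3)] by (intro Max_in) auto
    then show ?thesis using mono_JI[of s "gi i"] that by (cases "gi i < s") auto
  qed
  have first: "\<rho> 0 y \<le> Suc t" and last: "\<rho> 1 y \<le> m - t" if "t < m" "y \<in> tri t" for t y
  proof -
    have b: "J t < K" "J (Suc t) < K" "I t \<le> N" "I (Suc t) \<le> N" using J_lt I_le that by auto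
    have "fj (J t) \<le> Suc t" "fi (I t) \<le> Suc t" using fj[of t] fi[of t] by auto
    then show "\<rho> 0 y \<le> Suc t" using that(2) b fj[of "Suc t"] fi[of "Suc t"] unfolding \<rho>_def tri_def by (auto simp: onp)
    have "t \<le> gj (J t)" "t \<le> gi (I t)" "t \<le> gj (J (Suc t))" "t \<le> gi (I (Suc t))" 
      using gj[of t] gi[of t] gj[of "Suc t"] gi[of "Suc t"] that(1) by auto
    then show "\<rho> 1 y \<le> m - t" using that(2) b unfolding \<rho>_def tri_def by (auto simp: onp)
  qed
  have sep: "\<exists>k<4. tri t \<inter> C k = {} \<and> (\<forall>y\<in>tri t. \<rho> k y < \<rho> k x)" if t: "t < m" and x: "x \<in> verts G" "x \<notin> tri t" for t x
  proof -
    have "Suc t < \<rho> 0 x \<or> m - t < \<rho> 1 x"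
    proof (cases "\<exists>l\<le>N. x = r l")
      case True
      then obtain l where l: "l \<le> N" "x = r l" by blast
      then have "l \<noteq> I t" "l \<noteq> I (Suc t)" using x(2) r_in_tri[OF t] by auto
      then have "l < I t \<or> I (Suc t) < l" using path_step[OF t] by auto
      then show ?thesis
      proof
        assume "l < I t"
        then have "m - t < \<rho> 1 x" using gi'[of t l] t l by (auto simp: \<rho>_def onp)
        then show ?thesis by simp
      next
        assume "I (Suc t) < l"
        then show ?thesis using fi'[of "Suc t" l] t l by (auto simp: \<rho>_def onp)
      qed
    next
      case False
      then obtain l where l: "l < K" "x = p l" using x(1) verts_eq by auto
      then have "l \<noteq> J t" "l \<noteq> J (Suc t)" using x(2) p_in_tri[OF t] by auto
      then have "l < J t \<or> J (Suc t) < l" using path_step[OF t] by auto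
      then show ?thesis
      proof
        assume "l < J t"
        then have "m - t < \<rho> 1 x" using gj'[of t l] t l by (auto simp: \<rho>_def onp)
        then show ?thesis by simp
      next
        assume "J (Suc t) < l"
        then show ?thesis using fj'[of "Suc t" l] t l by (auto simp: \<rho>_def onp)
      qed
    qed
    then have "(\<forall>y\<in>tri t. \<rho> 0 y < \<rho> 0 x) \<or> (\<forall>y\<in>tri t. \<rho> 1 y < \<rho> 1 x)"
      using first[OF t] last[OF t] by (meson le_less_trans)
    moreover have "tri t \<inter> C 0 = {}" "tri t \<inter> C 1 = {}" unfolding C_def by auto
    ultimately show ?thesis by (meson one_less_numeral_iff zero_less_numeral semiring_norm(76))
  qed
  define B where "B = Suc (Max (\<Union>k\<in>{..<4}. \<rho> k ` verts G))"
  obtain ys where ys: "set ys = cells M" "distinct ys" using finite_distinct_list[OF finite_cells] by blast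
  define xs where "xs k = sort_key (key M (\<rho> k) (C k) B) ys" for k
  have "realizer (cells M) (P_VEF M) (map (\<lambda>k. list_order (xs k)) [0..<4])"
  proof (rule realizer_of_ranks[where B = B and \<rho> = \<rho> and C = C])
    show "\<rho> k v < B" if "k < 4" "v \<in> verts G" for k v
      unfolding B_def using that finite_verts by (intro le_imp_less_Suc Max_ge) auto
    show "\<exists>k<4. tri t \<inter> C k = {} \<and> (\<forall>y\<in>tri t. \<rho> k y < \<rho> k x)" if "t < m" "x \<in> verts G" "x \<notin> tri t" for t x
      using sep that by blast
    show "\<exists>k<4. \<forall>y\<in>tri t - {v}. \<rho> k y < \<rho> k v" if "t < m" "v \<in> tri t" "\<not> chord_set (tri t - {v})" for t v
      using _ _ _ _ that
    proof (rule sep_outerI)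
      fix t assume t: "t < m" "J (Suc t) = J t"
      then have "J t < K" "I t < N" using J_lt[of t] I_le[of "Suc t"] path_step[of t] by auto
      then show "\<exists>k<4. \<rho> k (r (I t)) < \<rho> k (p (J t)) \<and> \<rho> k (r (Suc (I t))) < \<rho> k (p (J t))"
        by (intro exI[of _ 2]) (auto simp: \<rho>_def onp)
    next
      fix t assume t: "t < m" "J (Suc t) = Suc (J t)"
      from t(1) show "\<exists>k<4. \<rho> k (p (J t)) < \<rho> k (r (I t)) \<and> \<rho> k (p (Suc (J t))) < \<rho> k (r (I t))"
        by (cases rule: tri_cases) (use t in \<open>auto intro!: exI[of _ 3] simp: \<rho>_def onp\<close>)
    next
      show "\<exists>k<4. \<rho> k (p 0) < \<rho> k (r 1) \<and> \<rho> k (r 0) < \<rho> k (r 1)"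
        using assms K_pos by (intro exI[of _ 3]) (auto simp: \<rho>_def onp)
    next
      show "\<exists>k<4. \<rho> k (p (K - 1)) < \<rho> k (r (N - 1)) \<and> \<rho> k (r N) < \<rho> k (r (N - 1))"
        using assms K_pos by (intro exI[of _ 3]) (auto simp: \<rho>_def onp)
    qed
    show "(\<exists>k<4. tri t \<inter> C k \<noteq> {}) \<and> (\<exists>k<4. tri t \<inter> C k = {})" if "t < m" for t
    proof
      show "\<exists>k<4. tri t \<inter> C k \<noteq> {}" by (intro exI[of _ 3]) (auto simp: C_def tri_def)
      show "\<exists>k<4. tri t \<inter> C k = {}" by (intro exI[of _ 0]) (auto simp: C_def)
    qed
    show "\<exists>k<4. X \<inter> C k \<noteq> {}" if "chord_set X" for X
      using that by (intro exI[of _ 3]) (auto simp: C_def chord_set_def)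
    show "distinct (xs k) \<and> set (xs k) = cells M \<and> sorted (map (key M (\<rho> k) (C k) B) (xs k))" if "k < 4" for k
      unfolding xs_def using ys by simp
  qed
  then show ?thesis by (intro exI[of _ "map (\<lambda>k. list_order (xs k)) [0..<4]"]) simp
qed

end

section \<open>Lower bound\<close>

lemma third:
  fixes a b c d :: nat
  shows "a < 3 \<Longrightarrow> b < 3 \<Longrightarrow> c < 3 \<Longrightarrow> d < 3 \<Longrightarrow> a \<noteq> b \<Longrightarrow> c \<noteq> a \<Longrightarrow> c \<noteq> b \<Longrightarrow> d \<noteq> a \<Longrightarrow> d \<noteq> b \<Longrightarrow> c = d"
  by linarith

context staircase
begin

definition fan_step :: "nat \<Rightarrow> bool" where
  "fan_step t \<longleftrightarrow> J (Suc t) = J t"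

definition inner :: "nat \<Rightarrow> bool" where
  "inner t \<longleftrightarrow> 0 < t \<and> Suc t < m"

text \<open>These names treat both kinds of step alike: \<open>lft t\<close> is the vertex dropped
  after \<open>tri t\<close>, \<open>rgt t\<close> is the one that \<open>tri t\<close> adds, and
  \<open>apex t\<close> lies on both rungs. The edge from \<open>lft t\<close> to
  \<open>rgt t\<close> is an outer edge.\<close>

definition apex :: "nat \<Rightarrow> 'v" where
  "apex t = (if fan_step t then p (J t) else r (I t))"
definition lft :: "nat \<Rightarrow> 'v" where
  "lft t = (if fan_step t then r (I t) else p (J t))"
definition rgt :: "nat \<Rightarrow> 'v" where
  "rgt t = (if fan_step t then r (I (Suc t)) else p (J (Suc t)))"

lemma not_fan_step: "t < m \<Longrightarrow> \<not> fan_step t \<Longrightarrow> J (Suc t) = Suc (J t) \<and> I (Suc t) = I t"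
  using path_step[of t] unfolding fan_step_def by auto
lemma fan_stepD: "t < m \<Longrightarrow> fan_step t \<Longrightarrow> J (Suc t) = J t \<and> I (Suc t) = Suc (I t)"
  using path_step[of t] unfolding fan_step_def by auto

lemma tri_alt: "t < m \<Longrightarrow> tri t = {apex t, lft t, rgt t}"
  using not_fan_step[of t] fan_stepD[of t] unfolding tri_def apex_def lft_def rgt_def by auto

lemma tri_dist: "t < m \<Longrightarrow> apex t \<noteq> lft t \<and> apex t \<noteq> rgt t \<and> lft t \<noteq> rgt t"
  using not_fan_step[of t] fan_stepD[of t] J_lt[of t] J_lt[of "Suc t"] I_le[of t] I_le[of "Suc t"] p_neq_r r_neq_p
  unfolding apex_def lft_def rgt_def by auto

lemma tri_mem: "t < m \<Longrightarrow> apex t \<in> tri t \<and> lft t \<in> tri t \<and> rgt t \<in> tri t"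
  using tri_alt by auto

lemma next_mem: "Suc t < m \<Longrightarrow> apex t \<in> tri (Suc t) \<and> rgt t \<in> tri (Suc t)"
  using not_fan_step[of t] fan_stepD[of t] unfolding tri_def apex_def rgt_def by auto

lemma prev_mem: "Suc t < m \<Longrightarrow> apex (Suc t) \<in> tri t \<and> lft (Suc t) \<in> tri t"
  using not_fan_step[of "Suc t"] fan_stepD[of "Suc t"] unfolding tri_def apex_def lft_def by auto

lemma lft_gone: assumes "s < t" "t < m" shows "lft s \<notin> tri t"
proof -
  have b: "J s < K" "I s \<le> N" "s < m" using J_lt I_le assms by auto
  have le: "J (Suc s) \<le> J t" "I (Suc s) \<le> I t" "J t \<le> J (Suc t)" "I t \<le> I (Suc t)"
    using mono_JI[of "Suc s" t] mono_JI[of t "Suc t"] assms by auto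
  show ?thesis
  proof (cases "fan_step s")
    case True
    then have "I s < I t" "I s < I (Suc t)" using fan_stepD[of s] b le by auto
    then show ?thesis using True r_in_tri[OF assms(2), of "I s"] b unfolding lft_def by auto
  next
    case False
    then have "J s < J t" "J s < J (Suc t)" using not_fan_step[of s] b le by auto
    then show ?thesis using False p_in_tri[OF assms(2), of "J s"] b unfolding lft_def by auto
  qed
qed

lemma rgt_new: assumes "s < t" "t < m" shows "rgt t \<notin> tri s"
proof -
  have b: "J (Suc t) < K" "I (Suc t) \<le> N" "s < m" using J_lt I_le assms by auto
  have le: "J (Suc s) \<le> J t" "I (Suc s) \<le> I t" "J s \<le> J (Suc s)" "I s \<le> I (Suc s)"
    using mono_JI[of "Suc s" t] mono_JI[of s "Suc s"] assms by auto
  show ?thesis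
  proof (cases "fan_step t")
    case True
    then have "I s < I (Suc t)" "I (Suc s) < I (Suc t)" using fan_stepD[of t] assms le by auto
    then show ?thesis using True r_in_tri[OF b(3,2)] unfolding rgt_def by auto
  next
    case False
    then have "J s < J (Suc t)" "J (Suc s) < J (Suc t)" using not_fan_step[of t] assms le by auto
    then show ?thesis using False p_in_tri[OF b(3,1)] unfolding rgt_def by auto
  qed
qed

lemma next_same: "Suc t < m \<Longrightarrow> fan_step t = fan_step (Suc t) \<Longrightarrow> apex (Suc t) = apex t \<and> lft (Suc t) = rgt t"
  using not_fan_step[of t] fan_stepD[of t] unfolding apex_def lft_def rgt_def by auto
lemma next_diff: "Suc t < m \<Longrightarrow> fan_step t \<noteq> fan_step (Suc t) \<Longrightarrow> apex (Suc t) = rgt t \<and> lft (Suc t) = apex t"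
  using not_fan_step[of t] fan_stepD[of t] unfolding apex_def lft_def rgt_def by auto

text \<open>Both vertices lie on the same side of the strip, whereas a chord joins the two
  sides.\<close>

lemma not_chord_pair: "t < m \<Longrightarrow> u \<noteq> v \<Longrightarrow> {u, v} = {lft t, rgt t} \<Longrightarrow> \<not> chord_set {u, v}"
proof
  assume t: "t < m" "u \<noteq> v" "{u, v} = {lft t, rgt t}" "chord_set {u, v}"
  then obtain s where s: "0 < s" "s < m" "{lft t, rgt t} = {p (J s), r (I s)}" unfolding chord_set_def by auto
  then show False using t(1) J_lt[of t] J_lt[of "Suc t"] J_lt[of s] I_le[of t] I_le[of "Suc t"] I_le[of s]  p_neq_r r_neq_p
    unfolding lft_def rgt_def by (auto simp: doubleton_eq_iff split: if_splits)
qed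

lemma tri_minus_apex: "t < m \<Longrightarrow> tri t - {apex t} = {lft t, rgt t}"
  using tri_alt[of t] tri_dist[of t] by auto

text \<open>The end triangle has two outer edges, so both vertices that it shares with the next
  triangle are opposite to one. This settles the case at the start of the strip in
  \<open>no_three_bi\<close>.\<close>

lemma first_outer: assumes "1 < m" "v \<in> tri 0" "v \<in> tri 1" shows "\<not> chord_set (tri 0 - {v})"
proof -
  have 0: "0 < m" using assms by simp
  have t0: "tri 0 = {p 0, r 0, r 1}" using path_start path_first first_step unfolding tri_def by auto
  have v: "v = p 0 \<or> v = r 1" using assms t0 chord_set_tri[of 1] path_first first_step by auto
  have d: "p 0 \<noteq> r 0" "p 0 \<noteq> r 1" "r 0 \<noteq> r 1" using p_neq_r K_pos N_pos by auto
  show ?thesis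
  proof
    assume "chord_set (tri 0 - {v})"
    then obtain s where s: "0 < s" "s < m" "tri 0 - {v} = {p (J s), r (I s)}" unfolding chord_set_def by auto
    have "r 0 \<in> tri 0 - {v}" using t0 v d by auto
    then have "r 0 = p (J s) \<or> r 0 = r (I s)" using s(3) by auto
    then have "I s = 0" using r_neq_p[OF J_lt[of s], of 0] s(2) I_le[of s] by auto
    moreover have "1 \<le> I s" using mono_JI[of 1 s] s first_step by auto
    ultimately show False by simp
  qed
qed

text \<open>Here \<open>gt k x y\<close> stands for \<open>x\<close> above \<open>y\<close> in order
  \<open>k\<close>, and \<open>\<chi> t\<close> for an order in which chord \<open>t\<close> is
  above the outer face. A vertex stays below the outer face in every order, so it cannot exceed a
  triangle in a colour of one of its chords; hence the form of \<open>sep\<close>.\<close>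

context
  fixes gt :: "nat \<Rightarrow> 'v \<Rightarrow> 'v \<Rightarrow> bool" and \<chi> :: "nat \<Rightarrow> nat"
  assumes asym: "\<And>k x y. gt k x y \<Longrightarrow> gt k y x \<Longrightarrow> False"
    and col: "\<And>t. \<chi> t < 3"
    and sep: "\<And>t x. t < m \<Longrightarrow> x \<in> verts G \<Longrightarrow> x \<notin> tri t \<Longrightarrow> \<exists>k<3. (0 < t \<longrightarrow> k \<noteq> \<chi> t) \<and>
        (Suc t < m \<longrightarrow> k \<noteq> \<chi> (Suc t)) \<and> (\<forall>y\<in>tri t. gt k x y)"
    and outer: "\<And>t v. t < m \<Longrightarrow> v \<in> tri t \<Longrightarrow> \<not> chord_set (tri t - {v}) \<Longrightarrow> \<exists>k<3. \<forall>y\<in>tri t - {v}. gt k v y"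
begin

text \<open>Across each chord, the new vertex exceeds the old triangle in one order and the vertex left
  behind exceeds the new triangle in another; neither is the colour of the chord.\<close>

lemma chord_orders:
  assumes "0 < t" "t < m"
  shows "\<exists>k l. k < 3 \<and> l < 3 \<and> k \<noteq> \<chi> t \<and> l \<noteq> \<chi> t \<and> k \<noteq> l \<and>
     (0 < t - 1 \<longrightarrow> k \<noteq> \<chi> (t - 1)) \<and> (Suc t < m \<longrightarrow> l \<noteq> \<chi> (Suc t)) \<and>
     (\<forall>y\<in>tri (t - 1). gt k (rgt t) y) \<and> (\<forall>y\<in>tri t. gt l (lft (t - 1)) y)"
proof -
  have t: "t - 1 < m" "Suc (t - 1) = t" using assms by auto
  have "rgt t \<notin> tri (t - 1)" "lft (t - 1) \<notin> tri t" using rgt_new lft_gone assms by auto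
  moreover have "rgt t \<in> verts G" "lft (t - 1) \<in> verts G" using tri_mem tri_verts assms t by blast+
  ultimately obtain k l where k: "k < 3" "0 < t - 1 \<longrightarrow> k \<noteq> \<chi> (t - 1)" "k \<noteq> \<chi> t" "\<forall>y\<in>tri (t - 1). gt k (rgt t) y"
    and l: "l < 3" "l \<noteq> \<chi> t" "Suc t < m \<longrightarrow> l \<noteq> \<chi> (Suc t)" "\<forall>y\<in>tri t. gt l (lft (t - 1)) y"
    using sep[of "t - 1" "rgt t"] sep[of t "lft (t - 1)"] assms t by auto
  have "k \<noteq> l" using k(4) l(4) tri_mem[of t] tri_mem[of "t - 1"] asym assms t by blast
  then show ?thesis by (intro exI[of _ k] exI[of _ l]) (use k l in simp)
qed

text \<open>Together with the colour \<open>\<chi> t\<close>, the values \<open>rup t\<close> and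
  \<open>lup t\<close> exhaust the three orders. \<open>lup\<close> is chosen relative to
  \<open>rup\<close>, so that the two form a joint witness.\<close>

definition rup :: "nat \<Rightarrow> nat" where
  "rup t = (SOME k. \<exists>l. k < 3 \<and> l < 3 \<and> k \<noteq> \<chi> t \<and> l \<noteq> \<chi> t \<and> k \<noteq> l \<and>
     (0 < t - 1 \<longrightarrow> k \<noteq> \<chi> (t - 1)) \<and> (Suc t < m \<longrightarrow> l \<noteq> \<chi> (Suc t)) \<and>
     (\<forall>y\<in>tri (t - 1). gt k (rgt t) y) \<and> (\<forall>y\<in>tri t. gt l (lft (t - 1)) y))"

definition lup :: "nat \<Rightarrow> nat" where
  "lup t = (SOME l. l < 3 \<and> l \<noteq> \<chi> t \<and> rup t \<noteq> l \<and> (Suc t < m \<longrightarrow> l \<noteq> \<chi> (Suc t)) \<and>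
     (\<forall>y\<in>tri t. gt l (lft (t - 1)) y))"

lemma ups:
  assumes "0 < t" "t < m"
  shows "rup t < 3" "rup t \<noteq> \<chi> t" "0 < t - 1 \<Longrightarrow> rup t \<noteq> \<chi> (t - 1)" "\<forall>y\<in>tri (t - 1). gt (rup t) (rgt t) y"
    "lup t < 3" "lup t \<noteq> \<chi> t" "rup t \<noteq> lup t" "Suc t < m \<Longrightarrow> lup t \<noteq> \<chi> (Suc t)" "\<forall>y\<in>tri t. gt (lup t) (lft (t - 1)) y"
proof -
  from someI_ex[OF chord_orders[OF assms]] obtain l where *: "rup t < 3" "l < 3" "rup t \<noteq> \<chi> t" "l \<noteq> \<chi> t" "rup t \<noteq> l"
     "(0 < t - 1 \<longrightarrow> rup t \<noteq> \<chi> (t - 1))" "(Suc t < m \<longrightarrow> l \<noteq> \<chi> (Suc t))"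
     "(\<forall>y\<in>tri (t - 1). gt (rup t) (rgt t) y)" "(\<forall>y\<in>tri t. gt l (lft (t - 1)) y)"
    unfolding rup_def[symmetric] by (elim exE conjE) (rule that; assumption)
  then have "l < 3 \<and> l \<noteq> \<chi> t \<and> rup t \<noteq> l \<and> (Suc t < m \<longrightarrow> l \<noteq> \<chi> (Suc t)) \<and>
     (\<forall>y\<in>tri t. gt l (lft (t - 1)) y)" by blast
  from someI[where P = "\<lambda>l. l < 3 \<and> l \<noteq> \<chi> t \<and> rup t \<noteq> l \<and> (Suc t < m \<longrightarrow> l \<noteq> \<chi> (Suc t)) \<and>
     (\<forall>y\<in>tri t. gt l (lft (t - 1)) y)", OF this]
  have "lup t < 3 \<and> lup t \<noteq> \<chi> t \<and> rup t \<noteq> lup t \<and> (Suc t < m \<longrightarrow> lup t \<noteq> \<chi> (Suc t)) \<and>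
     (\<forall>y\<in>tri t. gt (lup t) (lft (t - 1)) y)" unfolding lup_def[symmetric] .
  with * show "rup t < 3" "rup t \<noteq> \<chi> t" "0 < t - 1 \<Longrightarrow> rup t \<noteq> \<chi> (t - 1)" "\<forall>y\<in>tri (t - 1). gt (rup t) (rgt t) y"
    "lup t < 3" "lup t \<noteq> \<chi> t" "rup t \<noteq> lup t" "Suc t < m \<Longrightarrow> lup t \<noteq> \<chi> (Suc t)" "\<forall>y\<in>tri t. gt (lup t) (lft (t - 1)) y"
    by blast+
qed

definition mono :: "nat \<Rightarrow> bool" where
  "mono t \<longleftrightarrow> \<chi> t = \<chi> (Suc t)"

text \<open>Each vertex of an inner triangle exceeds the two others in some order:
  \<open>rgt t\<close> as the vertex added beyond chord \<open>t\<close>, \<open>lft t\<close> as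
  the one left behind at chord \<open>Suc t\<close>, and \<open>apex t\<close> as the vertex
  opposite the outer edge.\<close>

lemma inner_facts:
  assumes "inner t"
  shows "gt (rup t) (rgt t) (apex t)" "gt (rup t) (rgt t) (lft t)"
    "gt (lup (Suc t)) (lft t) (apex t)" "gt (lup (Suc t)) (lft t) (rgt t)"
    "\<exists>j<3. gt j (apex t) (lft t) \<and> gt j (apex t) (rgt t)"
    "rup t \<noteq> lup (Suc t)" "rup (Suc t) \<noteq> \<chi> t"
proof -
  have t: "0 < t" "t < m" "Suc t < m" "0 < Suc t" "Suc (t - 1) = t" using assms unfolding inner_def by auto
  have "apex t \<in> tri (t - 1)" "lft t \<in> tri (t - 1)" using prev_mem[of "t - 1"] t by auto
  then show a: "gt (rup t) (rgt t) (apex t)" "gt (rup t) (rgt t) (lft t)" using ups(4)[OF t(1,2)] by auto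
  show b: "gt (lup (Suc t)) (lft t) (apex t)" "gt (lup (Suc t)) (lft t) (rgt t)"
    using ups(9)[OF t(4,3)] next_mem[OF t(3)] by auto
  have "\<not> chord_set (tri t - {apex t})" 
    using not_chord_pair[OF t(2), of "lft t" "rgt t"] tri_minus_apex[OF t(2)] tri_dist[OF t(2)] by auto
  then have "\<exists>j<3. \<forall>y\<in>tri t - {apex t}. gt j (apex t) y" using outer[OF t(2)] tri_mem[OF t(2)] by blast
  then show "\<exists>j<3. gt j (apex t) (lft t) \<and> gt j (apex t) (rgt t)" unfolding tri_minus_apex[OF t(2)] by auto
  show "rup t \<noteq> lup (Suc t)" using a b asym by metis
  show "rup (Suc t) \<noteq> \<chi> t" using ups(3)[OF t(4,3)] t by auto
qed

text \<open>If both chords have the same colour, the two other orders are used up by the added and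
  the abandoned vertex, so the apex can be on top only in the colour itself.\<close>

lemma mono_facts:
  assumes "inner t" "mono t"
  shows "rup t = rup (Suc t)" "lup t = lup (Suc t)" "gt (\<chi> t) (apex t) (lft t)" "gt (\<chi> t) (apex t) (rgt t)"
proof -
  have t: "0 < t" "t < m" "Suc t < m" "0 < Suc t" using assms unfolding inner_def by auto
  note u = ups(1,2,5,6,7)[OF t(1,2)] ups(1,2,5,6,7)[OF t(4,3)] inner_facts(6)[OF assms(1)] col[of t]
  have e: "\<chi> (Suc t) = \<chi> t" using assms(2) unfolding mono_def by simp
  show "rup t = rup (Suc t)" by (rule third[of "\<chi> t" "lup (Suc t)"]) (use u e in simp_all)
  show "lup t = lup (Suc t)" by (rule third[of "\<chi> t" "rup t"]) (use u e in simp_all)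
  obtain j where j: "j < 3" "gt j (apex t) (lft t)" "gt j (apex t) (rgt t)" using inner_facts(5)[OF assms(1)] by blast
  have "j \<noteq> rup t" "j \<noteq> lup (Suc t)" using j asym inner_facts[OF assms(1)] by metis+
  then have "j = \<chi> t" using u e j(1) by (intro third[of "rup t" "lup (Suc t)"]) simp_all
  then show "gt (\<chi> t) (apex t) (lft t)" "gt (\<chi> t) (apex t) (rgt t)" using j by auto
qed

text \<open>Two colours at a triangle leave a single order for all separations of outside vertices
  from it. The vertices \<open>rgt t\<close> and \<open>lft t\<close> are then forced to the top in
  the colour of the chord that contains them.\<close>

lemma bi_facts:
  assumes "inner t" "\<not> mono t"
  shows "rup t = \<chi> (Suc t)" "lup (Suc t) = \<chi> t" "rup (Suc t) = lup t" "lup t \<noteq> \<chi> t" "lup t \<noteq> \<chi> (Suc t)" "lup t < 3"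
    "\<And>x y. x \<in> verts G \<Longrightarrow> x \<notin> tri t \<Longrightarrow> y \<in> tri t \<Longrightarrow> gt (lup t) x y"
proof -
  have t: "0 < t" "t < m" "Suc t < m" "0 < Suc t" using assms unfolding inner_def by auto
  note u = ups(1,2,5,6,7)[OF t(1,2)] ups(1,2,5,6,7)[OF t(4,3)] inner_facts(6)[OF assms(1)] col[of t]  col[of "Suc t"]
   ups(8)[OF t(1,2) t(3)] ups(3)[OF t(4,3)] inner_facts(7)[OF assms(1)]
  show l: "lup t \<noteq> \<chi> t" "lup t \<noteq> \<chi> (Suc t)" "lup t < 3" using u by auto
  have n: "\<chi> t \<noteq> \<chi> (Suc t)" using assms(2) unfolding mono_def .
  show "rup t = \<chi> (Suc t)" by (rule third[of "\<chi> t" "lup t"]; insert u n; (assumption | rule not_sym, assumption)+)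
  show e: "rup (Suc t) = lup t" by (rule third[of "\<chi> t" "\<chi> (Suc t)"]; insert u n; (assumption | rule not_sym, assumption)+)
  show "lup (Suc t) = \<chi> t" by (rule third[of "\<chi> (Suc t)" "rup (Suc t)"]; insert u n; (assumption | rule not_sym, assumption)+)
  fix x y assume xy: "x \<in> verts G" "x \<notin> tri t" "y \<in> tri t"
  from sep[OF t(2) xy(1,2)] obtain k where k0: "k < 3" "0 < t \<longrightarrow> k \<noteq> \<chi> t"
    "Suc t < m \<longrightarrow> k \<noteq> \<chi> (Suc t)" "\<forall>y\<in>tri t. gt k x y" by (elim exE conjE)
  note k = k0(1) mp[OF k0(2) t(1)] mp[OF k0(3) t(3)] bspec[OF k0(4) xy(3)]
  have "k = lup t" by (rule third[of "\<chi> t" "\<chi> (Suc t)"]; insert k(1-3) l col[of t] col[of "Suc t"] n; (assumption | rule not_sym, assumption)+)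
  show "gt (lup t) x y" using k(4) unfolding \<open>k = lup t\<close> .
qed

text \<open>The order that colours the common chord ranks its two ends: a triangle with
  \<open>mono\<close> puts its apex above the other end, a triangle without it does the opposite.
  The two triangles have the same apex if their steps have the same direction, and otherwise their
  apexes are the two different ends of the chord.\<close>

lemma alternation:
  assumes "inner t" "inner (Suc t)"
  shows "fan_step t = fan_step (Suc t) \<longleftrightarrow> mono t = mono (Suc t)"
proof -
  have t: "Suc t < m" using assms unfolding inner_def by auto
  note a = inner_facts[OF assms(1)] and b = inner_facts[OF assms(2)]
  have 1: False if "mono t" "mono (Suc t)" "fan_step t \<noteq> fan_step (Suc t)"
    using mono_facts[OF assms(1) that(1)] mono_facts[OF assms(2) that(2)] next_diff[OF t that(3)] that(1) asym
    unfolding mono_def by metis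
  have 2: False if "\<not> mono t" "\<not> mono (Suc t)" "fan_step t \<noteq> fan_step (Suc t)"
    using bi_facts(1)[OF assms(1) that(1)] bi_facts(2)[OF assms(2) that(2)] next_diff[OF t that(3)] a(1) b(3,4) asym
    by metis
  have 3: False if "mono t" "\<not> mono (Suc t)" "fan_step t = fan_step (Suc t)"
    using mono_facts[OF assms(1) that(1)] bi_facts(2)[OF assms(2) that(2)] next_same[OF t that(3)] that(1) b(3) asym
    unfolding mono_def by metis
  have 4: False if "\<not> mono t" "mono (Suc t)" "fan_step t = fan_step (Suc t)"
    using bi_facts(1)[OF assms(1) that(1)] mono_facts[OF assms(2) that(2)] next_same[OF t that(3)] a(1) asym
    by metis
  show ?thesis using 1 2 3 4 by blast
qed

text \<open>Each of two different triangles has a vertex outside the other. If the order left over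
  were the same for both, each of these vertices would exceed the other one in it.\<close>

lemma bi_types:
  assumes "inner s" "inner t" "\<not> mono s" "\<not> mono t" "lup s = lup t"
  shows "s = t"
proof (rule ccontr)
  assume "s \<noteq> t"
  have m: "s < m" "t < m" using assms unfolding inner_def by auto
  then obtain x y where "x \<in> tri s" "x \<notin> tri t" "y \<in> tri t" "y \<notin> tri s"
    using tri_subset_eq[of s t] tri_subset_eq[of t s] \<open>s \<noteq> t\<close> by blast
  moreover then have "x \<in> verts G" "y \<in> verts G" using tri_verts m by blast+
  ultimately show False using bi_facts(7)[OF assms(1,3)] bi_facts(7)[OF assms(2,4)] assms(5) asym by metis
qed

text \<open>Three such triangles have a common apex \<open>v\<close>, and their remaining orders are
  all three orders; this fixes the colours of their four rungs as a, b, c, a up to renaming.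
  Comparing the vertex \<open>x\<close> dropped before them with the vertex \<open>u3\<close> added
  last forces \<open>x\<close> above \<open>v\<close> in the order b. The triangle before them then
  has to put \<open>v\<close> above \<open>x\<close> in the same order, or it is an end triangle and
  no order is left in which \<open>v\<close> exceeds its opposite outer edge.\<close>

lemma no_three_bi:
  assumes "inner t" "inner (Suc t)" "inner (Suc (Suc t))"
    and "\<not> mono t" "\<not> mono (Suc t)" "\<not> mono (Suc (Suc t))"
    and "fan_step t = fan_step (Suc t)" "fan_step (Suc t) = fan_step (Suc (Suc t))"
  shows False
proof -
  let ?t1 = "Suc t" and ?t2 = "Suc (Suc t)" and ?t3 = "Suc (Suc (Suc t))"
  have t: "0 < t" "t < m" "?t1 < m" "?t2 < m" "?t3 < m" "t - 1 < m" "Suc (t - 1) = t" using assms unfolding inner_def by auto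
  note b0 = bi_facts[OF assms(1,4)] and b1 = bi_facts[OF assms(2,5)] and b2 = bi_facts[OF assms(3,6)]
  have types: "lup t \<noteq> lup ?t1" "lup ?t1 \<noteq> lup ?t2" "lup t \<noteq> lup ?t2"
    using bi_types[OF assms(1,2,4,5)] bi_types[OF assms(2,3,5,6)] bi_types[OF assms(1,3,4,6)] by auto
  note c = col[of t] col[of ?t1] col[of ?t2] col[of ?t3]
  have a: "\<chi> t \<noteq> \<chi> ?t1" "\<chi> ?t1 \<noteq> \<chi> ?t2" "\<chi> ?t2 \<noteq> \<chi> ?t3" using assms(4-6) unfolding mono_def by auto
  have cols5: "\<chi> t \<noteq> \<chi> ?t2"
  proof
    assume "\<chi> t = \<chi> ?t2"
    then have "lup t = lup ?t1" using third[of "\<chi> t" "\<chi> ?t1" "lup t" "lup ?t1"] c a b0(4-6) b1(4-6) by simp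
    then show False using types by simp
  qed
  have cols4: "\<chi> ?t1 \<noteq> \<chi> ?t3"
  proof
    assume "\<chi> ?t1 = \<chi> ?t3"
    then have "lup ?t1 = lup ?t2" using third[of "\<chi> ?t1" "\<chi> ?t2" "lup ?t1" "lup ?t2"] c a b1(4-6) b2(4-6) by simp
    then show False using types by simp
  qed
  have cols1: "\<chi> ?t3 = \<chi> t" using third[of "\<chi> ?t1" "\<chi> ?t2" "\<chi> ?t3" "\<chi> t"] c a cols5 cols4 by simp
  have "lup t = \<chi> ?t2" using third[of "\<chi> t" "\<chi> ?t1" "lup t" "\<chi> ?t2"] c a cols5 b0(4-6) by simp
  moreover have "lup ?t1 = \<chi> t" using third[of "\<chi> ?t1" "\<chi> ?t2" "lup ?t1" "\<chi> t"] c a cols5 b1(4-6) by simp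
  moreover have "lup ?t2 = \<chi> ?t1" using third[of "\<chi> ?t2" "\<chi> ?t3" "lup ?t2" "\<chi> ?t1"] c a cols4 b2(4-6) by simp
  ultimately have cols: "\<chi> ?t3 = \<chi> t" "lup t = \<chi> ?t2" "lup ?t1 = \<chi> t" "lup ?t2 = \<chi> ?t1" "\<chi> t \<noteq> \<chi> ?t2"
    using cols1 cols5 by simp_all
  define v where "v = apex t"
  define x where "x = lft (t - 1)"
  define u0 where "u0 = lft t"
  define u3 where "u3 = rgt ?t2"
  have v1: "apex ?t1 = v" "apex ?t2 = v" using next_same[OF t(3) assms(7)] next_same[OF t(4) assms(8)] v_def by auto
  have V: "x \<in> verts G" "u3 \<in> verts G" "u0 \<in> verts G" "v \<in> verts G"
    using tri_mem tri_verts t unfolding x_def u3_def u0_def v_def by blast+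
  have x: "x \<notin> tri t" "x \<notin> tri ?t2" "x \<notin> tri ?t3" "x \<in> tri (t - 1)"
    using lft_gone[of "t - 1"] tri_mem[OF t(6)] t unfolding x_def by auto
  have u3: "u3 \<in> tri ?t3" "u3 \<in> tri ?t2" "u3 \<notin> tri (t - 1)"
    using next_mem[OF t(5)] tri_mem[OF t(4)] rgt_new[of "t - 1" ?t2] t unfolding u3_def by auto
  have v: "v \<in> tri ?t3" "v \<in> tri t" "v \<in> tri ?t1" "v \<in> tri (t - 1)"
    using next_mem[OF t(5)] tri_mem[OF t(2)] tri_mem[OF t(3)] v1 prev_mem[of "t - 1"] t by (auto simp: v_def)
  have u0: "u0 \<notin> tri ?t1" "u0 \<in> tri (t - 1)" "u0 \<in> tri t" "u0 \<noteq> v"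
    using lft_gone[of t ?t1] prev_mem[of "t - 1"] tri_mem[OF t(2)] tri_dist[OF t(2)] t unfolding u0_def v_def by auto
  obtain k where k: "k < 3" "k \<noteq> \<chi> ?t3" "\<forall>y\<in>tri ?t3. gt k x y" using sep[OF t(5) V(1) x(3)] t by blast
  obtain l where l: "l < 3" "l \<noteq> \<chi> t" "\<forall>y\<in>tri (t - 1). gt l u3 y" using sep[OF t(6) V(2) u3(3)] t by auto
  \<comment> \<open>In the order \<open>\<chi> ?t1\<close>, the one remaining for
    \<open>tri ?t2\<close>, the vertex \<open>x\<close> exceeds \<open>u3\<close>. So
    \<open>u3\<close> exceeds \<open>x\<close> in \<open>\<chi> ?t2\<close>, and only
    \<open>\<chi> ?t1\<close> is left for \<open>x\<close> to exceed \<open>tri ?t3\<close>.\<close>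
  have "l \<noteq> \<chi> ?t1" using l(3) x(4) b2(7)[OF V(1) x(2) u3(2)] cols asym by metis
  then have "l = \<chi> ?t2" using third[of "\<chi> t" "\<chi> ?t1" l "\<chi> ?t2"] l c a cols by simp
  then have "k \<noteq> \<chi> ?t2" using k(3) l(3) u3(1) x(4) asym by metis
  then have "k = \<chi> ?t1" using third[of "\<chi> t" "\<chi> ?t2" k "\<chi> ?t1"] k c a cols by simp
  then have xv: "gt (\<chi> ?t1) x v" using k(3) v by auto
  show False
  proof (cases "t - 1 = 0")
    case False
    then have i: "inner (t - 1)" using t assms(1) unfolding inner_def by auto
    \<comment> \<open>A fourth bicoloured triangle would require a fourth remaining order.\<close>
    have mo: "mono (t - 1)"
    proof (rule ccontr)
      assume n: "\<not> mono (t - 1)"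
      have "lup (t - 1) \<noteq> lup t" "lup (t - 1) \<noteq> lup ?t1" "lup (t - 1) \<noteq> lup ?t2"
        using bi_types[OF i assms(1) n assms(4)] bi_types[OF i assms(2) n assms(5)] bi_types[OF i assms(3) n assms(6)] t by auto
      then have "lup (t - 1) = lup ?t2"
        using third[of "lup t" "lup ?t1" "lup (t - 1)" "lup ?t2"] types b0(6) b1(6) b2(6) bi_facts(6)[OF i n] by simp
      then show False using \<open>lup (t - 1) \<noteq> lup ?t2\<close> by simp
    qed
    have "fan_step (t - 1) \<noteq> fan_step t" using alternation[OF i] t assms(1,4) mo by auto
    then have "v = rgt (t - 1)" using next_diff[of "t - 1"] t v_def by auto
    moreover have "rup (t - 1) = \<chi> ?t1" using mono_facts(1)[OF i mo] t b0(1) by auto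
    moreover have "x \<in> tri (t - 1 - 1)" using prev_mem[of "t - 1 - 1"] t False unfolding x_def
      by (simp add: Suc_diff_Suc)
    moreover have "\<forall>y\<in>tri (t - 1 - 1). gt (rup (t - 1)) (rgt (t - 1)) y" using ups(4)[of "t - 1"] t False by auto
    ultimately have "gt (\<chi> ?t1) v x" by auto
    then show False using xv asym by blast
  next
    case True
    then have t1: "t = 1" using t by simp
    have "\<not> chord_set (tri 0 - {v})" using first_outer[of v] v t1 t by auto
    then obtain j where j: "j < 3" "\<forall>y\<in>tri 0 - {v}. gt j v y" using outer[of 0 v] v t1 t by auto
    have "x \<noteq> v" using x v by auto
    then have jx: "gt j v x" "gt j v u0" using j x u0 t1 by auto
    have "j \<noteq> \<chi> ?t1" using jx xv asym by metis
    moreover have "j \<noteq> \<chi> ?t2" using jx b0(7)[OF V(1) x(1) v(2)] cols asym by metis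
    moreover have "j \<noteq> \<chi> t" using jx b1(7)[OF V(3) u0(1) v(3)] cols asym by metis
    ultimately have "j = \<chi> ?t2" using third[of "\<chi> t" "\<chi> ?t1" j "\<chi> ?t2"] j(1) c a cols by simp
    then show False using \<open>j \<noteq> \<chi> ?t2\<close> by simp
  qed
qed

text \<open>By \<open>alternation\<close>, \<open>mono\<close> and \<open>fan_step\<close> change
  together along the strip, so their relation at the first inner triangle determines it at all of
  them.\<close>

lemma one_side:
  shows "(\<forall>t. inner t \<longrightarrow> mono t = fan_step t) \<or> (\<forall>t. inner t \<longrightarrow> mono t = (\<not> fan_step t))"
proof -
  have "inner t \<longrightarrow> (mono t = fan_step t) = (mono 1 = fan_step 1)" for t
  proof (induction t)
    case (Suc t)
    show ?case
    proof
      assume i: "inner (Suc t)"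
      show "(mono (Suc t) = fan_step (Suc t)) = (mono 1 = fan_step 1)"
      proof (cases "t = 0")
        case False
        then have "inner t" using i unfolding inner_def by auto
        then have "(mono t = fan_step t) = (mono 1 = fan_step 1)" "fan_step t = fan_step (Suc t) \<longleftrightarrow> mono t = mono (Suc t)"
          using Suc alternation[OF _ i] by blast+
        then show ?thesis by argo
      qed simp
    qed
  qed (simp add: inner_def)
  then show ?thesis by blast
qed

lemma card_bi: "card {t. inner t \<and> \<not> mono t} \<le> 3"
proof -
  have "inj_on lup {t. inner t \<and> \<not> mono t}" by (intro inj_onI) (use bi_types in simp)
  moreover have "lup ` {t. inner t \<and> \<not> mono t} \<subseteq> {..<3}" using bi_facts(6) by auto
  ultimately show ?thesis using card_inj_on_le[of lup _ "{..<3}"] by auto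
qed

lemma card_turns: "s \<le> m \<Longrightarrow> card {t. t < s \<and> \<not> fan_step t} = J s \<and> card {t. t < s \<and> fan_step t} = I s"
proof (induction s)
  case 0 then show ?case using path_start by simp
next
  case (Suc s)
  have "{t. t < Suc s \<and> \<not> fan_step t} = (if fan_step s then {t. t < s \<and> \<not> fan_step t} else insert s {t. t < s \<and> \<not> fan_step t})"
    "{t. t < Suc s \<and> fan_step t} = (if fan_step s then insert s {t. t < s \<and> fan_step t} else {t. t < s \<and> fan_step t})"
    by (auto simp: less_Suc_eq)
  then show ?case using Suc not_fan_step[of s] fan_stepD[of s] by (auto simp: card_insert_if)
qed

lemma turn_inner: assumes "t < m" "\<not> fan_step t" shows "inner t"
  using assms(1)
proof (cases rule: tri_cases)
  case Istep then show ?thesis using assms fan_step_def by auto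
qed (auto simp: inner_def)

lemma few_turns_or_fans:
  shows "(K \<le> 4 \<and> (\<forall>t. Suc (Suc t) < m \<longrightarrow> \<not> fan_step t \<longrightarrow> \<not> fan_step (Suc t) \<longrightarrow> \<not> fan_step (Suc (Suc t)) \<longrightarrow> False))
    \<or> (N \<le> 5 \<and> (\<forall>t. 0 < t \<longrightarrow> Suc (Suc (Suc t)) < m \<longrightarrow> fan_step t \<longrightarrow> fan_step (Suc t) \<longrightarrow> fan_step (Suc (Suc t)) \<longrightarrow> False))"
  using one_side
proof
  assume o: "\<forall>t. inner t \<longrightarrow> mono t = fan_step t"
  have "{t. t < m \<and> \<not> fan_step t} = {t. inner t \<and> \<not> mono t}" using o turn_inner by (auto simp: inner_def)
  then have "K \<le> 4" using card_bi card_turns[of m] path_end by simp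
  moreover have False if "Suc (Suc t) < m" "\<not> fan_step t" "\<not> fan_step (Suc t)" "\<not> fan_step (Suc (Suc t))" for t
    using no_three_bi[of t] that turn_inner o by auto
  ultimately show ?thesis by blast
next
  assume o: "\<forall>t. inner t \<longrightarrow> mono t = (\<not> fan_step t)"
  \<comment> \<open>The two end triangles are fans without being inner, which is why the bound for
    fans is three plus two.\<close>
  have "{t. t < m \<and> fan_step t} \<subseteq> insert 0 (insert (m - 1) {t. inner t \<and> \<not> mono t})" using o by (auto simp: inner_def)
  moreover have fin: "finite {t. inner t \<and> \<not> mono t}" by (rule finite_subset[of _ "{..<m}"]) (auto simp: inner_def)
  ultimately have "card {t. t < m \<and> fan_step t} \<le> card (insert 0 (insert (m - 1) {t. inner t \<and> \<not> mono t}))"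
    by (intro card_mono) auto
  also have "\<dots> \<le> Suc (Suc (card {t. inner t \<and> \<not> mono t}))" using fin by (auto simp: card_insert_if)
  finally have "N \<le> 5" using card_bi card_turns[of m] path_end by simp
  moreover have False if "0 < t" "Suc (Suc (Suc t)) < m" "fan_step t" "fan_step (Suc t)" "fan_step (Suc (Suc t))" for t
    using no_three_bi[of t] that o by (auto simp: inner_def)
  ultimately show ?thesis by blast
qed

end

lemma edge_set_arc: "edge_set X \<Longrightarrow> \<exists>a\<in>arcs G. {tail G a, head G a} = X"
  unfolding edge_set_def using rung side_p side_r by (elim disjE exE conjE) (metis insert_commute)+

lemma few_turns_or_fans_of_realizer:
  assumes R: "realizer (cells M) (P_VEF M) Ls" and Ls: "length Ls = 3"
  shows "(K \<le> 4 \<and> (\<forall>t. Suc (Suc t) < m \<longrightarrow> \<not> fan_step t \<longrightarrow> \<not> fan_step (Suc t) \<longrightarrow> \<not> fan_step (Suc (Suc t)) \<longrightarrow> False))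
    \<or> (N \<le> 5 \<and> (\<forall>t. 0 < t \<longrightarrow> Suc (Suc (Suc t)) < m \<longrightarrow> fan_step t \<longrightarrow> fan_step (Suc t) \<longrightarrow> fan_step (Suc (Suc t)) \<longrightarrow> False))"
proof -
  let ?O = "Face (outer_face M)"
  have lin: "linear_order_on (cells M) (Ls ! k)" and ext: "P_VEF M \<subseteq> Ls ! k" if "k < 3" for k
    using R that Ls unfolding realizer_def linear_extension_def by auto
  have anti: "x = y" if "k < 3" "(x, y) \<in> Ls ! k" "(y, x) \<in> Ls ! k" for k x y
    using lin[OF that(1)] that(2,3) unfolding linear_order_on_def partial_order_on_def antisym_def by blast
  have tra: "(x, z) \<in> Ls ! k" if "k < 3" "(x, y) \<in> Ls ! k" "(y, z) \<in> Ls ! k" for k x y z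
    using lin[OF that(1)] that(2,3) unfolding linear_order_on_def partial_order_on_def preorder_on_def trans_def by blast
  have rev: "\<exists>k<3. (y, x) \<in> Ls ! k" if xy: "x \<in> cells M" "y \<in> cells M" "(x, y) \<notin> P_VEF M" for x y
  proof -
    have "x \<noteq> y" using xy unfolding P_VEF_def by auto
    have "\<exists>L\<in>set Ls. (x, y) \<notin> L" using R xy unfolding realizer_def by auto
    then obtain k where k: "k < 3" "(x, y) \<notin> Ls ! k" using Ls by (metis in_set_conv_nth)
    then have "(y, x) \<in> Ls ! k" using lin[OF k(1)] xy(1,2) \<open>x \<noteq> y\<close> unfolding linear_order_on_def total_on_def by blast
    then show ?thesis using k(1) by blast
  qed
  have Vc: "Vertex v \<in> cells M" if "v \<in> verts G" for v using that unfolding cells_def G_def by auto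
  have Fc: "Face (F t) \<in> cells M" if "t < m" for t using that unfolding cells_def faces_eq by auto
  have Oc: "?O \<in> cells M" unfolding cells_def faces_eq by auto
  have Ec: "Edge {a, edge_rev M a} \<in> cells M" if "a \<in> arcs G" for a using that unfolding cells_def G_def by auto
  have VF: "(Vertex v, Face (F t)) \<in> P_VEF M \<longleftrightarrow> v \<in> tri t" if "v \<in> verts G" "t < m" for v t
    using Vc[OF that(1)] Fc[OF that(2)] tail_F[OF that(2)] unfolding P_VEF_def by (simp add: G_def)
  have VE: "(Vertex v, Edge {a, edge_rev M a}) \<in> P_VEF M \<longleftrightarrow> v \<in> {tail G a, head G a}" if "v \<in> verts G" "a \<in> arcs G" for v a
    using Vc[OF that(1)] Ec[OF that(2)] edge_verts[OF that(2)] unfolding P_VEF_def by (simp add: G_def)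
  have VO: "(Vertex v, ?O) \<in> P_VEF M" if "v \<in> verts G" for v
    using Vc[OF that] Oc tail_outer that unfolding P_VEF_def by (simp add: G_def)
  define arc where "arc t = (SOME a. a \<in> arcs G \<and> tail G a = p (J t) \<and> head G a = r (I t))" for t
  have arc: "arc t \<in> arcs G \<and> tail G (arc t) = p (J t) \<and> head G (arc t) = r (I t)" if "t \<le> m" for t
    unfolding arc_def using rung[OF that] by (intro someI_ex[of "\<lambda>a. a \<in> arcs G \<and> tail G a = p (J t) \<and> head G a = r (I t)"]) blast
  define ch :: "nat \<Rightarrow> ('v, 'a) cell" where "ch t = Edge {arc t, edge_rev M (arc t)}" for t
  have chF: "(ch t, Face (F s)) \<in> P_VEF M" if "0 < t" "t < m" "s = t \<or> Suc s = t" for s t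
  proof -
    have s: "s < m" using that by auto
    have "{tail G (arc t), head G (arc t)} \<subseteq> tri s" using arc[of t] that unfolding tri_def by auto
    then have "{arc t, edge_rev M (arc t)} \<inter> F s \<noteq> {}" using edge_in_F_iff[of "arc t" s] arc[of t] that s by auto
    then show ?thesis using Ec[of "arc t"] arc[of t] that Fc[OF s] unfolding P_VEF_def ch_def by simp
  qed
  have "\<exists>k<3. (?O, ch t) \<in> Ls ! k" if "0 < t" "t < m" for t
  proof (rule rev)
    have a: "arc t \<in> arcs G" "tail G (arc t) = p (J t)" "head G (arc t) = r (I t)" using arc[of t] that by auto
    show "ch t \<in> cells M" unfolding ch_def using Ec[OF a(1)] .
    show "?O \<in> cells M" by (rule Oc)
    have "chord_set {tail G (arc t), head G (arc t)}" unfolding chord_set_def a(2,3) using that by blast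
    then have "{arc t, edge_rev M (arc t)} \<inter> outer_face M = {}" using chordal_iff[OF a(1)] by simp
    then show "(ch t, ?O) \<notin> P_VEF M" unfolding P_VEF_def ch_def by simp
  qed
  then obtain \<chi>0 where \<chi>0: "\<chi>0 t < 3 \<and> (?O, ch t) \<in> Ls ! \<chi>0 t" if "0 < t" "t < m" for t by metis
  define \<chi> where "\<chi> t = (if 0 < t \<and> t < m then \<chi>0 t else 0)" for t
  define gt where "gt k x y \<longleftrightarrow> k < 3 \<and> x \<noteq> y \<and> (Vertex y, Vertex x) \<in> Ls ! k" for k x y
  have above: "gt k x y" if "k < 3" "(z, Vertex x) \<in> Ls ! k" "(Vertex y, z) \<in> P_VEF M" "(Vertex x, z) \<notin> P_VEF M" for k x y z
    using that tra[OF that(1) _ that(2), of "Vertex y"] ext[OF that(1)] unfolding gt_def by blast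
  \<comment> \<open>The colour places the outer face below the chord and hence below the triangle,
    and every vertex is below the outer face; so in this order no vertex can be above the
    triangle.\<close>
  have not_col: "k \<noteq> \<chi> t" if k: "k < 3" "(Face (F s), Vertex x) \<in> Ls ! k" "x \<in> verts G" "0 < t" "t < m" "s = t \<or> Suc s = t" for k t s x
  proof
    assume "k = \<chi> t"
    then have "(?O, ch t) \<in> Ls ! k" using \<chi>0[OF k(4,5)] k(4,5) unfolding \<chi>_def by simp
    then have "(Vertex x, Face (F s)) \<in> Ls ! k"
      using VO[OF k(3)] chF[OF k(4,5,6)] ext[OF k(1)] tra[OF k(1)] by (meson subsetD)
    then show False using anti[OF k(1) k(2)] by blast
  qed
  show ?thesis
  proof (rule few_turns_or_fans[where gt = gt and \<chi> = \<chi>])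
    show False if "gt k x y" "gt k y x" for k x y
      using that anti[of k "Vertex x" "Vertex y"] unfolding gt_def by blast
    show "\<chi> t < 3" for t unfolding \<chi>_def using \<chi>0 by auto
    show "\<exists>k<3. (0 < t \<longrightarrow> k \<noteq> \<chi> t) \<and> (Suc t < m \<longrightarrow> k \<noteq> \<chi> (Suc t)) \<and> (\<forall>y\<in>tri t. gt k x y)"
      if t: "t < m" "x \<in> verts G" "x \<notin> tri t" for t x
    proof -
      have n: "(Vertex x, Face (F t)) \<notin> P_VEF M" using VF[OF t(2,1)] t(3) by simp
      obtain k where k: "k < 3" "(Face (F t), Vertex x) \<in> Ls ! k" using rev[OF Vc[OF t(2)] Fc[OF t(1)] n] by blast
      have "\<forall>y\<in>tri t. gt k x y" using above[OF k _ n] VF t(1) tri_verts by blast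
      then show ?thesis using not_col[OF k t(2)] k(1) t(1) by (intro exI[of _ k]) auto
    qed
    show "\<exists>k<3. \<forall>y\<in>tri t - {v}. gt k v y" if t: "t < m" "v \<in> tri t" "\<not> chord_set (tri t - {v})" for t v
    proof -
      have vV: "v \<in> verts G" using tri_verts t by blast
      obtain y z where yz: "tri t - {v} = {y, z}" "y \<noteq> z"
      proof -
        have "tri t - {apex t} = {lft t, rgt t}" "tri t - {lft t} = {apex t, rgt t}" "tri t - {rgt t} = {apex t, lft t}"
          using tri_alt[OF t(1)] tri_dist[OF t(1)] by auto
        moreover have "v = apex t \<or> v = lft t \<or> v = rgt t" using t(2) tri_alt[OF t(1)] by auto
        ultimately have "\<exists>y z. tri t - {v} = {y, z} \<and> y \<noteq> z" using tri_dist[OF t(1)] by metis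
        then show ?thesis using that by blast
      qed
      then have "edge_set {y, z}" using pair_in_tri_edge[OF t(1), of y z] by blast
      then obtain a where a: "a \<in> arcs G" "{tail G a, head G a} = {y, z}" using edge_set_arc by blast
      have n: "(Vertex v, Edge {a, edge_rev M a}) \<notin> P_VEF M" using VE[OF vV a(1)] a(2) yz by blast
      obtain k where k: "k < 3" "(Edge {a, edge_rev M a}, Vertex v) \<in> Ls ! k" using rev[OF Vc[OF vV] Ec[OF a(1)] n] by blast
      have "gt k v w" if "w \<in> tri t - {v}" for w
      proof -
        have "w \<in> verts G" using tri_verts[OF t(1)] that by blast
        then have "(Vertex w, Edge {a, edge_rev M a}) \<in> P_VEF M" using VE[OF _ a(1)] a(2) yz(1) that by blast
        then show ?thesis using above[OF k _ n] by blast
      qed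
      then show ?thesis using k(1) by blast
    qed
  qed
qed

end

text \<open>A shorter realizer can be padded by repeating one of its orders. The pair outside
  \<open>P\<close> ensures that there is one to repeat, since the empty family realizes the full
  relation.\<close>

lemma order_dim_eq_Suc:
  assumes ex: "\<exists>Ls. length Ls = Suc d \<and> realizer X P Ls"
    and none: "\<not> (\<exists>Ls. length Ls = d \<and> realizer X P Ls)"
    and proper: "x \<in> X" "y \<in> X" "(x, y) \<notin> P"
  shows "order_dim X P = Suc d"
  unfolding order_dim_def
proof (rule Least_equality)
  show "\<exists>Ls. length Ls = Suc d \<and> realizer X P Ls" by (rule ex)
next
  fix k assume "\<exists>Ls. length Ls = k \<and> realizer X P Ls"
  then obtain Ls where Ls: "length Ls = k" "realizer X P Ls" by blast
  show "Suc d \<le> k"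
  proof (rule ccontr)
    assume "\<not> Suc d \<le> k"
    have "Ls \<noteq> []" using Ls(2) proper unfolding realizer_def by auto
    then have s: "set (Ls @ replicate (d - k) (hd Ls)) = set Ls" by (cases Ls) auto
    have "length (Ls @ replicate (d - k) (hd Ls)) = d" using Ls(1) \<open>\<not> Suc d \<le> k\<close> by simp
    moreover have "realizer X P (Ls @ replicate (d - k) (hd Ls))" using Ls(2) unfolding realizer_def s .
    ultimately show False using none by blast
  qed
qed

section \<open>Structure of maximal path-like maps\<close>

text \<open>This is the form in which connectedness enters: a function that agrees on the ends of
  every arc is constant, so no path has to be followed.\<close>

lemma connected_const:
  assumes "Digraph_Component.connected H" "\<And>a. a \<in> arcs H \<Longrightarrow> f (tail H a) = f (head H a)"
    and "u \<in> verts H" "v \<in> verts H"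
  shows "f u = f v"
proof -
  have "u \<rightarrow>\<^sup>*\<^bsub>with_proj (mk_symmetric H)\<^esub> v"
    using assms(1,3,4) unfolding Digraph_Component.connected_def strongly_connected_def by (auto simp: mk_symmetric_def)
  then show ?thesis unfolding reachable_def
  proof (induction rule: rtrancl_on_induct)
    case (step x y)
    then have "(x, y) \<in> (\<Union>e\<in>arcs H. {(tail H e, head H e), (head H e, tail H e)})"
      by (auto simp: mk_symmetric_def arcs_ends_def arc_to_ends_def)
    then show ?case using step.IH assms(2) by auto
  qed simp
qed

text \<open>The values of \<open>f\<close> represent classes of vertices. Identifying the ends of
  one more pair merges at most two values into one, so at most one value is lost per pair. This
  plays the role of counting the components of a graph with few edges.\<close>

lemma many_classes:
  assumes "finite D" "finite V"
  shows "\<exists>f :: 'v \<Rightarrow> 'v. (\<forall>(x, y)\<in>D. f x = f y) \<and> card V \<le> card (f ` V) + card D"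
  using assms(1)
proof induction
  case empty
  show ?case by (intro exI[of _ id]) simp
next
  case (insert e D)
  obtain f :: "'v \<Rightarrow> 'v" where f: "\<forall>(x, y)\<in>D. f x = f y" "card V \<le> card (f ` V) + card D" using insert.IH by blast
  obtain x y where e: "e = (x, y)" by (cases e)
  define g where "g v = (if f v = f x then f y else f v)" for v
  have "f ` V \<subseteq> Set.insert (f x) (g ` V)" unfolding g_def by (auto simp: image_iff)
  then have "card (f ` V) \<le> card (Set.insert (f x) (g ` V))" using assms(2) by (intro card_mono) auto
  also have "\<dots> \<le> Suc (card (g ` V))" by (rule card_insert_le_m1) auto
  finally have "card V \<le> card (g ` V) + card (Set.insert e D)" using f(2) insert.hyps by simp
  moreover have "\<forall>(x, y)\<in>Set.insert e D. g x = g y" using f(1) e unfolding g_def by auto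
  ultimately show ?case by blast
qed

text \<open>\<open>ph\<close> runs along an arc and turns to the next arc around its head, so its
  orbits are the boundary walks of the faces.\<close>

locale simple_pmap =
  fixes M :: "('v, 'a) pmap"
  fixes G rv ph
  defines G_def: "G \<equiv> underlying M" and rv_def: "rv \<equiv> edge_rev M"
    and ph_def: "ph \<equiv> edge_succ M \<circ> edge_rev M"
  assumes planar: "planar_map M" and simple: "simple_map M"
begin

lemma fin: "fin_digraph G" and bidir: "bidirected_digraph G rv" and succ_permutes: "edge_succ M permutes arcs G"
  and rot: "v \<in> verts G \<Longrightarrow> out_arcs G v \<noteq> {} \<Longrightarrow> cyclic_on (edge_succ M) (out_arcs G v)"
  and conn: "Digraph_Component.connected G"
  and euler: "card (verts G) + card (faces M) = card (arcs G) div 2 + 2"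
  and outer_in: "outer_face M \<in> faces M"
  using planar unfolding planar_map_def planar_rotation_def rotation_system_def faces_def G_def rv_def by auto

lemma nomulti: "nomulti_digraph G" and loopfree: "loopfree_digraph G"
  using simple unfolding simple_map_def G_def by auto

lemma finite_arcs: "finite (arcs G)" and finite_vs: "finite (verts G)"
  using fin by (auto simp: fin_digraph.finite_arcs fin_digraph.finite_verts)

lemma wf: "wf_digraph G" using fin unfolding fin_digraph_def by simp

lemma ends_in: "a \<in> arcs G \<Longrightarrow> tail G a \<in> verts G" "a \<in> arcs G \<Longrightarrow> head G a \<in> verts G"
  using wf by (auto simp: wf_digraph_def)

lemma rv_facts: 
  shows "rv (rv a) = a" "a \<in> arcs G \<Longrightarrow> rv a \<in> arcs G" "a \<in> arcs G \<Longrightarrow> tail G (rv a) = head G a"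
    "a \<in> arcs G \<Longrightarrow> head G (rv a) = tail G a" "rv a = rv b \<longleftrightarrow> a = b" "a \<in> arcs G \<Longrightarrow> rv a \<noteq> a"
  using bidir by (auto simp: bidirected_digraph.arev_arev bidirected_digraph.arev_in_arcs bidirected_digraph.tail_arev
      bidirected_digraph.head_arev bidirected_digraph.arev_eq_iff bidirected_digraph.arev_neq)

lemma arc_eqI: "a \<in> arcs G \<Longrightarrow> b \<in> arcs G \<Longrightarrow> tail G a = tail G b \<Longrightarrow> head G a = head G b \<Longrightarrow> a = b"
  using nomulti nomulti_digraph.no_multi_arcs[of G a b] by (auto simp: arc_to_ends_def)

lemma no_loop: "a \<in> arcs G \<Longrightarrow> tail G a \<noteq> head G a"
  using loopfree by (simp add: loopfree_digraph.no_loops)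

lemma ph_permutes: "ph permutes arcs G"
  unfolding ph_def using permutes_compose[OF bidirected_digraph.arev_permutes_arcs[OF bidir] succ_permutes]
  by (simp add: rv_def)

lemma ph_arc: "a \<in> arcs G \<Longrightarrow> ph a \<in> arcs G" using permutes_in_image[OF ph_permutes] by simp
lemma ph_inj: "ph a = ph b \<longleftrightarrow> a = b" using permutes_inj[OF ph_permutes] by (auto dest: injD)

lemma tail_succ: "a \<in> arcs G \<Longrightarrow> tail G (edge_succ M a) = tail G a"
proof -
  assume a: "a \<in> arcs G"
  then have "a \<in> out_arcs G (tail G a)" by simp
  then have "edge_succ M a \<in> out_arcs G (tail G a)" using cyclic_on_inI[OF rot[OF ends_in(1)[OF a]]] by blast
  then show ?thesis by simp
qed

lemma tail_ph: "a \<in> arcs G \<Longrightarrow> tail G (ph a) = head G a"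
  unfolding ph_def using tail_succ[of "rv a"] rv_facts by (simp add: rv_def)

abbreviation fc where "fc a \<equiv> face_of (edge_rev M) (edge_succ M) a"

lemma fc_eq: "fc a = orbit ph a" unfolding face_of_def ph_def by simp

lemma self_in_fc: "a \<in> fc a"
proof -
  have "permutation ph" using ph_permutes finite_arcs permutation_permutes by blast
  then show ?thesis unfolding fc_eq by (rule permutation_self_in_orbit)
qed

lemma fc_cong: "b \<in> fc a \<Longrightarrow> fc b = fc a"
  unfolding fc_eq by (rule orbit_cyclic_eq3[OF cyclic_on_orbit[OF ph_permutes finite_arcs]])

lemma fc_arcs: "a \<in> arcs G \<Longrightarrow> fc a \<subseteq> arcs G"
  unfolding fc_eq using permutes_orbit_subset[OF ph_permutes] .

lemma ph_in_fc: "b \<in> fc a \<Longrightarrow> ph b \<in> fc a"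
  unfolding fc_eq by (rule orbit.step)

lemma faces_alt: "faces M = fc ` arcs G" unfolding faces_def face_set_def G_def ..

lemma face_fc: assumes "f \<in> faces M" "a \<in> f" shows "f = fc a \<and> a \<in> arcs G"
proof -
  obtain c where c: "c \<in> arcs G" "f = fc c" using assms(1) unfolding faces_alt by auto
  then show ?thesis using fc_cong[of a c] fc_arcs[of c] assms(2) by auto
qed

lemma fc_in_faces: "a \<in> arcs G \<Longrightarrow> fc a \<in> faces M" unfolding faces_alt by simp

lemma face_nonempty: "f \<in> faces M \<Longrightarrow> f \<noteq> {}" unfolding faces_alt using self_in_fc by blast

lemma orbit_least: "a \<in> X \<Longrightarrow> (\<And>b. b \<in> X \<Longrightarrow> ph b \<in> X) \<Longrightarrow> fc a \<subseteq> X"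
proof
  fix b assume X: "a \<in> X" "\<And>b. b \<in> X \<Longrightarrow> ph b \<in> X" and "b \<in> fc a"
  from this(3) show "b \<in> X" unfolding fc_eq by (induction rule: orbit.induct) (use X in auto)
qed

lemma triangle:
  assumes f: "f \<in> faces M" "card f = 3" and a: "a \<in> f"
  shows "f = {a, ph a, ph (ph a)}" "ph (ph (ph a)) = a" "a \<noteq> ph a" "ph (ph a) \<noteq> a" "ph a \<noteq> ph (ph a)"
proof -
  have fa: "f = fc a" "a \<in> arcs G" using face_fc f a by auto
  have finf: "finite f" using fa fc_arcs finite_arcs finite_subset by metis
  show 1: "a \<noteq> ph a"
  proof
    assume "a = ph a"
    then have "fc a \<subseteq> {a}" by (intro orbit_least) auto
    then have "card f \<le> card {a}" using fa by (intro card_mono) auto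
    then show False using f by simp
  qed
  show 2: "ph (ph a) \<noteq> a"
  proof
    assume "ph (ph a) = a"
    then have "fc a \<subseteq> {a, ph a}" by (intro orbit_least) auto
    then have "card f \<le> card {a, ph a}" using fa by (intro card_mono) auto
    then show False using f 1 by simp
  qed
  show 3: "ph a \<noteq> ph (ph a)" using 1 ph_inj by simp
  have mem: "ph a \<in> f" "ph (ph a) \<in> f" "ph (ph (ph a)) \<in> f" using a fa ph_in_fc by auto
  have "{a, ph a, ph (ph a)} = f" using mem a finf f 1 2 3 by (intro card_subset_eq) auto
  then show "f = {a, ph a, ph (ph a)}" by simp
  then have "ph (ph (ph a)) \<in> {a, ph a, ph (ph a)}" using mem by simp
  then show "ph (ph (ph a)) = a" using 2 3 ph_inj by auto
qed

lemma vertex_has_arc: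
  assumes "2 \<le> card (verts G)" "v \<in> verts G" shows "\<exists>a\<in>arcs G. tail G a = v"
proof (rule ccontr)
  assume n: "\<not> ?thesis"
  have "\<exists>u\<in>verts G. u \<noteq> v"
  proof (rule ccontr)
    assume "\<not> ?thesis"
    then have "verts G \<subseteq> {v}" by auto
    then have "card (verts G) \<le> card {v}" by (intro card_mono) auto
    then show False using assms by simp
  qed
  then obtain u where u: "u \<in> verts G" "u \<noteq> v" by blast
  have "(tail G a = v) = (head G a = v)" if "a \<in> arcs G" for a using n rv_facts that by metis
  from connected_const[OF conn this u(1) assms(2)] show False using u by simp
qed

end

text \<open>The arc \<open>b0\<close> orients the strip. If there is a second triangle, the arc
  shared with it comes two steps after \<open>b0\<close> around the first triangle and therefore
  ends at the tail of \<open>b0\<close>. So \<open>b0\<close> can become rung 0, with its head, the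
  tip of the end triangle, as \<open>r 0\<close>.\<close>

locale strip_map = simple_pmap M for M :: "('v, 'a :: linorder) pmap" +
  fixes vs :: "'a set list" and m :: nat
  defines m_def: "m \<equiv> length vs"
  assumes two: "two_connected G"
    and vs_ne: "vs \<noteq> []" and vs_dist: "distinct vs" and vs_set: "set vs = bounded_faces M"
    and card3: "\<And>f. f \<in> set vs \<Longrightarrow> card f = 3"
    and adj: "\<And>a i j. a \<in> arcs G \<Longrightarrow> i < m \<Longrightarrow> j < m \<Longrightarrow> a \<in> vs ! i \<Longrightarrow> rv a \<in> vs ! j \<Longrightarrow> i = Suc j \<or> j = Suc i"
    and adj_ex: "\<And>i. Suc i < m \<Longrightarrow> \<exists>a\<in>arcs G. a \<in> vs ! i \<and> rv a \<in> vs ! Suc i"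
    and adj_unique: "\<And>a b i j. a \<in> arcs G \<Longrightarrow> b \<in> arcs G \<Longrightarrow> i < m \<Longrightarrow> j < m \<Longrightarrow> a \<in> vs ! i \<Longrightarrow> rv a \<in> vs ! j \<Longrightarrow>
        b \<in> vs ! i \<Longrightarrow> rv b \<in> vs ! j \<Longrightarrow> a = b"
  fixes b0 :: 'a
  assumes b0: "b0 \<in> vs ! 0" and b0_next: "1 < m \<Longrightarrow> rv (ph (ph b0)) \<in> vs ! 1"
begin

lemma m_pos: "0 < m" using vs_ne m_def by simp
lemma vs_face: "i < m \<Longrightarrow> vs ! i \<in> faces M" "i < m \<Longrightarrow> vs ! i \<noteq> outer_face M" "i < m \<Longrightarrow> card (vs ! i) = 3"
  using vs_set card3 nth_mem[of i vs] unfolding m_def bounded_faces_def by auto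
lemma vs_inj: "i < m \<Longrightarrow> j < m \<Longrightarrow> vs ! i = vs ! j \<longleftrightarrow> i = j"
  using vs_dist nth_eq_iff_index_eq unfolding m_def by blast
lemma face_cases: "f \<in> faces M \<Longrightarrow> f = outer_face M \<or> (\<exists>i<m. f = vs ! i)"
  proof -
  assume f: "f \<in> faces M"
  show ?thesis
  proof (cases "f = outer_face M")
    case False
    then have "f \<in> set vs" using f vs_set unfolding bounded_faces_def by simp
    then show ?thesis unfolding m_def in_set_conv_nth by auto
  qed simp
qed
lemma vs_arc: "i < m \<Longrightarrow> a \<in> vs ! i \<Longrightarrow> a \<in> arcs G" using face_fc[OF vs_face(1)] by simp
lemma face_disj: "f \<in> faces M \<Longrightarrow> g \<in> faces M \<Longrightarrow> a \<in> f \<Longrightarrow> a \<in> g \<Longrightarrow> f = g" using face_fc[of f a] face_fc[of g a] by simp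
lemma vs_disj: "i < m \<Longrightarrow> j < m \<Longrightarrow> a \<in> vs ! i \<Longrightarrow> a \<in> vs ! j \<Longrightarrow> i = j" using face_disj[OF vs_face(1) vs_face(1)] vs_inj by simp
lemma vs_outer: "i < m \<Longrightarrow> a \<in> vs ! i \<Longrightarrow> a \<notin> outer_face M" using face_disj[OF vs_face(1) outer_in] vs_face(2) by blast
lemma arc_cases: "a \<in> arcs G \<Longrightarrow> a \<in> outer_face M \<or> (\<exists>i<m. a \<in> vs ! i)"
  using face_cases[OF fc_in_faces, of a] self_in_fc[of a] by auto
lemma outer_arc: "a \<in> outer_face M \<Longrightarrow> a \<in> arcs G" using face_fc[OF outer_in] by simp

definition x :: "nat \<Rightarrow> 'a" where "x i = (SOME a. a \<in> vs ! i \<and> rv a \<in> vs ! Suc i)"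

lemma x: "Suc i < m \<Longrightarrow> x i \<in> vs ! i \<and> rv (x i) \<in> vs ! Suc i"
  unfolding x_def using adj_ex[of i] by (intro someI_ex[of "\<lambda>a. a \<in> vs ! i \<and> rv a \<in> vs ! Suc i"]) auto

text \<open>\<open>b t\<close> is rung \<open>t\<close>, directed from the \<open>p\<close>-side to
  the \<open>r\<close>-side and lying on the boundary of triangle \<open>t\<close> for
  \<open>t < m\<close>. The second alternative supplies the final rung, which is an outer edge; it
  is chosen so that the last step is an \<open>I\<close>-step.\<close>

primrec b :: "nat \<Rightarrow> 'a" where
  "b 0 = b0"
| "b (Suc i) = (if Suc i < m then rv (x i) else rv (ph (ph (b i))))"

lemma b_in: "t < m \<Longrightarrow> b t \<in> vs ! t"
  using b0 x by (cases t) auto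
lemma b_prev: "0 < t \<Longrightarrow> t < m \<Longrightarrow> rv (b t) \<in> vs ! (t - 1)"
  using x[of "t - 1"] rv_facts(1) by (cases t) auto

lemma tri_t: "t < m \<Longrightarrow> vs ! t = {b t, ph (b t), ph (ph (b t))}" "t < m \<Longrightarrow> ph (ph (ph (b t))) = b t"
   "t < m \<Longrightarrow> b t \<noteq> ph (b t)" "t < m \<Longrightarrow> ph (ph (b t)) \<noteq> b t" "t < m \<Longrightarrow> ph (b t) \<noteq> ph (ph (b t))"
  using triangle[OF vs_face(1,3) b_in] by simp_all

lemma b_arc: "t \<le> m \<Longrightarrow> b t \<in> arcs G"
proof (cases "t < m")
  case True then show ?thesis using b_in vs_arc by blast
next
  case False
  assume "t \<le> m"
  then have "t = m" using False by simp
  obtain k where k: "m = Suc k" using m_pos gr0_conv_Suc by auto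
  have "b k \<in> arcs G" using b_in[of k] vs_arc[of k] k by simp
  then show ?thesis using rv_facts(2)[OF ph_arc[OF ph_arc]] unfolding \<open>t = m\<close> k b.simps(2) by (simp flip: k)
qed

lemma b_step: assumes "t < m" shows "rv (b (Suc t)) = ph (b t) \<or> rv (b (Suc t)) = ph (ph (b t))"
proof (cases "Suc t < m")
  case True
  then have xt: "x t \<in> vs ! t" "rv (x t) \<in> vs ! Suc t" "rv (b (Suc t)) = x t" using x rv_facts(1) by auto
  \<comment> \<open>The arc into the next triangle is not the rung just crossed: that one leads back
    to the previous triangle, and at the start \<open>b0\<close> lies two steps before the shared
    arc.\<close>
  have "x t \<noteq> b t"
  proof
    assume e: "x t = b t"
    show False
    proof (cases t)
      case 0
      then have 1: "1 < m" "rv (ph (ph b0)) \<in> vs ! 1" "ph (ph b0) \<in> vs ! 0"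
        using True b0_next tri_t(1)[of 0] m_pos by auto
      have "ph (ph b0) = x 0"
        by (rule adj_unique[of _ _ 0 1]) (use 1 xt 0 m_pos vs_arc in auto)
      then show False using e 0 tri_t(4)[of 0] m_pos by simp
    next
      case (Suc s)
      then have "rv (b t) \<in> vs ! s" using b_prev[of t] assms by simp
      then have "Suc t = s" using vs_disj[of "Suc t" s "rv (x t)"] xt e True Suc by simp
      then show False using Suc by simp
    qed
  qed
  then show ?thesis using xt tri_t(1)[OF assms] by auto
qed (simp add: rv_facts)

lemma b_first: "rv (b 1) = ph (ph (b 0))"
proof (cases "1 < m")
  case True
  have 1: "rv (ph (ph b0)) \<in> vs ! 1" "ph (ph b0) \<in> vs ! 0" using True b0_next tri_t(1)[of 0] by auto
  have "x 0 \<in> vs ! 0" "rv (x 0) \<in> vs ! 1" using x[of 0] True by auto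
  then have "ph (ph b0) = x 0" by (intro adj_unique[of _ _ 0 1]) (use 1 True vs_arc in auto)
  then show ?thesis using True rv_facts(1) by simp
qed (simp add: rv_facts)

lemma b_last: "rv (b m) = ph (ph (b (m - 1)))"
  using m_pos rv_facts(1) by (cases m) auto

declare b.simps [simp del]

text \<open>In a fan step the next rung returns to the tail of \<open>b t\<close>, so the
  \<open>p\<close>-vertex is kept. The remaining side \<open>y t\<close> is an outer edge, traversed
  with the triangle on its face.\<close>

definition fan where "fan t \<longleftrightarrow> rv (b (Suc t)) = ph (ph (b t))"
definition y :: "nat \<Rightarrow> 'a" where "y t = (if fan t then ph (b t) else ph (ph (b t)))"

lemma face_parts: assumes "t < m" shows "vs ! t = {b t, y t, rv (b (Suc t))}" "y t \<noteq> b t" "y t \<noteq> rv (b (Suc t))" "b t \<noteq> rv (b (Suc t))"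
proof -
  note f = tri_t(1,3,4,5)[OF assms]
  have "vs ! t = {b t, y t, rv (b (Suc t))} \<and> y t \<noteq> b t \<and> y t \<noteq> rv (b (Suc t)) \<and> b t \<noteq> rv (b (Suc t))"
  proof (cases "fan t")
    case True
    then have e: "rv (b (Suc t)) = ph (ph (b t))" "y t = ph (b t)" unfolding fan_def y_def by simp_all
    show ?thesis unfolding e by (rule conjI[OF f(1) conjI[OF not_sym[OF f(2)] conjI[OF f(4) not_sym[OF f(3)]]]])
  next
    case False
    then have e: "rv (b (Suc t)) = ph (b t)" "y t = ph (ph (b t))" using b_step[OF assms] unfolding fan_def y_def by simp_all
    have "vs ! t = {b t, ph (ph (b t)), ph (b t)}" unfolding f(1) by (rule arg_cong[OF insert_commute])
    then show ?thesis unfolding e by (rule conjI[OF _ conjI[OF f(3) conjI[OF not_sym[OF f(4)] f(2)]]])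
  qed
  then show "vs ! t = {b t, y t, rv (b (Suc t))}" "y t \<noteq> b t" "y t \<noteq> rv (b (Suc t))" "b t \<noteq> rv (b (Suc t))" by blast+
qed

lemma y_in: "t < m \<Longrightarrow> y t \<in> vs ! t" using face_parts(1)[of t] by blast
lemma y_arc: "t < m \<Longrightarrow> y t \<in> arcs G" using y_in vs_arc by blast

lemma out_of: assumes "t < m" "a \<in> vs ! t" "0 < t \<Longrightarrow> a \<noteq> b t" "Suc t < m \<Longrightarrow> a \<noteq> rv (b (Suc t))"
  shows "rv a \<in> outer_face M"
proof (rule ccontr)
  assume n: "\<not> ?thesis"
  have a: "a \<in> arcs G" using assms vs_arc by blast
  then obtain j where j: "j < m" "rv a \<in> vs ! j" using arc_cases[OF rv_facts(2)] n by blast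
  from adj[OF a assms(1) j(1) assms(2) j(2)] show False
  proof
    assume t: "t = Suc j"
    then have "b t \<in> vs ! t" "rv (b t) \<in> vs ! j" "b t \<in> arcs G" using b_in[of t] b_prev[of t] b_arc[of t] assms by auto
    then have "a = b t" using adj_unique[OF a _ assms(1) j(1) assms(2) j(2)] by blast
    then show False using assms t by simp
  next
    assume t: "j = Suc t"
    then have "rv (b j) \<in> vs ! t" "b j \<in> vs ! j" "b j \<in> arcs G" using b_prev[of j] b_in[of j] b_arc[of j] j by auto
    then have "a = rv (b j)" using adj_unique[OF a rv_facts(2) assms(1) j(1) assms(2) j(2)] rv_facts(1) by simp
    then show False using assms t j by simp
  qed
qed

lemma y_outer: "t < m \<Longrightarrow> rv (y t) \<in> outer_face M" using out_of[of t "y t"] y_in[of t] face_parts(2,3)[of t] by blast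
lemma b0_outer: "rv (b 0) \<in> outer_face M" using out_of[of 0 "b 0"] face_parts(1,4)[of 0] m_pos by blast
lemma face_last: "rv (b m) \<in> vs ! (m - 1)" "rv (b m) \<noteq> y (m - 1)" "rv (b m) \<noteq> b (m - 1)"
proof -
  obtain k where k: "m = Suc k" using m_pos gr0_conv_Suc by auto
  have f: "vs ! k = {b k, y k, rv (b (Suc k))}" "y k \<noteq> rv (b (Suc k))" "b k \<noteq> rv (b (Suc k))"
    using face_parts[of k] k by blast+
  have e: "m - 1 = k" using k by simp
  show "rv (b m) \<in> vs ! (m - 1)" "rv (b m) \<noteq> y (m - 1)" "rv (b m) \<noteq> b (m - 1)"
    unfolding e using f unfolding k[symmetric] by (simp, metis+)
qed

lemma bm_outer: "b m \<in> outer_face M"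
proof -
  have e: "m - 1 < m" "\<not> Suc (m - 1) < m" using m_pos by simp_all
  have "rv (rv (b m)) \<in> outer_face M" by (rule out_of[OF e(1) face_last(1)]) (use face_last e in blast)+
  then show ?thesis unfolding rv_facts(1) .
qed

lemma n_ge3: "3 \<le> card (verts G)" using two unfolding two_connected_def by simp

lemma card_faces: "card (faces M) = Suc m"
proof -
  have "finite (faces M)" unfolding faces_alt using finite_arcs by simp
  then have "card (faces M) = Suc (card (bounded_faces M))"
    using outer_in unfolding bounded_faces_def by (metis card_Suc_Diff1)
  then show ?thesis using vs_set vs_dist distinct_card m_def by metis
qed

lemma card_arcs: "card (arcs G) = 3 * m + card (outer_face M)"
proof -
  have "arcs G = (\<Union>i<m. vs ! i) \<union> outer_face M" using arc_cases vs_arc outer_arc by blast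
  moreover have "(\<Union>i<m. vs ! i) \<inter> outer_face M = {}" using vs_outer by blast
  moreover have "card (\<Union>i<m. vs ! i) = (\<Sum>i<m. card (vs ! i))"
  proof (rule card_UN_disjoint)
    show "\<forall>i\<in>{..<m}. finite (vs ! i)" using vs_face(3) card.infinite by fastforce
    show "\<forall>i\<in>{..<m}. \<forall>j\<in>{..<m}. i \<noteq> j \<longrightarrow> vs ! i \<inter> vs ! j = {}" using vs_disj by blast
  qed simp
  moreover have "(\<Sum>i<m. card (vs ! i)) = 3 * m" using vs_face(3) by simp
  moreover have "finite (\<Union>i<m. vs ! i)" by (rule finite_subset[OF _ finite_arcs]) (use vs_arc in blast)
  moreover have "finite (outer_face M)" by (rule finite_subset[OF _ finite_arcs]) (use outer_arc in blast)
  ultimately show ?thesis using card_Un_disjoint by metis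
qed

definition bridges where "bridges = {a \<in> outer_face M. rv a \<in> outer_face M}"

text \<open>The \<open>m\<close> sides \<open>y t\<close> and the two end rungs are
  \<open>m + 2\<close> distinct arcs on triangles whose reverses lie on the outer face. None of
  these reverses is in \<open>bridges\<close>, so the bridges count in addition.\<close>

lemma outer_count: "m + 2 + card bridges \<le> card (outer_face M)"
proof -
  let ?Z = "insert (b 0) (insert (rv (b m)) (y ` {..<m}))"
  have fo: "finite (outer_face M)" by (rule finite_subset[OF _ finite_arcs]) (use outer_arc in blast)
  have yi: "inj_on y {..<m}"
  proof (rule inj_onI)
    fix s t assume "s \<in> {..<m}" "t \<in> {..<m}" "y s = y t"
    then show "s = t" using vs_disj[of s t "y s"] y_in[of s] y_in[of t] by simp
  qed
  note l = face_last
  have 1: "rv (b m) \<notin> y ` {..<m}"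
  proof
    assume "rv (b m) \<in> y ` {..<m}"
    then obtain t where t: "t < m" "rv (b m) = y t" by auto
    then have "t = m - 1" using vs_disj[of t "m - 1" "y t"] y_in[of t] l(1) m_pos by simp
    then show False using t l(2) by simp
  qed
  have 2: "b 0 \<noteq> rv (b m)"
  proof
    assume "b 0 = rv (b m)"
    moreover then have "m - 1 = 0" using vs_disj[of "m - 1" 0 "b 0"] l(1) b_in[of 0] m_pos by simp
    ultimately show False using l(3) by simp
  qed
  have 3: "b 0 \<notin> y ` {..<m}"
  proof
    assume "b 0 \<in> y ` {..<m}"
    then obtain t where t: "t < m" "b 0 = y t" by auto
    then have "t = 0" using vs_disj[of t 0 "y t"] y_in[of t] b_in[of 0] m_pos by simp
    then show False using t face_parts(2)[of 0] by simp
  qed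
  have "card ?Z = m + 2" using 1 2 3 yi by (simp add: card_image)
  moreover have "inj rv" using rv_facts(5) by (auto intro: injI)
  ultimately have "card (rv ` ?Z) = m + 2" using card_image[OF inj_on_subset[of rv UNIV ?Z]] by simp
  moreover have "rv ` ?Z \<subseteq> outer_face M - bridges"
  proof
    fix a assume "a \<in> rv ` ?Z"
    then have "a \<in> outer_face M" using b0_outer bm_outer y_outer rv_facts(1) by auto
    moreover have "rv a \<in> ?Z" using \<open>a \<in> rv ` ?Z\<close> rv_facts(1) by auto
    moreover have "?Z \<inter> outer_face M = {}"
      using vs_outer[OF _ l(1)] vs_outer[of 0 "b 0"] b_in[of 0] vs_outer[OF _ y_in] m_pos by auto
    ultimately show "a \<in> outer_face M - bridges" unfolding bridges_def by blast
  qed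
  ultimately have "m + 2 \<le> card (outer_face M - bridges)" using card_mono[of "outer_face M - bridges" "rv ` ?Z"] fo by simp
  then show ?thesis using fo card_Diff_subset[of bridges "outer_face M"] card_mono[of "outer_face M" bridges]
    finite_subset[of bridges "outer_face M"] unfolding bridges_def by auto
qed

text \<open>In each triangle the first rung and the outer side connect all three vertices, so
  agreement passes from rung to rung.\<close>

lemma rest_const:
  assumes "f (tail G (b 0)) = f (head G (b 0))" "\<And>t. t < m \<Longrightarrow> f (tail G (y t)) = f (head G (y t))" "t \<le> m"
  shows "f (tail G (b t)) = f (head G (b t))"
  using assms(3)
proof (induction t)
  case (Suc t)
  then have t: "t < m" and IH: "f (tail G (b t)) = f (head G (b t))" by auto
  have B: "b t \<in> arcs G" "b (Suc t) \<in> arcs G" "ph (b t) \<in> arcs G" "ph (ph (b t)) \<in> arcs G" using b_arc t ph_arc Suc by auto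
  have hh: "tail G (ph (b t)) = head G (b t)" "tail G (ph (ph (b t))) = head G (ph (b t))" "head G (ph (ph (b t))) = tail G (b t)"
    using tail_ph[OF B(1)] tail_ph[OF B(3)] tail_ph[OF B(4)] tri_t(2)[OF t] by simp_all
  have e: "tail G (b (Suc t)) = head G (rv (b (Suc t)))" "head G (b (Suc t)) = tail G (rv (b (Suc t)))"
    using rv_facts B by auto
  show ?case
  proof (cases "fan t")
    case True
    then have "rv (b (Suc t)) = ph (ph (b t))" "y t = ph (b t)" unfolding fan_def y_def by auto
    then show ?thesis using assms(2)[OF t] e hh IH by simp
  next
    case False
    then have "rv (b (Suc t)) = ph (b t)" "y t = ph (ph (b t))" using b_step[OF t] unfolding fan_def y_def by auto
    then show ?thesis using assms(2)[OF t] e hh IH by simp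
  qed
qed (simp add: assms)

text \<open>An edge with the outer face on both sides would be a bridge: after deleting it and the rungs
  \<open>b 1, \<dots>, b m\<close>, Euler's formula leaves too few edges to connect all vertices, while
  each deleted rung closes a triangle with edges that are already there.\<close>

lemma no_bridges: "bridges = {}"
proof (rule ccontr)
  assume "bridges \<noteq> {}"
  define H where "H = {a \<in> bridges. a < rv a}"
  have fb: "finite bridges" "finite (outer_face M)"
    by (rule finite_subset[OF _ finite_arcs]; use outer_arc bridges_def in blast)+
  have brv: "a \<in> bridges \<Longrightarrow> rv a \<in> bridges" for a unfolding bridges_def using rv_facts by auto
  have "bridges = H \<union> rv ` H"
  proof
    show "bridges \<subseteq> H \<union> rv ` H"
    proof
      fix a assume a: "a \<in> bridges"
      then have "rv a \<noteq> a" using rv_facts(6) outer_arc unfolding bridges_def by blast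
      then consider "a < rv a" | "rv a < a" by fastforce
      then show "a \<in> H \<union> rv ` H"
      proof cases
        case 2
        then have "rv a \<in> H" unfolding H_def using brv[OF a] rv_facts(1) by simp
        then have "rv (rv a) \<in> rv ` H" by (rule imageI)
        then show ?thesis unfolding rv_facts(1) by (rule UnI2)
      qed (use a H_def in auto)
    qed
  qed (use brv H_def in auto)
  moreover have "H \<inter> rv ` H = {}" unfolding H_def using rv_facts(1) by fastforce
  moreover have "card (rv ` H) = card H" using rv_facts(5) by (intro card_image inj_onI) auto
  moreover have fH: "finite H" using fb(1) unfolding H_def by simp
  ultimately have cb: "card bridges = 2 * card H" using card_Un_disjoint[of H "rv ` H"] by simp
  have "H \<noteq> {}" using \<open>bridges = H \<union> rv ` H\<close> \<open>bridges \<noteq> {}\<close> by auto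
  then obtain a where a: "a \<in> H" by blast
  have aa: "a \<in> arcs G" "rv a \<in> arcs G" using a outer_arc unfolding H_def bridges_def by auto
  have "4 * m + 2 + 2 * card H \<le> card (arcs G)" using card_arcs outer_count cb by simp
  then have n: "m + 2 + card H \<le> card (verts G)" using euler card_faces by simp
  define D where "D = insert (b 0) (y ` {..<m}) \<union> (H - {a})"
  have "card D \<le> card (insert (b 0) (y ` {..<m})) + card (H - {a})" unfolding D_def by (rule card_Un_le)
  also have "card (insert (b 0) (y ` {..<m})) \<le> Suc (card (y ` {..<m}))" by (rule card_insert_le_m1) auto
  also have "card (y ` {..<m}) \<le> m" using card_image_le[of "{..<m}" y] by simp
  finally have cD: "card D \<le> m + card H" using a fH card_Suc_Diff1[of H a] by simp
  have fD: "finite D" unfolding D_def using fH by simp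
  obtain f :: "'v \<Rightarrow> 'v" where f: "\<forall>(u, w)\<in>(\<lambda>c. (tail G c, head G c)) ` D. f u = f w"
      "card (verts G) \<le> card (f ` verts G) + card ((\<lambda>c. (tail G c, head G c)) ` D)"
    using many_classes[of "(\<lambda>c. (tail G c, head G c)) ` D" "verts G"] fD finite_vs by blast
  have "card ((\<lambda>c. (tail G c, head G c)) ` D) \<le> card D" using fD by (rule card_image_le)
  then have f2: "2 \<le> card (f ` verts G)" using f(2) cD n by simp
  have fD': "f (tail G c) = f (head G c)" if "c \<in> D" for c using f(1) that by auto
  have fb: "f (tail G (b t)) = f (head G (b t))" if "t \<le> m" for t
    using rest_const[of f] fD' that unfolding D_def by auto
  have fy: "f (tail G (y t)) = f (head G (y t))" if "t < m" for t using fD' that unfolding D_def by auto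
  have frv: "f (tail G (rv c)) = f (head G (rv c)) \<longleftrightarrow> f (tail G c) = f (head G c)" if "c \<in> arcs G" for c
    using rv_facts that by auto
  have fall: "f (tail G c) = f (head G c)" if c: "c \<in> arcs G" "c \<noteq> a" "c \<noteq> rv a" for c
  proof -
    have bd: "f (tail G d) = f (head G d)" if "d \<in> vs ! t" "t < m" for d t
      using that face_parts(1)[of t] fb[of t] fb[of "Suc t"] fy[of t] frv[of "b (Suc t)"] b_arc[of "Suc t"] by auto
    consider t where "t < m" "c \<in> vs ! t" | t where "t < m" "rv c \<in> vs ! t" | "c \<in> bridges"
      using arc_cases[OF c(1)] arc_cases[OF rv_facts(2)[OF c(1)]] unfolding bridges_def by blast
    then show ?thesis
    proof cases
      case 2 then show ?thesis using bd frv[OF c(1)] by blast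
    next
      case 3
      then have "c \<in> H \<or> rv c \<in> H" using \<open>bridges = H \<union> rv ` H\<close> rv_facts(1) by auto
      moreover have "rv c \<noteq> a" using c(3) rv_facts(1) by auto
      ultimately have "c \<in> D \<or> rv c \<in> D" unfolding D_def using c by auto
      then show ?thesis using fD' frv[OF c(1)] by blast
    qed (use bd in blast)
  qed
  let ?u = "tail G a" and ?w = "head G a"
  have uw: "?u \<in> verts G" "?w \<in> verts G" "?u \<noteq> ?w" using ends_in aa no_loop by auto
  have ne: "f ?u \<noteq> f ?w"
  proof
    assume e: "f ?u = f ?w"
    have "f (tail G c) = f (head G c)" if "c \<in> arcs G" for c
      using fall[OF that] e rv_facts aa by (cases "c = a \<or> c = rv a") auto
    then have "f s = f ?u" if "s \<in> verts G" for s by (rule connected_const[OF conn _ that uw(1)])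
    then have "f ` verts G \<subseteq> {f ?u}" by blast
    then have "card (f ` verts G) \<le> card {f ?u}" by (intro card_mono) auto
    then show False using f2 by simp
  qed
  \<comment> \<open>Deleting an end of \<open>a\<close> deletes \<open>a\<close> as well, so
    2-connectedness makes \<open>f\<close> constant on the remaining vertices. Applied to both ends,
    this gives a third vertex the value of either end.\<close>
  have del: "f s = f t" if "z \<in> {?u, ?w}" "s \<in> verts G - {z}" "t \<in> verts G - {z}" for s t z
  proof -
    have "Digraph_Component.connected (G \<restriction> (verts G - {z}))" using two that uw unfolding two_connected_def by auto
    moreover have "f (tail G c) = f (head G c)" if "c \<in> arcs G" "tail G c \<noteq> z" "head G c \<noteq> z" for c
      using fall[of c] that \<open>z \<in> {?u, ?w}\<close> rv_facts aa by auto
    ultimately show ?thesis using connected_const[of "G \<restriction> (verts G - {z})" f s t] that by auto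
  qed
  have "\<not> verts G \<subseteq> {?u, ?w}"
  proof
    assume "verts G \<subseteq> {?u, ?w}"
    then have "card (verts G) \<le> card {?u, ?w}" by (intro card_mono) auto
    then show False using n_ge3 uw by simp
  qed
  then obtain z where z: "z \<in> verts G" "z \<noteq> ?u" "z \<noteq> ?w" by blast
  have "f z = f ?w" "f z = f ?u" using del[of ?u z ?w] del[of ?w z ?u] z uw by auto
  then show False using ne by simp
qed

lemma n_ge: "m + 2 \<le> card (verts G)"
proof -
  have "4 * m + 2 \<le> card (arcs G)" using card_arcs outer_count by simp
  then show ?thesis using euler card_faces by simp
qed


primrec Jx :: "nat \<Rightarrow> nat" where
  "Jx 0 = 0" | "Jx (Suc t) = (if fan t then Jx t else Suc (Jx t))"
primrec Ix :: "nat \<Rightarrow> nat" where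
  "Ix 0 = 0" | "Ix (Suc t) = (if fan t then Suc (Ix t) else Ix t)"

text \<open>The least index is an arbitrary choice: all rungs with the same coordinate share the
  respective end, by \<open>tail_const\<close> and \<open>head_const\<close>.\<close>

definition pp :: "nat \<Rightarrow> 'v" where "pp j = tail G (b (LEAST t. Jx t = j))"
definition rr :: "nat \<Rightarrow> 'v" where "rr i = head G (b (LEAST t. Ix t = i))"

lemma ends_step:
  assumes t: "t < m"
  shows "fan t \<Longrightarrow> tail G (b (Suc t)) = tail G (b t) \<and> head G (b (Suc t)) = head G (y t) \<and> tail G (y t) = head G (b t)"
    "\<not> fan t \<Longrightarrow> head G (b (Suc t)) = head G (b t) \<and> tail G (b (Suc t)) = tail G (y t) \<and> head G (y t) = tail G (b t)"
proof -
  have B: "b t \<in> arcs G" "b (Suc t) \<in> arcs G" using b_arc t by auto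
  then have B2: "ph (b t) \<in> arcs G" "ph (ph (b t)) \<in> arcs G" using ph_arc by auto
  have hh: "tail G (ph (b t)) = head G (b t)" "tail G (ph (ph (b t))) = head G (ph (b t))" "head G (ph (ph (b t))) = tail G (b t)"
    using tail_ph[OF B(1)] tail_ph[OF B2(1)] tail_ph[OF B2(2)] tri_t(2)[OF t] by simp_all
  have e: "tail G (b (Suc t)) = head G (rv (b (Suc t)))" "head G (b (Suc t)) = tail G (rv (b (Suc t)))"
    using rv_facts B by auto
  show "fan t \<Longrightarrow> tail G (b (Suc t)) = tail G (b t) \<and> head G (b (Suc t)) = head G (y t) \<and> tail G (y t) = head G (b t)"
    using e hh unfolding fan_def y_def by simp
  assume "\<not> fan t"
  then have "rv (b (Suc t)) = ph (b t)" "y t = ph (ph (b t))" using b_step[OF t] unfolding fan_def y_def by auto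
  then show "head G (b (Suc t)) = head G (b t) \<and> tail G (b (Suc t)) = tail G (y t) \<and> head G (y t) = tail G (b t)"
    using e hh by simp
qed

lemma Jx_mono: "s \<le> t \<Longrightarrow> Jx s \<le> Jx t \<and> Ix s \<le> Ix t"
  by (induction t) (auto simp: le_Suc_eq)

lemma tail_const: "s \<le> t \<Longrightarrow> t \<le> m \<Longrightarrow> Jx s = Jx t \<Longrightarrow> tail G (b s) = tail G (b t)"
proof (induction t)
  case (Suc t)
  show ?case
  proof (cases "s = Suc t")
    case False
    then have "s \<le> t" "t < m" using Suc by auto
    moreover have "fan t" "Jx s = Jx t" using Jx_mono[OF \<open>s \<le> t\<close>] Suc.prems(3) by (auto split: if_splits)
    ultimately show ?thesis using Suc.IH ends_step(1)[of t] by simp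
  qed simp
qed simp

lemma head_const: "s \<le> t \<Longrightarrow> t \<le> m \<Longrightarrow> Ix s = Ix t \<Longrightarrow> head G (b s) = head G (b t)"
proof (induction t)
  case (Suc t)
  show ?case
  proof (cases "s = Suc t")
    case False
    then have "s \<le> t" "t < m" using Suc by auto
    moreover have "\<not> fan t" "Ix s = Ix t" using Jx_mono[OF \<open>s \<le> t\<close>] Suc.prems(3) by (auto split: if_splits)
    ultimately show ?thesis using Suc.IH ends_step(2)[of t] by simp
  qed simp
qed simp

lemma b_tail: "t \<le> m \<Longrightarrow> tail G (b t) = pp (Jx t)"
  unfolding pp_def by (rule tail_const[symmetric]) (auto intro: Least_le LeastI)
lemma b_head: "t \<le> m \<Longrightarrow> head G (b t) = rr (Ix t)"
  unfolding rr_def by (rule head_const[symmetric]) (auto intro: Least_le LeastI)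

lemma y_ends:
  assumes "t < m"
  shows "fan t \<Longrightarrow> tail G (y t) = rr (Ix t) \<and> head G (y t) = rr (Suc (Ix t))"
    "\<not> fan t \<Longrightarrow> tail G (y t) = pp (Suc (Jx t)) \<and> head G (y t) = pp (Jx t)"
  using ends_step[OF assms] b_tail[of t] b_tail[of "Suc t"] b_head[of t] b_head[of "Suc t"] assms by auto

lemma sum_m: "Jx t + Ix t = t" by (induction t) auto

lemma fan_first: "fan 0" using b_first unfolding fan_def by simp
lemma fan_last: "fan (m - 1)" using b_last m_pos unfolding fan_def by simp

lemma arc_list: assumes "a \<in> arcs G"
  obtains t where "t \<le> m" "a = b t \<or> a = rv (b t)" | t where "t < m" "a = y t \<or> a = rv (y t)"
proof -
  have *: "(\<exists>t\<le>m. a = b t \<or> a = rv (b t)) \<or> (\<exists>t<m. a = y t \<or> a = rv (y t))" if tc: "t < m" "c \<in> vs ! t" "a = c \<or> a = rv c" for t c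
  proof -
    consider "c = b t" | "c = y t" | "c = rv (b (Suc t))" using tc(2) unfolding face_parts(1)[OF tc(1)] by blast
    then show ?thesis
    proof cases
      case 1 then show ?thesis using tc by (intro disjI1 exI[of _ t]) auto
    next
      case 2 then show ?thesis using tc by (intro disjI2 exI[of _ t]) auto
    next
      case 3 then show ?thesis using tc rv_facts(1) by (intro disjI1 exI[of _ "Suc t"]) auto
    qed
  qed
  have "\<not> (a \<in> outer_face M \<and> rv a \<in> outer_face M)" using no_bridges unfolding bridges_def by blast
  then obtain t where "t < m" "a \<in> vs ! t \<or> rv a \<in> vs ! t"
    using arc_cases[OF assms] arc_cases[OF rv_facts(2)[OF assms]] by blast
  then have "(\<exists>t\<le>m. a = b t \<or> a = rv (b t)) \<or> (\<exists>t<m. a = y t \<or> a = rv (y t))" using *[of t a] *[of t "rv a"] rv_facts(1) by auto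
  then show thesis using that by blast
qed

lemma hits: "j \<le> Jx t \<Longrightarrow> \<exists>s\<le>t. Jx s = j" "i \<le> Ix t \<Longrightarrow> \<exists>s\<le>t. Ix s = i"
proof (induction t)
  case (Suc t)
  { case 1 then show ?case using Suc(1) by (cases "j = Jx (Suc t)") (auto split: if_splits intro: le_SucI) }
  { case 2 then show ?case using Suc(2) by (cases "i = Ix (Suc t)") (auto split: if_splits intro: le_SucI) }
qed auto

lemma turns: "j < Jx t \<Longrightarrow> \<exists>s<t. Jx s = j \<and> \<not> fan s" "i < Ix t \<Longrightarrow> \<exists>s<t. Ix s = i \<and> fan s"
proof (induction t)
  case (Suc t)
  { case 1 then show ?case using Suc(1) by (cases "j < Jx t") (auto split: if_splits intro: less_SucI) }
  { case 2 then show ?case using Suc(2) by (cases "i < Ix t") (auto split: if_splits intro: less_SucI) }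
qed auto

lemma verts_sub: "verts G = pp ` {..<Suc (Jx m)} \<union> rr ` {..Ix m}"
proof
  have J: "t \<le> m \<Longrightarrow> Jx t < Suc (Jx m)" "t \<le> m \<Longrightarrow> Ix t \<le> Ix m" for t using Jx_mono[of t m] by auto
  have bV: "t \<le> m \<Longrightarrow> pp (Jx t) \<in> verts G \<and> rr (Ix t) \<in> verts G" for t
    using ends_in[OF b_arc] b_tail b_head by metis
  show "verts G \<subseteq> pp ` {..<Suc (Jx m)} \<union> rr ` {..Ix m}"
  proof
    fix v assume "v \<in> verts G"
    then obtain a where a: "a \<in> arcs G" "tail G a = v" using vertex_has_arc n_ge3 by fastforce
    from a(1) show "v \<in> pp ` {..<Suc (Jx m)} \<union> rr ` {..Ix m}"
    proof (cases rule: arc_list)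
      case (1 t)
      then have "v = pp (Jx t) \<or> v = rr (Ix t)" using a b_tail b_head rv_facts(3)[OF b_arc] by auto
      then show ?thesis using J[OF 1(1)] by auto
    next
      case (2 t)
      then have "v = tail G (y t) \<or> v = head G (y t)" using a rv_facts(3)[OF y_arc] by auto
      moreover have "fan t \<Longrightarrow> Suc (Ix t) \<le> Ix m" "\<not> fan t \<Longrightarrow> Suc (Jx t) < Suc (Jx m)" "Ix t \<le> Ix m" "Jx t < Suc (Jx m)"
        using J[of "Suc t"] J[of t] 2 by auto
      ultimately show ?thesis using y_ends[OF 2(1)] by (cases "fan t") auto
    qed
  qed
  show "pp ` {..<Suc (Jx m)} \<union> rr ` {..Ix m} \<subseteq> verts G"
  proof
    fix v assume "v \<in> pp ` {..<Suc (Jx m)} \<union> rr ` {..Ix m}"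
    then consider j where "j \<le> Jx m" "v = pp j" | i where "i \<le> Ix m" "v = rr i" by (auto simp: less_Suc_eq_le)
    then show "v \<in> verts G"
    proof cases
      case 1 then show ?thesis using hits(1)[of j m] bV by auto
    next
      case 2 then show ?thesis using hits(2)[of i m] bV by auto
    qed
  qed
qed

text \<open>At most \<open>m + 2\<close> vertices have been named, and by Euler's formula there are
  at least \<open>m + 2\<close>; so no two names coincide. Distinctness thus follows by counting
  rather than from the shape of the drawing.\<close>

lemma verts_inj: "inj_on pp {..<Suc (Jx m)}" "inj_on rr {..Ix m}" "pp ` {..<Suc (Jx m)} \<inter> rr ` {..Ix m} = {}"
proof -
  let ?P = "pp ` {..<Suc (Jx m)}" and ?R = "rr ` {..Ix m}"
  have "card ?P + card ?R = card (verts G) + card (?P \<inter> ?R)" unfolding verts_sub by (rule card_Un_Int) auto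
  moreover have "card ?P \<le> Suc (Jx m)" "card ?R \<le> Suc (Ix m)"
    using card_image_le[of "{..<Suc (Jx m)}" pp] card_image_le[of "{..Ix m}" rr] by auto
  ultimately have *: "card ?P = Suc (Jx m)" "card ?R = Suc (Ix m)" "card (?P \<inter> ?R) = 0" using n_ge sum_m[of m] by linarith+
  then show "inj_on pp {..<Suc (Jx m)}" "inj_on rr {..Ix m}" by (auto intro: eq_card_imp_inj_on)
  show "?P \<inter> ?R = {}" using *(3) by (simp add: card_eq_0_iff)
qed


lemma tail_vs:
  assumes t: "t < m"
  shows "tail G ` (vs ! t) = {pp (Jx t), rr (Ix t), pp (Jx (Suc t)), rr (Ix (Suc t))}"
proof -
  have e: "tail G (b t) = pp (Jx t)" "tail G (rv (b (Suc t))) = rr (Ix (Suc t))"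
    using b_tail b_head[of "Suc t"] rv_facts(3)[OF b_arc[of "Suc t"]] t by auto
  show ?thesis unfolding face_parts(1)[OF t] image_insert e using y_ends[OF t] by (cases "fan t") auto
qed

text \<open>In a graph without multiple edges, an edge between two vertices of a triangle is a side
  of this triangle.\<close>

lemma in_vs_iff:
  assumes t: "t < m" and a: "a \<in> arcs G"
  shows "a \<in> vs ! t \<or> rv a \<in> vs ! t \<longleftrightarrow> tail G a \<in> tail G ` (vs ! t) \<and> head G a \<in> tail G ` (vs ! t)"
proof
  have hd: "head G c \<in> tail G ` (vs ! t)" if "c \<in> vs ! t" for c
  proof -
    have "ph c \<in> vs ! t" using face_fc[OF vs_face(1)[OF t] that] ph_in_fc that by simp
    then show ?thesis using tail_ph[OF vs_arc[OF t that]] by (metis imageI)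
  qed
  { assume "a \<in> vs ! t \<or> rv a \<in> vs ! t"
    then show "tail G a \<in> tail G ` (vs ! t) \<and> head G a \<in> tail G ` (vs ! t)"
    proof
      assume "a \<in> vs ! t" then show ?thesis using hd by blast
    next
      assume r: "rv a \<in> vs ! t"
      then have "tail G (rv a) \<in> tail G ` (vs ! t)" by blast
      then show ?thesis using hd[OF r] rv_facts(3,4)[OF a] by simp
    qed }
  assume ends: "tail G a \<in> tail G ` (vs ! t) \<and> head G a \<in> tail G ` (vs ! t)"
  let ?c = "b t" and ?d = "ph (b t)" and ?e = "ph (ph (b t))"
  have arc: "?c \<in> arcs G" "?d \<in> arcs G" "?e \<in> arcs G" using b_arc[of t] t ph_arc by auto
  have hds: "head G ?c = tail G ?d" "head G ?d = tail G ?e" "head G ?e = tail G ?c"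
    using tail_ph[OF arc(1)] tail_ph[OF arc(2)] tail_ph[OF arc(3)] tri_t(2)[OF t] by auto
  have vt: "vs ! t = {?c, ?d, ?e}" using tri_t(1)[OF t] .
  have mem: "?c \<in> vs ! t" "?d \<in> vs ! t" "?e \<in> vs ! t" unfolding vt by auto
  have *: "a \<in> vs ! t \<or> rv a \<in> vs ! t" 
    if "c \<in> vs ! t" "tail G a = tail G c \<and> head G a = head G c \<or> tail G a = head G c \<and> head G a = tail G c" for c
  proof -
    have c: "c \<in> arcs G" using vs_arc[OF t that(1)] .
    from that(2) have "a = c \<or> rv a = c"
      using arc_eqI[OF a c] arc_eqI[OF rv_facts(2)[OF a] c] rv_facts(3,4)[OF a] by auto
    then show ?thesis using that(1) by auto
  qed
  have "tail G a \<noteq> head G a" using no_loop[OF a] .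
  moreover have "tail G ` (vs ! t) = {tail G ?c, tail G ?d, tail G ?e}" unfolding vt by simp
  moreover have "tail G a \<in> {A, B, C} \<Longrightarrow> head G a \<in> {A, B, C} \<Longrightarrow> tail G a \<noteq> head G a \<Longrightarrow>
     (tail G a = A \<and> head G a = B \<or> tail G a = B \<and> head G a = A) \<or> (tail G a = B \<and> head G a = C \<or> tail G a = C \<and> head G a = B)
     \<or> (tail G a = C \<and> head G a = A \<or> tail G a = A \<and> head G a = C)" for A B C by auto
  ultimately consider "tail G a = tail G ?c \<and> head G a = tail G ?d \<or> tail G a = tail G ?d \<and> head G a = tail G ?c"
    | "tail G a = tail G ?d \<and> head G a = tail G ?e \<or> tail G a = tail G ?e \<and> head G a = tail G ?d"
    | "tail G a = tail G ?e \<and> head G a = tail G ?c \<or> tail G a = tail G ?c \<and> head G a = tail G ?e"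
    using ends by metis
  then show "a \<in> vs ! t \<or> rv a \<in> vs ! t"
  proof cases
    case 1 then show ?thesis using *[OF mem(1)] hds by auto
  next
    case 2 then show ?thesis using *[OF mem(2)] hds by auto
  next
    case 3 then show ?thesis using *[OF mem(3)] hds by auto
  qed
qed

lemma outer_cases:
  assumes "a \<in> outer_face M"
  obtains "a = rv (b 0)" | "a = b m" | t where "t < m" "a = rv (y t)"
proof -
  have "rv a \<notin> outer_face M" using no_bridges assms unfolding bridges_def by blast
  then obtain t where t: "t < m" "rv a \<in> vs ! t" using arc_cases[OF rv_facts(2)[OF outer_arc[OF assms]]] by blast
  then consider "rv a = b t" | "rv a = y t" | "rv a = rv (b (Suc t))" using face_parts(1)[of t] by auto
  then show thesis
  proof cases
    case 1
    then have a: "a = rv (b t)" using rv_facts(1) by metis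
    have "t = 0"
    proof (rule ccontr)
      assume "t \<noteq> 0"
      then have "a \<in> vs ! (t - 1)" "t - 1 < m" using b_prev[of t] t(1) a by auto
      then show False using assms vs_outer by blast
    qed
    then show thesis using that(1) a by simp
  next
    case 2
    then have "a = rv (y t)" using rv_facts(1) by metis
    then show thesis using that(3) t by blast
  next
    case 3
    then have a: "a = b (Suc t)" using rv_facts(5) by blast
    then have "\<not> Suc t < m" using b_in[of "Suc t"] vs_outer assms by blast
    then have "Suc t = m" using t by simp
    then show thesis using that(2) a by simp
  qed
qed

lemma is_staircase: "staircase M (Suc (Jx m)) (Ix m) Jx Ix pp rr ((!) vs)"
proof -
  have mm: "Suc (Jx m) + Ix m - 1 = m" using sum_m[of m] by simp
  obtain k where k: "m = Suc k" using m_pos gr0_conv_Suc by auto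
  have fk: "fan k" using fan_last k by simp
  have G: "underlying M = G" "edge_rev M = rv" unfolding G_def rv_def by simp_all
  have le: "t \<le> m \<Longrightarrow> Jx t \<le> Jx m \<and> Ix t \<le> Ix m" for t using Jx_mono by blast
  have bends: "{tail G (b t), head G (b t)} = {pp (Jx t), rr (Ix t)}" if "t \<le> m" for t using b_tail b_head that by simp
  have rvends: "{tail G (rv a), head G (rv a)} = {tail G a, head G a}" if "a \<in> arcs G" for a using rv_facts that by auto
  have yends: "fan t \<Longrightarrow> {tail G (y t), head G (y t)} = {rr (Ix t), rr (Suc (Ix t))} \<and> Ix t < Ix m"
    "\<not> fan t \<Longrightarrow> {tail G (y t), head G (y t)} = {pp (Jx t), pp (Suc (Jx t))} \<and> Suc (Jx t) < Suc (Jx m)" if "t < m" for t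
    using y_ends[OF that] le[of "Suc t"] that by auto
  show ?thesis
    unfolding staircase_def mm G
  proof (intro conjI allI impI)
    show "0 < Suc (Jx m)" by simp
    show "0 < Ix m" using fk k by simp
    show "Jx 0 = 0" "Ix 0 = 0" "Ix 1 = 1" using fan_first by simp_all
    show "Jx (Suc t) = Jx t \<and> Ix (Suc t) = Suc (Ix t) \<or> Jx (Suc t) = Suc (Jx t) \<and> Ix (Suc t) = Ix t" for t by simp
    show "Jx m = Suc (Jx m) - 1" "Ix m = Ix m" by simp_all
    show "Ix (m - 1) = Ix m - 1" using fk k by simp
    show "verts G = pp ` {..<Suc (Jx m)} \<union> rr ` {..Ix m}" by (rule verts_sub)
    show "inj_on pp {..<Suc (Jx m)}" "inj_on rr {..Ix m}" by (rule verts_inj)+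
    show "pp j \<noteq> rr i" if "j < Suc (Jx m)" "i \<le> Ix m" for j i using verts_inj(3) that by blast
    show "fin_digraph G" "bidirected_digraph G rv" "nomulti_digraph G" using fin bidir nomulti by auto
    show "(\<exists>t\<le>m. {tail G a, head G a} = {pp (Jx t), rr (Ix t)}) \<or>
         (\<exists>j. Suc j < Suc (Jx m) \<and> {tail G a, head G a} = {pp j, pp (Suc j)}) \<or>
         (\<exists>i<Ix m. {tail G a, head G a} = {rr i, rr (Suc i)})" if a: "a \<in> arcs G" for a
      using a
    proof (cases rule: arc_list)
      case (1 t)
      then have "{tail G a, head G a} = {pp (Jx t), rr (Ix t)}" using bends rvends[OF b_arc] by auto
      then show ?thesis using 1(1) by blast
    next
      case (2 t)
      then have e: "{tail G a, head G a} = {tail G (y t), head G (y t)}" using rvends[OF y_arc] by auto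
      show ?thesis
      proof (cases "fan t")
        case True
        note f = yends(1)[OF 2(1) True]
        show ?thesis unfolding e by (intro disjI2 exI[of _ "Ix t"]) (use f in simp)
      next
        case False
        note f = yends(2)[OF 2(1) False]
        show ?thesis unfolding e by (intro disjI2 disjI1 exI[of _ "Jx t"]) (use f in simp)
      qed
    qed
    show "\<exists>a\<in>arcs G. tail G a = pp (Jx t) \<and> head G a = rr (Ix t)" if "t \<le> m" for t
      using b_arc[OF that] b_tail[OF that] b_head[OF that] by (intro bexI[of _ "b t"]) simp_all
    show "\<exists>a\<in>arcs G. tail G a = pp j \<and> head G a = pp (Suc j)" if j: "Suc j < Suc (Jx m)" for j
    proof -
      obtain t where "t < m" "Jx t = j" "\<not> fan t" using turns(1)[of j m] j by auto
      then show ?thesis using y_ends(2)[of t] y_arc[of t] rv_facts(2,3,4)[of "y t"] by (intro bexI[of _ "rv (y t)"]) auto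
    qed
    show "\<exists>a\<in>arcs G. tail G a = rr (Suc i) \<and> head G a = rr i" if i: "i < Ix m" for i
    proof -
      obtain t where "t < m" "Ix t = i" "fan t" using turns(2)[of i m] i by auto
      then show ?thesis using y_ends(1)[of t] y_arc[of t] rv_facts(2,3,4)[of "y t"] by (intro bexI[of _ "rv (y t)"]) auto
    qed
    show "faces M = insert (outer_face M) ((!) vs ` {..<m})"
      using face_cases vs_face(1) outer_in by auto
    show "vs ! t \<noteq> outer_face M" if "t < m" for t using vs_face(2)[OF that] .
    show "vs ! t \<subseteq> arcs G" if "t < m" for t using vs_arc[OF that] by blast
    show "tail G ` (vs ! t) = {pp (Jx t), rr (Ix t), pp (Jx (Suc t)), rr (Ix (Suc t))}" if "t < m" for t
      using tail_vs[OF that] .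
    show "(a \<in> vs ! t \<or> rv a \<in> vs ! t) = (tail G a \<in> {pp (Jx t), rr (Ix t), pp (Jx (Suc t)), rr (Ix (Suc t))} \<and>
         head G a \<in> {pp (Jx t), rr (Ix t), pp (Jx (Suc t)), rr (Ix (Suc t))})" if "t < m" "a \<in> arcs G" for t a
      using in_vs_iff[OF that] unfolding tail_vs[OF that(1)] .
    show "outer_face M \<subseteq> arcs G" using outer_arc by blast
    show oe: "tail G a = rr 0 \<and> head G a = pp 0 \<or> (\<exists>j. Suc j < Suc (Jx m) \<and> tail G a = pp j \<and> head G a = pp (Suc j)) \<or>
         tail G a = pp (Suc (Jx m) - 1) \<and> head G a = rr (Ix m) \<or> (\<exists>i<Ix m. tail G a = rr (Suc i) \<and> head G a = rr i)"
      if a: "a \<in> outer_face M" for a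
      using a
    proof (cases rule: outer_cases)
      case 1
      then show ?thesis using b_tail[of 0] b_head[of 0] rv_facts(3,4)[OF b_arc[of 0]] by simp
    next
      case 2
      then show ?thesis using b_tail[of m] b_head[of m] by simp
    next
      case (3 t)
      then show ?thesis using y_ends[OF 3(1)] rv_facts(3,4)[OF y_arc[OF 3(1)]] yends[OF 3(1)] by (cases "fan t") auto
    qed
    show "tail G ` outer_face M = verts G"
    proof
      show "tail G ` outer_face M \<subseteq> verts G" using outer_arc ends_in by blast
      show "verts G \<subseteq> tail G ` outer_face M"
      proof
        fix v assume "v \<in> verts G"
        then consider j where "j < Jx m" "v = pp j" | "v = pp (Jx m)" | i where "i < Ix m" "v = rr (Suc i)" | "v = rr 0"
          unfolding verts_sub by (auto simp: less_Suc_eq) (metis less_eq_Suc_le not0_implies_Suc)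
        then show "v \<in> tail G ` outer_face M"
        proof cases
          case 1
          then obtain t where "t < m" "Jx t = j" "\<not> fan t" using turns(1) by blast
          then show ?thesis using y_ends(2)[of t] y_outer[of t] rv_facts(3)[OF y_arc[of t]] 1
            by (intro image_eqI[of _ _ "rv (y t)"]) auto
        next
          case 2 then show ?thesis using b_tail[of m] bm_outer by (intro image_eqI[of _ _ "b m"]) auto
        next
          case 3
          then obtain t where "t < m" "Ix t = i" "fan t" using turns(2) by blast
          then show ?thesis using y_ends(1)[of t] y_outer[of t] rv_facts(3)[OF y_arc[of t]] 3
            by (intro image_eqI[of _ _ "rv (y t)"]) auto
        next
          case 4 then show ?thesis using b_head[of 0] b0_outer rv_facts(3)[OF b_arc[of 0]] by (intro image_eqI[of _ _ "rv (b 0)"]) auto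
        qed
      qed
    qed
    show "(a \<in> outer_face M \<or> rv a \<in> outer_face M) = (\<not> (\<exists>t. 0 < t \<and> t < m \<and> {tail G a, head G a} = {pp (Jx t), rr (Ix t)}))"
      if a: "a \<in> arcs G" for a
    proof
      assume o: "a \<in> outer_face M \<or> rv a \<in> outer_face M"
      show "\<not> (\<exists>t. 0 < t \<and> t < m \<and> {tail G a, head G a} = {pp (Jx t), rr (Ix t)})"
      proof
        assume "\<exists>t. 0 < t \<and> t < m \<and> {tail G a, head G a} = {pp (Jx t), rr (Ix t)}"
        then obtain t where t: "0 < t" "t < m" "{tail G a, head G a} = {tail G (b t), head G (b t)}" using bends by auto
        have B: "b t \<in> arcs G" using b_arc t by simp
        have "a = b t \<or> a = rv (b t)"
          using t(3) arc_eqI[OF a B] arc_eqI[OF a rv_facts(2)[OF B]] rv_facts(3,4)[OF B] by (auto simp: doubleton_eq_iff)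
        then have "a \<in> vs ! t \<and> rv a \<in> vs ! (t - 1) \<or> a \<in> vs ! (t - 1) \<and> rv a \<in> vs ! t" using b_in b_prev t rv_facts(1) by auto
        then show False using o vs_outer[of t] vs_outer[of "t - 1"] t by auto
      qed
    next
      assume n: "\<not> (\<exists>t. 0 < t \<and> t < m \<and> {tail G a, head G a} = {pp (Jx t), rr (Ix t)})"
      from a show "a \<in> outer_face M \<or> rv a \<in> outer_face M"
      proof (cases rule: arc_list)
        case (1 t)
        then have "{tail G a, head G a} = {pp (Jx t), rr (Ix t)}" using bends rvends[OF b_arc] by auto
        then have "\<not> (0 < t \<and> t < m)" using n by blast
        then have "t = 0 \<or> t = m" using 1(1) by linarith
        then show ?thesis using 1(2) b0_outer bm_outer rv_facts(1) by auto
      next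
        case (2 t)
        then show ?thesis using y_outer[OF 2(1)] rv_facts(1) by auto
      qed
    qed
  qed
qed

lemma rr_0: "rr 0 = head G b0" using b_head[of 0] by (simp add: b.simps)
end

section \<open>Programs\<close>

fun block :: "com list \<Rightarrow> com" where
  "block [] = Skip"
| "block (c # cs) = Seq c (block cs)"

text \<open>Loops are not admissible, so the values of \<open>eff\<close> and \<open>cost\<close> on them are irrelevant.\<close>

fun eff :: "com \<Rightarrow> state \<Rightarrow> state" where
  "eff Skip s = s"
| "eff (Assign i e) s = s\<lparr>regs := (regs s)(i := val e s)\<rparr>"
| "eff (Write A i j) s = s\<lparr>mem := (mem s)(A := (mem s A)(regs s i := regs s j))\<rparr>"
| "eff (Seq c1 c2) s = eff c2 (eff c1 s)"
| "eff (Cond b c1 c2) s = (if holds b s then eff c1 s else eff c2 s)"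
| "eff (While b c) s = s"

fun adm :: "nat \<Rightarrow> com \<Rightarrow> state \<Rightarrow> bool" where
  "adm W Skip s \<longleftrightarrow> True"
| "adm W (Assign i e) s \<longleftrightarrow> val e s < W"
| "adm W (Write A i j) s \<longleftrightarrow> True"
| "adm W (Seq c1 c2) s \<longleftrightarrow> adm W c1 s \<and> adm W c2 (eff c1 s)"
| "adm W (Cond b c1 c2) s \<longleftrightarrow> (if holds b s then adm W c1 s else adm W c2 s)"
| "adm W (While b c) s \<longleftrightarrow> False"

fun cost :: "com \<Rightarrow> nat" where
  "cost Skip = 0"
| "cost (Assign i e) = 1"
| "cost (Write A i j) = 1"
| "cost (Seq c1 c2) = cost c1 + cost c2"
| "cost (Cond b c1 c2) = 1 + cost c1 + cost c2"
| "cost (While b c) = 0"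

fun mod_regs :: "com \<Rightarrow> nat set" where
  "mod_regs Skip = {}"
| "mod_regs (Assign i e) = {i}"
| "mod_regs (Write A i j) = {}"
| "mod_regs (Seq c1 c2) = mod_regs c1 \<union> mod_regs c2"
| "mod_regs (Cond b c1 c2) = mod_regs c1 \<union> mod_regs c2"
| "mod_regs (While b c) = mod_regs c"

fun mod_mem :: "com \<Rightarrow> nat set" where
  "mod_mem Skip = {}"
| "mod_mem (Assign i e) = {}"
| "mod_mem (Write A i j) = {A}"
| "mod_mem (Seq c1 c2) = mod_mem c1 \<union> mod_mem c2"
| "mod_mem (Cond b c1 c2) = mod_mem c1 \<union> mod_mem c2"
| "mod_mem (While b c) = mod_mem c"

definition agree :: "com \<Rightarrow> state \<Rightarrow> state \<Rightarrow> bool" where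
  "agree c s s' \<longleftrightarrow> (\<forall>i. i \<notin> mod_regs c \<longrightarrow> regs s' i = regs s i) \<and> (\<forall>A. A \<notin> mod_mem c \<longrightarrow> mem s' A = mem s A)"

lemma agreeD: "agree c s s' \<Longrightarrow> i \<notin> mod_regs c \<Longrightarrow> regs s' i = regs s i"
  "agree c s s' \<Longrightarrow> A \<notin> mod_mem c \<Longrightarrow> mem s' A = mem s A"
  unfolding agree_def by auto

lemma exec_agree: "exec W c s t s' \<Longrightarrow> agree c s s'"
  by (induction rule: exec.induct) (auto simp: agree_def)

lemma exec_eff: "adm W c s \<Longrightarrow> \<exists>t\<le>cost c. exec W c s t (eff c s)"
proof (induction c arbitrary: s)
  case Skip then show ?case using exec.skip by fastforce
next
  case (Assign i e) then show ?case using exec.assign by fastforce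
next
  case (Write A i j) then show ?case using exec.store by fastforce
next
  case (Seq c1 c2)
  then obtain t1 t2 where "t1 \<le> cost c1" "exec W c1 s t1 (eff c1 s)" "t2 \<le> cost c2" "exec W c2 (eff c1 s) t2 (eff c2 (eff c1 s))"
    by (metis adm.simps(4))
  then show ?case using exec.seq by (intro exI[of _ "t1 + t2"]) auto
next
  case (Cond b c1 c2)
  show ?case
  proof (cases "holds b s")
    case True
    then obtain t where "t \<le> cost c1" "exec W c1 s t (eff c1 s)" using Cond by auto
    then show ?thesis using True exec.cond_true[of b s W c1 t "eff c1 s" c2] by (intro exI[of _ "1 + t"]) auto
  next
    case False
    then obtain t where "t \<le> cost c2" "exec W c2 s t (eff c2 s)" using Cond by auto
    then show ?thesis using False exec.cond_false[of b s W c2 t "eff c2 s" c1] by (intro exI[of _ "1 + t"]) auto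
  qed
next
  case (While b c) then show ?case by simp
qed

text \<open>Total correctness with a time bound. The frame condition \<open>agree\<close> comes from
  the syntactic sets of written registers and arrays, so that postconditions only have to describe
  what a program changes.\<close>

definition runs :: "nat \<Rightarrow> com \<Rightarrow> state \<Rightarrow> nat \<Rightarrow> (state \<Rightarrow> bool) \<Rightarrow> bool" where
  "runs W c s T Q \<longleftrightarrow> (\<exists>t s'. exec W c s t s' \<and> t \<le> T \<and> agree c s s' \<and> Q s')"

lemma runs_eff: "adm W c s \<Longrightarrow> cost c \<le> T \<Longrightarrow> Q (eff c s) \<Longrightarrow> runs W c s T Q"
  unfolding runs_def using exec_eff exec_agree by (meson le_trans)

lemma runs_mono: "runs W c s T Q \<Longrightarrow> T \<le> T' \<Longrightarrow> (\<And>s'. agree c s s' \<Longrightarrow> Q s' \<Longrightarrow> Q' s') \<Longrightarrow> runs W c s T' Q'"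
  unfolding runs_def by (meson le_trans)

lemma runs_Seq:
  assumes "runs W c1 s Ta Q" "\<And>s'. agree c1 s s' \<Longrightarrow> Q s' \<Longrightarrow> runs W c2 s' Tb R" "Ta + Tb \<le> T"
  shows "runs W (Seq c1 c2) s T R"
proof -
  obtain t1 s1 where 1: "exec W c1 s t1 s1" "t1 \<le> Ta" "agree c1 s s1" "Q s1" using assms(1) unfolding runs_def by blast
  obtain t2 s2 where 2: "exec W c2 s1 t2 s2" "t2 \<le> Tb" "R s2" using assms(2)[OF 1(3,4)] unfolding runs_def by blast
  show ?thesis unfolding runs_def using exec.seq[OF 1(1) 2(1)] exec_agree[OF exec.seq[OF 1(1) 2(1)]] 1(2) 2(2,3) assms(3)
    by (intro exI[of _ "t1 + t2"] exI[of _ s2]) auto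
qed

lemma runs_Cond:
  assumes "holds b s \<Longrightarrow> runs W c1 s T Q" "\<not> holds b s \<Longrightarrow> runs W c2 s T Q" "Suc T \<le> T'"
  shows "runs W (Cond b c1 c2) s T' Q"
proof (cases "holds b s")
  case True
  then obtain t s' where "exec W c1 s t s'" "t \<le> T" "Q s'" using assms(1) unfolding runs_def by blast
  then show ?thesis unfolding runs_def using exec.cond_true[OF True] exec_agree[OF exec.cond_true[OF True]] assms(3)
    by (intro exI[of _ "1 + t"] exI[of _ s']) auto
next
  case False
  then obtain t s' where "exec W c2 s t s'" "t \<le> T" "Q s'" using assms(2) unfolding runs_def by blast
  then show ?thesis unfolding runs_def using exec.cond_false[OF False] exec_agree[OF exec.cond_false[OF False]] assms(3)
    by (intro exI[of _ "1 + t"] exI[of _ s']) auto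
qed

lemma agree_trans: "agree c s s' \<Longrightarrow> agree c s' s'' \<Longrightarrow> agree c s s''" unfolding agree_def by auto
lemma agree_refl: "agree c s s" unfolding agree_def by auto
lemma agree_While: "agree (While b c) s s' \<longleftrightarrow> agree c s s'" unfolding agree_def by simp

text \<open>The measure \<open>\<mu>\<close> bounds the number of iterations. Since the body may
  assume \<open>agree\<close> with the state before the loop, facts about registers that the loop
  never writes are available without being part of \<open>Inv\<close>.\<close>

lemma runs_While:
  assumes "Inv s" and "\<mu> s \<le> n"
    and step: "\<And>s'. agree c s s' \<Longrightarrow> Inv s' \<Longrightarrow> holds b s' \<Longrightarrow> runs W c s' T (\<lambda>s''. Inv s'' \<and> \<mu> s'' < \<mu> s')"
    and T: "Suc (n * Suc T) \<le> T'"
  shows "runs W (While b c) s T' (\<lambda>s'. Inv s' \<and> \<not> holds b s')"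
proof -
  have "\<exists>t u. exec W (While b c) s' t u \<and> t \<le> Suc (k * Suc T) \<and> Inv u \<and> \<not> holds b u"
    if "agree c s s'" "Inv s'" "\<mu> s' \<le> k" for k s'
    using that
  proof (induction k arbitrary: s')
    case 0
    have "\<not> holds b s'"
    proof
      assume "holds b s'"
      from step[OF 0(1,2) this] show False using 0(3) unfolding runs_def by auto
    qed
    then show ?case using exec.while_false 0 by fastforce
  next
    case (Suc k)
    show ?case
    proof (cases "holds b s'")
      case False
      then show ?thesis using exec.while_false Suc.prems by fastforce
    next
      case True
      obtain t1 s1 where 1: "exec W c s' t1 s1" "t1 \<le> T" "agree c s' s1" "Inv s1" "\<mu> s1 < \<mu> s'"
        using step[OF Suc.prems(1,2) True] unfolding runs_def by blast
      then have "\<mu> s1 \<le> k" using Suc.prems(3) by simp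
      then obtain t u where 2: "exec W (While b c) s1 t u" "t \<le> Suc (k * Suc T)" "Inv u" "\<not> holds b u"
        using Suc.IH[OF agree_trans[OF Suc.prems(1) 1(3)] 1(4)] by blast
      show ?thesis using exec.while_true[OF True 1(1) 2(1)] 1(2) 2(2,3,4)
        by (intro exI[of _ "1 + t1 + t"] exI[of _ u]) auto
    qed
  qed
  from this[OF agree_refl assms(1,2)] obtain t u where u: "exec W (While b c) s t u" "t \<le> Suc (n * Suc T)" "Inv u" "\<not> holds b u"
    by blast
  show ?thesis unfolding runs_def
    by (intro exI[of _ t] exI[of _ u] conjI) (use u T exec_agree[OF u(1)] in auto)
qed

lemma runs_for:
  assumes "Inv 0 s" "regs s i = 0"
    and lim: "regs s l = n" "l \<notin> mod_regs c"
    and step: "\<And>s' j. agree c s s' \<Longrightarrow> Inv j s' \<Longrightarrow> regs s' i = j \<Longrightarrow> j < n \<Longrightarrow>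
        runs W c s' T (\<lambda>s''. Inv (Suc j) s'' \<and> regs s'' i = Suc j)"
    and T: "Suc (n * Suc T) \<le> T'"
  shows "runs W (While (Less i l) c) s T' (Inv n)"
proof (rule runs_mono[where Q = "\<lambda>s'. (Inv (regs s' i) s' \<and> regs s' i \<le> n \<and> regs s' l = n) \<and> \<not> holds (Less i l) s'" and T = T'])
  show "runs W (While (Less i l) c) s T' (\<lambda>s'. (Inv (regs s' i) s' \<and> regs s' i \<le> n \<and> regs s' l = n) \<and> \<not> holds (Less i l) s')"
  proof (rule runs_While[where \<mu> = "\<lambda>s. n - regs s i" and n = n and T = T])
    show "Inv (regs s i) s \<and> regs s i \<le> n \<and> regs s l = n" using assms by simp
    fix s' assume a: "agree c s s'" and I: "Inv (regs s' i) s' \<and> regs s' i \<le> n \<and> regs s' l = n" and h: "holds (Less i l) s'"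
    have lt: "regs s' i < n" using h I by simp
    show "runs W c s' T (\<lambda>s''. (Inv (regs s'' i) s'' \<and> regs s'' i \<le> n \<and> regs s'' l = n) \<and> n - regs s'' i < n - regs s' i)"
      by (rule runs_mono[OF step[OF a _ refl lt] order_refl]) (use I lt agreeD(1)[OF _ lim(2)] in auto)
  qed (use T in auto)
next
  fix s' assume "(Inv (regs s' i) s' \<and> regs s' i \<le> n \<and> regs s' l = n) \<and> \<not> holds (Less i l) s'"
  then show "Inv n s'" by (auto simp: not_less)
qed simp

section \<open>Bucket sort with linked lists\<close>

type_synonym item = "nat \<times> nat \<times> nat"

abbreviation kind_of :: "item \<Rightarrow> nat" where "kind_of x \<equiv> fst x"
abbreviation id_of :: "item \<Rightarrow> nat" where "id_of x \<equiv> fst (snd x)"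
abbreviation key_of :: "item \<Rightarrow> nat" where "key_of x \<equiv> snd (snd x)"

text \<open>The bucket with key \<open>q\<close> is a linked list; nodes are numbered from 1, and 0 is the empty list.
  Its first node is the item with key \<open>q\<close> that was added last.\<close>

fun newest :: "item list \<Rightarrow> nat \<Rightarrow> nat" where
  "newest [] q = 0"
| "newest (x # xs) q = (if newest xs q = 0 then if key_of x = q then 1 else 0 else Suc (newest xs q))"

lemma newest_snoc: "newest (xs @ [x]) q = (if key_of x = q then Suc (length xs) else newest xs q)"
  by (induction xs) auto

lemma newest_le: "newest xs q \<le> length xs" by (induction xs) auto

text \<open>Read from the latest insertion backwards, a bucket is its newest item followed by the
  same bucket for the items added earlier. This is why the successor of a node is
  \<open>newest\<close> of the prefix before it.\<close>

lemma newest_filter: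
  "rev (filter (\<lambda>x. key_of x = q) xs) =
    (if newest xs q = 0 then [] else (xs ! (newest xs q - 1)) # rev (filter (\<lambda>x. key_of x = q) (take (newest xs q - 1) xs)))"
proof (induction xs rule: rev_induct)
  case (snoc x xs)
  show ?case
  proof (cases "key_of x = q")
    case True then show ?thesis by (simp add: newest_snoc nth_append)
  next
    case False
    then show ?thesis using snoc newest_le[of xs q] by (cases "newest xs q") (auto simp: newest_snoc nth_append)
  qed
qed simp

lemma newest_key: "newest xs q \<noteq> 0 \<Longrightarrow> key_of (xs ! (newest xs q - 1)) = q"
proof -
  assume "newest xs q \<noteq> 0"
  then have "xs ! (newest xs q - 1) \<in> set (rev (filter (\<lambda>x. key_of x = q) xs))" by (subst newest_filter) simp
  then show ?thesis by simp
qed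

definition buckets :: "item list \<Rightarrow> nat \<Rightarrow> item list" where
  "buckets xs b = concat (map (\<lambda>q. rev (filter (\<lambda>x. key_of x = q) xs)) [0..<b])"

lemma buckets_Suc: "buckets xs (Suc b) = buckets xs b @ rev (filter (\<lambda>x. key_of x = b) xs)"
  unfolding buckets_def by simp

lemma set_buckets: "set (buckets xs b) = {x \<in> set xs. key_of x < b}"
  unfolding buckets_def by auto

lemma sorted_buckets: "sorted (map key_of (buckets xs b))"
proof (induction b)
  case (Suc b)
  have "sorted (map key_of (rev (filter (\<lambda>x. key_of x = b) xs)))"
  proof -
    have "map key_of (rev (filter (\<lambda>x. key_of x = b) xs)) = replicate (length (filter (\<lambda>x. key_of x = b) xs)) b"
      by (intro replicate_eqI) auto
    then show ?thesis by simp
  qed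
  then show ?case unfolding buckets_Suc map_append sorted_append using Suc by (auto simp: set_buckets)
qed (simp add: buckets_def)

lemma distinct_buckets: "distinct xs \<Longrightarrow> distinct (buckets xs b)"
proof (induction b)
  case (Suc b) then show ?case unfolding buckets_Suc by (auto simp: set_buckets)
qed (simp add: buckets_def)

lemma length_buckets: "(\<And>x. x \<in> set xs \<Longrightarrow> key_of x < b) \<Longrightarrow> length (buckets xs b) = length xs"
proof (induction xs)
  case Nil
  have "set (buckets [] b) = {}" by (simp add: set_buckets)
  then show ?case by simp
next
  case (Cons x xs)
  have "length (buckets (x # xs) c) = length (buckets xs c) + (if key_of x < c then 1 else 0)" for c
  proof (induction c)
    case (Suc c) then show ?case by (auto simp: buckets_Suc less_Suc_eq)
  qed (simp add: buckets_def)
  then show ?case using Cons by simp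
qed

text \<open>Registers: 40 counts the nodes; 41, 42, 43 hold key, kind and identifier of the item to be
  added. Arrays \<open>q + 2, \<dots>, q + 5\<close>: first node of each bucket, successor, kind and identifier of
  each node.\<close>

definition push :: "nat \<Rightarrow> com" where
  "push q = block [Assign 40 (Plus 40 3), Write (q + 4) 40 42, Write (q + 5) 40 43,
     Assign 45 (Read (q + 2) 41), Write (q + 3) 40 45, Write (q + 2) 41 40]"

definition nodes :: "nat \<Rightarrow> item list \<Rightarrow> state \<Rightarrow> bool" where
  "nodes q xs s \<longleftrightarrow> regs s 40 = length xs \<and>
     (\<forall>x<length xs. mem s (q + 4) (Suc x) = kind_of (xs ! x) \<and> mem s (q + 5) (Suc x) = id_of (xs ! x) \<and>
        mem s (q + 3) (Suc x) = newest (take x xs) (key_of (xs ! x))) \<and>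
     mem s (q + 2) = newest xs"

lemma push:
  assumes "nodes q xs s" "regs s 3 = 1" "Suc (length xs) < W"
  shows "adm W (push q) s" "nodes q (xs @ [(regs s 42, regs s 43, regs s 41)]) (eff (push q) s)"
    "agree (push q) s (eff (push q) s)" "mod_regs (push q) = {40, 45}" "mod_mem (push q) = {q + 2, q + 3, q + 4, q + 5}" "cost (push q) = 6"
proof -
  have n: "regs s 40 = length xs" "mem s (q + 2) = newest xs"
    "\<And>x. x < length xs \<Longrightarrow> mem s (q + 4) (Suc x) = kind_of (xs ! x)" "\<And>x. x < length xs \<Longrightarrow> mem s (q + 5) (Suc x) = id_of (xs ! x)"
    "\<And>x. x < length xs \<Longrightarrow> mem s (q + 3) (Suc x) = newest (take x xs) (key_of (xs ! x))"
    using assms(1) unfolding nodes_def by auto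
  show a: "adm W (push q) s" using assms(2,3) n newest_le[of xs "regs s 41"] unfolding push_def by auto
  show "agree (push q) s (eff (push q) s)" using exec_eff[OF a] exec_agree by blast
  show "mod_regs (push q) = {40, 45}" "mod_mem (push q) = {q + 2, q + 3, q + 4, q + 5}" "cost (push q) = 6" unfolding push_def by auto
  have r: "regs (eff (push q) s) 40 = Suc (length xs)"
    "mem (eff (push q) s) (q + 4) = (mem s (q + 4))(Suc (length xs) := regs s 42)"
    "mem (eff (push q) s) (q + 5) = (mem s (q + 5))(Suc (length xs) := regs s 43)"
    "mem (eff (push q) s) (q + 3) = (mem s (q + 3))(Suc (length xs) := newest xs (regs s 41))"
    "mem (eff (push q) s) (q + 2) = (newest xs)(regs s 41 := Suc (length xs))"
    unfolding push_def using assms(2) n by simp_all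
  show "nodes q (xs @ [(regs s 42, regs s 43, regs s 41)]) (eff (push q) s)"
    unfolding nodes_def r
  proof (intro conjI allI impI)
    show "(newest xs)(regs s 41 := Suc (length xs)) = newest (xs @ [(regs s 42, regs s 43, regs s 41)])"
      by (rule ext) (simp add: newest_snoc)
  qed (auto simp: less_Suc_eq nth_append n)
qed

text \<open>Registers 30, 31 and 32 hold the current bucket, the next node in it and the output
  position; 33 holds the limit for buckets. Kinds and identifiers go to the arrays \<open>d\<close>
  and \<open>Suc d\<close>. Registers 3 and 4 serve as the constants 1 and 0.\<close>

definition pop_all :: "nat \<Rightarrow> nat \<Rightarrow> com" where
  "pop_all q d = Seq (block [Assign 30 (Reg 4), Assign 31 (Read (q + 2) 30), Assign 32 (Reg 4)])
     (While (Less 30 33) (Cond (Equal 31 4)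
       (block [Assign 30 (Plus 30 3), Assign 31 (Read (q + 2) 30)])
       (block [Assign 34 (Read (q + 4) 31), Write d 32 34, Assign 34 (Read (q + 5) 31), Write (Suc d) 32 34,
          Assign 32 (Plus 32 3), Assign 31 (Read (q + 3) 31)])))"

text \<open>Each iteration either moves on to the next bucket or outputs one node, so the number of
  buckets plus the number of items bounds the number of iterations.\<close>

lemma pop_all:
  assumes nodes: "nodes q xs s" and c: "regs s 3 = 1" "regs s 4 = 0" "regs s 33 = L"
    and W: "\<And>x. x \<in> set xs \<Longrightarrow> kind_of x < W \<and> id_of x < W \<and> key_of x < L" "L < W" "length xs < W"
    and d: "Suc d < q"
  shows "runs W (pop_all q d) s (10 * (L + length xs) + 10) (\<lambda>s'.
      \<forall>i<length xs. mem s' d i = kind_of (buckets xs (Suc L) ! i) \<and> mem s' (Suc d) i = id_of (buckets xs (Suc L) ! i))"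
proof -
  let ?c = "Cond (Equal 31 4)
       (block [Assign 30 (Plus 30 3), Assign 31 (Read (q + 2) 30)])
       (block [Assign 34 (Read (q + 4) 31), Write d 32 34, Assign 34 (Read (q + 5) 31), Write (Suc d) 32 34,
          Assign 32 (Plus 32 3), Assign 31 (Read (q + 3) 31)])"
  have n: "mem s (q + 2) = newest xs"
    "\<And>x. x < length xs \<Longrightarrow> mem s (q + 4) (Suc x) = kind_of (xs ! x)" "\<And>x. x < length xs \<Longrightarrow> mem s (q + 5) (Suc x) = id_of (xs ! x)"
    "\<And>x. x < length xs \<Longrightarrow> mem s (q + 3) (Suc x) = newest (take x xs) (key_of (xs ! x))"
    using nodes unfolding nodes_def by auto
  define rem where "rem k b = rev (filter (\<lambda>x. key_of x = b) (take k xs))" for k b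
  \<comment> \<open>What is left of the current bucket are its items among the first
    \<open>k\<close>, in reverse order; every output lowers \<open>k\<close> to the index of the
    item just written.\<close>
  define Inv :: "state \<Rightarrow> bool" where "Inv s' \<longleftrightarrow> regs s' 30 \<le> L \<and> (\<exists>k\<le>length xs. regs s' 31 = newest (take k xs) (regs s' 30) \<and>
      (\<exists>ys. length ys = regs s' 32 \<and> ys @ rem k (regs s' 30) = buckets xs (Suc (regs s' 30)) \<and>
        (\<forall>i<length ys. mem s' d i = kind_of (ys ! i) \<and> mem s' (Suc d) i = id_of (ys ! i))))" for s'
  have keys: "\<And>x. x \<in> set xs \<Longrightarrow> key_of x < Suc b" if "L \<le> b" for b using W(1) that by fastforce
  have lenle: "length (buckets xs (Suc b)) \<le> length xs" if "b \<le> L" for b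
  proof -
    have "buckets xs (Suc L) = buckets xs (Suc b) @ concat (map (\<lambda>q. rev (filter (\<lambda>x. key_of x = q) xs)) [Suc b..<Suc L])"
      unfolding buckets_def using that upt_add_eq_append[of 0 "Suc b" "L - b"] by (simp del: upt_Suc)
    then have "length (buckets xs (Suc L)) \<ge> length (buckets xs (Suc b))" by (simp del: upt_Suc)
    moreover have "length (buckets xs (Suc L)) = length xs" by (rule length_buckets) (rule keys[OF order_refl])
    ultimately show ?thesis by simp
  qed
  define s1 where "s1 = eff (block [Assign 30 (Reg 4), Assign 31 (Read (q + 2) 30), Assign 32 (Reg 4)]) s"
  have s1: "regs s1 30 = 0" "regs s1 31 = newest xs 0" "regs s1 32 = 0" "regs s1 3 = 1" "regs s1 4 = 0" "regs s1 33 = L" "mem s1 = mem s"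
    unfolding s1_def using c n by simp_all
  have step: "runs W ?c s' 9 (\<lambda>s''. Inv s'' \<and> (L - regs s'' 30) + (length xs - regs s'' 32) < (L - regs s' 30) + (length xs - regs s' 32))"
    if a: "agree ?c s1 s'" and I: "Inv s'" and h: "holds (Less 30 33) s'" for s'
  proof -
    have u: "regs s' 3 = 1" "regs s' 4 = 0" "regs s' 33 = L" "mem s' (q + 2) = mem s (q + 2)" "mem s' (q + 3) = mem s (q + 3)"
       "mem s' (q + 4) = mem s (q + 4)" "mem s' (q + 5) = mem s (q + 5)"
      using agreeD[OF a] s1 d by auto
    have lt: "regs s' 30 < L" using h u by simp
    obtain k ys where k: "k \<le> length xs" "regs s' 31 = newest (take k xs) (regs s' 30)" "length ys = regs s' 32"
      "ys @ rem k (regs s' 30) = buckets xs (Suc (regs s' 30))"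
      "\<forall>i<length ys. mem s' d i = kind_of (ys ! i) \<and> mem s' (Suc d) i = id_of (ys ! i)"
      using I unfolding Inv_def by blast
    let ?q = "regs s' 30"
    show ?thesis
    proof (rule runs_Cond[where T = 8])
      assume "holds (Equal 31 4) s'"
      then have z: "newest (take k xs) ?q = 0" using k(2) u by simp
      then have "rem k ?q = []" unfolding rem_def using newest_filter[of ?q "take k xs"] by simp
      then have ys: "ys = buckets xs (Suc ?q)" using k(4) by simp
      show "runs W (block [Assign 30 (Plus 30 3), Assign 31 (Read (q + 2) 30)]) s' 8
          (\<lambda>s''. Inv s'' \<and> (L - regs s'' 30) + (length xs - regs s'' 32) < (L - regs s' 30) + (length xs - regs s' 32))"
      proof (rule runs_eff)
        show "adm W (block [Assign 30 (Plus 30 3), Assign 31 (Read (q + 2) 30)]) s'"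
          using u lt W(2,3) newest_le[of xs "Suc ?q"] n by auto
        let ?s = "eff (block [Assign 30 (Plus 30 3), Assign 31 (Read (q + 2) 30)]) s'"
        have r: "regs ?s 30 = Suc ?q" "regs ?s 31 = newest xs (Suc ?q)" "regs ?s 32 = regs s' 32" "mem ?s = mem s'" using u n by simp_all
        have "Inv ?s" unfolding Inv_def r
          using lt k(3,5) ys unfolding rem_def
          by (intro conjI exI[of _ "length xs"] exI[of _ ys]) (auto simp: buckets_Suc)
        then show "Inv ?s \<and> (L - regs ?s 30) + (length xs - regs ?s 32) < (L - regs s' 30) + (length xs - regs s' 32)"
          unfolding r using lt by simp
      qed simp
    next
      assume "\<not> holds (Equal 31 4) s'"
      then have nz: "newest (take k xs) ?q \<noteq> 0" using k(2) u by simp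
      define x where "x = newest (take k xs) ?q - 1"
      have x: "newest (take k xs) ?q = Suc x" "x < k" using nz newest_le[of "take k xs" ?q] k(1) unfolding x_def by auto
      have kx: "key_of (xs ! x) = ?q" using newest_key[OF nz] x by simp
      have rm: "rem k ?q = (xs ! x) # rem x ?q"
        unfolding rem_def using newest_filter[of ?q "take k xs"] nz x by (simp add: min_def)
      have xl: "x < length xs" "xs ! x \<in> set xs" using x k(1) by auto
      have "length (buckets xs (Suc ?q)) = length ys + Suc (length (rem x ?q))" using k(4)[symmetric] rm by simp
      then have yl: "Suc (length ys) \<le> length xs" using lenle[of ?q] lt by simp
      let ?B = "block [Assign 34 (Read (q + 4) 31), Write d 32 34, Assign 34 (Read (q + 5) 31), Write (Suc d) 32 34,
          Assign 32 (Plus 32 3), Assign 31 (Read (q + 3) 31)]"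
      show "runs W ?B s' 8 (\<lambda>s''. Inv s'' \<and> (L - regs s'' 30) + (length xs - regs s'' 32) < (L - regs s' 30) + (length xs - regs s' 32))"
      proof (rule runs_eff)
        have nl: "newest (take x xs) ?q < W" using newest_le[of "take x xs" ?q] xl W(3) by auto
        have dq: "d \<noteq> q + 3" "d \<noteq> q + 4" "d \<noteq> q + 5" "Suc d \<noteq> q + 3" "Suc d \<noteq> q + 5" using d by auto
        have mm: "mem s' (q + 4) (regs s' 31) = kind_of (xs ! x)" "mem s' (q + 5) (regs s' 31) = id_of (xs ! x)"
          "mem s' (q + 3) (regs s' 31) = newest (take x xs) ?q"
          unfolding u k(2) x(1) using n xl kx by simp_all
        have "kind_of (xs ! x) < W" "id_of (xs ! x) < W" "Suc (regs s' 32) < W" using W(1)[OF xl(2)] yl W(3) k(3) by auto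
        then show "adm W ?B s'"
          using mm nl u(1) dq by simp
        let ?s = "eff ?B s'"
        have r: "regs ?s 30 = ?q" "regs ?s 31 = newest (take x xs) ?q" "regs ?s 32 = Suc (regs s' 32)"
          "mem ?s d = (mem s' d)(regs s' 32 := kind_of (xs ! x))" "mem ?s (Suc d) = (mem s' (Suc d))(regs s' 32 := id_of (xs ! x))"
          using mm u(1) dq by simp_all
        have "Inv ?s" unfolding Inv_def r
        proof (intro conjI exI[of _ x] exI[of _ "ys @ [xs ! x]"])
          show "\<forall>i<length (ys @ [xs ! x]). ((mem s' d)(regs s' 32 := kind_of (xs ! x))) i = kind_of ((ys @ [xs ! x]) ! i) \<and>
              ((mem s' (Suc d))(regs s' 32 := id_of (xs ! x))) i = id_of ((ys @ [xs ! x]) ! i)"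
            using k(3,5) by (auto simp: nth_append less_Suc_eq)
        qed (use lt x xl k rm in auto)
        then show "Inv ?s \<and> (L - regs ?s 30) + (length xs - regs ?s 32) < (L - regs s' 30) + (length xs - regs s' 32)"
          unfolding r using k(3) yl by simp
      qed simp
    qed simp
  qed
  have I1: "Inv s1" unfolding Inv_def s1 rem_def
    by (intro conjI exI[of _ "length xs"] exI[of _ "[]"]) (auto simp: buckets_def)
  have loop: "runs W (While (Less 30 33) ?c) s1 (10 * (L + length xs) + 2) (\<lambda>s'. Inv s' \<and> \<not> holds (Less 30 33) s')"
    by (rule runs_While[where \<mu> = "\<lambda>s. (L - regs s 30) + (length xs - regs s 32)" and n = "L + length xs" and T = 9])
      (use I1 step in auto)
  have fin: "\<forall>i<length xs. mem s' d i = kind_of (buckets xs (Suc L) ! i) \<and> mem s' (Suc d) i = id_of (buckets xs (Suc L) ! i)"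
    if a: "agree ?c s1 s'" and I: "Inv s'" "\<not> holds (Less 30 33) s'" for s'
  proof -
    have "regs s' 33 = L" using agreeD[OF a] s1 by auto
    then have q: "regs s' 30 = L" using I unfolding Inv_def by auto
    obtain k ys where k: "k \<le> length xs" "ys @ rem k L = buckets xs (Suc L)"
      "\<forall>i<length ys. mem s' d i = kind_of (ys ! i) \<and> mem s' (Suc d) i = id_of (ys ! i)"
      using I(1) unfolding Inv_def q by blast
    \<comment> \<open>All keys are below \<open>L\<close>, so the bucket at which the loop stops is
      empty and nothing is missed.\<close>
    have "rem k L = []" unfolding rem_def using W(1) by (auto simp: filter_empty_conv dest: in_set_takeD)
    then have "ys = buckets xs (Suc L)" using k(2) by simp
    then show ?thesis using k(3) length_buckets[OF keys[OF order_refl]] by simp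
  qed
  show ?thesis unfolding pop_all_def
  proof (rule runs_Seq[where Ta = 3 and Tb = "10 * (L + length xs) + 2" and Q = "\<lambda>t. t = s1"])
    show "runs W (block [Assign 30 (Reg 4), Assign 31 (Read (q + 2) 30), Assign 32 (Reg 4)]) s 3 (\<lambda>t. t = s1)"
      by (rule runs_eff) (use c W newest_le[of xs 0] n s1_def in auto)
    fix t assume t: "t = s1"
    show "runs W (While (Less 30 33) ?c) t (10 * (L + length xs) + 2) (\<lambda>s'.
      \<forall>i<length xs. mem s' d i = kind_of (buckets xs (Suc L) ! i) \<and> mem s' (Suc d) i = id_of (buckets xs (Suc L) ! i))"
      unfolding t by (rule runs_mono[OF loop order_refl]) (use fin agree_While in blast)
  qed simp
qed

lemma nodes_cong: "mem s2 = mem s1 \<Longrightarrow> regs s2 40 = regs s1 40 \<Longrightarrow> nodes q xs s2 \<longleftrightarrow> nodes q xs s1"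
  unfolding nodes_def by simp

lemma runs_push:
  assumes "adm W (block cs) s" "mem (eff (block cs) s) = mem s" "regs (eff (block cs) s) 40 = regs s 40"
    "nodes q xs s" "regs (eff (block cs) s) 3 = 1" "Suc (length xs) < W" "cost (block cs) + 6 \<le> T"
    "x = (regs (eff (block cs) s) 42, regs (eff (block cs) s) 43, regs (eff (block cs) s) 41)"
  shows "runs W (Seq (block cs) (push q)) s T (\<lambda>s'. nodes q (xs @ [x]) s' \<and>
     (\<forall>i. i \<noteq> 40 \<longrightarrow> i \<noteq> 45 \<longrightarrow> regs s' i = regs (eff (block cs) s) i))"
proof -
  let ?s = "eff (block cs) s"
  have n: "nodes q xs ?s" using assms(4) nodes_cong[OF assms(2,3)] by blast
  note p = push[OF n assms(5,6)]
  show ?thesis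
  proof (rule runs_eff)
    show "adm W (Seq (block cs) (push q)) s" using assms(1) p(1) by simp
    show "cost (Seq (block cs) (push q)) \<le> T" using assms(7) p(6) by simp
    show "nodes q (xs @ [x]) (eff (Seq (block cs) (push q)) s) \<and>
     (\<forall>i. i \<noteq> 40 \<longrightarrow> i \<noteq> 45 \<longrightarrow> regs (eff (Seq (block cs) (push q)) s) i = regs ?s i)"
      using p(2) agreeD(1)[OF p(3)] unfolding p(4) assms(8) by simp
  qed
qed

section \<open>Listing all cells with their keys\<close>

definition push_verts :: "nat \<Rightarrow> com" where
  "push_verts q = While (Less 30 0) (Seq (block [Assign 46 (Read q 30), Assign 41 (Plus 46 46), Assign 41 (Plus 41 46),
     Assign 42 (Reg 4), Assign 43 (Reg 30), Assign 30 (Plus 30 3)]) (push q))"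

lemma push_verts:
  assumes "nodes q xs s" "regs s 30 = 0" "regs s 0 = n" "regs s 3 = 1" "regs s 4 = 0" "\<And>v. v < n \<Longrightarrow> 3 * mem s q v < W"
    "length xs + n < W"
  shows "runs W (push_verts q) s (13 * n + 1) (nodes q (xs @ map (\<lambda>v. (0, v, 3 * mem s q v)) [0..<n]))"
  unfolding push_verts_def
proof (rule runs_for[where n = n and T = 12 and Inv = "\<lambda>j. nodes q (xs @ map (\<lambda>v. (0, v, 3 * mem s q v)) [0..<j])"])
  let ?cs = "[Assign 46 (Read q 30), Assign 41 (Plus 46 46), Assign 41 (Plus 41 46),
     Assign 42 (Reg 4), Assign 43 (Reg 30), Assign 30 (Plus 30 3)]"
  have mods: "mod_regs (Seq (block ?cs) (push q)) = {46, 41, 42, 43, 30, 40, 45}" "mod_mem (Seq (block ?cs) (push q)) = {q + 2, q + 3, q + 4, q + 5}"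
    unfolding push_def by auto
  show "0 \<notin> mod_regs (Seq (block ?cs) (push q))" unfolding mods by simp
  fix s' j assume a: "agree (Seq (block ?cs) (push q)) s s'" and n: "nodes q (xs @ map (\<lambda>v. (0, v, 3 * mem s q v)) [0..<j]) s'"
    and j: "regs s' 30 = j" "j < n"
  have u: "regs s' 0 = n" "regs s' 3 = 1" "regs s' 4 = 0" "mem s' q = mem s q" using agreeD[OF a, unfolded mods] assms by simp_all
  have b: "3 * mem s q j < W" "j < W" "Suc j < W" using assms(6)[OF j(2)] assms(7) j by auto
  show "runs W (Seq (block ?cs) (push q)) s' 12 (\<lambda>s''. nodes q (xs @ map (\<lambda>v. (0, v, 3 * mem s q v)) [0..<Suc j]) s'' \<and> regs s'' 30 = Suc j)"
    by (rule runs_mono[OF runs_push[OF _ _ _ n, where T = 12 and x = "(0, j, 3 * mem s q j)"]]) (use u j b assms(7) in auto)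
qed (use assms in auto)

text \<open>Array 11 marks the arcs of the outer face. An edge with no marked arc is a chord and
  takes its ranks from array \<open>q + 1\<close>, where coloured vertices have the bound as rank;
  other edges use array \<open>q\<close>. Comparing an arc with its reverse selects one arc per
  edge, and with truncated subtraction \<open>x + (y - x)\<close> is a maximum.\<close>

definition push_edges_body :: "nat \<Rightarrow> com" where
  "push_edges_body q = Seq (block [Assign 47 (Read 1 30), Assign 48 (Read 0 30), Assign 49 (Read 0 47),
       Assign 50 (Read 11 30), Assign 51 (Read 11 47), Assign 50 (Plus 50 51), Assign 43 (Reg 30), Assign 42 (Const 1), Assign 30 (Plus 30 3)])
     (Cond (Less 43 47)
       (Cond (Equal 50 4)
         (Seq (block [Assign 52 (Read (q + 1) 48), Assign 53 (Read (q + 1) 49), Assign 53 (Minus 53 52), Assign 52 (Plus 52 53),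
            Assign 41 (Plus 52 52), Assign 41 (Plus 41 52), Assign 41 (Plus 41 3)]) (push q))
         (Seq (block [Assign 52 (Read q 48), Assign 53 (Read q 49), Assign 53 (Minus 53 52), Assign 52 (Plus 52 53),
            Assign 41 (Plus 52 52), Assign 41 (Plus 41 52), Assign 41 (Plus 41 3)]) (push q)))
       Skip)"

definition edge_items :: "nat \<Rightarrow> state \<Rightarrow> nat \<Rightarrow> item list" where
  "edge_items q s a = (let b = mem s 1 a; R = (if mem s 11 a + mem s 11 b = 0 then mem s (q + 1) else mem s q) in
     if a < b then [(1, a, 3 * max (R (mem s 0 a)) (R (mem s 0 b)) + 1)] else [])"

lemma nat_max_minus: "x + (y - x) = max x (y :: nat)" by auto

lemma push_edges:
  assumes "nodes q xs s" "regs s 30 = 0" "regs s 1 = A" "regs s 3 = 1" "regs s 4 = 0"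
    and tables: "\<And>a. a < A \<Longrightarrow> mem s 1 a < A \<and> mem s 0 a < n" "\<And>v. v < n \<Longrightarrow> mem s q v \<le> B \<and> mem s (q + 1) v \<le> B"
      "\<And>a. mem s 11 a \<le> 1"
    and W: "length xs + A < W" "n < W" "3 * B + 3 < W" "3 < W" and q: "100 \<le> q"
  shows "runs W (While (Less 30 1) (push_edges_body q)) s (40 * A + 1) (nodes q (xs @ concat (map (edge_items q s) [0..<A])))"
proof (rule runs_for[where n = A and T = 39 and Inv = "\<lambda>j. nodes q (xs @ concat (map (edge_items q s) [0..<j]))"])
  have mods: "mod_regs (push_edges_body q) = {47, 48, 49, 50, 51, 43, 42, 30, 52, 53, 41, 40, 45}" "mod_mem (push_edges_body q) = {q + 2, q + 3, q + 4, q + 5}"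
    unfolding push_edges_body_def push_def by auto
  show "1 \<notin> mod_regs (push_edges_body q)" unfolding mods by simp
  fix s' j assume a: "agree (push_edges_body q) s s'" and n: "nodes q (xs @ concat (map (edge_items q s) [0..<j])) s'"
    and j: "regs s' 30 = j" "j < A"
  have u: "regs s' 1 = A" "regs s' 3 = 1" "regs s' 4 = 0" "mem s' q = mem s q" "mem s' (q + 1) = mem s (q + 1)"
     "mem s' 0 = mem s 0" "mem s' 1 = mem s 1" "mem s' 11 = mem s 11" using agreeD[OF a, unfolded mods] assms q by simp_all
  let ?b = "mem s 1 j"
  let ?R = "if mem s 11 j + mem s 11 ?b = 0 then mem s (q + 1) else mem s q"
  have tb: "?b < A" "mem s 0 j < n" "mem s 0 ?b < n" "mem s 11 j \<le> 1" "mem s 11 ?b \<le> 1" using tables j by auto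
  have len: "length (concat (map (edge_items q s) [0..<j])) \<le> j" 
    by (induction j) (auto simp: edge_items_def Let_def)
  let ?pre = "block [Assign 47 (Read 1 30), Assign 48 (Read 0 30), Assign 49 (Read 0 47),
       Assign 50 (Read 11 30), Assign 51 (Read 11 47), Assign 50 (Plus 50 51), Assign 43 (Reg 30), Assign 42 (Const 1), Assign 30 (Plus 30 3)]"
  define s2 where "s2 = eff ?pre s'"
  have s2: "regs s2 47 = ?b" "regs s2 48 = mem s 0 j" "regs s2 49 = mem s 0 ?b" "regs s2 50 = mem s 11 j + mem s 11 ?b"
    "regs s2 43 = j" "regs s2 42 = 1" "regs s2 30 = Suc j" "regs s2 3 = 1" "regs s2 4 = 0" "regs s2 40 = regs s' 40" "mem s2 = mem s'"
    unfolding s2_def using u j by simp_all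
  have n2: "nodes q (xs @ concat (map (edge_items q s) [0..<j])) s2" using n nodes_cong[OF s2(11,10)] by blast
  have snoc: "xs @ concat (map (edge_items q s) [0..<Suc j]) = (xs @ concat (map (edge_items q s) [0..<j])) @ edge_items q s j" by simp
  have adm_pre: "adm W ?pre s'" using u j tb W by simp
  show "runs W (push_edges_body q) s' 39 (\<lambda>s''. nodes q (xs @ concat (map (edge_items q s) [0..<Suc j])) s'' \<and> regs s'' 30 = Suc j)"
    unfolding push_edges_body_def snoc
  proof (rule runs_Seq[where Ta = 9 and Tb = 30 and Q = "\<lambda>t. t = s2"])
    show "runs W ?pre s' 9 (\<lambda>t. t = s2)" by (rule runs_eff[OF adm_pre]) (auto simp: s2_def)
    fix t assume t: "t = s2"
    have bnd: "?R (mem s 0 j) \<le> B" "?R (mem s 0 ?b) \<le> B" using tables(2) tb by auto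
    let ?m = "max (?R (mem s 0 j)) (?R (mem s 0 ?b))"
    have mB: "3 * ?m + 1 < W" using bnd W by (auto simp: max_def)
    have L: "Suc (length (xs @ concat (map (edge_items q s) [0..<j]))) < W" using len W j by simp
    have C: "runs W (Seq (block [Assign 52 (Read X 48), Assign 53 (Read X 49), Assign 53 (Minus 53 52), Assign 52 (Plus 52 53),
            Assign 41 (Plus 52 52), Assign 41 (Plus 41 52), Assign 41 (Plus 41 3)]) (push q)) s2 28
            (\<lambda>s''. nodes q ((xs @ concat (map (edge_items q s) [0..<j])) @ edge_items q s j) s'' \<and> regs s'' 30 = Suc j)"
      if X: "X = (if mem s 11 j + mem s 11 ?b = 0 then q + 1 else q)" and lt: "j < ?b" for X
    proof -
      have R: "mem s' X = ?R" using X u by simp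
      have it: "edge_items q s j = [(1, j, 3 * ?m + 1)]" unfolding edge_items_def using lt by (simp add: Let_def)
      show ?thesis unfolding it
        by (rule runs_mono[OF runs_push[OF _ _ _ n2, where T = 28 and x = "(1, j, 3 * ?m + 1)"]])
          (use s2 R mB L bnd W in \<open>auto simp: nat_max_minus\<close>)
    qed
    show "runs W (Cond (Less 43 47)
       (Cond (Equal 50 4)
         (Seq (block [Assign 52 (Read (q + 1) 48), Assign 53 (Read (q + 1) 49), Assign 53 (Minus 53 52), Assign 52 (Plus 52 53),
            Assign 41 (Plus 52 52), Assign 41 (Plus 41 52), Assign 41 (Plus 41 3)]) (push q))
         (Seq (block [Assign 52 (Read q 48), Assign 53 (Read q 49), Assign 53 (Minus 53 52), Assign 52 (Plus 52 53),
            Assign 41 (Plus 52 52), Assign 41 (Plus 41 52), Assign 41 (Plus 41 3)]) (push q)))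
       Skip) t 30 (\<lambda>s''. nodes q ((xs @ concat (map (edge_items q s) [0..<j])) @ edge_items q s j) s'' \<and> regs s'' 30 = Suc j)"
      unfolding t
    proof (rule runs_Cond[where T = 29])
      assume "holds (Less 43 47) s2"
      then have lt: "j < ?b" using s2 by simp
      show "runs W (Cond (Equal 50 4)
         (Seq (block [Assign 52 (Read (q + 1) 48), Assign 53 (Read (q + 1) 49), Assign 53 (Minus 53 52), Assign 52 (Plus 52 53),
            Assign 41 (Plus 52 52), Assign 41 (Plus 41 52), Assign 41 (Plus 41 3)]) (push q))
         (Seq (block [Assign 52 (Read q 48), Assign 53 (Read q 49), Assign 53 (Minus 53 52), Assign 52 (Plus 52 53),
            Assign 41 (Plus 52 52), Assign 41 (Plus 41 52), Assign 41 (Plus 41 3)]) (push q))) s2 29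
         (\<lambda>s''. nodes q ((xs @ concat (map (edge_items q s) [0..<j])) @ edge_items q s j) s'' \<and> regs s'' 30 = Suc j)"
        by (rule runs_Cond[where T = 28]; (rule C[OF _ lt])?) (use s2 in auto)
    next
      assume "\<not> holds (Less 43 47) s2"
      then have "edge_items q s j = []" using s2 unfolding edge_items_def by (simp add: Let_def)
      then show "runs W Skip s2 29 (\<lambda>s''. nodes q ((xs @ concat (map (edge_items q s) [0..<j])) @ edge_items q s j) s'' \<and> regs s'' 30 = Suc j)"
        using n2 s2 by (intro runs_eff) auto
    qed simp
  qed simp
qed (use assms in auto)

text \<open>A triangle is listed at the smallest of its arcs, by comparing an arc with its two
  successors on the face. Marked arcs are skipped, as the outer face is added separately.\<close>

definition push_faces_body :: "nat \<Rightarrow> com" where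
  "push_faces_body q = Seq (block [Assign 47 (Read 1 30), Assign 48 (Read 2 47), Assign 47 (Read 1 48), Assign 49 (Read 2 47),
       Assign 50 (Read 11 30), Assign 51 (Read 0 30), Assign 52 (Read 0 48), Assign 53 (Read 0 49),
       Assign 43 (Reg 30), Assign 42 (Const 2), Assign 30 (Plus 30 3)])
     (Cond (Equal 50 4) (Cond (Less 43 48) (Cond (Less 43 49)
         (Seq (block [Assign 54 (Read (q + 1) 51), Assign 55 (Read (q + 1) 52), Assign 56 (Read (q + 1) 53),
            Assign 55 (Minus 55 54), Assign 54 (Plus 54 55), Assign 56 (Minus 56 54), Assign 54 (Plus 54 56),
            Assign 41 (Plus 54 54), Assign 41 (Plus 41 54), Assign 41 (Plus 41 42)]) (push q))
       Skip) Skip) Skip)"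

definition face_items :: "nat \<Rightarrow> state \<Rightarrow> nat \<Rightarrow> item list" where
  "face_items q s a = (let b = mem s 2 (mem s 1 a); c = mem s 2 (mem s 1 b); R = mem s (q + 1) in
     if mem s 11 a = 0 \<and> a < b \<and> a < c
     then [(2, a, 3 * max (max (R (mem s 0 a)) (R (mem s 0 b))) (R (mem s 0 c)) + 2)] else [])"

lemma push_faces:
  assumes "nodes q xs s" "regs s 30 = 0" "regs s 1 = A" "regs s 3 = 1" "regs s 4 = 0"
    and tables: "\<And>a. a < A \<Longrightarrow> mem s 1 a < A \<and> mem s 2 a < A \<and> mem s 0 a < n" "\<And>v. v < n \<Longrightarrow> mem s (q + 1) v \<le> B"
      "\<And>a. mem s 11 a \<le> 1"
    and W: "length xs + A < W" "n < W" "3 * B + 3 < W" "3 < W" and q: "100 \<le> q"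
  shows "runs W (While (Less 30 1) (push_faces_body q)) s (40 * A + 1) (nodes q (xs @ concat (map (face_items q s) [0..<A])))"
proof (rule runs_for[where n = A and T = 39 and Inv = "\<lambda>j. nodes q (xs @ concat (map (face_items q s) [0..<j]))"])
  have mods: "mod_regs (push_faces_body q) = {47, 48, 49, 50, 51, 43, 42, 30, 52, 53, 54, 55, 56, 41, 40, 45}" "mod_mem (push_faces_body q) = {q + 2, q + 3, q + 4, q + 5}"
    unfolding push_faces_body_def push_def by auto
  show "1 \<notin> mod_regs (push_faces_body q)" unfolding mods by simp
  fix s' j assume a: "agree (push_faces_body q) s s'" and n: "nodes q (xs @ concat (map (face_items q s) [0..<j])) s'"
    and j: "regs s' 30 = j" "j < A"
  have u: "regs s' 1 = A" "regs s' 3 = 1" "regs s' 4 = 0" "mem s' (q + 1) = mem s (q + 1)"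
     "mem s' 0 = mem s 0" "mem s' 1 = mem s 1" "mem s' 2 = mem s 2" "mem s' 11 = mem s 11" using agreeD[OF a, unfolded mods] assms q by simp_all
  let ?b = "mem s 2 (mem s 1 j)"
  let ?c = "mem s 2 (mem s 1 ?b)"
  let ?R = "mem s (q + 1)"
  have tb: "mem s 1 j < A" "?b < A" "mem s 1 ?b < A" "?c < A" "mem s 0 j < n" "mem s 0 ?b < n" "mem s 0 ?c < n" "mem s 11 j \<le> 1"
    using tables j by auto
  have len: "length (concat (map (face_items q s) [0..<j])) \<le> j" 
    by (induction j) (auto simp: face_items_def Let_def)
  let ?pre = "block [Assign 47 (Read 1 30), Assign 48 (Read 2 47), Assign 47 (Read 1 48), Assign 49 (Read 2 47),
       Assign 50 (Read 11 30), Assign 51 (Read 0 30), Assign 52 (Read 0 48), Assign 53 (Read 0 49),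
       Assign 43 (Reg 30), Assign 42 (Const 2), Assign 30 (Plus 30 3)]"
  define s2 where "s2 = eff ?pre s'"
  have s2: "regs s2 48 = ?b" "regs s2 49 = ?c" "regs s2 50 = mem s 11 j" "regs s2 51 = mem s 0 j" "regs s2 52 = mem s 0 ?b" "regs s2 53 = mem s 0 ?c"
    "regs s2 43 = j" "regs s2 42 = 2" "regs s2 30 = Suc j" "regs s2 3 = 1" "regs s2 4 = 0" "regs s2 40 = regs s' 40" "mem s2 = mem s'"
    unfolding s2_def using u j by simp_all
  have n2: "nodes q (xs @ concat (map (face_items q s) [0..<j])) s2" using n nodes_cong[OF s2(13,12)] by blast
  have snoc: "xs @ concat (map (face_items q s) [0..<Suc j]) = (xs @ concat (map (face_items q s) [0..<j])) @ face_items q s j" by simp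
  have adm_pre: "adm W ?pre s'" using u j tb W by simp
  let ?Q = "\<lambda>s''. nodes q ((xs @ concat (map (face_items q s) [0..<j])) @ face_items q s j) s'' \<and> regs s'' 30 = Suc j"
  have skip: "runs W Skip s2 T ?Q" if "\<not> (mem s 11 j = 0 \<and> j < ?b \<and> j < ?c)" for T
  proof -
    have "face_items q s j = []" using that unfolding face_items_def by (auto simp: Let_def)
    then show ?thesis using n2 s2 by (intro runs_eff) auto
  qed
  show "runs W (push_faces_body q) s' 39 (\<lambda>s''. nodes q (xs @ concat (map (face_items q s) [0..<Suc j])) s'' \<and> regs s'' 30 = Suc j)"
    unfolding push_faces_body_def snoc
  proof (rule runs_Seq[where Ta = 11 and Tb = 28 and Q = "\<lambda>t. t = s2"])
    show "runs W ?pre s' 11 (\<lambda>t. t = s2)" by (rule runs_eff[OF adm_pre]) (auto simp: s2_def)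
    fix t assume t: "t = s2"
    have bnd: "?R (mem s 0 j) \<le> B" "?R (mem s 0 ?b) \<le> B" "?R (mem s 0 ?c) \<le> B" using tables(2) tb by auto
    let ?m = "max (max (?R (mem s 0 j)) (?R (mem s 0 ?b))) (?R (mem s 0 ?c))"
    have mle: "?m \<le> B" using bnd by simp
    then have mB: "3 * ?m + 2 < W" using W by linarith
    have L: "Suc (length (xs @ concat (map (face_items q s) [0..<j]))) < W" using len W j by simp
    show "runs W (Cond (Equal 50 4) (Cond (Less 43 48) (Cond (Less 43 49)
         (Seq (block [Assign 54 (Read (q + 1) 51), Assign 55 (Read (q + 1) 52), Assign 56 (Read (q + 1) 53),
            Assign 55 (Minus 55 54), Assign 54 (Plus 54 55), Assign 56 (Minus 56 54), Assign 54 (Plus 54 56),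
            Assign 41 (Plus 54 54), Assign 41 (Plus 41 54), Assign 41 (Plus 41 42)]) (push q))
       Skip) Skip) Skip) t 28 ?Q" (is "runs W (Cond _ (Cond _ (Cond _ ?P Skip) Skip) Skip) t 28 ?Q")
      unfolding t
    proof (rule runs_Cond[where T = 27])
      assume h1: "holds (Equal 50 4) s2"
      show "runs W (Cond (Less 43 48) (Cond (Less 43 49) ?P Skip) Skip) s2 27 ?Q"
      proof (rule runs_Cond[where T = 26])
        assume h2: "holds (Less 43 48) s2"
        show "runs W (Cond (Less 43 49) ?P Skip) s2 26 ?Q"
        proof (rule runs_Cond[where T = 25])
          assume h3: "holds (Less 43 49) s2"
          have it: "face_items q s j = [(2, j, 3 * ?m + 2)]" unfolding face_items_def using h1 h2 h3 s2 by (simp add: Let_def)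
          show "runs W ?P s2 25 ?Q" unfolding it
            by (rule runs_mono[OF runs_push[OF _ _ _ n2, where T = 25 and x = "(2, j, 3 * ?m + 2)"]])
              (use s2 u mB L bnd W mle in \<open>auto simp: nat_max_minus\<close>)
        next
          assume "\<not> holds (Less 43 49) s2" then show "runs W Skip s2 25 ?Q" using s2 by (intro skip) simp
        qed simp
      next
        assume "\<not> holds (Less 43 48) s2" then show "runs W Skip s2 26 ?Q" using s2 by (intro skip) simp
      qed simp
    next
      assume "\<not> holds (Equal 50 4) s2" then show "runs W Skip s2 27 ?Q" using s2 by (intro skip) simp
    qed simp
  qed simp
qed (use assms in auto)

definition keeps :: "nat set \<Rightarrow> nat set \<Rightarrow> state \<Rightarrow> state \<Rightarrow> bool" where
  "keeps R Q s s' \<longleftrightarrow> (\<forall>i\<in>R. regs s' i = regs s i) \<and> (\<forall>i\<in>Q. mem s' i = mem s i)"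

lemma keeps_agree:
  assumes "keeps R Q s s'" "agree c s' s''" "mod_regs c \<inter> R = {}" "mod_mem c \<inter> Q = {}"
  shows "keeps R Q s s''"
  unfolding keeps_def
proof (intro conjI ballI)
  fix i assume "i \<in> R"
  then have "i \<notin> mod_regs c" using assms(3) by blast
  then show "regs s'' i = regs s i" using assms(1) agreeD(1)[OF assms(2)] \<open>i \<in> R\<close> unfolding keeps_def by simp
next
  fix i assume "i \<in> Q"
  then have "i \<notin> mod_mem c" using assms(4) by blast
  then show "mem s'' i = mem s i" using assms(1) agreeD(2)[OF assms(2)] \<open>i \<in> Q\<close> unfolding keeps_def by simp
qed

text \<open>The outer face is added last, under the arc kept in register 5 and with three times the
  bound in register 60 as key. The limit for buckets is larger by three, beyond the keys of lifted
  chords and triangles.\<close>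

definition emit :: "nat \<Rightarrow> nat \<Rightarrow> com" where
  "emit q d = Seq (block [Assign 30 (Reg 4), Assign 40 (Reg 4)]) (Seq (push_verts q)
     (Seq (Assign 30 (Reg 4)) (Seq (While (Less 30 1) (push_edges_body q))
     (Seq (Assign 30 (Reg 4)) (Seq (While (Less 30 1) (push_faces_body q))
     (Seq (Seq (block [Assign 43 (Reg 5), Assign 42 (Const 2), Assign 41 (Plus 60 60), Assign 41 (Plus 41 60),
         Assign 33 (Plus 41 3), Assign 33 (Plus 33 3), Assign 33 (Plus 33 3)]) (push q))
     (pop_all q d)))))))"

definition all_items :: "nat \<Rightarrow> state \<Rightarrow> item list" where
  "all_items q s = map (\<lambda>v. (0, v, 3 * mem s q v)) [0..<regs s 0] @ concat (map (edge_items q s) [0..<regs s 1])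
     @ concat (map (face_items q s) [0..<regs s 1]) @ [(2, regs s 5, 3 * regs s 60)]"

lemma emit_mods:
  "mod_regs (emit q d) = {30, 31, 32, 33, 34, 40, 41, 42, 43, 45, 46, 47, 48, 49, 50, 51, 52, 53, 54, 55, 56}"
  "mod_mem (emit q d) = {q + 2, q + 3, q + 4, q + 5, d, Suc d}"
  unfolding emit_def push_verts_def push_edges_body_def push_faces_body_def pop_all_def push_def by auto

lemma part_mods:
  "mod_regs (push_verts q) = {30, 40, 41, 42, 43, 45, 46}"
  "mod_mem (push_verts q) = {q + 2, q + 3, q + 4, q + 5}"
  "mod_regs (push_edges_body q) = {47, 48, 49, 50, 51, 43, 42, 30, 52, 53, 41, 40, 45}"
  "mod_mem (push_edges_body q) = {q + 2, q + 3, q + 4, q + 5}"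
  "mod_regs (push_faces_body q) = {47, 48, 49, 50, 51, 43, 42, 30, 52, 53, 54, 55, 56, 41, 40, 45}"
  "mod_mem (push_faces_body q) = {q + 2, q + 3, q + 4, q + 5}"
  unfolding push_verts_def push_edges_body_def push_faces_body_def push_def by auto

lemma length_edge_items: "length (concat (map (edge_items q s) [0..<j])) \<le> j"
  by (induction j) (auto simp: edge_items_def Let_def)
lemma length_face_items: "length (concat (map (face_items q s) [0..<j])) \<le> j"
  by (induction j) (auto simp: face_items_def Let_def)

lemma emit:
  assumes r: "regs s 0 = n" "regs s 1 = A" "regs s 3 = 1" "regs s 4 = 0" "regs s 60 = B" "regs s 5 < W"
    and zero: "mem s (q + 2) = (\<lambda>_. 0)"
    and tables: "\<And>a. a < A \<Longrightarrow> mem s 1 a < A \<and> mem s 2 a < A \<and> mem s 0 a < n"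
      "\<And>v. v < n \<Longrightarrow> mem s q v < B \<and> mem s (q + 1) v \<le> B" "\<And>a. mem s 11 a \<le> 1"
    and W: "n + 2 * A + 3 * B + 9 < W" and q: "100 \<le> q" "d < 10"
  shows "runs W (emit q d) s (100 * (n + A + B) + 200) (\<lambda>s'.
      let ys = buckets (all_items q s) (3 * B + 4) in length ys = length (all_items q s) \<and>
       (\<forall>i<length ys. mem s' d i = kind_of (ys ! i) \<and> mem s' (Suc d) i = id_of (ys ! i)))"
proof -
  let ?V = "map (\<lambda>v. (0, v, 3 * mem s q v)) [0..<n]"
  let ?E = "concat (map (edge_items q s) [0..<A])" and ?F = "concat (map (face_items q s) [0..<A])"
  let ?X = "?V @ ?E @ ?F @ [(2, regs s 5, 3 * B)]"
  let ?st = "{0, 1, 3, 4, 5, 60 :: nat}" and ?ar = "{0, 1, 2, 11, q, q + 1}"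
  define good where "good = keeps ?st ?ar s"
  have goodI: "good s''" if "good s'" "agree c s' s''" "mod_regs c \<inter> ?st = {}" "mod_mem c \<inter> ?ar = {}" for c s' s''
    using keeps_agree that unfolding good_def by blast
  have gd: "regs s' 0 = n" "regs s' 1 = A" "regs s' 3 = 1" "regs s' 4 = 0" "regs s' 60 = B" "regs s' 5 = regs s 5"
     "mem s' 0 = mem s 0" "mem s' 1 = mem s 1" "mem s' 2 = mem s 2" "mem s' 11 = mem s 11" "mem s' q = mem s q" "mem s' (q + 1) = mem s (q + 1)"
     if "good s'" for s' using that r unfolding good_def keeps_def by auto
  have ei: "edge_items q s' = edge_items q s" "face_items q s' = face_items q s" if "good s'" for s'
    unfolding edge_items_def face_items_def by (rule ext, simp only: gd[OF that])+
  have g30: "good (t\<lparr>regs := (regs t)(30 := x)\<rparr>)" if "good t" for t x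
    using that unfolding good_def keeps_def by simp
  have n30: "nodes q xs (t\<lparr>regs := (regs t)(30 := x)\<rparr>) = nodes q xs t" for t xs x by (simp add: nodes_def)
  have lens: "length ?E \<le> A" "length ?F \<le> A" using length_edge_items length_face_items by auto
  have keys: "kind_of x < W \<and> id_of x < W \<and> key_of x < 3 * B + 3" if "x \<in> set ?X" for x
  proof -
    consider "x \<in> set ?V" | a where "a < A" "x \<in> set (edge_items q s a)" | a where "a < A" "x \<in> set (face_items q s a)" | "x = (2, regs s 5, 3 * B)"
      using \<open>x \<in> set ?X\<close> by auto
    then show ?thesis
    proof cases
      case 1 then show ?thesis using tables(2) W by fastforce
    next
      case 2
      have "mem s 0 a < n" "mem s 0 (mem s 1 a) < n" using tables(1) 2 by auto
      then have "mem s q (mem s 0 a) \<le> B" "mem s (q + 1) (mem s 0 a) \<le> B" "mem s q (mem s 0 (mem s 1 a)) \<le> B" "mem s (q + 1) (mem s 0 (mem s 1 a)) \<le> B"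
        using tables(2) by (auto simp: less_imp_le_nat)
      then show ?thesis using 2 W unfolding edge_items_def Let_def by (auto simp: max_def split: if_splits)
    next
      case 3
      let ?b = "mem s 2 (mem s 1 a)"
      have "mem s 0 a < n" "mem s 0 ?b < n" "mem s 0 (mem s 2 (mem s 1 ?b)) < n" using tables(1) 3 by auto
      then have "mem s (q + 1) (mem s 0 a) \<le> B" "mem s (q + 1) (mem s 0 ?b) \<le> B" "mem s (q + 1) (mem s 0 (mem s 2 (mem s 1 ?b))) \<le> B"
        using tables(2) by auto
      then have "max (max (mem s (q + 1) (mem s 0 a)) (mem s (q + 1) (mem s 0 ?b))) (mem s (q + 1) (mem s 0 (mem s 2 (mem s 1 ?b)))) \<le> B" by simp
      then show ?thesis using 3 W unfolding face_items_def Let_def by (auto split: if_splits)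
    next
      case 4 then show ?thesis using W r by auto
    qed
  qed
  have items: "all_items q s = ?X" unfolding all_items_def using r by simp
  show ?thesis unfolding emit_def items
  proof (rule runs_Seq[where Ta = 2 and Q = "\<lambda>t. nodes q [] t \<and> good t \<and> regs t 30 = 0" and Tb = "100 * (n + A + B) + 198"])
    show "runs W (block [Assign 30 (Reg 4), Assign 40 (Reg 4)]) s 2 (\<lambda>t. nodes q [] t \<and> good t \<and> regs t 30 = 0)"
      by (rule runs_eff) (use r W zero in \<open>auto simp: nodes_def good_def keeps_def fun_eq_iff\<close>)
    fix s1 assume s1: "nodes q [] s1 \<and> good s1 \<and> regs s1 30 = 0"
    note g = gd[of s1] 
    show "runs W (Seq (push_verts q)
     (Seq (Assign 30 (Reg 4)) (Seq (While (Less 30 1) (push_edges_body q))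
     (Seq (Assign 30 (Reg 4)) (Seq (While (Less 30 1) (push_faces_body q))
     (Seq (Seq (block [Assign 43 (Reg 5), Assign 42 (Const 2), Assign 41 (Plus 60 60), Assign 41 (Plus 41 60),
         Assign 33 (Plus 41 3), Assign 33 (Plus 33 3), Assign 33 (Plus 33 3)]) (push q))
     (pop_all q d))))))) s1 (100 * (n + A + B) + 198) (\<lambda>s'.
      let ys = buckets ?X (3 * B + 4) in length ys = length ?X \<and>
       (\<forall>i<length ys. mem s' d i = kind_of (ys ! i) \<and> mem s' (Suc d) i = id_of (ys ! i)))"
    proof (rule runs_Seq[where Ta = "13 * n + 1" and Q = "nodes q ?V" and Tb = "87 * n + 100 * A + 100 * B + 197"])
      have b3: "3 * mem s q v < W" if "v < n" for v using tables(2)[OF that] W by linarith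
      have "runs W (push_verts q) s1 (13 * n + 1) (nodes q ([] @ map (\<lambda>v. (0, v, 3 * mem s1 q v)) [0..<n]))"
        by (rule push_verts) (use s1 gd[of s1] W b3 in auto)
      then show "runs W (push_verts q) s1 (13 * n + 1) (nodes q ?V)" using gd(11)[of s1] s1 by simp
      fix s2 assume a2: "agree (push_verts q) s1 s2" and n2: "nodes q ?V s2"
      have g2: "good s2" by (rule goodI[of s1, OF _ a2]) (use s1 q in \<open>auto simp: part_mods\<close>)
      show "runs W (Seq (Assign 30 (Reg 4)) (Seq (While (Less 30 1) (push_edges_body q))
     (Seq (Assign 30 (Reg 4)) (Seq (While (Less 30 1) (push_faces_body q))
     (Seq (Seq (block [Assign 43 (Reg 5), Assign 42 (Const 2), Assign 41 (Plus 60 60), Assign 41 (Plus 41 60),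
         Assign 33 (Plus 41 3), Assign 33 (Plus 33 3), Assign 33 (Plus 33 3)]) (push q))
     (pop_all q d)))))) s2 (87 * n + 100 * A + 100 * B + 197) (\<lambda>s'.
      let ys = buckets ?X (3 * B + 4) in length ys = length ?X \<and>
       (\<forall>i<length ys. mem s' d i = kind_of (ys ! i) \<and> mem s' (Suc d) i = id_of (ys ! i)))"
      proof (rule runs_Seq[where Ta = 1 and Q = "\<lambda>t. nodes q ?V t \<and> good t \<and> regs t 30 = 0" and Tb = "87 * n + 100 * A + 100 * B + 196"])
        show "runs W (Assign 30 (Reg 4)) s2 1 (\<lambda>t. nodes q ?V t \<and> good t \<and> regs t 30 = 0)"
          by (rule runs_eff) (use gd(4)[OF g2] W g2 n2 in \<open>simp_all add: g30 n30\<close>)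
        fix s3 assume s3: "nodes q ?V s3 \<and> good s3 \<and> regs s3 30 = 0"
        show "runs W (Seq (While (Less 30 1) (push_edges_body q))
     (Seq (Assign 30 (Reg 4)) (Seq (While (Less 30 1) (push_faces_body q))
     (Seq (Seq (block [Assign 43 (Reg 5), Assign 42 (Const 2), Assign 41 (Plus 60 60), Assign 41 (Plus 41 60),
         Assign 33 (Plus 41 3), Assign 33 (Plus 33 3), Assign 33 (Plus 33 3)]) (push q))
     (pop_all q d))))) s3 (87 * n + 100 * A + 100 * B + 196) (\<lambda>s'.
      let ys = buckets ?X (3 * B + 4) in length ys = length ?X \<and>
       (\<forall>i<length ys. mem s' d i = kind_of (ys ! i) \<and> mem s' (Suc d) i = id_of (ys ! i)))"
        proof (rule runs_Seq[where Ta = "40 * A + 1" and Q = "nodes q (?V @ ?E)" and Tb = "87 * n + 60 * A + 100 * B + 195"])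
          have "runs W (While (Less 30 1) (push_edges_body q)) s3 (40 * A + 1) (nodes q (?V @ concat (map (edge_items q s3) [0..<A])))"
            by (rule push_edges[where n = n and B = B]) (use s3 gd[of s3] W tables q in \<open>auto simp: less_imp_le_nat\<close>)
          then show "runs W (While (Less 30 1) (push_edges_body q)) s3 (40 * A + 1) (nodes q (?V @ ?E))" using ei(1)[of s3] s3 by simp
          fix s4 assume a4: "agree (While (Less 30 1) (push_edges_body q)) s3 s4" and n4: "nodes q (?V @ ?E) s4"
          have g4: "good s4" by (rule goodI[of s3, OF _ a4]) (use s3 q in \<open>auto simp: part_mods\<close>)
          show "runs W (Seq (Assign 30 (Reg 4)) (Seq (While (Less 30 1) (push_faces_body q))
     (Seq (Seq (block [Assign 43 (Reg 5), Assign 42 (Const 2), Assign 41 (Plus 60 60), Assign 41 (Plus 41 60),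
         Assign 33 (Plus 41 3), Assign 33 (Plus 33 3), Assign 33 (Plus 33 3)]) (push q))
     (pop_all q d)))) s4 (87 * n + 60 * A + 100 * B + 195) (\<lambda>s'.
      let ys = buckets ?X (3 * B + 4) in length ys = length ?X \<and>
       (\<forall>i<length ys. mem s' d i = kind_of (ys ! i) \<and> mem s' (Suc d) i = id_of (ys ! i)))"
          proof (rule runs_Seq[where Ta = 1 and Q = "\<lambda>t. nodes q (?V @ ?E) t \<and> good t \<and> regs t 30 = 0" and Tb = "87 * n + 60 * A + 100 * B + 194"])
            show "runs W (Assign 30 (Reg 4)) s4 1 (\<lambda>t. nodes q (?V @ ?E) t \<and> good t \<and> regs t 30 = 0)"
              by (rule runs_eff) (use gd(4)[OF g4] W g4 n4 in \<open>simp_all add: g30 n30\<close>)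
            fix s5 assume s5: "nodes q (?V @ ?E) s5 \<and> good s5 \<and> regs s5 30 = 0"
            show "runs W (Seq (While (Less 30 1) (push_faces_body q))
     (Seq (Seq (block [Assign 43 (Reg 5), Assign 42 (Const 2), Assign 41 (Plus 60 60), Assign 41 (Plus 41 60),
         Assign 33 (Plus 41 3), Assign 33 (Plus 33 3), Assign 33 (Plus 33 3)]) (push q))
     (pop_all q d))) s5 (87 * n + 60 * A + 100 * B + 194) (\<lambda>s'.
      let ys = buckets ?X (3 * B + 4) in length ys = length ?X \<and>
       (\<forall>i<length ys. mem s' d i = kind_of (ys ! i) \<and> mem s' (Suc d) i = id_of (ys ! i)))"
            proof (rule runs_Seq[where Ta = "40 * A + 1" and Q = "nodes q (?V @ ?E @ ?F)" and Tb = "87 * n + 20 * A + 100 * B + 193"])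
              have "runs W (While (Less 30 1) (push_faces_body q)) s5 (40 * A + 1) (nodes q ((?V @ ?E) @ concat (map (face_items q s5) [0..<A])))"
                by (rule push_faces[where n = n and B = B]) (use s5 gd[of s5] W tables q lens in \<open>auto simp: less_imp_le_nat\<close>)
              then show "runs W (While (Less 30 1) (push_faces_body q)) s5 (40 * A + 1) (nodes q (?V @ ?E @ ?F))" using ei(2)[of s5] s5 by simp
              fix s6 assume a6: "agree (While (Less 30 1) (push_faces_body q)) s5 s6" and n6: "nodes q (?V @ ?E @ ?F) s6"
              have g6: "good s6" by (rule goodI[of s5, OF _ a6]) (use s5 q in \<open>auto simp: part_mods\<close>)
              note h = gd[OF g6]
              let ?cs = "[Assign 43 (Reg 5), Assign 42 (Const 2), Assign 41 (Plus 60 60), Assign 41 (Plus 41 60),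
         Assign 33 (Plus 41 3), Assign 33 (Plus 33 3), Assign 33 (Plus 33 3)]"
              show "runs W (Seq (Seq (block ?cs) (push q)) (pop_all q d)) s6 (87 * n + 20 * A + 100 * B + 193) (\<lambda>s'.
      let ys = buckets ?X (3 * B + 4) in length ys = length ?X \<and>
       (\<forall>i<length ys. mem s' d i = kind_of (ys ! i) \<and> mem s' (Suc d) i = id_of (ys ! i)))"
              proof (rule runs_Seq[where Ta = 13 and Q = "\<lambda>t. nodes q ?X t \<and> regs t 3 = 1 \<and> regs t 4 = 0 \<and> regs t 33 = 3 * B + 3" and Tb = "10 * (3 * B + 3 + length ?X) + 10"])
                show "runs W (Seq (block ?cs) (push q)) s6 13 (\<lambda>t. nodes q ?X t \<and> regs t 3 = 1 \<and> regs t 4 = 0 \<and> regs t 33 = 3 * B + 3)"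
                  by (rule runs_mono[OF runs_push[OF _ _ _ n6, where T = 13 and x = "(2, regs s 5, 3 * B)"]])
                    (use h r W lens in auto)
                show "13 + (10 * (3 * B + 3 + length ?X) + 10) \<le> 87 * n + 20 * A + 100 * B + 193" using lens by simp
                fix s7 assume s7: "nodes q ?X s7 \<and> regs s7 3 = 1 \<and> regs s7 4 = 0 \<and> regs s7 33 = 3 * B + 3"
                have "runs W (pop_all q d) s7 (10 * (3 * B + 3 + length ?X) + 10) (\<lambda>s'.
                    \<forall>i<length ?X. mem s' d i = kind_of (buckets ?X (Suc (3 * B + 3)) ! i) \<and> mem s' (Suc d) i = id_of (buckets ?X (Suc (3 * B + 3)) ! i))"
                  by (rule pop_all) (use s7 keys W lens q in auto)
                moreover have "length (buckets ?X (3 * B + 4)) = length ?X"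
                proof (rule length_buckets)
                  fix x assume "x \<in> set ?X"
                  from keys[OF this] show "key_of x < 3 * B + 4" by linarith
                qed
                moreover have "Suc (3 * B + 3) = 3 * B + 4" by simp
                ultimately show "runs W (pop_all q d) s7 (10 * (3 * B + 3 + length ?X) + 10) (\<lambda>s'.
      let ys = buckets ?X (3 * B + 4) in length ys = length ?X \<and>
       (\<forall>i<length ys. mem s' d i = kind_of (ys ! i) \<and> mem s' (Suc d) i = id_of (ys ! i)))"
                  unfolding Let_def by simp
              qed
            qed simp
          qed simp
        qed simp
      qed simp
    qed simp
  qed simp
qed

text \<open>Register 31 holds 0 for a vertex \<open>r i\<close> and \<open>j + 1\<close> for a vertex \<open>p j\<close>, register 32 holds
  \<open>i\<close>. Registers 60, 64, 65, 66 hold \<open>4 * S, S, 2 * S, 3 * S\<close>; 61, 62, 63 hold the three turns.\<close>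

definition store_rank :: "nat \<Rightarrow> nat \<Rightarrow> nat \<Rightarrow> com" where
  "store_rank q x y = block [Write q 35 x, Write (q + 1) 35 y]"

definition rank_sel :: "nat \<Rightarrow> nat \<Rightarrow> com" where
  "rank_sel k q =
    (if k = 0 then
      Cond (Equal 31 4)
        (Cond (Less 32 62) (Seq (block [Assign 33 (Minus 62 32), Assign 33 (Plus 33 68)]) (store_rank q 33 33))
          (Cond (Less 62 32) (Seq (block [Assign 33 (Minus 32 62), Assign 33 (Plus 33 69)]) (store_rank q 33 33))
            (store_rank q 3 3)))
        (Cond (Equal 31 70) (store_rank q 4 4) (Cond (Equal 31 71) (store_rank q 4 4) (store_rank q 66 60)))
     else if k = 1 then
      Cond (Equal 31 4)
        (Cond (Less 32 63)
          (Cond (Less 32 67) (Seq (block [Assign 33 (Plus 65 32), Assign 33 (Plus 33 3)]) (store_rank q 33 33))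
            (Seq (block [Assign 33 (Minus 63 32), Assign 33 (Plus 33 64)]) (store_rank q 33 33)))
          (Seq (block [Assign 33 (Minus 32 63), Assign 33 (Plus 33 3)]) (store_rank q 33 33)))
        (Cond (Equal 31 3) (store_rank q 65 65) (Cond (Equal 31 70) (store_rank q 66 60) (store_rank q 4 4)))
     else
      Cond (Equal 31 4)
        (Cond (Less 61 32)
          (Cond (Less 32 62) (Seq (block [Assign 33 (Minus 32 61), Assign 33 (Plus 33 64)]) (store_rank q 33 33))
            (Seq (block [Assign 33 (Minus 66 32)]) (store_rank q 33 33)))
          (Seq (block [Assign 33 (Minus 61 32), Assign 33 (Plus 33 3)]) (store_rank q 33 33)))
        (Cond (Equal 31 71) (store_rank q 66 60) (Cond (Equal 31 3) (store_rank q 4 4) (Cond (Equal 31 70) (store_rank q 4 4) (store_rank q 65 65)))))"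

definition rank_of :: "nat \<Rightarrow> nat \<Rightarrow> nat \<Rightarrow> nat \<Rightarrow> nat \<Rightarrow> nat \<Rightarrow> nat \<Rightarrow> nat" where
  "rank_of S i1 i2 i3 k x i = (if x = 0 then rank_r S i1 i2 i3 k i else rank_p S k (x - 1))"

text \<open>Giving a coloured vertex the rank \<open>4 * S\<close> turns \<open>level\<close> into
  an ordinary maximum of ranks, so that lifting needs no case distinction when edges and faces are
  processed.\<close>

definition high_rank_of :: "nat \<Rightarrow> nat \<Rightarrow> nat \<Rightarrow> nat \<Rightarrow> nat \<Rightarrow> nat \<Rightarrow> nat \<Rightarrow> nat" where
  "high_rank_of S i1 i2 i3 k x i = (if x \<noteq> 0 \<and> (x - 1) mod 3 = k then 4 * S else rank_of S i1 i2 i3 k x i)"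

definition rank_regs :: "nat \<Rightarrow> nat \<Rightarrow> nat \<Rightarrow> nat \<Rightarrow> state \<Rightarrow> bool" where
  "rank_regs S i1 i2 i3 s \<longleftrightarrow> regs s 3 = 1 \<and> regs s 4 = 0 \<and> regs s 60 = 4 * S \<and> regs s 61 = i1 \<and> regs s 62 = i2 \<and> regs s 63 = i3 \<and>
     regs s 64 = S \<and> regs s 65 = 2 * S \<and> regs s 66 = 3 * S \<and> regs s 67 = (if i1 = i2 then i2 + 1 else i2) \<and>
     regs s 68 = (if i1 = i2 then S else 1) \<and> regs s 69 = (if i1 = i2 then 1 else S) \<and> regs s 70 = 2 \<and> regs s 71 = 3"

lemma rank_sel:
  assumes rr: "rank_regs S i1 i2 i3 s" and x: "regs s 31 \<le> 4" and k: "k < 3"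
    and W: "4 * S < W" "S + i3 + 1 < W" "S + regs s 32 + 1 < W" "2 * S + regs s 32 + 1 < W" "S + i1 + 1 < W" "S + i2 + 1 < W" "1 < W"
  shows "adm W (rank_sel k q) s" 
    "mem (eff (rank_sel k q) s) = (mem s)(q := (mem s q)(regs s 35 := rank_of S i1 i2 i3 k (regs s 31) (regs s 32)),
       q + 1 := (mem s (q + 1))(regs s 35 := high_rank_of S i1 i2 i3 k (regs s 31) (regs s 32)))"
proof -
  have r: "regs s 3 = 1" "regs s 4 = 0" "regs s 60 = 4 * S" "regs s 61 = i1" "regs s 62 = i2" "regs s 63 = i3"
     "regs s 64 = S" "regs s 65 = 2 * S" "regs s 66 = 3 * S" "regs s 67 = (if i1 = i2 then i2 + 1 else i2)"
     "regs s 68 = (if i1 = i2 then S else 1)" "regs s 69 = (if i1 = i2 then 1 else S)" "regs s 70 = 2" "regs s 71 = 3"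
    using rr unfolding rank_regs_def by auto
  have k3: "k = 0 \<or> k = 1 \<or> k = 2" using k by auto
  have x5: "regs s 31 = 0 \<or> regs s 31 = 1 \<or> regs s 31 = 2 \<or> regs s 31 = 3 \<or> regs s 31 = 4" using x by auto
  show "adm W (rank_sel k q) s"
    using k3 W unfolding rank_sel_def store_rank_def by (elim disjE) (auto simp: r)
  show "mem (eff (rank_sel k q) s) = (mem s)(q := (mem s q)(regs s 35 := rank_of S i1 i2 i3 k (regs s 31) (regs s 32)),
       q + 1 := (mem s (q + 1))(regs s 35 := high_rank_of S i1 i2 i3 k (regs s 31) (regs s 32)))"
    using k3 x5
    by (elim disjE; simp add: rank_sel_def store_rank_def r rank_of_def high_rank_of_def rank_p_def rank_r_def; simp add: add.commute)
qed

lemma rank_sel_mods: "mod_regs (rank_sel k q) \<subseteq> {33}" "mod_mem (rank_sel k q) = {q, q + 1}" "cost (rank_sel k q) \<le> 40"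
  unfolding rank_sel_def store_rank_def by auto

definition rank_body :: "nat \<Rightarrow> nat \<Rightarrow> nat \<Rightarrow> com" where
  "rank_body k q P = Seq (block [Assign 31 (Read P 30), Assign 32 (Read (P + 1) 30), Assign 35 (Reg 30), Assign 30 (Plus 30 3)]) (rank_sel k q)"

lemma rank_body_mods: "mod_regs (rank_body k q P) \<subseteq> {30, 31, 32, 33, 35}" "mod_mem (rank_body k q P) = {q, q + 1}"
proof -
  have "mod_regs (rank_body k q P) = {31, 32, 35, 30} \<union> mod_regs (rank_sel k q)" unfolding rank_body_def by (simp add: insert_commute)
  then show "mod_regs (rank_body k q P) \<subseteq> {30, 31, 32, 33, 35}" using rank_sel_mods(1)[of k q] by blast
  show "mod_mem (rank_body k q P) = {q, q + 1}" unfolding rank_body_def using rank_sel_mods(2)[of k q] by simp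
qed

lemma rank_loop:
  assumes rr: "rank_regs S i1 i2 i3 s" and n: "regs s 0 = n" "regs s 30 = 0" and k: "k < 3"
    and P: "\<And>v. v < n \<Longrightarrow> mem s P v \<le> 4 \<and> mem s (P + 1) v < S" "P + 1 < q"
    and W: "4 * S < W" "i1 \<le> S" "i2 \<le> S" "i3 \<le> S" "3 < S" "n < S"
  shows "runs W (While (Less 30 0) (rank_body k q P)) s (50 * n + 1) (\<lambda>s'. \<forall>v<n.
      mem s' q v = rank_of S i1 i2 i3 k (mem s P v) (mem s (P + 1) v) \<and>
      mem s' (q + 1) v = high_rank_of S i1 i2 i3 k (mem s P v) (mem s (P + 1) v))"
proof (rule runs_for[where n = n and T = 49 and Inv = "\<lambda>j s'. \<forall>v<j. mem s' q v = rank_of S i1 i2 i3 k (mem s P v) (mem s (P + 1) v) \<and>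
      mem s' (q + 1) v = high_rank_of S i1 i2 i3 k (mem s P v) (mem s (P + 1) v)"])
  show "0 \<notin> mod_regs (rank_body k q P)" using rank_body_mods(1)[of k q P] by auto
  fix s' j assume a: "agree (rank_body k q P) s s'" and j: "regs s' 30 = j" "j < n"
    and I: "\<forall>v<j. mem s' q v = rank_of S i1 i2 i3 k (mem s P v) (mem s (P + 1) v) \<and>
      mem s' (q + 1) v = high_rank_of S i1 i2 i3 k (mem s P v) (mem s (P + 1) v)"
  have kr: "regs s' i = regs s i" if "i \<notin> {30, 31, 32, 33, 35}" for i using agreeD(1)[OF a] rank_body_mods(1) that by blast
  have km: "mem s' P = mem s P" "mem s' (P + 1) = mem s (P + 1)" using agreeD(2)[OF a] P(2) unfolding rank_body_mods(2) by auto
  let ?pre = "block [Assign 31 (Read P 30), Assign 32 (Read (P + 1) 30), Assign 35 (Reg 30), Assign 30 (Plus 30 3)]"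
  define s2 where "s2 = eff ?pre s'"
  have r3: "regs s' 3 = 1" using kr[of 3] rr unfolding rank_regs_def by simp
  have s2: "regs s2 31 = mem s P j" "regs s2 32 = mem s (P + 1) j" "regs s2 35 = j" "regs s2 30 = Suc j" "mem s2 = mem s'"
    unfolding s2_def using km j r3 by simp_all
  have s2r: "regs s2 i = regs s i" if "i \<notin> {30, 31, 32, 33, 35}" for i unfolding s2_def using kr[OF that] that by simp
  have rr2: "rank_regs S i1 i2 i3 s2" using rr unfolding rank_regs_def by (simp add: s2r)
  have Pj: "mem s P j \<le> 4" "mem s (P + 1) j < S" using P(1)[OF j(2)] by auto
  note sel = rank_sel[OF rr2 _ k, of W q]
  have sW: "adm W (rank_sel k q) s2" and sm: "mem (eff (rank_sel k q) s2) = (mem s2)(q := (mem s2 q)(regs s2 35 := rank_of S i1 i2 i3 k (regs s2 31) (regs s2 32)),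
       q + 1 := (mem s2 (q + 1))(regs s2 35 := high_rank_of S i1 i2 i3 k (regs s2 31) (regs s2 32)))"
    using sel Pj s2 W by auto
  have r30: "regs (eff (rank_sel k q) s2) 30 = Suc j"
  proof -
    have "agree (rank_sel k q) s2 (eff (rank_sel k q) s2)" using exec_eff[OF sW] exec_agree by blast
    moreover have "30 \<notin> mod_regs (rank_sel k q)"
    proof
      assume "30 \<in> mod_regs (rank_sel k q)"
      then have "30 \<in> {33 :: nat}" using rank_sel_mods(1) by blast
      then show False by simp
    qed
    ultimately show ?thesis using agreeD(1) s2(4) by metis
  qed
  show "runs W (rank_body k q P) s' 49 (\<lambda>s''. (\<forall>v<Suc j. mem s'' q v = rank_of S i1 i2 i3 k (mem s P v) (mem s (P + 1) v) \<and>
      mem s'' (q + 1) v = high_rank_of S i1 i2 i3 k (mem s P v) (mem s (P + 1) v)) \<and> regs s'' 30 = Suc j)"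
    unfolding rank_body_def
  proof (rule runs_eff)
    have "adm W ?pre s'" using km j Pj W r3 by auto
    then show "adm W (Seq ?pre (rank_sel k q)) s'" using sW unfolding s2_def by simp
    show "cost (Seq ?pre (rank_sel k q)) \<le> 49" using rank_sel_mods(3)[of k q] by simp
    have e: "eff (Seq ?pre (rank_sel k q)) s' = eff (rank_sel k q) s2" unfolding s2_def by simp
    show "(\<forall>v<Suc j. mem (eff (Seq ?pre (rank_sel k q)) s') q v = rank_of S i1 i2 i3 k (mem s P v) (mem s (P + 1) v) \<and>
      mem (eff (Seq ?pre (rank_sel k q)) s') (q + 1) v = high_rank_of S i1 i2 i3 k (mem s P v) (mem s (P + 1) v)) \<and> regs (eff (Seq ?pre (rank_sel k q)) s') 30 = Suc j"
      unfolding e sm using r30 I s2 by (auto simp: less_Suc_eq)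
  qed
qed (use n in auto)

text \<open>The walk along the outer face: array 10 records the arcs met in two rounds, array 11 marks
  them, and registers 20 and 21 keep the last two positions where the rotation has order two.\<close>

definition walk_body :: com where
  "walk_body = Seq (block [Write 10 7 2, Write 11 2 3, Assign 8 (Read 2 2), Assign 8 (Read 2 8), Assign 9 (Reg 2),
       Assign 10 (Read 1 2), Assign 2 (Read 2 10), Assign 12 (Reg 7), Assign 7 (Plus 7 3)])
     (Cond (Less 12 0) (Cond (Equal 8 9) (block [Assign 20 (Reg 21), Assign 21 (Reg 12)]) Skip) Skip)"

text \<open>The two leading zeros of \<open>zs\<close> are the initial contents of registers 20 and
  21, so the statement about the last two positions holds even before two of them have been met. Two
  rounds are recorded so that a side can be read off without reducing indices, but only positions of
  the first round are tested.\<close>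

lemma walk:
  assumes r: "regs s 0 = n" "regs s 3 = 1" "regs s 7 = 0" "regs s 6 = 2 * n" "regs s 20 = 0" "regs s 21 = 0"
    and zero: "mem s 11 = (\<lambda>_. 0)"
    and tables: "\<And>a. a < A \<Longrightarrow> mem s 1 a < A \<and> mem s 2 a < A" "regs s 2 < A" and W: "A < W" "2 * n < W"
  defines "f \<equiv> \<lambda>j. ((\<lambda>a. mem s 2 (mem s 1 a)) ^^ j) (regs s 2)"
  defines "zs \<equiv> 0 # 0 # filter (\<lambda>j. mem s 2 (mem s 2 (f j)) = f j) [0..<n]"
  shows "runs W (While (Less 7 6) walk_body) s (40 * n + 1) (\<lambda>s'. (\<forall>j<2 * n. mem s' 10 j = f j) \<and>
     (\<forall>a. mem s' 11 a = (if a \<in> f ` {..<2 * n} then 1 else 0)) \<and>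
     regs s' 20 = zs ! (length zs - 2) \<and> regs s' 21 = zs ! (length zs - 1))"
proof -
  define g where "g j = 0 # 0 # filter (\<lambda>j. mem s 2 (mem s 2 (f j)) = f j) [0..<min j n]" for j
  have fA: "f j < A" for j unfolding f_def using tables by (induction j) auto
  have gl: "2 \<le> length (g j)" for j unfolding g_def by simp
  have "runs W (While (Less 7 6) walk_body) s (40 * n + 1) ((\<lambda>j s'. regs s' 2 = f j \<and> (\<forall>i<j. mem s' 10 i = f i) \<and>
     (\<forall>a. mem s' 11 a = (if a \<in> f ` {..<j} then 1 else 0)) \<and>
     regs s' 20 = g j ! (length (g j) - 2) \<and> regs s' 21 = g j ! (length (g j) - 1)) (2 * n))"
  proof (rule runs_for[where n = "2 * n" and T = 19])
    show "6 \<notin> mod_regs walk_body" unfolding walk_body_def by simp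
    show "regs s 2 = f 0 \<and> (\<forall>i<0. mem s 10 i = f i) \<and>
     (\<forall>a. mem s 11 a = (if a \<in> f ` {..<0} then 1 else 0)) \<and>
     regs s 20 = g 0 ! (length (g 0) - 2) \<and> regs s 21 = g 0 ! (length (g 0) - 1)"
      unfolding g_def f_def using zero r by simp
    fix s' j
    assume a: "agree walk_body s s'" and j: "regs s' 7 = j" "j < 2 * n"
      and I: "regs s' 2 = f j \<and> (\<forall>i<j. mem s' 10 i = f i) \<and>
     (\<forall>a. mem s' 11 a = (if a \<in> f ` {..<j} then 1 else 0)) \<and>
     regs s' 20 = g j ! (length (g j) - 2) \<and> regs s' 21 = g j ! (length (g j) - 1)"
    have u: "regs s' 0 = n" "regs s' 3 = 1" "mem s' 1 = mem s 1" "mem s' 2 = mem s 2"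
      using agreeD[OF a] r unfolding walk_body_def by auto
    let ?pre = "block [Write 10 7 2, Write 11 2 3, Assign 8 (Read 2 2), Assign 8 (Read 2 8), Assign 9 (Reg 2),
       Assign 10 (Read 1 2), Assign 2 (Read 2 10), Assign 12 (Reg 7), Assign 7 (Plus 7 3)]"
    define s2 where "s2 = eff ?pre s'"
    have s2: "regs s2 0 = n" "regs s2 8 = mem s 2 (mem s 2 (f j))" "regs s2 9 = f j" "regs s2 12 = j" "regs s2 7 = Suc j" "regs s2 2 = f (Suc j)"
      "mem s2 10 = (mem s' 10)(j := f j)" "mem s2 11 = (mem s' 11)(f j := 1)" "regs s2 20 = regs s' 20" "regs s2 21 = regs s' 21"
      unfolding s2_def using u j I by (simp_all add: f_def)
    have tb: "mem s 2 (f j) < A" "mem s 2 (mem s 2 (f j)) < A" "mem s 1 (f j) < A" "mem s 2 (mem s 1 (f j)) < A"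
      using tables fA[of j] by auto
    have adm: "adm W ?pre s'" using u j I tb fA[of j] W by auto
    have gS: "g (Suc j) = (if j < n \<and> mem s 2 (mem s 2 (f j)) = f j then g j @ [j] else g j)"
      unfolding g_def by (cases "j < n") (auto simp: min_def)
    have glW: "g j ! (length (g j) - 1) < W"
    proof -
      have "g j ! (length (g j) - 1) \<in> set (g j)" using gl[of j] by (intro nth_mem) simp
      then show ?thesis using W j unfolding g_def by auto
    qed
    let ?Q = "\<lambda>s''. (regs s'' 2 = f (Suc j) \<and> (\<forall>i<Suc j. mem s'' 10 i = f i) \<and>
       (\<forall>a. mem s'' 11 a = (if a \<in> f ` {..<Suc j} then 1 else 0)) \<and>
       regs s'' 20 = g (Suc j) ! (length (g (Suc j)) - 2) \<and> regs s'' 21 = g (Suc j) ! (length (g (Suc j)) - 1)) \<and> regs s'' 7 = Suc j"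
    have base: "regs s2 2 = f (Suc j) \<and> (\<forall>i<Suc j. mem s2 10 i = f i) \<and>
       (\<forall>a. mem s2 11 a = (if a \<in> f ` {..<Suc j} then 1 else 0)) \<and> regs s2 7 = Suc j"
      using I s2 by (auto simp: less_Suc_eq lessThan_Suc)
    show "runs W walk_body s' 19 ?Q"
      unfolding walk_body_def
    proof (rule runs_Seq[where Ta = 9 and Tb = 10 and Q = "\<lambda>t. t = s2"])
      show "runs W ?pre s' 9 (\<lambda>t. t = s2)" by (rule runs_eff[OF adm]) (auto simp: s2_def)
      fix t assume t: "t = s2"
      show "runs W (Cond (Less 12 0) (Cond (Equal 8 9) (block [Assign 20 (Reg 21), Assign 21 (Reg 12)]) Skip) Skip) t 10 ?Q"
        unfolding t
      proof (rule runs_eff)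
        show "adm W (Cond (Less 12 0) (Cond (Equal 8 9) (block [Assign 20 (Reg 21), Assign 21 (Reg 12)]) Skip) Skip) s2"
          using s2 glW I W by auto
        show "?Q (eff (Cond (Less 12 0) (Cond (Equal 8 9) (block [Assign 20 (Reg 21), Assign 21 (Reg 12)]) Skip) Skip) s2)"
        proof (cases "j < n \<and> mem s 2 (mem s 2 (f j)) = f j")
          case True
          then show ?thesis using base s2 I gS gl[of j] by (auto simp: nth_append)
        next
          case False
          then have "eff (Cond (Less 12 0) (Cond (Equal 8 9) (block [Assign 20 (Reg 21), Assign 21 (Reg 12)]) Skip) Skip) s2 = s2" using s2 by auto
          then show ?thesis using base s2 I gS False by simp
        qed
      qed simp
    qed simp
  qed (use r in auto)
  moreover have gz: "g (2 * n) = zs" unfolding g_def zs_def by simp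
  ultimately show ?thesis by (elim runs_mono) (simp_all add: gz)
qed

section \<open>Labelling both sides and locating the turns\<close>

lemma runs_fill:
  assumes s: "regs s i = 0" "regs s l = L" "l \<notin> mod_regs c" and inj: "inj_on g {..<L}"
    and step: "\<And>s' j. agree c s s' \<Longrightarrow> regs s' i = j \<Longrightarrow> j < L \<Longrightarrow>
        runs W c s' T (\<lambda>s''. mem s'' X = (mem s' X)(g j := h j) \<and> regs s'' i = Suc j)"
    and T: "Suc (L * Suc T) \<le> T'"
  shows "runs W (While (Less i l) c) s T' (\<lambda>s'. (\<forall>j<L. mem s' X (g j) = h j) \<and> (\<forall>v. v \<notin> g ` {..<L} \<longrightarrow> mem s' X v = mem s X v))"
proof -
  have "runs W (While (Less i l) c) s T' ((\<lambda>L s'. (\<forall>j<L. mem s' X (g j) = h j) \<and> (\<forall>v. v \<notin> g ` {..<L} \<longrightarrow> mem s' X v = mem s X v)) L)"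
  proof (rule runs_for[where n = L and T = T])
    fix s' j assume a: "agree c s s'" and I: "(\<forall>ja<j. mem s' X (g ja) = h ja) \<and> (\<forall>v. v \<notin> g ` {..<j} \<longrightarrow> mem s' X v = mem s X v)"
      and j: "regs s' i = j" "j < L"
    show "runs W c s' T (\<lambda>s''. ((\<forall>ja<Suc j. mem s'' X (g ja) = h ja) \<and> (\<forall>v. v \<notin> g ` {..<Suc j} \<longrightarrow> mem s'' X v = mem s X v)) \<and> regs s'' i = Suc j)"
    proof (rule runs_mono[OF step[OF a j] order_refl])
      fix s'' assume e: "mem s'' X = (mem s' X)(g j := h j) \<and> regs s'' i = Suc j"
      have "g ja \<noteq> g j" if "ja < j" for ja using inj that j(2) by (auto dest: inj_onD)
      then show "((\<forall>ja<Suc j. mem s'' X (g ja) = h ja) \<and> (\<forall>v. v \<notin> g ` {..<Suc j} \<longrightarrow> mem s'' X v = mem s X v)) \<and> regs s'' i = Suc j"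
        using e I by (auto simp: less_Suc_eq lessThan_Suc)
    qed
  qed (use s T in auto)
  then show ?thesis by simp
qed

text \<open>One scan over the arcs. With \<open>P\<close> equal to 0 on the
  \<open>r\<close>-vertices and to \<open>j + 1\<close> on \<open>p j\<close>, and with
  \<open>R\<close> the index of an \<open>r\<close>-vertex, the value at \<open>j + 1\<close> is the
  largest index of an \<open>r\<close>-vertex adjacent to \<open>p j\<close>, which is
  \<open>hi j\<close>.\<close>

primrec fan_max :: "(nat \<Rightarrow> nat) \<Rightarrow> (nat \<Rightarrow> nat) \<Rightarrow> (nat \<Rightarrow> nat) \<Rightarrow> (nat \<Rightarrow> nat) \<Rightarrow> nat \<Rightarrow> nat \<Rightarrow> nat" where
  "fan_max P R ta he 0 x = 0"
| "fan_max P R ta he (Suc a) x = (if P (he a) = 0 \<and> P (ta a) = x then max (fan_max P R ta he a x) (R (he a)) else fan_max P R ta he a x)"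

text \<open>Registers 22, 23, 25 hold the position of the first ear, \<open>K\<close> and \<open>N\<close>.\<close>

definition fill_r :: "nat \<Rightarrow> com" where
  "fill_r P = block [Assign 31 (Minus 27 30), Assign 32 (Read 10 31), Assign 32 (Read 0 32), Write (P + 1) 32 30, Assign 30 (Plus 30 3)]"
definition fill_p :: "nat \<Rightarrow> com" where
  "fill_p P = block [Assign 31 (Plus 22 30), Assign 31 (Plus 31 3), Assign 32 (Read 10 31), Assign 32 (Read 0 32),
     Assign 30 (Plus 30 3), Write P 32 30]"
definition fill_h :: "nat \<Rightarrow> com" where
  "fill_h P = Seq (block [Assign 31 (Read 1 30), Assign 31 (Read 0 31), Assign 32 (Read 0 30), Assign 33 (Read P 31), Assign 34 (Read P 32),
     Assign 35 (Read (P + 2) 34), Assign 36 (Read (P + 1) 31), Assign 30 (Plus 30 3)])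
     (Cond (Equal 33 4) (Cond (Less 35 36) (Write (P + 2) 34 36) Skip) Skip)"
text \<open>The second branches compute the imagined turns: \<open>N + 2 - K\<close>,
  \<open>N + 3 - K\<close> and \<open>N + 4 - K\<close>, as in \<open>turn\<close>.\<close>

definition find_turns :: "nat \<Rightarrow> com" where
  "find_turns P = block [
     Cond (Less 3 23) (Assign 61 (Read (P + 2) 3)) (block [Assign 61 (Plus 25 70), Assign 61 (Minus 61 23)]),
     Cond (Less 70 23) (Assign 62 (Read (P + 2) 70)) (block [Assign 62 (Plus 25 71), Assign 62 (Minus 62 23)]),
     Cond (Less 71 23) (Assign 63 (Read (P + 2) 71)) (block [Assign 63 (Plus 25 71), Assign 63 (Plus 63 3), Assign 63 (Minus 63 23)])]"
definition setup_side :: "nat \<Rightarrow> com" where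
  "setup_side P = Seq (block [Assign 26 (Plus 25 3), Assign 27 (Plus 22 0), Assign 30 (Reg 4)])
    (Seq (While (Less 30 26) (fill_r P)) (Seq (Assign 30 (Reg 4)) (Seq (While (Less 30 23) (fill_p P))
    (Seq (Assign 30 (Reg 4)) (Seq (While (Less 30 1) (fill_h P)) (find_turns P))))))"

lemma setup_mods:
  "mod_regs (fill_r P) = {31, 32, 30}" "mod_mem (fill_r P) = {P + 1}"
  "mod_regs (fill_p P) = {31, 32, 30}" "mod_mem (fill_p P) = {P}"
  "mod_regs (fill_h P) = {30, 31, 32, 33, 34, 35, 36}" "mod_mem (fill_h P) = {P + 2}"
  "mod_regs (setup_side P) = {26, 27, 30, 31, 32, 33, 34, 35, 36, 61, 62, 63}" "mod_mem (setup_side P) = {P, P + 1, P + 2}"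
  unfolding setup_side_def fill_r_def fill_p_def fill_h_def find_turns_def by auto

lemma runs_fill_h:
  assumes r: "regs s 30 = 0" "regs s 1 = A" "regs s 3 = 1" "regs s 4 = 0" and zero: "mem s (P + 2) = (\<lambda>_. 0)"
    and tables: "\<And>a. a < A \<Longrightarrow> mem s 1 a < A \<and> mem s 0 a < n"
    and small: "\<And>v. mem s P v \<le> 4" "\<And>v. mem s (P + 1) v \<le> n" and W: "A < W" "n < W" "4 < W" and P: "12 < P"
  shows "runs W (While (Less 30 1) (fill_h P)) s (20 * A + 1) (\<lambda>s'. mem s' (P + 2) =
     fan_max (mem s P) (mem s (P + 1)) (mem s 0) (\<lambda>a. mem s 0 (mem s 1 a)) A)"
proof -
  let ?F = "\<lambda>j. fan_max (mem s P) (mem s (P + 1)) (mem s 0) (\<lambda>a. mem s 0 (mem s 1 a)) j"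
  have Fn: "?F j x \<le> n" for j x using small by (induction j) auto
  have "runs W (While (Less 30 1) (fill_h P)) s (20 * A + 1) ((\<lambda>j s'. mem s' (P + 2) = ?F j) A)"
  proof (rule runs_for[where n = A and T = 19])
    show "1 \<notin> mod_regs (fill_h P)" unfolding setup_mods by simp
    fix s' j assume a: "agree (fill_h P) s s'" and I: "mem s' (P + 2) = ?F j" and j: "regs s' 30 = j" "j < A"
    have u: "regs s' 3 = 1" "regs s' 4 = 0" "mem s' 0 = mem s 0" "mem s' 1 = mem s 1" "mem s' P = mem s P" "mem s' (P + 1) = mem s (P + 1)"
      using agreeD[OF a, unfolded setup_mods] r P by auto
    let ?h = "mem s 0 (mem s 1 j)" and ?t = "mem s 0 j"
    have tb: "mem s 1 j < A" "?h < n" "?t < n" using tables j by auto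
    have I': "mem s' (Suc (Suc P)) = ?F j" using I by simp
    have F1: "?F (Suc j) = (if mem s P ?h = 0 \<and> ?F j (mem s P ?t) < mem s (P + 1) ?h then (?F j)(mem s P ?t := mem s (P + 1) ?h) else ?F j)"
      by (rule ext) (auto simp: max_def)
    show "runs W (fill_h P) s' 19 (\<lambda>s''. mem s'' (P + 2) = ?F (Suc j) \<and> regs s'' 30 = Suc j)"
      unfolding F1 fill_h_def
    proof (rule runs_eff)
      show "adm W (Seq (block [Assign 31 (Read 1 30), Assign 31 (Read 0 31), Assign 32 (Read 0 30), Assign 33 (Read P 31), Assign 34 (Read P 32),
     Assign 35 (Read (P + 2) 34), Assign 36 (Read (P + 1) 31), Assign 30 (Plus 30 3)])
     (Cond (Equal 33 4) (Cond (Less 35 36) (Write (P + 2) 34 36) Skip) Skip)) s'"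
        using u j tb W I I' Fn[of j "mem s P ?t"] le_less_trans[OF small(1), of W ?h] le_less_trans[OF small(1), of W ?t] le_less_trans[OF small(2), of W ?h] by auto
    qed (use u j I I' in auto)
  qed (use r zero in auto)
  then show ?thesis by simp
qed

lemma find_turns:
  assumes s: "regs s 3 = 1" "regs s 23 = K" "regs s 25 = N" "regs s 70 = 2" "regs s 71 = 3" "mem s (P + 2) = H"
    and K: "1 \<le> K" "K \<le> 4" and W: "\<And>x. H x < W" "N + 5 < W"
  shows "adm W (find_turns P) s" "mem (eff (find_turns P) s) = mem s"
    "regs (eff (find_turns P) s) 61 = (if 1 < K then H 1 else N + 2 - K)"
    "regs (eff (find_turns P) s) 62 = (if 2 < K then H 2 else N + 3 - K)"
    "regs (eff (find_turns P) s) 63 = (if 3 < K then H 3 else N + 4 - K)"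
proof -
  have H: "mem s (Suc (Suc P)) = H" using s(6) by simp
  have K4: "K = 1 \<or> K = 2 \<or> K = 3 \<or> K = 4" using K by auto
  show "adm W (find_turns P) s" unfolding find_turns_def using K4 W by (elim disjE) (simp_all add: s(1-5) H)
  show "mem (eff (find_turns P) s) = mem s" unfolding find_turns_def by simp
  show "regs (eff (find_turns P) s) 61 = (if 1 < K then H 1 else N + 2 - K)"
    "regs (eff (find_turns P) s) 62 = (if 2 < K then H 2 else N + 3 - K)"
    "regs (eff (find_turns P) s) 63 = (if 3 < K then H 3 else N + 4 - K)"
    unfolding find_turns_def using K4 by (elim disjE; simp add: s(1-5) H)+
qed

lemma setup_side:
  assumes r: "regs s 0 = n" "regs s 1 = A" "regs s 3 = 1" "regs s 4 = 0" "regs s 22 = st" "regs s 23 = K" "regs s 25 = N" "regs s 70 = 2" "regs s 71 = 3"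
    and K: "1 \<le> K" "K \<le> 4" "n = K + N + 1" "st < n"
    and zero: "mem s P = (\<lambda>_. 0)" "mem s (P + 1) = (\<lambda>_. 0)" "mem s (P + 2) = (\<lambda>_. 0)"
    and tables: "\<And>a. a < A \<Longrightarrow> mem s 1 a < A \<and> mem s 0 a < n" "\<And>j. j < 2 * n \<Longrightarrow> mem s 10 j < A"
    and W: "A < W" "2 * n + 10 < W" and P: "12 < P"
  defines "pv \<equiv> \<lambda>j. mem s 0 (mem s 10 (st + j + 1))" and "rv \<equiv> \<lambda>i. mem s 0 (mem s 10 (st + n - i))"
  assumes inj: "inj_on pv {..<K}" "inj_on rv {..<N + 1}"
  shows "runs W (setup_side P) s (20 * A + 50 * n + 100) (\<lambda>s'.
     (\<forall>j<K. mem s' P (pv j) = Suc j) \<and> (\<forall>v. v \<notin> pv ` {..<K} \<longrightarrow> mem s' P v = 0) \<and>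
     (\<forall>i\<le>N. mem s' (P + 1) (rv i) = i) \<and> (\<forall>v. v \<notin> rv ` {..<N + 1} \<longrightarrow> mem s' (P + 1) v = 0) \<and>
     (let H = fan_max (mem s' P) (mem s' (P + 1)) (mem s 0) (\<lambda>a. mem s 0 (mem s 1 a)) A in
      regs s' 61 = (if 1 < K then H 1 else N + 2 - K) \<and> regs s' 62 = (if 2 < K then H 2 else N + 3 - K) \<and> regs s' 63 = (if 3 < K then H 3 else N + 4 - K)))"
proof -
  let ?R = "{0, 1, 3, 4, 22, 23, 25, 26, 27, 70, 71}"
  have W5: "5 < W" using W by simp
  define s1 where "s1 = eff (block [Assign 26 (Plus 25 3), Assign 27 (Plus 22 0), Assign 30 (Reg 4)]) s"
  have s1: "regs s1 0 = n" "regs s1 1 = A" "regs s1 3 = 1" "regs s1 4 = 0" "regs s1 22 = st" "regs s1 23 = K" "regs s1 25 = N" "regs s1 70 = 2" "regs s1 71 = 3"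
    "regs s1 26 = N + 1" "regs s1 27 = st + n" "regs s1 30 = 0" "mem s1 = mem s"
    unfolding s1_def using r by simp_all
  let ?k = "keeps ?R {0, 1, 10} s1"
  let ?Q = "\<lambda>s'. (\<forall>j<K. mem s' P (pv j) = Suc j) \<and> (\<forall>v. v \<notin> pv ` {..<K} \<longrightarrow> mem s' P v = 0) \<and>
     (\<forall>i\<le>N. mem s' (P + 1) (rv i) = i) \<and> (\<forall>v. v \<notin> rv ` {..<N + 1} \<longrightarrow> mem s' (P + 1) v = 0) \<and>
     (let H = fan_max (mem s' P) (mem s' (P + 1)) (mem s 0) (\<lambda>a. mem s 0 (mem s 1 a)) A in
      regs s' 61 = (if 1 < K then H 1 else N + 2 - K) \<and> regs s' 62 = (if 2 < K then H 2 else N + 3 - K) \<and> regs s' 63 = (if 3 < K then H 3 else N + 4 - K))"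
  have kk: "regs t 0 = n" "regs t 1 = A" "regs t 3 = 1" "regs t 4 = 0" "regs t 22 = st" "regs t 23 = K" "regs t 25 = N" "regs t 70 = 2" "regs t 71 = 3"
    "regs t 26 = N + 1" "regs t 27 = st + n" "mem t 0 = mem s 0" "mem t 1 = mem s 1" "mem t 10 = mem s 10" if "?k t" for t
    using that s1 unfolding keeps_def by auto
  have k30: "?k (t\<lparr>regs := (regs t)(30 := x)\<rparr>)" if "?k t" for t x using that unfolding keeps_def by simp
  have k1: "?k s1" unfolding keeps_def by simp
  show ?thesis unfolding setup_side_def
  proof (rule runs_Seq[where Ta = 3 and Tb = "20 * A + 50 * n + 97" and Q = "\<lambda>t. t = s1"])
    show "runs W (block [Assign 26 (Plus 25 3), Assign 27 (Plus 22 0), Assign 30 (Reg 4)]) s 3 (\<lambda>t. t = s1)"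
      by (rule runs_eff) (use r W K s1_def in auto)
    fix t assume t: "t = s1"
    show "runs W (Seq (While (Less 30 26) (fill_r P)) (Seq (Assign 30 (Reg 4)) (Seq (While (Less 30 23) (fill_p P))
    (Seq (Assign 30 (Reg 4)) (Seq (While (Less 30 1) (fill_h P)) (find_turns P)))))) t (20 * A + 50 * n + 97) ?Q"
      unfolding t
    proof (rule runs_Seq[where Ta = "6 * (N + 1) + 1" and Tb = "20 * A + 44 * n + 96" and Q = "\<lambda>s'. (\<forall>i<N + 1. mem s' (P + 1) (rv i) = i) \<and> (\<forall>v. v \<notin> rv ` {..<N + 1} \<longrightarrow> mem s' (P + 1) v = mem s1 (P + 1) v)"])
      show "runs W (While (Less 30 26) (fill_r P)) s1 (6 * (N + 1) + 1) (\<lambda>s'. (\<forall>i<N + 1. mem s' (P + 1) (rv i) = i) \<and> (\<forall>v. v \<notin> rv ` {..<N + 1} \<longrightarrow> mem s' (P + 1) v = mem s1 (P + 1) v))"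
      proof (rule runs_fill[where T = 5, OF s1(12,10) _ inj(2)])
        show "26 \<notin> mod_regs (fill_r P)" unfolding setup_mods by simp
        fix s' j assume a: "agree (fill_r P) s1 s'" and j: "regs s' 30 = j" "j < N + 1"
        have u: "?k s'" by (rule keeps_agree[OF k1 a]) (use P in \<open>auto simp: setup_mods\<close>)
        have b: "mem s 10 (st + n - j) < A" "mem s 0 (mem s 10 (st + n - j)) < n" using tables K j by auto
        show "runs W (fill_r P) s' 5 (\<lambda>s''. mem s'' (P + 1) = (mem s' (P + 1))(rv j := j) \<and> regs s'' 30 = Suc j)"
          by (rule runs_eff) (use kk[OF u] j W K b in \<open>auto simp: fill_r_def rv_def\<close>)
      qed simp
      fix s2 assume a2: "agree (While (Less 30 26) (fill_r P)) s1 s2" and q2: "(\<forall>i<N + 1. mem s2 (P + 1) (rv i) = i) \<and> (\<forall>v. v \<notin> rv ` {..<N + 1} \<longrightarrow> mem s2 (P + 1) v = mem s1 (P + 1) v)"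
      have k2: "?k s2" by (rule keeps_agree[OF k1 a2]) (use P in \<open>auto simp: setup_mods\<close>)
      have z2: "mem s2 P = (\<lambda>_. 0)" "mem s2 (P + 2) = (\<lambda>_. 0)" using agreeD(2)[OF a2] zero s1 P by (auto simp: setup_mods)
      define s3 where "s3 = s2\<lparr>regs := (regs s2)(30 := 0)\<rparr>"
      have k3: "?k s3" "regs s3 30 = 0" "mem s3 = mem s2" using k30[OF k2] unfolding s3_def by auto
      show "runs W (Seq (Assign 30 (Reg 4)) (Seq (While (Less 30 23) (fill_p P))
    (Seq (Assign 30 (Reg 4)) (Seq (While (Less 30 1) (fill_h P)) (find_turns P))))) s2 (20 * A + 44 * n + 96) ?Q"
      proof (rule runs_Seq[where Ta = 1 and Tb = "20 * A + 44 * n + 95" and Q = "\<lambda>t. t = s3"])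
        show "runs W (Assign 30 (Reg 4)) s2 1 (\<lambda>t. t = s3)" by (rule runs_eff) (use kk[OF k2] W s3_def in auto)
        fix t assume t: "t = s3"
        show "runs W (Seq (While (Less 30 23) (fill_p P)) (Seq (Assign 30 (Reg 4)) (Seq (While (Less 30 1) (fill_h P)) (find_turns P)))) t (20 * A + 44 * n + 95) ?Q"
          unfolding t
        proof (rule runs_Seq[where Ta = "7 * K + 1" and Tb = "20 * A + 37 * n + 94" and Q = "\<lambda>s'. (\<forall>j<K. mem s' P (pv j) = Suc j) \<and> (\<forall>v. v \<notin> pv ` {..<K} \<longrightarrow> mem s' P v = mem s3 P v)"])
          show "runs W (While (Less 30 23) (fill_p P)) s3 (7 * K + 1) (\<lambda>s'. (\<forall>j<K. mem s' P (pv j) = Suc j) \<and> (\<forall>v. v \<notin> pv ` {..<K} \<longrightarrow> mem s' P v = mem s3 P v))"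
          proof (rule runs_fill[where T = 6, OF k3(2) kk(6)[OF k3(1)] _ inj(1)])
            show "23 \<notin> mod_regs (fill_p P)" unfolding setup_mods by simp
            fix s' j assume a: "agree (fill_p P) s3 s'" and j: "regs s' 30 = j" "j < K"
            have u: "?k s'" by (rule keeps_agree[OF k3(1) a]) (use P in \<open>auto simp: setup_mods\<close>)
            have b: "mem s 10 (st + j + 1) < A" "mem s 0 (mem s 10 (st + j + 1)) < n" using tables K j by auto
            show "runs W (fill_p P) s' 6 (\<lambda>s''. mem s'' P = (mem s' P)(pv j := Suc j) \<and> regs s'' 30 = Suc j)"
              by (rule runs_eff) (use kk[OF u] j W K b in \<open>auto simp: fill_p_def pv_def\<close>)
          qed simp
          fix s4 assume a4: "agree (While (Less 30 23) (fill_p P)) s3 s4" and q4: "(\<forall>j<K. mem s4 P (pv j) = Suc j) \<and> (\<forall>v. v \<notin> pv ` {..<K} \<longrightarrow> mem s4 P v = mem s3 P v)"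
          have k4: "?k s4" by (rule keeps_agree[OF k3(1) a4]) (use P in \<open>auto simp: setup_mods\<close>)
          have z4: "mem s4 (P + 1) = mem s2 (P + 1)" "mem s4 (P + 2) = (\<lambda>_. 0)" using agreeD(2)[OF a4] z2 k3 P by (auto simp: setup_mods)
          define s5 where "s5 = s4\<lparr>regs := (regs s4)(30 := 0)\<rparr>"
          have k5: "?k s5" "regs s5 30 = 0" "mem s5 = mem s4" using k30[OF k4] unfolding s5_def by auto
          have P4: "(\<forall>j<K. mem s5 P (pv j) = Suc j) \<and> (\<forall>v. v \<notin> pv ` {..<K} \<longrightarrow> mem s5 P v = 0)" using q4 z2 k3 k5 by simp
          have R4: "(\<forall>i<N + 1. mem s5 (P + 1) (rv i) = i) \<and> (\<forall>v. v \<notin> rv ` {..<N + 1} \<longrightarrow> mem s5 (P + 1) v = 0)"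
            using q2 z4 k5 s1 zero by simp
          have small: "mem s5 P v \<le> 4" "mem s5 (P + 1) v \<le> n" for v
          proof -
            show "mem s5 P v \<le> 4" using P4 K by (cases "v \<in> pv ` {..<K}") auto
            show "mem s5 (P + 1) v \<le> n" using R4 K by (cases "v \<in> rv ` {..<N + 1}") auto
          qed
          show "runs W (Seq (Assign 30 (Reg 4)) (Seq (While (Less 30 1) (fill_h P)) (find_turns P))) s4 (20 * A + 37 * n + 94) ?Q"
          proof (rule runs_Seq[where Ta = 1 and Tb = "20 * A + 37 * n + 93" and Q = "\<lambda>t. t = s5"])
            show "runs W (Assign 30 (Reg 4)) s4 1 (\<lambda>t. t = s5)" by (rule runs_eff) (use kk[OF k4] W s5_def in auto)
            fix t assume t: "t = s5"
            let ?H = "fan_max (mem s5 P) (mem s5 (P + 1)) (mem s 0) (\<lambda>a. mem s 0 (mem s 1 a)) A"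
            have Hn: "fan_max (mem s5 P) (mem s5 (P + 1)) (mem s 0) (\<lambda>a. mem s 0 (mem s 1 a)) j x \<le> n" for j x using small by (induction j) auto
            show "runs W (Seq (While (Less 30 1) (fill_h P)) (find_turns P)) t (20 * A + 37 * n + 93) ?Q"
              unfolding t
            proof (rule runs_Seq[where Ta = "20 * A + 1" and Tb = "37 * n + 92" and Q = "\<lambda>s'. mem s' (P + 2) = ?H"])
              show "runs W (While (Less 30 1) (fill_h P)) s5 (20 * A + 1) (\<lambda>s'. mem s' (P + 2) = ?H)"
                using runs_fill_h[of s5 A P n W] kk[OF k5(1)] k5 z4 tables small W P by auto
              fix s6 assume a6: "agree (While (Less 30 1) (fill_h P)) s5 s6" and q6: "mem s6 (P + 2) = ?H"
              have k6: "?k s6" by (rule keeps_agree[OF k5(1) a6]) (use P in \<open>auto simp: setup_mods\<close>)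
              have m6: "mem s6 P = mem s5 P" "mem s6 (P + 1) = mem s5 (P + 1)" using agreeD(2)[OF a6] P by (auto simp: setup_mods)
              have HW: "?H x < W" for x using Hn[of A x] W by simp
              have W6: "N + 5 < W" using W K by simp
              note ft = find_turns[OF kk(3)[OF k6] kk(6)[OF k6] kk(7)[OF k6] kk(8)[OF k6] kk(9)[OF k6] q6 K(1,2) HW W6]
              show "runs W (find_turns P) s6 (37 * n + 92) ?Q"
              proof (rule runs_eff)
                show "adm W (find_turns P) s6" by (rule ft(1))
                show "?Q (eff (find_turns P) s6)"
                  unfolding ft(2) m6 Let_def using ft(3-5) P4 R4 by (simp only: less_Suc_eq_le Suc_eq_plus1[symmetric] simp_thms) blast
              qed (simp add: find_turns_def)
            qed simp
          qed simp
        qed (use K in simp)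
      qed simp
    qed (use K in simp)
  qed simp
qed

section \<open>Computing the ranks and writing the three orders\<close>

definition one_order :: "nat \<Rightarrow> nat \<Rightarrow> com" where
  "one_order P k = Seq (Assign 30 (Reg 4)) (Seq (While (Less 30 0) (rank_body k (100 + 20 * k) P)) (emit (100 + 20 * k) (3 + 2 * k)))"

text \<open>\<open>S\<close> is \<open>4 * n\<close>, which exceeds \<open>N + 5\<close> and all
  turns, real or imagined. Registers 67, 68 and 69 hold the parts of \<open>rank_r\<close> that
  depend on whether \<open>i1 = i2\<close>, so that this is tested once and not for every
  vertex.\<close>

definition prepare :: com where
  "prepare = block [Assign 64 (Plus 0 0), Assign 64 (Plus 64 64), Assign 65 (Plus 64 64), Assign 66 (Plus 65 64), Assign 60 (Plus 65 65),
     Cond (Equal 61 62) (block [Assign 68 (Reg 64), Assign 69 (Reg 3), Assign 67 (Plus 62 3)])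
       (block [Assign 68 (Reg 3), Assign 69 (Reg 64), Assign 67 (Reg 62)])]"

definition emit_all :: "nat \<Rightarrow> com" where
  "emit_all P = Seq prepare (Seq (one_order P 0) (Seq (one_order P 1) (Seq (one_order P 2) (Assign 24 (Reg 3)))))"

lemma one_order_mods:
  "mod_regs (one_order P k) \<subseteq> {30, 31, 32, 33, 34, 35, 40, 41, 42, 43, 45, 46, 47, 48, 49, 50, 51, 52, 53, 54, 55, 56}"
  "mod_mem (one_order P k) = {100 + 20 * k, 101 + 20 * k, 102 + 20 * k, 103 + 20 * k, 104 + 20 * k, 105 + 20 * k, 3 + 2 * k, 4 + 2 * k}"
proof -
  have "mod_regs (one_order P k) = {30} \<union> mod_regs (rank_body k (100 + 20 * k) P) \<union> mod_regs (emit (100 + 20 * k) (3 + 2 * k))"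
    unfolding one_order_def by simp
  then show "mod_regs (one_order P k) \<subseteq> {30, 31, 32, 33, 34, 35, 40, 41, 42, 43, 45, 46, 47, 48, 49, 50, 51, 52, 53, 54, 55, 56}"
    unfolding emit_mods using rank_body_mods(1)[of k "100 + 20 * k" P] by blast
  show "mod_mem (one_order P k) = {100 + 20 * k, 101 + 20 * k, 102 + 20 * k, 103 + 20 * k, 104 + 20 * k, 105 + 20 * k, 3 + 2 * k, 4 + 2 * k}"
    unfolding one_order_def by (simp add: emit_mods rank_body_mods(2)) auto
qed

text \<open>\<open>ordered\<close> says that the arrays of the \<open>k\<close>-th output list all cells, sorted by the keys that
  result from the ranks; \<open>s0\<close> is the state in which the ranks have just been computed.\<close>

definition ordered :: "state \<Rightarrow> nat \<Rightarrow> (nat \<Rightarrow> nat) \<Rightarrow> (nat \<Rightarrow> nat) \<Rightarrow> nat \<Rightarrow> nat \<Rightarrow> nat \<Rightarrow> nat \<Rightarrow> nat \<Rightarrow> state \<Rightarrow> bool" where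
  "ordered s n Pf Rf S i1 i2 i3 k s' \<longleftrightarrow> (\<exists>s0. keeps {0, 1, 5} {0, 1, 2, 11} s s0 \<and> regs s0 60 = 4 * S \<and>
     (\<forall>v<n. mem s0 (100 + 20 * k) v = rank_of S i1 i2 i3 k (Pf v) (Rf v) \<and> mem s0 (100 + 20 * k + 1) v = high_rank_of S i1 i2 i3 k (Pf v) (Rf v)) \<and>
     (let ys = buckets (all_items (100 + 20 * k) s0) (3 * (4 * S) + 4) in length ys = length (all_items (100 + 20 * k) s0) \<and>
       (\<forall>i<length ys. mem s' (3 + 2 * k) i = kind_of (ys ! i) \<and> mem s' (4 + 2 * k) i = id_of (ys ! i))))"

lemma ordered_cong: "ordered s n Pf Rf S i1 i2 i3 k s' \<Longrightarrow> mem s'' (3 + 2 * k) = mem s' (3 + 2 * k) \<Longrightarrow> mem s'' (4 + 2 * k) = mem s' (4 + 2 * k)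
   \<Longrightarrow> ordered s n Pf Rf S i1 i2 i3 k s''"
  unfolding ordered_def by simp

lemma rank_of_bounds:
  assumes "k < 3" "x \<le> 4" "i < S" "i1 < S" "i2 < S" "i3 < S" "0 < S"
  shows "rank_of S i1 i2 i3 k x i < 4 * S" "high_rank_of S i1 i2 i3 k x i \<le> 4 * S"
proof -
  have k3: "k = 0 \<or> k = 1 \<or> k = 2" using assms(1) by auto
  show 1: "rank_of S i1 i2 i3 k x i < 4 * S" unfolding rank_of_def rank_p_def rank_r_def
    using k3 assms by (elim disjE) auto
  show "high_rank_of S i1 i2 i3 k x i \<le> 4 * S" unfolding high_rank_of_def using 1 by simp
qed

text \<open>The arrays with numbers from \<open>100 + 20 * k\<close> to \<open>105 + 20 * k\<close>
  belong to order \<open>k\<close> alone, so its bucket heads are still zero when sorting begins and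
  nothing has to be cleared.\<close>

lemma one_order:
  assumes rr: "rank_regs S i1 i2 i3 s" and r: "regs s 0 = n" "regs s 1 = A" "regs s 5 < W"
    and k: "k < 3" and zero: "mem s (102 + 20 * k) = (\<lambda>_. 0)"
    and tables: "\<And>a. a < A \<Longrightarrow> mem s 1 a < A \<and> mem s 2 a < A \<and> mem s 0 a < n" "\<And>a. mem s 11 a \<le> 1"
    and P: "\<And>v. v < n \<Longrightarrow> mem s P v \<le> 4 \<and> mem s (P + 1) v < S" "P < 90"
    and W: "n + 2 * A + 12 * S + 9 < W" "i1 < S" "i2 < S" "i3 < S" "3 < S" "n < S"
  shows "runs W (one_order P k) s (150 * n + 100 * A + 400 * S + 210) (ordered s n (mem s P) (mem s (P + 1)) S i1 i2 i3 k)"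
proof -
  let ?q = "100 + 20 * k"
  define s1 where "s1 = s\<lparr>regs := (regs s)(30 := 0)\<rparr>"
  have s1: "rank_regs S i1 i2 i3 s1" "regs s1 0 = n" "regs s1 1 = A" "regs s1 5 = regs s 5" "regs s1 30 = 0" "mem s1 = mem s"
    using rr r unfolding s1_def rank_regs_def by auto
  have r4: "regs s 4 = 0" using rr unfolding rank_regs_def by simp
  show ?thesis unfolding one_order_def
  proof (rule runs_Seq[where Ta = 1 and Tb = "150 * n + 100 * A + 400 * S + 209" and Q = "\<lambda>t. t = s1"])
    show "runs W (Assign 30 (Reg 4)) s 1 (\<lambda>t. t = s1)" by (rule runs_eff) (use r4 W s1_def in auto)
    fix t assume t: "t = s1"
    show "runs W (Seq (While (Less 30 0) (rank_body k ?q P)) (emit ?q (3 + 2 * k))) t (150 * n + 100 * A + 400 * S + 209)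
      (ordered s n (mem s P) (mem s (P + 1)) S i1 i2 i3 k)"
      unfolding t
    proof (rule runs_Seq[OF rank_loop[OF s1(1,2,5) k], where Tb = "100 * (n + A + 4 * S) + 200"])
      show "mem s1 P v \<le> 4 \<and> mem s1 (P + 1) v < S" if "v < n" for v using P(1)[OF that] s1 by simp
      show "P + 1 < ?q" using P(2) by simp
      show "50 * n + 1 + (100 * (n + A + 4 * S) + 200) \<le> 150 * n + 100 * A + 400 * S + 209" by simp
      fix s2 assume a: "agree (While (Less 30 0) (rank_body k ?q P)) s1 s2"
        and Q: "\<forall>v<n. mem s2 ?q v = rank_of S i1 i2 i3 k (mem s1 P v) (mem s1 (P + 1) v) \<and>
          mem s2 (?q + 1) v = high_rank_of S i1 i2 i3 k (mem s1 P v) (mem s1 (P + 1) v)"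
      have kr: "regs s2 i = regs s1 i" if "i \<notin> {30, 31, 32, 33, 35}" for i
        using agreeD(1)[OF a] rank_body_mods(1)[of k ?q P] that by auto
      have km: "mem s2 i = mem s i" if "i \<noteq> ?q" "i \<noteq> ?q + 1" for i
        using agreeD(2)[OF a] that s1(6) by (simp add: rank_body_mods(2))
      have u: "regs s2 0 = n" "regs s2 1 = A" "regs s2 3 = 1" "regs s2 4 = 0" "regs s2 60 = 4 * S" "regs s2 5 = regs s 5"
        using kr s1 unfolding rank_regs_def by auto
      have m: "mem s2 0 = mem s 0" "mem s2 1 = mem s 1" "mem s2 2 = mem s 2" "mem s2 11 = mem s 11" "mem s2 (?q + 2) = mem s (102 + 20 * k)"
        using km[of 0] km[of 1] km[of 2] km[of 11] km[of "?q + 2"] by auto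
      have bd: "mem s2 ?q v < 4 * S \<and> mem s2 (?q + 1) v \<le> 4 * S" if "v < n" for v
        using Q that rank_of_bounds[OF k, of "mem s P v" "mem s (P + 1) v" S i1 i2 i3] P(1)[OF that] W s1 by simp
      show "runs W (emit ?q (3 + 2 * k)) s2 (100 * (n + A + 4 * S) + 200) (ordered s n (mem s P) (mem s (P + 1)) S i1 i2 i3 k)"
      proof (rule runs_mono[OF emit[OF u(1-5)] order_refl])
        show "regs s2 5 < W" using u r by simp
        show "mem s2 (?q + 2) = (\<lambda>_. 0)" using m zero by simp
        show "mem s2 1 a < A \<and> mem s2 2 a < A \<and> mem s2 0 a < n" if "a < A" for a unfolding m by (rule tables(1)[OF that])
        show "mem s2 ?q v < 4 * S \<and> mem s2 (?q + 1) v \<le> 4 * S" if "v < n" for v by (rule bd[OF that])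
        show "mem s2 11 a \<le> 1" for a unfolding m by (rule tables(2))
        show "n + 2 * A + 3 * (4 * S) + 9 < W" using W by simp
        show "100 \<le> ?q" "3 + 2 * k < 10" using k by auto
        fix s' :: state assume e: "let ys = buckets (all_items ?q s2) (3 * (4 * S) + 4) in length ys = length (all_items ?q s2) \<and>
           (\<forall>i<length ys. mem s' (3 + 2 * k) i = kind_of (ys ! i) \<and> mem s' (Suc (3 + 2 * k)) i = id_of (ys ! i))"
        have kp: "keeps {0, 1, 5} {0, 1, 2, 11} s s2" unfolding keeps_def using u m r by auto
        show "ordered s n (mem s P) (mem s (P + 1)) S i1 i2 i3 k s'"
          unfolding ordered_def
          by (rule exI[of _ s2]) (use kp u Q e in \<open>simp add: s1(6)\<close>)
      qed
    qed (use W in auto)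
  qed simp
qed

lemma prepare:
  assumes "regs s 0 = n" "regs s 3 = 1" "regs s 4 = 0" "regs s 61 = i1" "regs s 62 = i2" "regs s 63 = i3" "regs s 70 = 2" "regs s 71 = 3"
    and "16 * n + 1 < W" "i2 + 1 < W"
  shows "adm W prepare s" "rank_regs (4 * n) i1 i2 i3 (eff prepare s)" "cost prepare = 12" "mod_regs prepare = {60, 64, 65, 66, 67, 68, 69}" "mod_mem prepare = {}"
  unfolding prepare_def rank_regs_def using assms(9,10) by (cases "i1 = i2"; simp add: assms(1-8); auto)+

lemma emit_all:
  assumes r: "regs s 0 = n" "regs s 1 = A" "regs s 3 = 1" "regs s 4 = 0" "regs s 61 = i1" "regs s 62 = i2" "regs s 63 = i3" "regs s 70 = 2" "regs s 71 = 3" "regs s 5 < W"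
    and zero: "\<And>x. 100 \<le> x \<Longrightarrow> mem s x = (\<lambda>_. 0)"
    and tables: "\<And>a. a < A \<Longrightarrow> mem s 1 a < A \<and> mem s 2 a < A \<and> mem s 0 a < n" "\<And>a. mem s 11 a \<le> 1"
    and P: "\<And>v. mem s P v \<le> 4 \<and> mem s (P + 1) v < 4 * n" "P < 90" "12 < P"
    and W: "49 * n + 2 * A + 10 < W" "i1 < 4 * n" "i2 < 4 * n" "i3 < 4 * n" "0 < n"
  shows "runs W (emit_all P) s (6000 * n + 300 * A + 700) (\<lambda>s'. regs s' 24 = 1 \<and> (\<forall>k<3. ordered s n (mem s P) (mem s (P + 1)) (4 * n) i1 i2 i3 k s'))"
proof -
  let ?T = "150 * n + 100 * A + 400 * (4 * n) + 210"
  let ?R = "{0, 1, 3, 4, 5, 60, 61, 62, 63, 64, 65, 66, 67, 68, 69, 70, 71 :: nat}"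
  let ?o = "ordered s n (mem s P) (mem s (P + 1)) (4 * n) i1 i2 i3"
  have n4: "3 < 4 * n" using W by linarith
  have pW: "16 * n + 1 < W" "i2 + 1 < W" using W by auto
  note prep = prepare[OF r(1,3-9) pW]
  define s1 where "s1 = eff prepare s"
  have ag: "agree prepare s s1" using exec_eff[OF prep(1)] exec_agree unfolding s1_def by blast
  have s1: "regs s1 0 = n" "regs s1 1 = A" "regs s1 5 = regs s 5" "mem s1 = mem s" "rank_regs (4 * n) i1 i2 i3 s1"
    using agreeD[OF ag] r prep unfolding s1_def by auto
  have step: "runs W (one_order P k) t ?T (\<lambda>t'. ?o k t' \<and> keeps ?R ({0, 1, 2, 11, P, P + 1} \<union> {x. 100 + 20 * Suc k \<le> x}) s1 t')"
    if t: "keeps ?R ({0, 1, 2, 11, P, P + 1} \<union> {x. 100 + 20 * k \<le> x}) s1 t" and k: "k < 3" for t k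
  proof (rule runs_mono[OF one_order[of "4 * n" i1 i2 i3 t n A W k P, OF _ _ _ _ k] order_refl])
    have rt: "regs t i = regs s1 i" if "i \<in> ?R" for i using t that unfolding keeps_def by blast
    have mt: "mem t i = mem s i" if "i \<in> {0, 1, 2, 11, P, P + 1} \<or> 100 + 20 * k \<le> i" for i
    proof -
      have "mem t i = mem s1 i" using t that unfolding keeps_def by blast
      then show ?thesis using s1(4) by simp
    qed
    show "rank_regs (4 * n) i1 i2 i3 t" using s1(5) unfolding rank_regs_def by (simp add: rt)
    show "regs t 0 = n" "regs t 1 = A" "regs t 5 < W" using rt s1 r by auto
    show "mem t (102 + 20 * k) = (\<lambda>_. 0)" using mt zero by simp
    show "mem t 1 a < A \<and> mem t 2 a < A \<and> mem t 0 a < n" if "a < A" for a using tables(1)[OF that] mt by simp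
    show "mem t 11 a \<le> 1" for a using tables(2) mt by simp
    show "mem t P v \<le> 4 \<and> mem t (P + 1) v < 4 * n" for v using P(1)[of v] mt by simp
    show "n + 2 * A + 12 * (4 * n) + 9 < W" using W by simp
    fix t' assume a: "agree (one_order P k) t t'" and o: "ordered t n (mem t P) (mem t (P + 1)) (4 * n) i1 i2 i3 k t'"
    have "keeps {0, 1, 5} {0, 1, 2, 11} s t" unfolding keeps_def using rt mt s1 r by auto
    then have "keeps {0, 1, 5} {0, 1, 2, 11} t s0 \<Longrightarrow> keeps {0, 1, 5} {0, 1, 2, 11} s s0" for s0 unfolding keeps_def by simp
    then have "?o k t'" using o mt[of P] mt[of "P + 1"] unfolding ordered_def by auto
    moreover have "keeps ?R ({0, 1, 2, 11, P, P + 1} \<union> {x. 100 + 20 * Suc k \<le> x}) s1 t'"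
      unfolding keeps_def
    proof (intro conjI ballI)
      fix i assume i: "i \<in> ?R"
      then have "i \<notin> mod_regs (one_order P k)" using one_order_mods(1)[of P k] by auto
      then show "regs t' i = regs s1 i" using agreeD(1)[OF a] rt[OF i] by simp
    next
      fix i assume i: "i \<in> {0, 1, 2, 11, P, P + 1} \<union> {x. 100 + 20 * Suc k \<le> x}"
      then have "i \<notin> mod_mem (one_order P k)" unfolding one_order_mods(2) using P k by auto
      moreover have "mem t i = mem s i" by (rule mt) (use i in auto)
      ultimately show "mem t' i = mem s1 i" using agreeD(2)[OF a] s1(4) by simp
    qed
    ultimately show "?o k t' \<and> keeps ?R ({0, 1, 2, 11, P, P + 1} \<union> {x. 100 + 20 * Suc k \<le> x}) s1 t'" by simp
  qed (use W P n4 in auto)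
  have k0: "keeps ?R ({0, 1, 2, 11, P, P + 1} \<union> {x. 100 + 20 * 0 \<le> x}) s1 s1" unfolding keeps_def by simp
  have oth: "?o k t'" if "?o k t" "agree (one_order P k') t t'" "k < k'" "k' < 3" for k k' t t'
    by (rule ordered_cong[OF that(1)]) (use agreeD(2)[OF that(2), unfolded one_order_mods(2)] that(3,4) in \<open>simp_all\<close>)
  show ?thesis unfolding emit_all_def
  proof (rule runs_Seq[where Ta = 12 and Q = "\<lambda>t. t = s1" and Tb = "3 * ?T + 1"])
    show "runs W prepare s 12 (\<lambda>t. t = s1)" by (rule runs_eff) (use prep s1_def in auto)
    fix t assume t: "t = s1"
    show "runs W (Seq (one_order P 0) (Seq (one_order P 1) (Seq (one_order P 2) (Assign 24 (Reg 3))))) t (3 * ?T + 1) (\<lambda>s'. regs s' 24 = 1 \<and> (\<forall>k<3. ?o k s'))"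
      unfolding t
    proof (rule runs_Seq[OF step[OF k0], where Tb = "2 * ?T + 1"])
      fix s2 assume s2: "?o 0 s2 \<and> keeps ?R ({0, 1, 2, 11, P, P + 1} \<union> {x. 100 + 20 * Suc 0 \<le> x}) s1 s2"
      have k2: "keeps ?R ({0, 1, 2, 11, P, P + 1} \<union> {x. 100 + 20 * 1 \<le> x}) s1 s2" using s2 by simp
      show "runs W (Seq (one_order P 1) (Seq (one_order P 2) (Assign 24 (Reg 3)))) s2 (2 * ?T + 1) (\<lambda>s'. regs s' 24 = 1 \<and> (\<forall>k<3. ?o k s'))"
      proof (rule runs_Seq[OF step[OF k2], where Tb = "?T + 1"])
        fix s3 assume a3: "agree (one_order P 1) s2 s3" and s3: "?o 1 s3 \<and> keeps ?R ({0, 1, 2, 11, P, P + 1} \<union> {x. 100 + 20 * Suc 1 \<le> x}) s1 s3"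
        have o3: "?o 0 s3" using oth[OF _ a3] s2 by simp
        have k3: "keeps ?R ({0, 1, 2, 11, P, P + 1} \<union> {x. 100 + 20 * 2 \<le> x}) s1 s3" using s3 by (simp add: numeral_2_eq_2)
        show "runs W (Seq (one_order P 2) (Assign 24 (Reg 3))) s3 (?T + 1) (\<lambda>s'. regs s' 24 = 1 \<and> (\<forall>k<3. ?o k s'))"
        proof (rule runs_Seq[OF step[OF k3], where Tb = 1])
          fix s4 assume a4: "agree (one_order P 2) s3 s4" and s4: "?o 2 s4 \<and> keeps ?R ({0, 1, 2, 11, P, P + 1} \<union> {x. 100 + 20 * Suc 2 \<le> x}) s1 s4"
          have o4: "?o 0 s4" "?o 1 s4" using oth[OF o3 a4] oth[OF _ a4, of 1] s3 by auto
          have "regs s4 3 = 1" using s4 s1(5) unfolding keeps_def rank_regs_def by simp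
          moreover have "?o k (s4\<lparr>regs := (regs s4)(24 := 1)\<rparr>)" if "k < 3" for k
          proof -
            have "k = 0 \<or> k = 1 \<or> k = 2" using that by auto
            then have "?o k s4" using o4 s4 by auto
            then show ?thesis by (rule ordered_cong) simp_all
          qed
          ultimately show "runs W (Assign 24 (Reg 3)) s4 1 (\<lambda>s'. regs s' 24 = 1 \<and> (\<forall>k<3. ?o k s'))"
            by (intro runs_eff) (use W in auto)
        qed simp_all
      qed simp_all
    qed simp_all
  qed simp
qed

text \<open>The vertex at position \<open>j\<close> of the outer walk is \<open>v j\<close>. In a side, the ear at position \<open>st\<close> is
  followed by \<open>K\<close> vertices, numbered from 1 by \<open>Pf\<close>; the others, starting with the ear, are numbered
  backwards from 0 by \<open>Rf\<close>.\<close>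

definition side :: "(nat \<Rightarrow> nat) \<Rightarrow> nat \<Rightarrow> (nat \<Rightarrow> nat) \<Rightarrow> (nat \<Rightarrow> nat) \<Rightarrow> nat \<Rightarrow> nat \<Rightarrow> nat \<Rightarrow>
    (nat \<Rightarrow> nat) \<Rightarrow> (nat \<Rightarrow> nat) \<Rightarrow> nat \<Rightarrow> nat \<Rightarrow> nat \<Rightarrow> bool" where
  "side v n ta he A st K Pf Rf i1 i2 i3 \<longleftrightarrow> 1 \<le> K \<and> K \<le> 4 \<and>
     (let N = n - K - 1 in
     (\<forall>j<K. Pf (v (st + j + 1)) = Suc j) \<and> (\<forall>u. u \<notin> (\<lambda>j. v (st + j + 1)) ` {..<K} \<longrightarrow> Pf u = 0) \<and>
     (\<forall>i\<le>N. Rf (v (st + n - i)) = i) \<and> (\<forall>u. u \<notin> (\<lambda>i. v (st + n - i)) ` {..<N + 1} \<longrightarrow> Rf u = 0) \<and>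
     (let H = fan_max Pf Rf ta he A in
       i1 = (if 1 < K then H 1 else N + 2 - K) \<and> i2 = (if 2 < K then H 2 else N + 3 - K) \<and> i3 = (if 3 < K then H 3 else N + 4 - K)))"

lemma fan_max_le: "(\<And>u. Rf u \<le> N) \<Longrightarrow> fan_max Pf Rf ta he A x \<le> N"
  by (induction A) auto

lemma side_bounds:
  assumes "side v n ta he A st K Pf Rf i1 i2 i3" "K < n"
  shows "Pf u \<le> 4" "Rf u < n" "i1 < 4 * n" "i2 < 4 * n" "i3 < 4 * n"
proof -
  have K: "1 \<le> K" "K \<le> 4" and
    a: "\<And>j. j < K \<Longrightarrow> Pf (v (st + j + 1)) = Suc j" "\<And>u. u \<notin> (\<lambda>j. v (st + j + 1)) ` {..<K} \<Longrightarrow> Pf u = 0"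
     "\<And>i. i \<le> n - K - 1 \<Longrightarrow> Rf (v (st + n - i)) = i" "\<And>u. u \<notin> (\<lambda>i. v (st + n - i)) ` {..<n - K - 1 + 1} \<Longrightarrow> Rf u = 0"
    and t: "i1 = (if 1 < K then fan_max Pf Rf ta he A 1 else n - K - 1 + 2 - K)" "i2 = (if 2 < K then fan_max Pf Rf ta he A 2 else n - K - 1 + 3 - K)"
      "i3 = (if 3 < K then fan_max Pf Rf ta he A 3 else n - K - 1 + 4 - K)"
    using assms(1) unfolding side_def Let_def by auto
  show "Pf u \<le> 4" using a(1,2) K by (cases "u \<in> (\<lambda>j. v (st + j + 1)) ` {..<K}") auto
  have R: "Rf u \<le> n - K - 1" for u
  proof (cases "u \<in> (\<lambda>i. v (st + n - i)) ` {..<n - K - 1 + 1}")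
    case True
    then obtain i where "u = v (st + n - i)" "i \<le> n - K - 1" by auto
    then show ?thesis using a(3) by simp
  qed (simp add: a(4))
  then show "Rf u < n" using assms(2) K by (metis diff_diff_left diff_less le_less_trans less_nat_zero_code neq0_conv zero_less_Suc Suc_eq_plus1 add_Suc_right)
  show "i1 < 4 * n" "i2 < 4 * n" "i3 < 4 * n"
    unfolding t using fan_max_le[of Rf, OF R, of Pf ta he A 1] fan_max_le[of Rf, OF R, of Pf ta he A 2] fan_max_le[of Rf, OF R, of Pf ta he A 3] assms(2) K by auto
qed

text \<open>This is the criterion: \<open>K\<close> lies between 1 and 4, and the first and the last
  turn differ. For \<open>K < 4\<close> the imagined turns make them differ anyway, so one
  comparison covers all cases.\<close>

definition attempt :: "nat \<Rightarrow> com" where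
  "attempt P = Cond (Less 4 23) (Cond (Less 23 72)
     (Seq (block [Assign 25 (Minus 0 23), Assign 25 (Minus 25 3)]) (Seq (setup_side P) (Cond (Equal 61 63) Skip (emit_all P)))) Skip) Skip"

lemma attempt_mods: "3 \<notin> mod_regs (attempt P)" "4 \<notin> mod_regs (attempt P)"
proof -
  have "mod_regs (attempt P) = {25, 24} \<union> mod_regs (setup_side P) \<union> mod_regs prepare \<union> mod_regs (one_order P 0) \<union> mod_regs (one_order P 1) \<union> mod_regs (one_order P 2)"
    unfolding attempt_def emit_all_def by (simp add: Un_assoc insert_commute Un_left_commute Un_commute)
  moreover have "mod_regs prepare = {60, 64, 65, 66, 67, 68, 69}" unfolding prepare_def by auto
  moreover have "x \<notin> mod_regs (one_order P k)" if "x = 3 \<or> x = 4" for x k using one_order_mods(1)[of P k] that by auto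
  ultimately show "3 \<notin> mod_regs (attempt P)" "4 \<notin> mod_regs (attempt P)" by (simp_all add: setup_mods)
qed

text \<open>The failing outcome records that nothing beyond the registers and arrays of the setup
  has changed. The sorting arrays are then still zero, so another attempt can start from the state
  reached.\<close>

lemma attempt:
  assumes r: "regs s 0 = n" "regs s 1 = A" "regs s 3 = 1" "regs s 4 = 0" "regs s 22 = st" "regs s 23 = K" "regs s 24 = 0" "regs s 70 = 2" "regs s 71 = 3"
      "regs s 72 = 5" "regs s 5 < W"
    and K: "K < n" "st < n" and P: "12 < P" "P < 90"
    and zero: "mem s P = (\<lambda>_. 0)" "mem s (P + 1) = (\<lambda>_. 0)" "mem s (P + 2) = (\<lambda>_. 0)" "\<And>x. 100 \<le> x \<Longrightarrow> mem s x = (\<lambda>_. 0)"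
    and tables: "\<And>a. a < A \<Longrightarrow> mem s 1 a < A \<and> mem s 2 a < A \<and> mem s 0 a < n" "\<And>j. j < 2 * n \<Longrightarrow> mem s 10 j < A" "\<And>a. mem s 11 a \<le> 1"
    and W: "49 * n + 2 * A + 20 < W"
  defines "v \<equiv> \<lambda>j. mem s 0 (mem s 10 j)"
  defines "sd \<equiv> side v n (mem s 0) (\<lambda>a. mem s 0 (mem s 1 a)) A st K"
  assumes inj: "inj_on v {st<..st + n}"
  shows "runs W (attempt P) s (6100 * n + 400 * A + 900) (\<lambda>s'.
     (regs s' 24 = 1 \<and> (\<exists>Pf Rf i1 i2 i3. sd Pf Rf i1 i2 i3 \<and> i1 \<noteq> i3 \<and> (\<forall>k<3. ordered s n Pf Rf (4 * n) i1 i2 i3 k s'))) \<or>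
     (regs s' 24 = 0 \<and> (K = 0 \<or> 5 \<le> K \<or> (\<exists>Pf Rf i1 i2 i3. sd Pf Rf i1 i2 i3 \<and> i1 = i3)) \<and> agree (Seq (Assign 25 (Reg 4)) (setup_side P)) s s'))"
    (is "runs _ _ _ _ ?Q")
proof (cases "1 \<le> K \<and> K \<le> 4")
  case False
  have q: "?Q s" using False r agree_refl by auto
  have sk: "runs W Skip s T ?Q" for T by (rule runs_eff) (use q in auto)
  show ?thesis unfolding attempt_def
  proof (rule runs_Cond[where T = 1])
    assume "holds (Less 4 23) s"
    then have "\<not> holds (Less 23 72) s" using False r by auto
    then show "runs W (Cond (Less 23 72) (Seq (block [Assign 25 (Minus 0 23), Assign 25 (Minus 25 3)])
      (Seq (setup_side P) (Cond (Equal 61 63) Skip (emit_all P)))) Skip) s 1 ?Q"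
      by (intro runs_Cond[where T = 0] sk) auto
  qed (rule sk, simp)
next
  case True
  define N where "N = n - K - 1"
  have N: "n = K + N + 1" using K N_def by simp
  define s1 where "s1 = s\<lparr>regs := (regs s)(25 := N)\<rparr>"
  have s1: "regs s1 0 = n" "regs s1 1 = A" "regs s1 3 = 1" "regs s1 4 = 0" "regs s1 22 = st" "regs s1 23 = K" "regs s1 25 = N" "regs s1 70 = 2" "regs s1 71 = 3"
    "mem s1 = mem s" using r unfolding s1_def by auto
  have a1: "agree (Assign 25 (Reg 4)) s s1" unfolding s1_def agree_def by simp
  have ij: "inj_on (\<lambda>j. mem s1 0 (mem s1 10 (st + j + 1))) {..<K}" "inj_on (\<lambda>i. mem s1 0 (mem s1 10 (st + n - i))) {..<N + 1}"
  proof -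
    show "inj_on (\<lambda>j. mem s1 0 (mem s1 10 (st + j + 1))) {..<K}"
    proof (rule inj_onI)
      fix x y assume "x \<in> {..<K}" "y \<in> {..<K}" "mem s1 0 (mem s1 10 (st + x + 1)) = mem s1 0 (mem s1 10 (st + y + 1))"
      then show "x = y" using inj_onD[OF inj, of "st + x + 1" "st + y + 1"] s1(10) N unfolding v_def by auto
    qed
    show "inj_on (\<lambda>i. mem s1 0 (mem s1 10 (st + n - i))) {..<N + 1}"
    proof (rule inj_onI)
      fix x y assume xy: "x \<in> {..<N + 1}" "y \<in> {..<N + 1}" "mem s1 0 (mem s1 10 (st + n - x)) = mem s1 0 (mem s1 10 (st + n - y))"
      have "st + n - x = st + n - y"
        by (rule inj_onD[OF inj]) (use xy s1(10) N True in \<open>auto simp: v_def\<close>)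
      moreover have "x < n" "y < n" using xy N by auto
      ultimately show "x = y" by linarith
    qed
  qed
  have tb: "mem s1 1 a < A \<and> mem s1 0 a < n" if "a < A" for a using tables(1)[OF that] s1(10) by simp
  have tb2: "mem s1 10 j < A" if "j < 2 * n" for j using tables(2)[OF that] s1(10) by simp
  have zz: "mem s1 P = (\<lambda>_. 0)" "mem s1 (P + 1) = (\<lambda>_. 0)" "mem s1 (P + 2) = (\<lambda>_. 0)" using zero s1 by auto
  have W2: "A < W" "2 * n + 10 < W" using W by auto
  note su = setup_side[OF s1(1-9) _ _ N K(2) zz tb tb2 W2 P(1) ij, simplified s1(10)]
  show ?thesis unfolding attempt_def
  proof (rule runs_Cond[where T = "6100 * n + 400 * A + 899"])
    show "\<not> holds (Less 4 23) s \<Longrightarrow> runs W Skip s (6100 * n + 400 * A + 899) ?Q" using True r by simp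
    show "runs W (Cond (Less 23 72) (Seq (block [Assign 25 (Minus 0 23), Assign 25 (Minus 25 3)])
      (Seq (setup_side P) (Cond (Equal 61 63) Skip (emit_all P)))) Skip) s (6100 * n + 400 * A + 899) ?Q"
    proof (rule runs_Cond[where T = "6100 * n + 400 * A + 898"])
      show "\<not> holds (Less 23 72) s \<Longrightarrow> runs W Skip s (6100 * n + 400 * A + 898) ?Q" using True r by simp
      show "runs W (Seq (block [Assign 25 (Minus 0 23), Assign 25 (Minus 25 3)])
        (Seq (setup_side P) (Cond (Equal 61 63) Skip (emit_all P)))) s (6100 * n + 400 * A + 898) ?Q"
      proof (rule runs_Seq[where Ta = 2 and Tb = "6100 * n + 400 * A + 896" and Q = "\<lambda>t. t = s1"])
        show "runs W (block [Assign 25 (Minus 0 23), Assign 25 (Minus 25 3)]) s 2 (\<lambda>t. t = s1)"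
          by (rule runs_eff) (use r W s1_def N_def in auto)
        fix t assume t: "t = s1"
        show "runs W (Seq (setup_side P) (Cond (Equal 61 63) Skip (emit_all P))) t (6100 * n + 400 * A + 896) ?Q"
          unfolding t
        proof (rule runs_Seq[OF su, where Tb = "6050 * n + 380 * A + 796"])
          show "1 \<le> K" "K \<le> 4" using True by auto
          fix s2 assume a2: "agree (setup_side P) s1 s2" and q2: "(\<forall>j<K. mem s2 P (mem s 0 (mem s 10 (st + j + 1))) = Suc j) \<and>
             (\<forall>v. v \<notin> (\<lambda>j. mem s 0 (mem s 10 (st + j + 1))) ` {..<K} \<longrightarrow> mem s2 P v = 0) \<and>
             (\<forall>i\<le>N. mem s2 (P + 1) (mem s 0 (mem s 10 (st + n - i))) = i) \<and>
             (\<forall>v. v \<notin> (\<lambda>i. mem s 0 (mem s 10 (st + n - i))) ` {..<N + 1} \<longrightarrow> mem s2 (P + 1) v = 0) \<and>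
             (let H = fan_max (mem s2 P) (mem s2 (P + 1)) (mem s 0) (\<lambda>a. mem s 0 (mem s 1 a)) A in
              regs s2 61 = (if 1 < K then H 1 else N + 2 - K) \<and> regs s2 62 = (if 2 < K then H 2 else N + 3 - K) \<and> regs s2 63 = (if 3 < K then H 3 else N + 4 - K))"
          have sd2: "sd (mem s2 P) (mem s2 (P + 1)) (regs s2 61) (regs s2 62) (regs s2 63)"
            unfolding sd_def side_def Let_def v_def N_def[symmetric] using q2 True unfolding Let_def by blast
          note bd = side_bounds[OF sd2[unfolded sd_def] K(1)]
          have kr: "regs s2 i = regs s i" if "i \<notin> {25, 26, 27, 30, 31, 32, 33, 34, 35, 36, 61, 62, 63}" for i
            using agreeD(1)[OF a2, of i] that unfolding s1_def by (simp add: setup_mods)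
          have km: "mem s2 i = mem s i" if "i \<noteq> P" "i \<noteq> P + 1" "i \<noteq> P + 2" for i
            using agreeD(2)[OF a2, of i] that s1(10) by (simp add: setup_mods)
          have aa: "agree (Seq (Assign 25 (Reg 4)) (setup_side P)) s s2"
            using a1 a2 unfolding agree_def by simp
          show "runs W (Cond (Equal 61 63) Skip (emit_all P)) s2 (6050 * n + 380 * A + 796) ?Q"
          proof (rule runs_Cond[where T = "6000 * n + 300 * A + 700"])
            assume "holds (Equal 61 63) s2"
            then have "?Q s2" using sd2 aa kr[of 24] r(7) by auto
            then show "runs W Skip s2 (6000 * n + 300 * A + 700) ?Q" by (intro runs_eff) auto
          next
            assume h: "\<not> holds (Equal 61 63) s2"
            have kk: "regs s2 0 = n" "regs s2 1 = A" "regs s2 3 = 1" "regs s2 4 = 0" "regs s2 70 = 2" "regs s2 71 = 3" "regs s2 5 = regs s 5"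
              using kr r by auto
            have mm: "mem s2 0 = mem s 0" "mem s2 1 = mem s 1" "mem s2 2 = mem s 2" "mem s2 11 = mem s 11" using km P by auto
            have kp: "keeps {0, 1, 5} {0, 1, 2, 11} s s2" unfolding keeps_def using kk mm r by simp
            show "runs W (emit_all P) s2 (6000 * n + 300 * A + 700) ?Q"
            proof (rule runs_mono[OF emit_all[OF kk(1-4) refl refl refl kk(5,6)] order_refl])
              show "regs s2 5 < W" using kk r by simp
              show "mem s2 x = (\<lambda>_. 0)" if "100 \<le> x" for x using km zero(4)[OF that] P that by simp
              show "mem s2 1 a < A \<and> mem s2 2 a < A \<and> mem s2 0 a < n" if "a < A" for a using tables(1)[OF that] mm by simp
              show "mem s2 11 a \<le> 1" for a using tables(3) mm by simp
              show "mem s2 P u \<le> 4 \<and> mem s2 (P + 1) u < 4 * n" for u using bd(1,2)[of u] by simp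
              show "P < 90" "12 < P" by (rule P)+
              show "49 * n + 2 * A + 10 < W" "0 < n" using W K by auto
              show "regs s2 61 < 4 * n" "regs s2 62 < 4 * n" "regs s2 63 < 4 * n" by (rule bd)+
              fix s' assume e: "regs s' 24 = 1 \<and> (\<forall>k<3. ordered s2 n (mem s2 P) (mem s2 (P + 1)) (4 * n) (regs s2 61) (regs s2 62) (regs s2 63) k s')"
              have "ordered s n (mem s2 P) (mem s2 (P + 1)) (4 * n) (regs s2 61) (regs s2 62) (regs s2 63) k s'" if "k < 3" for k
              proof -
                have "keeps {0, 1, 5} {0, 1, 2, 11} s2 s0 \<Longrightarrow> keeps {0, 1, 5} {0, 1, 2, 11} s s0" for s0 using kp unfolding keeps_def by simp
                then show ?thesis using e that unfolding ordered_def by blast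
              qed
              moreover have "regs s2 61 \<noteq> regs s2 63" using h by simp
              ultimately show "?Q s'" using e sd2 by blast
            qed
          qed simp
        qed simp_all
      qed simp
    qed simp
  qed simp
qed

text \<open>The second attempt exchanges the roles of the ears, which replaces the side between them
  by the complementary one. It labels vertices in arrays 30 to 32, since 20 to 22 may already be
  filled. Register 24 reports success.\<close>

definition program :: com where
  "program = Seq (block [Assign 3 (Const 1), Assign 70 (Const 2), Assign 71 (Const 3), Assign 72 (Const 5), Assign 5 (Reg 2), Assign 6 (Plus 0 0)])
     (Seq (While (Less 7 6) walk_body)
     (Seq (block [Assign 22 (Reg 20), Assign 23 (Minus 21 20), Assign 23 (Minus 23 3)])
     (Seq (attempt 20)
     (Seq (Cond (Equal 24 4) (Seq (block [Assign 22 (Reg 21), Assign 23 (Minus 21 20), Assign 23 (Minus 0 23), Assign 23 (Minus 23 3)]) (attempt 30)) Skip)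
     (Cond (Equal 24 4) (Assign 0 (Reg 3)) (Assign 0 (Reg 4)))))))"

lemma ordered_keeps:
  assumes "ordered s n Pf Rf S i1 i2 i3 k s'" "keeps {0, 1, 5} {0, 1, 2, 11} sr s"
  shows "ordered sr n Pf Rf S i1 i2 i3 k s'"
proof -
  have "keeps {0, 1, 5} {0, 1, 2, 11} s s0 \<Longrightarrow> keeps {0, 1, 5} {0, 1, 2, 11} sr s0" for s0 using assms(2) unfolding keeps_def by simp
  then show ?thesis using assms(1) unfolding ordered_def by blast
qed

text \<open>The prefix \<open>xs\<close> allows for more than two positions at which the rotation
  has order two, as happens for a single triangle; the program works with the last two.\<close>

lemma program:
  fixes ta rv sc :: "nat \<Rightarrow> nat"
  assumes s: "regs s = (\<lambda>_. 0)(0 := n, 1 := A, 2 := a0)" "mem s = (\<lambda>_ _. 0)(0 := ta, 1 := rv, 2 := sc)"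
    and tables: "\<And>a. a < A \<Longrightarrow> rv a < A \<and> sc a < A \<and> ta a < n" "a0 < A"
    and W: "49 * n + 2 * A + 20 < W"
  defines "f \<equiv> \<lambda>j. ((\<lambda>a. sc (rv a)) ^^ j) a0"
  defines "v \<equiv> \<lambda>j. ta (f j)"
  defines "sd \<equiv> side v n ta (\<lambda>a. ta (rv a)) A"
  defines "sr \<equiv> \<lparr>regs = (\<lambda>_. 0)(0 := n, 1 := A, 5 := a0), mem = (\<lambda>_ _. 0)(0 := ta, 1 := rv, 2 := sc, 11 := \<lambda>a. if a \<in> f ` {..<2 * n} then 1 else 0)\<rparr>"
  assumes inj: "inj_on v {..<n}" and per: "\<And>j. f (j + n) = f j"
    and ears: "filter (\<lambda>j. sc (sc (f j)) = f j) [0..<n] = xs @ [e1, e2]"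
  defines "good \<equiv> \<lambda>st K s'. \<exists>Pf Rf i1 i2 i3. sd st K Pf Rf i1 i2 i3 \<and> i1 \<noteq> i3 \<and> (\<forall>k<3. ordered sr n Pf Rf (4 * n) i1 i2 i3 k s')"
  defines "bad \<equiv> \<lambda>st K. K = 0 \<or> 5 \<le> K \<or> (\<exists>Pf Rf i1 i2 i3. sd st K Pf Rf i1 i2 i3 \<and> i1 = i3)"
  shows "runs W program s (14000 * n + 1000 * A + 3000) (\<lambda>s'.
     (regs s' 0 = 0 \<and> (good e1 (e2 - e1 - 1) s' \<or> good e2 (n - (e2 - e1) - 1) s')) \<or>
     (regs s' 0 = 1 \<and> bad e1 (e2 - e1 - 1) \<and> bad e2 (n - (e2 - e1) - 1)))" (is "runs _ _ _ _ ?Q")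
proof -
  have e: "e1 < n" "e2 < n" "e1 < e2"
  proof -
    have "{e1, e2} \<subseteq> set (filter (\<lambda>j. sc (sc (f j)) = f j) [0..<n])" unfolding ears by simp
    then show "e1 < n" "e2 < n" by auto
    have "sorted_wrt (<) (filter (\<lambda>j. sc (sc (f j)) = f j) [0..<n])" by (rule sorted_wrt_filter) simp
    then show "e1 < e2" unfolding ears by (simp add: sorted_wrt_append)
  qed
  have fA: "f j < A" for j unfolding f_def using tables by (induction j) auto
  have vper: "v (j + n) = v j" for j unfolding v_def per ..
  \<comment> \<open>The indices of a side may run past \<open>n\<close>; subtracting one round
    brings them back to the range on which \<open>v\<close> is injective.\<close>
  have injs: "inj_on v {st<..st + n}" if "st < n" for st
  proof (rule inj_onI)
    fix x y assume xy: "x \<in> {st<..st + n}" "y \<in> {st<..st + n}" "v x = v y"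
    have red: "v z = v (if z < n then z else z - n)" for z using vper[of "z - n"] by (cases "z < n") auto
    have "(if x < n then x else x - n) = (if y < n then y else y - n)"
      by (rule inj_onD[OF inj]) (use xy red[of x] red[of y] that in auto)
    then show "x = y" using xy by (auto split: if_splits)
  qed
  define K1 where "K1 = e2 - e1 - 1"
  define K2 where "K2 = n - (e2 - e1) - 1"
  have KK: "K1 < n" "K2 < n" using e unfolding K1_def K2_def by auto
  let ?init = "block [Assign 3 (Const 1), Assign 70 (Const 2), Assign 71 (Const 3), Assign 72 (Const 5), Assign 5 (Reg 2), Assign 6 (Plus 0 0)]"
  define s1 where "s1 = eff ?init s"
  have s1: "regs s1 0 = n" "regs s1 1 = A" "regs s1 2 = a0" "regs s1 3 = 1" "regs s1 4 = 0" "regs s1 5 = a0" "regs s1 6 = 2 * n" "regs s1 7 = 0" "regs s1 20 = 0"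
     "regs s1 21 = 0" "regs s1 24 = 0" "regs s1 70 = 2" "regs s1 71 = 3" "regs s1 72 = 5" "mem s1 = mem s"
    unfolding s1_def using s by simp_all
  have m1: "mem s1 0 = ta" "mem s1 1 = rv" "mem s1 2 = sc" "mem s1 11 = (\<lambda>_. 0)" using s1(15) s(2) by auto
  have z1: "mem s1 x = (\<lambda>_. 0)" if "13 \<le> x" for x using s1(15) s(2) that by auto
  have wt: "mem s1 1 a < A \<and> mem s1 2 a < A" if "a < A" for a using tables(1)[OF that] m1 by simp
  have wa: "regs s1 2 < A" using tables s1 by simp
  have wW: "A < W" "2 * n < W" using W by auto
  define zs where "zs = 0 # 0 # filter (\<lambda>j. sc (sc (f j)) = f j) [0..<n]"
  have zl: "zs ! (length zs - 2) = e1" "zs ! (length zs - 1) = e2" unfolding zs_def ears by (auto simp: nth_append)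
  have wk: "runs W (While (Less 7 6) walk_body) s1 (40 * n + 1) (\<lambda>s'. (\<forall>j<2 * n. mem s' 10 j = f j) \<and>
     (\<forall>a. mem s' 11 a = (if a \<in> f ` {..<2 * n} then 1 else 0)) \<and> regs s' 20 = e1 \<and> regs s' 21 = e2)"
  proof -
    have feq: "\<And>j. ((\<lambda>a. sc (rv a)) ^^ j) a0 = f j" unfolding f_def ..
    show ?thesis using walk[OF s1(1,4,8,7,9,10) m1(4) wt wa wW] unfolding m1 s1(3) feq zs_def[symmetric] zl .
  qed
  let ?k = "keeps {0, 1, 3, 4, 5, 20, 21, 70, 71, 72} ({0, 1, 2, 10, 11} \<union> {30, 31, 32} \<union> {x. 100 \<le> x})"
  show ?thesis unfolding program_def
  proof (rule runs_Seq[where Ta = 6 and Tb = "14000 * n + 1000 * A + 2994" and Q = "\<lambda>t. t = s1"])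
    show "runs W ?init s 6 (\<lambda>t. t = s1)" by (rule runs_eff) (use s W tables(2) s1_def in auto)
    fix t assume t: "t = s1"
    show "runs W (Seq (While (Less 7 6) walk_body)
     (Seq (block [Assign 22 (Reg 20), Assign 23 (Minus 21 20), Assign 23 (Minus 23 3)])
     (Seq (attempt 20)
     (Seq (Cond (Equal 24 4) (Seq (block [Assign 22 (Reg 21), Assign 23 (Minus 21 20), Assign 23 (Minus 0 23), Assign 23 (Minus 23 3)]) (attempt 30)) Skip)
     (Cond (Equal 24 4) (Assign 0 (Reg 3)) (Assign 0 (Reg 4))))))) t (14000 * n + 1000 * A + 2994) ?Q"
      unfolding t
    proof (rule runs_Seq[OF wk, where Tb = "13900 * n + 1000 * A + 2990"])
      fix s2 assume a2: "agree (While (Less 7 6) walk_body) s1 s2" and q2: "(\<forall>j<2 * n. mem s2 10 j = f j) \<and>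
        (\<forall>a. mem s2 11 a = (if a \<in> f ` {..<2 * n} then 1 else 0)) \<and> regs s2 20 = e1 \<and> regs s2 21 = e2"
      define s3 where "s3 = s2\<lparr>regs := (regs s2)(22 := e1, 23 := K1)\<rparr>"
      have s2: "regs s2 0 = n" "regs s2 1 = A" "regs s2 3 = 1" "regs s2 4 = 0" "regs s2 5 = a0" "regs s2 24 = 0" "regs s2 70 = 2" "regs s2 71 = 3" "regs s2 72 = 5"
        using agreeD(1)[OF a2] s1 by (auto simp: walk_body_def)
      have m2: "mem s2 0 = ta" "mem s2 1 = rv" "mem s2 2 = sc" using agreeD(2)[OF a2] m1 by (auto simp: walk_body_def)
      have z2: "mem s2 x = (\<lambda>_. 0)" if "13 \<le> x" for x using agreeD(2)[OF a2, of x] z1[OF that] that by (auto simp: walk_body_def)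
      have s3: "regs s3 0 = n" "regs s3 1 = A" "regs s3 3 = 1" "regs s3 4 = 0" "regs s3 22 = e1" "regs s3 23 = K1" "regs s3 24 = 0" "regs s3 70 = 2" "regs s3 71 = 3" "regs s3 72 = 5"
        "regs s3 5 = a0" "regs s3 20 = e1" "regs s3 21 = e2" "mem s3 = mem s2"
        unfolding s3_def using s2 q2 by auto
      have core: "runs W (attempt P) u (6100 * n + 400 * A + 900) (\<lambda>s'. (regs s' 24 = 1 \<and> good st K s') \<or>
          (regs s' 24 = 0 \<and> bad st K \<and> agree (Seq (Assign 25 (Reg 4)) (setup_side P)) u s'))"
        if u: "?k s3 u" "regs u 22 = st" "regs u 23 = K" "regs u 24 = 0" and K: "K < n" "st < n" and P: "P = 20 \<or> P = 30"
          and zP: "mem u P = (\<lambda>_. 0)" "mem u (P + 1) = (\<lambda>_. 0)" "mem u (P + 2) = (\<lambda>_. 0)" for u st K P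
      proof -
        have ur: "regs u 0 = n" "regs u 1 = A" "regs u 3 = 1" "regs u 4 = 0" "regs u 70 = 2" "regs u 71 = 3" "regs u 72 = 5" "regs u 5 = a0"
          using u(1) s3 unfolding keeps_def by auto
        have um': "mem u i = mem s2 i" if "i \<in> {0, 1, 2, 10, 11} \<or> 100 \<le> i" for i
        proof -
          have "mem u i = mem s3 i" using u(1) that unfolding keeps_def by blast
          then show ?thesis using s3(14) by simp
        qed
        have um: "mem u 0 = ta" "mem u 1 = rv" "mem u 2 = sc" "\<And>j. j < 2 * n \<Longrightarrow> mem u 10 j = f j" "mem u 11 = (\<lambda>a. if a \<in> f ` {..<2 * n} then 1 else 0)"
          using um' m2 q2 by auto
        have kp: "keeps {0, 1, 5} {0, 1, 2, 11} sr u" unfolding keeps_def sr_def using ur um by simp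
        have vv: "mem u 0 (mem u 10 j) = v j" if "j < 2 * n" for j using um that unfolding v_def by simp
        have sdv: "side (\<lambda>j. mem u 0 (mem u 10 j)) n (mem u 0) (\<lambda>a. mem u 0 (mem u 1 a)) A st K = sd st K"
        proof -
          have "(\<lambda>j. v (st + j + 1)) ` {..<K} = (\<lambda>j. mem u 0 (mem u 10 (st + j + 1))) ` {..<K}" 
            "(\<lambda>i. v (st + n - i)) ` {..<n - K - 1 + 1} = (\<lambda>i. mem u 0 (mem u 10 (st + n - i))) ` {..<n - K - 1 + 1}"
            using vv K by (auto intro!: image_cong)
          then show ?thesis unfolding sd_def side_def Let_def fun_eq_iff um(1,2) using vv[unfolded um(1)] K by simp
        qed
        have "runs W (attempt P) u (6100 * n + 400 * A + 900) (\<lambda>s'.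
     (regs s' 24 = 1 \<and> (\<exists>Pf Rf i1 i2 i3. sd st K Pf Rf i1 i2 i3 \<and> i1 \<noteq> i3 \<and> (\<forall>k<3. ordered u n Pf Rf (4 * n) i1 i2 i3 k s'))) \<or>
     (regs s' 24 = 0 \<and> (K = 0 \<or> 5 \<le> K \<or> (\<exists>Pf Rf i1 i2 i3. sd st K Pf Rf i1 i2 i3 \<and> i1 = i3)) \<and> agree (Seq (Assign 25 (Reg 4)) (setup_side P)) u s'))"
        proof (rule attempt[OF ur(1-4) u(2-4) ur(5-7), unfolded sdv])
          show "regs u 5 < W" using ur tables W by simp
          show "K < n" "st < n" by (rule K)+
          show "12 < P" "P < 90" using P by auto
          show "mem u P = (\<lambda>_. 0)" "mem u (P + 1) = (\<lambda>_. 0)" "mem u (P + 2) = (\<lambda>_. 0)" by (rule zP)+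
          show "mem u x = (\<lambda>_. 0)" if "100 \<le> x" for x using um' z2 that by simp
          show "mem u 1 a < A \<and> mem u 2 a < A \<and> mem u 0 a < n" if "a < A" for a unfolding um by (rule tables(1)[OF that])
          show "mem u 10 j < A" if "j < 2 * n" for j using um(4)[OF that] fA by simp
          show "mem u 11 a \<le> 1" for a unfolding um by simp
          show "inj_on (\<lambda>j. mem u 0 (mem u 10 j)) {st<..st + n}"
          proof -
            have "inj_on (\<lambda>j. mem u 0 (mem u 10 j)) {st<..st + n} = inj_on v {st<..st + n}" by (rule inj_on_cong) (use vv K in auto)
            then show ?thesis using injs[OF K(2)] by simp
          qed
        qed (rule W)
        then show ?thesis
        proof (rule runs_mono[OF _ order_refl], goal_cases)
          case (1 s')
          from 1(2) show ?case
          proof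
            assume l: "regs s' 24 = 1 \<and> (\<exists>Pf Rf i1 i2 i3. sd st K Pf Rf i1 i2 i3 \<and> i1 \<noteq> i3 \<and> (\<forall>k<3. ordered u n Pf Rf (4 * n) i1 i2 i3 k s'))"
            then obtain Pf Rf i1 i2 i3 where "sd st K Pf Rf i1 i2 i3" "i1 \<noteq> i3" "\<forall>k<3. ordered u n Pf Rf (4 * n) i1 i2 i3 k s'" by blast
            then have "good st K s'" unfolding good_def using ordered_keeps[OF _ kp] by blast
            then show ?case using l by blast
          qed (simp add: bad_def)
        qed
      qed
      show "runs W (Seq (block [Assign 22 (Reg 20), Assign 23 (Minus 21 20), Assign 23 (Minus 23 3)]) (Seq (attempt 20)
     (Seq (Cond (Equal 24 4) (Seq (block [Assign 22 (Reg 21), Assign 23 (Minus 21 20), Assign 23 (Minus 0 23), Assign 23 (Minus 23 3)]) (attempt 30)) Skip)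
     (Cond (Equal 24 4) (Assign 0 (Reg 3)) (Assign 0 (Reg 4)))))) s2 (13900 * n + 1000 * A + 2990) ?Q"
      proof (rule runs_Seq[where Ta = 3 and Q = "\<lambda>t. t = s3" and Tb = "13900 * n + 1000 * A + 2987"])
        show "runs W (block [Assign 22 (Reg 20), Assign 23 (Minus 21 20), Assign 23 (Minus 23 3)]) s2 3 (\<lambda>t. t = s3)"
          by (rule runs_eff) (use q2 s2 e W s3_def K1_def in auto)
        fix t assume t: "t = s3"
        have k3: "?k s3 s3" unfolding keeps_def by simp
        have zP: "mem s3 20 = (\<lambda>_. 0)" "mem s3 (20 + 1) = (\<lambda>_. 0)" "mem s3 (20 + 2) = (\<lambda>_. 0)" using s3(14) z2 by auto
        show "runs W (Seq (attempt 20)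
     (Seq (Cond (Equal 24 4) (Seq (block [Assign 22 (Reg 21), Assign 23 (Minus 21 20), Assign 23 (Minus 0 23), Assign 23 (Minus 23 3)]) (attempt 30)) Skip)
     (Cond (Equal 24 4) (Assign 0 (Reg 3)) (Assign 0 (Reg 4))))) t (13900 * n + 1000 * A + 2987) ?Q"
          unfolding t
        proof (rule runs_Seq[OF core[OF k3 s3(5,6,7) KK(1) e(1) _ zP], where Tb = "6200 * n + 500 * A + 1000"])
          fix s4 assume a4: "agree (attempt 20) s3 s4" and q4: "(regs s4 24 = 1 \<and> good e1 K1 s4) \<or>
            (regs s4 24 = 0 \<and> bad e1 K1 \<and> agree (Seq (Assign 25 (Reg 4)) (setup_side 20)) s3 s4)"
          let ?C = "Seq (block [Assign 22 (Reg 21), Assign 23 (Minus 21 20), Assign 23 (Minus 0 23), Assign 23 (Minus 23 3)]) (attempt 30)"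
          have r34: "regs s4 3 = 1 \<and> regs s4 4 = 0"
            using agreeD(1)[OF a4 attempt_mods(1)] agreeD(1)[OF a4 attempt_mods(2)] s3(3,4) by simp
          show "runs W (Seq (Cond (Equal 24 4) ?C Skip) (Cond (Equal 24 4) (Assign 0 (Reg 3)) (Assign 0 (Reg 4)))) s4 (6200 * n + 500 * A + 1000) ?Q"
          proof (rule runs_Seq[where Ta = "6100 * n + 400 * A + 910" and Tb = 10 and Q = "\<lambda>t. regs t 3 = 1 \<and> regs t 4 = 0 \<and>
               ((regs t 24 = 1 \<and> (good e1 K1 t \<or> good e2 K2 t)) \<or> (regs t 24 = 0 \<and> bad e1 K1 \<and> bad e2 K2))"])
            show "runs W (Cond (Equal 24 4) ?C Skip) s4 (6100 * n + 400 * A + 910) (\<lambda>t. regs t 3 = 1 \<and> regs t 4 = 0 \<and>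
               ((regs t 24 = 1 \<and> (good e1 K1 t \<or> good e2 K2 t)) \<or> (regs t 24 = 0 \<and> bad e1 K1 \<and> bad e2 K2)))"
            proof (rule runs_Cond[where T = "6100 * n + 400 * A + 905"])
              assume "\<not> holds (Equal 24 4) s4"
              then show "runs W Skip s4 (6100 * n + 400 * A + 905) (\<lambda>t. regs t 3 = 1 \<and> regs t 4 = 0 \<and>
               ((regs t 24 = 1 \<and> (good e1 K1 t \<or> good e2 K2 t)) \<or> (regs t 24 = 0 \<and> bad e1 K1 \<and> bad e2 K2)))"
                using r34 q4 by (intro runs_eff) auto
            next
              assume h: "holds (Equal 24 4) s4"
              have b4: "regs s4 24 = 0" "bad e1 K1" "agree (Seq (Assign 25 (Reg 4)) (setup_side 20)) s3 s4" using h r34 q4 by auto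
              define s5 where "s5 = s4\<lparr>regs := (regs s4)(22 := e2, 23 := K2)\<rparr>"
              have r4: "regs s4 i = regs s3 i" if "i \<notin> {25, 26, 27, 30, 31, 32, 33, 34, 35, 36, 61, 62, 63}" for i
                using agreeD(1)[OF b4(3), of i] that by (simp add: setup_mods)
              have m4: "mem s4 i = mem s3 i" if "i \<notin> {20, 21, 22}" for i using agreeD(2)[OF b4(3), of i] that by (simp add: setup_mods)
              have k5: "?k s3 s5" unfolding keeps_def s5_def using r4 m4 by auto
              have u5: "regs s5 22 = e2" "regs s5 23 = K2" "regs s5 24 = 0" unfolding s5_def using b4 by auto
              have z5: "mem s5 30 = (\<lambda>_. 0)" "mem s5 (30 + 1) = (\<lambda>_. 0)" "mem s5 (30 + 2) = (\<lambda>_. 0)"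
                using m4[of 30] m4[of 31] m4[of 32] s3(14) z2 unfolding s5_def by auto
              show "runs W ?C s4 (6100 * n + 400 * A + 905) (\<lambda>t. regs t 3 = 1 \<and> regs t 4 = 0 \<and>
               ((regs t 24 = 1 \<and> (good e1 K1 t \<or> good e2 K2 t)) \<or> (regs t 24 = 0 \<and> bad e1 K1 \<and> bad e2 K2)))"
              proof (rule runs_Seq[where Ta = 4 and Q = "\<lambda>t. t = s5" and Tb = "6100 * n + 400 * A + 900"])
                show "runs W (block [Assign 22 (Reg 21), Assign 23 (Minus 21 20), Assign 23 (Minus 0 23), Assign 23 (Minus 23 3)]) s4 4 (\<lambda>t. t = s5)"
                  by (rule runs_eff) (use r4 s3 e W s5_def K2_def in auto)
                fix t assume t: "t = s5"
                show "runs W (attempt 30) t (6100 * n + 400 * A + 900) (\<lambda>t. regs t 3 = 1 \<and> regs t 4 = 0 \<and>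
               ((regs t 24 = 1 \<and> (good e1 K1 t \<or> good e2 K2 t)) \<or> (regs t 24 = 0 \<and> bad e1 K1 \<and> bad e2 K2)))"
                  unfolding t
                proof (rule runs_mono[OF core[OF k5 u5 KK(2) e(2) _ z5] order_refl])
                  fix s6 assume a6: "agree (attempt 30) s5 s6" and q6: "(regs s6 24 = 1 \<and> good e2 K2 s6) \<or>
                    (regs s6 24 = 0 \<and> bad e2 K2 \<and> agree (Seq (Assign 25 (Reg 4)) (setup_side 30)) s5 s6)"
                  have "regs s6 3 = 1 \<and> regs s6 4 = 0"
                    using agreeD(1)[OF a6 attempt_mods(1)] agreeD(1)[OF a6 attempt_mods(2)] r34 by (simp add: s5_def)
                  then show "regs s6 3 = 1 \<and> regs s6 4 = 0 \<and>
               ((regs s6 24 = 1 \<and> (good e1 K1 s6 \<or> good e2 K2 s6)) \<or> (regs s6 24 = 0 \<and> bad e1 K1 \<and> bad e2 K2))"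
                    using q6 b4(2) by auto
                qed simp
              qed simp
            qed simp
            fix s7 assume q7: "regs s7 3 = 1 \<and> regs s7 4 = 0 \<and>
               ((regs s7 24 = 1 \<and> (good e1 K1 s7 \<or> good e2 K2 s7)) \<or> (regs s7 24 = 0 \<and> bad e1 K1 \<and> bad e2 K2))"
            have g7: "good st K (s7\<lparr>regs := x\<rparr>) = good st K s7" for st K x
              unfolding good_def ordered_def by simp
            show "runs W (Cond (Equal 24 4) (Assign 0 (Reg 3)) (Assign 0 (Reg 4))) s7 10 ?Q"
              unfolding K1_def[symmetric] K2_def[symmetric] by (rule runs_eff) (use q7 g7 W in auto)
          qed simp
        qed simp_all
      qed simp
    qed simp
  qed simp
qed

section \<open>The outer walk\<close>

locale outer_walk = simple_pmap M + staircase M K N J I p r F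
  for M :: "('v, 'a) pmap" and K N J I p r F +
  fixes a0 :: 'a
  assumes a0: "a0 \<in> outer_face M" and card_F: "\<And>t. t < m \<Longrightarrow> card (F t) = 3"
begin

definition walk :: "nat \<Rightarrow> 'a" where "walk j = (ph ^^ j) a0"
definition wv :: "nat \<Rightarrow> 'v" where "wv j = tail G (walk j)"

lemma outer_ph: "a \<in> outer_face M \<Longrightarrow> ph a \<in> outer_face M"
  using face_fc[OF outer_in] ph_in_fc self_in_fc by metis

lemma walk_Suc: "walk (Suc j) = ph (walk j)" unfolding walk_def by simp
lemma walk_outer: "walk j \<in> outer_face M"
  by (induction j) (use a0 outer_ph in \<open>auto simp: walk_def\<close>)
lemma walk_arc: "walk j \<in> arcs G" using walk_outer outer_arcs by blast
lemma wv_Suc: "wv (Suc j) = head G (walk j)" unfolding wv_def walk_Suc using tail_ph[OF walk_arc] .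

lemma outer_range: "outer_face M = range walk"
proof
  have "fc a0 \<subseteq> range walk"
  proof (rule orbit_least)
    show "a0 \<in> range walk" by (rule image_eqI[of _ _ 0]) (auto simp: walk_def)
    show "b \<in> range walk \<Longrightarrow> ph b \<in> range walk" for b using walk_Suc by (metis image_iff rangeI)
  qed
  then show "outer_face M \<subseteq> range walk" using face_fc[OF outer_in a0] by simp
qed (use walk_outer in auto)

lemma wv_p: assumes "wv st = r 0" "j < K" shows "wv (st + 1 + j) = p j"
  using assms(2)
proof (induction j)
  case 0
  have "head G (walk st) = p 0"
    using outer_ends[OF walk_outer[of st]]
  proof (elim disjE exE conjE)
    fix j' assume "Suc j' < K" "tail G (walk st) = p j'"
    then show ?thesis using assms(1) r_neq_p[of j' 0] unfolding wv_def by simp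
  next
    assume "tail G (walk st) = p (K - 1)"
    then show ?thesis using assms(1) r_neq_p[of "K - 1" 0] K_pos unfolding wv_def by simp
  next
    fix i assume "i < N" "tail G (walk st) = r (Suc i)"
    then show ?thesis using assms(1) unfolding wv_def by simp
  qed
  then show ?case using wv_Suc[of st] by simp
next
  case (Suc j)
  then have t: "tail G (walk (st + 1 + j)) = p j" unfolding wv_def by simp
  have "head G (walk (st + 1 + j)) = p (Suc j)"
    using outer_ends[OF walk_outer[of "st + 1 + j"]]
  proof (elim disjE exE conjE)
    assume "tail G (walk (st + 1 + j)) = r 0" then show ?thesis using t p_neq_r[of j 0] Suc.prems by simp
  next
    fix j' assume "Suc j' < K" "tail G (walk (st + 1 + j)) = p j'" "head G (walk (st + 1 + j)) = p (Suc j')"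
    then show ?thesis using t Suc.prems by simp
  next
    assume "tail G (walk (st + 1 + j)) = p (K - 1)" then show ?thesis using t Suc.prems by simp
  next
    fix i assume "i < N" "tail G (walk (st + 1 + j)) = r (Suc i)" then show ?thesis using t p_neq_r[of j "Suc i"] Suc.prems by simp
  qed
  then show ?case using wv_Suc[of "st + 1 + j"] by simp
qed

lemma wv_r: assumes "wv st = r 0" "i \<le> N" shows "wv (st + K + 1 + i) = r (N - i)"
  using assms(2)
proof (induction i)
  case 0
  have t: "tail G (walk (st + K)) = p (K - 1)" using wv_p[OF assms(1), of "K - 1"] K_pos unfolding wv_def by simp
  have "head G (walk (st + K)) = r N"
    using outer_ends[OF walk_outer[of "st + K"]]
  proof (elim disjE exE conjE)
    assume "tail G (walk (st + K)) = r 0" then show ?thesis using t p_neq_r[of "K - 1" 0] K_pos by simp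
  next
    fix j' assume "Suc j' < K" "tail G (walk (st + K)) = p j'"
    then show ?thesis using t by simp
  next
    fix i assume "i < N" "tail G (walk (st + K)) = r (Suc i)" then show ?thesis using t p_neq_r[of "K - 1" "Suc i"] K_pos by simp
  qed
  then show ?case using wv_Suc[of "st + K"] by simp
next
  case (Suc i)
  let ?a = "walk (st + K + 1 + i)"
  have t: "tail G ?a = r (N - i)" using Suc unfolding wv_def by simp
  have "head G ?a = r (N - Suc i)"
    using outer_ends[OF walk_outer[of "st + K + 1 + i"]]
  proof (elim disjE exE conjE)
    assume "tail G ?a = r 0" then show ?thesis using t Suc.prems by simp
  next
    fix j' assume "Suc j' < K" "tail G ?a = p j'"
    then show ?thesis using t p_neq_r[of j' "N - i"] by simp
  next
    assume "tail G ?a = p (K - 1)" then show ?thesis using t p_neq_r[of "K - 1" "N - i"] K_pos by simp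
  next
    fix i' assume "i' < N" "tail G ?a = r (Suc i')" "head G ?a = r i'"
    moreover from this have "Suc i' = N - i" using t by simp
    ultimately show ?thesis by (metis Suc_diff_Suc Suc_inject Suc_le_lessD Suc.prems)
  qed
  then show ?case using wv_Suc[of "st + K + 1 + i"] by simp
qed

abbreviation nv where "nv \<equiv> K + N + 1"

lemma wv_r': "wv st = r 0 \<Longrightarrow> i \<le> N \<Longrightarrow> wv (st + nv - i) = r i"
proof -
  assume a: "wv st = r 0" "i \<le> N"
  have "st + K + 1 + (N - i) = st + nv - i" using a(2) by simp
  then show ?thesis using wv_r[OF a(1), of "N - i"] a(2) by simp
qed

text \<open>The outer boundary is the cycle \<open>r 0\<close>, \<open>p 0\<close>, ...,
  \<open>p (K - 1)\<close>, \<open>r N\<close>, ..., \<open>r 1\<close>, which leaves each vertex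
  only once. Hence the arc at a position of the walk is determined by its vertex.\<close>

lemma outer_tail_inj: "a \<in> outer_face M \<Longrightarrow> b \<in> outer_face M \<Longrightarrow> tail G a = tail G b \<Longrightarrow> head G a = head G b"
proof -
  assume a: "a \<in> outer_face M" and b: "b \<in> outer_face M" and e: "tail G a = tail G b"
  have neq: "Suc j < K \<Longrightarrow> i \<le> N \<Longrightarrow> p j \<noteq> r i" "i \<le> N \<Longrightarrow> p (K - 1) \<noteq> r i" for i j using p_neq_r K_pos by auto
  have pk: "Suc j < K \<Longrightarrow> p j \<noteq> p (K - 1)" "Suc j < K \<Longrightarrow> Suc j' < K \<Longrightarrow> p j = p j' \<Longrightarrow> j = j'" for j j' using K_pos by auto
  have rk: "i < N \<Longrightarrow> r 0 \<noteq> r (Suc i)" "i < N \<Longrightarrow> i' < N \<Longrightarrow> r (Suc i) = r (Suc i') \<Longrightarrow> i = i'" for i i' by auto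
  note E = e[symmetric]
  from outer_ends[OF a] show ?thesis
  proof (elim disjE exE conjE)
    assume 1: "tail G a = r 0" "head G a = p 0"
    from outer_ends[OF b] show ?thesis unfolding E 1 using neq[where i = 0] rk(1) by (metis le0)
  next
    fix j assume 1: "Suc j < K" "tail G a = p j" "head G a = p (Suc j)"
    from outer_ends[OF b] show ?thesis unfolding E 1 using neq(1)[OF 1(1)] pk[OF 1(1)] by (metis Suc_leI le0)
  next
    assume 1: "tail G a = p (K - 1)" "head G a = r N"
    from outer_ends[OF b] show ?thesis unfolding E 1 using neq(2) pk(1) by (metis Suc_leI le0)
  next
    fix i assume 1: "i < N" "tail G a = r (Suc i)" "head G a = r i"
    from outer_ends[OF b] show ?thesis unfolding E 1 using neq[where i = "Suc i"] rk[OF 1(1)] 1(1) by (metis Suc_leI)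
  qed
qed

lemma walk_eq: "wv i = wv j \<Longrightarrow> walk i = walk j"
  unfolding wv_def using arc_unique[OF walk_arc walk_arc] outer_tail_inj[OF walk_outer walk_outer] by blast

lemma start_ex: "\<exists>st. wv st = r 0"
proof -
  have "r 0 \<in> tail G ` outer_face M" unfolding tail_outer verts_eq by auto
  then show ?thesis unfolding outer_range wv_def by auto
qed

text \<open>One full round leads from an arc at \<open>r 0\<close> back to the same arc. This
  carries over to every start because the powers of \<open>ph\<close> are injective.\<close>

lemma walk_period: "walk (j + nv) = walk j"
proof -
  obtain st where st: "wv st = r 0" using start_ex by blast
  have 1: "walk (st + nv) = walk st" by (rule walk_eq) (use wv_r[OF st, of N] st in \<open>simp add: add.assoc\<close>)
  have add: "walk (i + k) = (ph ^^ k) (walk i)" for i k unfolding walk_def by (simp add: funpow_add add.commute[of i k])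
  have inj: "inj (ph ^^ k)" for k using permutes_inj[OF ph_permutes] by (rule inj_fn)
  have "(ph ^^ st) (walk (j + nv)) = (ph ^^ st) (walk j)"
    using add[of "j + nv" st] add[of j st] add[of "st + nv" j] add[of st j] 1 by (simp add: ac_simps)
  then show ?thesis using inj by (auto dest: injD)
qed

lemma wv_period: "wv (j + nv) = wv j" unfolding wv_def walk_period ..

lemma walk_mod: "walk (j mod nv) = walk j"
proof -
  have "walk (i + k * nv) = walk i" for i k
  proof (induction k)
    case (Suc k)
    have "i + Suc k * nv = (i + k * nv) + nv" by simp
    then show ?case using walk_period[of "i + k * nv"] Suc by metis
  qed simp
  from this[of "j mod nv" "j div nv"] show ?thesis by (metis mod_div_mult_eq)
qed

lemma wv_mod: "wv (j mod nv) = wv j" unfolding wv_def walk_mod ..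

lemma outer_image: "n \<ge> nv \<Longrightarrow> walk ` {..<n} = outer_face M"
proof -
  assume n: "n \<ge> nv"
  have "walk j \<in> walk ` {..<n}" for j
  proof (rule image_eqI)
    show "walk j = walk (j mod nv)" by (rule walk_mod[symmetric])
    have "j mod nv < nv" by simp
    then show "j mod nv \<in> {..<n}" using n by (simp only: lessThan_iff)
  qed
  then show ?thesis unfolding outer_range by auto
qed

lemma wv_image: "wv ` {..<nv} = verts G"
  using outer_image[of nv] tail_outer unfolding wv_def by (metis image_image order_refl)

lemma card_nv: "card (verts G) = nv"
proof -
  have "p ` {..<K} \<inter> r ` {..N} = {}" using p_neq_r by auto
  then show ?thesis unfolding verts_eq by (simp add: card_Un_disjoint card_image inj_p inj_r)
qed

lemma wv_inj: "inj_on wv {..<nv}"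
  by (rule eq_card_imp_inj_on[OF finite_lessThan]) (simp only: wv_image card_nv card_lessThan)

text \<open>In a graph without multiple edges the heads tell the outgoing arcs of a vertex apart, so
  there are at most two of them here, whereas three different iterates of the rotation would be
  three outgoing arcs.\<close>

lemma succ_two:
  assumes a: "a \<in> arcs G" and two: "head G ` out_arcs G (tail G a) \<subseteq> {x, y}"
  shows "edge_succ M (edge_succ M a) = a"
proof (rule ccontr)
  let ?S = "out_arcs G (tail G a)" and ?s = "edge_succ M"
  assume ne: "?s (?s a) \<noteq> a"
  have s: "?s b \<in> ?S" if "b \<in> ?S" for b
    using that tail_succ[of b] permutes_in_image[OF succ_permutes] by auto
  have mem: "a \<in> ?S" "?s a \<in> ?S" "?s (?s a) \<in> ?S" using s[of a] s[of "?s a"] a by auto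
  have d: "?s a \<noteq> a" "?s (?s a) \<noteq> ?s a"
    using ne permutes_inj[OF succ_permutes] by (metis, metis injD)
  have "inj_on (head G) ?S" by (rule inj_onI) (auto intro: arc_unique)
  then have "card ?S \<le> card {x, y}" using two by (meson card_inj_on_le finite.emptyI finite.insertI)
  moreover have "card {x, y} \<le> 2" by (metis card_2_iff card.insert_remove card_insert_le_m1 finite.emptyI insert_absorb2 numeral_2_eq_2 is_singletonI is_singleton_altdef one_le_numeral order_refl)
  moreover have "finite ?S" using finite_arcs unfolding out_arcs_def by simp
  then have "card {a, ?s a, ?s (?s a)} \<le> card ?S" using mem by (intro card_mono) auto
  moreover have "card {a, ?s a, ?s (?s a)} = 3" using d ne by auto
  ultimately show False by simp
qed

lemma I_zero: "t \<le> m \<Longrightarrow> I t = 0 \<Longrightarrow> t = 0"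
  using mono_JI[of 1 t] first_step by (cases t) auto
lemma I_last: "t \<le> m \<Longrightarrow> I t = N \<Longrightarrow> t = m"
proof (rule ccontr)
  assume t: "t \<le> m" "I t = N" "t \<noteq> m"
  then have "t \<le> m - 1" by simp
  then have "I t \<le> N - 1" using mono_JI[of t "m - 1"] last_step by simp
  then show False using t(2) N_pos by simp
qed

lemma ear_heads:
  assumes a: "a \<in> arcs G"
  shows "tail G a = r 0 \<Longrightarrow> head G a \<in> {p 0, r 1}" "tail G a = r N \<Longrightarrow> head G a \<in> {p (K - 1), r (N - 1)}"
proof -
  assume t: "tail G a = r 0"
  from arc_ends[OF a] show "head G a \<in> {p 0, r 1}"
  proof (elim disjE exE conjE)
    fix s assume s: "s \<le> m" "{tail G a, head G a} = {p (J s), r (I s)}"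
    then have "r 0 = r (I s)" "head G a = p (J s)" using t r_neq_p[OF J_lt[OF s(1)], of 0] by (auto simp: doubleton_eq_iff)
    then show ?thesis using I_zero[OF s(1)] I_le[OF s(1)] path_start by auto
  next
    fix j assume "Suc j < K" "{tail G a, head G a} = {p j, p (Suc j)}"
    then show ?thesis using t r_neq_p[of j 0] r_neq_p[of "Suc j" 0] by (auto simp: doubleton_eq_iff)
  next
    fix i assume i: "i < N" "{tail G a, head G a} = {r i, r (Suc i)}"
    then show ?thesis using t by (auto simp: doubleton_eq_iff)
  qed
next
  assume t: "tail G a = r N"
  from arc_ends[OF a] show "head G a \<in> {p (K - 1), r (N - 1)}"
  proof (elim disjE exE conjE)
    fix s assume s: "s \<le> m" "{tail G a, head G a} = {p (J s), r (I s)}"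
    then have "r N = r (I s)" "head G a = p (J s)" using t r_neq_p[OF J_lt[OF s(1)], of N] by (auto simp: doubleton_eq_iff)
    then have "I s = N" using I_le[OF s(1)] by simp
    from I_last[OF s(1) this] have "J s = K - 1" using path_end(1) by simp
    then show ?thesis using \<open>head G a = p (J s)\<close> by simp
  next
    fix j assume "Suc j < K" "{tail G a, head G a} = {p j, p (Suc j)}"
    then show ?thesis using t r_neq_p[of j N] r_neq_p[of "Suc j" N] by (auto simp: doubleton_eq_iff)
  next
    fix i assume i: "i < N" "{tail G a, head G a} = {r i, r (Suc i)}"
    then have "r N = r i \<and> head G a = r (Suc i) \<or> r N = r (Suc i) \<and> head G a = r i" using t by (auto simp: doubleton_eq_iff)
    moreover have "r N \<noteq> r i" "r N = r (Suc i) \<Longrightarrow> N = Suc i" using i(1) r_eq_iff[of N i] r_eq_iff[of N "Suc i"] by auto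
    ultimately have "head G a = r i" "i = N - 1" by auto
    then show ?thesis by simp
  qed
qed

text \<open>The vertices \<open>p 0\<close> and \<open>p (K - 1)\<close> also lie on the end rungs,
  which are no chords; for them the rungs 1 and \<open>m - 1\<close> serve, since the end steps keep
  the \<open>p\<close>-vertex.\<close>

lemma chord_at:
  assumes m: "2 \<le> m" and v: "v \<in> verts G" "v \<noteq> r 0" "v \<noteq> r N"
  shows "\<exists>t. 0 < t \<and> t < m \<and> (v = p (J t) \<or> v = r (I t))"
proof -
  consider j where "j < K" "v = p j" | i where "i \<le> N" "v = r i" using v(1) unfolding verts_eq by auto
  then show ?thesis
  proof cases
    case 1
    show ?thesis
    proof (cases "j = 0 \<or> j = K - 1")
      case True
      then show ?thesis using 1 m path_first path_last by (elim disjE) (intro exI[of _ 1], simp, intro exI[of _ "m - 1"], simp)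
    next
      case False
      obtain t where t: "t \<le> m" "J t = j" using J_surj[OF 1(1)] by blast
      then have "t \<noteq> 0" "t \<noteq> m" using False path_start(1) path_end(1) by metis+
      then show ?thesis using t 1 by (intro exI[of _ t]) auto
    qed
  next
    case 2
    obtain t where t: "t \<le> m" "I t = i" using I_surj[OF 2(1)] by blast
    then have "t \<noteq> 0" "t \<noteq> m" using 2 v path_start(2) path_end(2) by metis+
    then show ?thesis using t 2 by (intro exI[of _ t]) auto
  qed
qed

text \<open>Order two of the rotation is how the program recognizes an ear. Every other vertex lies
  on a chord, but an orbit of length two consists only of the outgoing outer arc and the reverse of
  the incoming one.\<close>

lemma ear_iff:
  assumes m: "2 \<le> m"
  shows "edge_succ M (edge_succ M (walk j)) = walk j \<longleftrightarrow> wv j = r 0 \<or> wv j = r N"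
proof
  assume "wv j = r 0 \<or> wv j = r N"
  then show "edge_succ M (edge_succ M (walk j)) = walk j"
  proof
    assume e: "wv j = r 0"
    show ?thesis by (rule succ_two[OF walk_arc, of _ "p 0" "r 1"]) (use ear_heads(1) e[unfolded wv_def] in \<open>fastforce\<close>)
  next
    assume e: "wv j = r N"
    show ?thesis by (rule succ_two[OF walk_arc, of _ "p (K - 1)" "r (N - 1)"]) (use ear_heads(2) e[unfolded wv_def] in \<open>fastforce\<close>)
  qed
next
  assume e: "edge_succ M (edge_succ M (walk j)) = walk j"
  let ?s = "edge_succ M" and ?a = "walk j" and ?S = "out_arcs G (wv j)"
  show "wv j = r 0 \<or> wv j = r N"
  proof (rule ccontr)
    assume n: "\<not> (wv j = r 0 \<or> wv j = r N)"
    obtain t where t: "0 < t" "t < m" "wv j = p (J t) \<or> wv j = r (I t)"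
      using chord_at[OF m, of "wv j"] n ends_in(1)[OF walk_arc[of j]] unfolding wv_def by auto
    obtain c0 where c0: "c0 \<in> arcs G" "tail G c0 = p (J t)" "head G c0 = r (I t)" using rung[of t] t by auto
    define c where "c = (if wv j = p (J t) then c0 else rv c0)"
    have c: "c \<in> arcs G" "tail G c = wv j" "{tail G c, head G c} = {p (J t), r (I t)}"
      unfolding c_def using c0 rv_facts[of c0] t(3) by (auto simp: rv_facts(2-4))
    have co: "c \<notin> outer_face M" "rv c \<notin> outer_face M" using in_outer_iff[OF c(1)] c(3) t(1,2) unfolding rv_def by blast+
    define b where "b = rv (walk (j + K + N))"
    have sb: "?s b = ?a"
    proof -
      have "?s b = walk (Suc (j + K + N))" unfolding b_def walk_Suc ph_def rv_def by simp
      then show ?thesis using walk_period[of j] by (simp add: add.assoc)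
    qed
    have ab: "?s ?a = b" using e sb permutes_inj[OF succ_permutes] by (metis injD)
    have v: "wv j \<in> verts G" using ends_in(1)[OF walk_arc] unfolding wv_def by blast
    have aS: "?a \<in> ?S" using walk_arc unfolding wv_def by simp
    have cy: "cyclic_on ?s ?S" by (rule rot[OF v]) (use aS in blast)
    have "x \<in> {?a, b}" if "x \<in> orbit ?s ?a" for x
      using that by (induction rule: orbit.induct) (use ab sb in auto)
    moreover have "c \<in> orbit ?s ?a" using orbit_cyclic_eq3[OF cy aS] c(1,2) by simp
    ultimately have "c = ?a \<or> c = b" by blast
    then show False
    proof
      assume "c = ?a" then show False using co walk_outer by simp
    next
      assume "c = b" then show False using co walk_outer[of "j + K + N"] rv_facts(1) unfolding b_def by simp
    qed
  qed
qed

text \<open>The walk may start anywhere on the outer face. Either \<open>r 0\<close> comes first and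
  the \<open>p\<close>-side lies between the two positions, or \<open>r N\<close> comes first and
  the \<open>p\<close>-side wraps around the end of the round.\<close>

lemma two_ears:
  assumes m: "2 \<le> m"
  obtains e1 e2 where "filter (\<lambda>j. edge_succ M (edge_succ M (walk j)) = walk j) [0..<nv] = [e1, e2]"
    "wv e1 = r 0 \<and> wv e2 = r N \<and> e2 - e1 - 1 = K \<or> wv e2 = r 0 \<and> wv e1 = r N \<and> nv - (e2 - e1) - 1 = K"
    "e1 < e2" "e2 < nv"
proof -
  have lst: "filter Q [0..<nv] = [x, y]" if "x < y" "y < nv" "\<And>j. j < nv \<Longrightarrow> Q j \<longleftrightarrow> j = x \<or> j = y" for Q x y
  proof (rule sorted_distinct_set_unique)
    show "sorted (filter Q [0..<nv])" "distinct (filter Q [0..<nv])" by (rule sorted_wrt_filter, rule sorted_upt) (rule distinct_filter, rule distinct_upt)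
    show "set (filter Q [0..<nv]) = set [x, y]" using that by auto
  qed (use that in auto)
  obtain st0 where "wv st0 = r 0" using start_ex by blast
  then have st: "wv (st0 mod nv) = r 0" using wv_mod by simp
  define st where "st = st0 mod nv"
  have stn: "st < nv" unfolding st_def by simp
  have s0: "wv st = r 0" using st st_def by simp
  have uniq: "wv i = wv j \<Longrightarrow> i = j" if "i < nv" "j < nv" for i j using wv_inj that by (auto dest: inj_onD)
  have at: "wv j = wv i \<longleftrightarrow> j = i" if "i < nv" "j < nv" for i j using uniq that by blast
  have sN: "wv (st + K + 1) = r N" using wv_r[OF s0, of 0] by simp
  show thesis
  proof (cases "st + K + 1 < nv")
    case True
    show thesis
    proof (rule that[of st "st + K + 1"])
      show "filter (\<lambda>j. edge_succ M (edge_succ M (walk j)) = walk j) [0..<nv] = [st, st + K + 1]"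
      proof (rule lst)
        fix j assume j: "j < nv"
        show "edge_succ M (edge_succ M (walk j)) = walk j \<longleftrightarrow> j = st \<or> j = st + K + 1"
          unfolding ear_iff[OF m] s0[symmetric] sN[symmetric] at[OF stn j] at[OF True j] ..
      qed (use True in auto)
    qed (use s0 sN True in auto)
  next
    case False
    define e where "e = st + K + 1 - nv"
    have e: "e + nv = st + K + 1" "e < st" using False stn N_pos unfolding e_def by auto
    have eN: "wv e = r N" using wv_period[of e, unfolded e(1)] sN by simp
    show thesis
    proof (rule that[of e st])
      show "filter (\<lambda>j. edge_succ M (edge_succ M (walk j)) = walk j) [0..<nv] = [e, st]"
      proof (rule lst)
        fix j assume j: "j < nv"
        have "e < nv" using e(2) stn by linarith
        then show "edge_succ M (edge_succ M (walk j)) = walk j \<longleftrightarrow> j = e \<or> j = st"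
          unfolding ear_iff[OF m] s0[symmetric] eN[symmetric] using at[OF stn j] at[OF _ j] by blast
      qed (use e stn in auto)
      have "nv - (st - e) - 1 = K" using e stn by linarith
      then show "wv e = r 0 \<and> wv st = r N \<and> st - e - 1 = K \<or> wv st = r 0 \<and> wv e = r N \<and> nv - (st - e) - 1 = K" using s0 eN by simp
    qed (use e stn in auto)
  qed
qed

end

lemma fan_max_ge: "a < A \<Longrightarrow> P (he a) = 0 \<Longrightarrow> P (ta a) = x \<Longrightarrow> R (he a) \<le> fan_max P R ta he A x"
  by (induction A) (auto simp: less_Suc_eq max_def)

lemma fan_max_cases: "fan_max P R ta he A x = 0 \<or> (\<exists>a<A. P (he a) = 0 \<and> P (ta a) = x \<and> fan_max P R ta he A x = R (he a))"
proof (induction A)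
  case (Suc A)
  show ?case
  proof (cases "P (he A) = 0 \<and> P (ta A) = x \<and> fan_max P R ta he A x \<le> R (he A)")
    case True
    then have "fan_max P R ta he (Suc A) x = R (he A)" by simp
    then show ?thesis using True by blast
  next
    case False
    then have "fan_max P R ta he (Suc A) x = fan_max P R ta he A x" by auto
    then show ?thesis using Suc less_SucI by metis
  qed
qed simp

lemma distinct_singletons:
  fixes g :: "nat \<Rightarrow> item list"
  assumes "\<And>a. g a = [] \<or> (\<exists>c k. g a = [(c, a, k)])"
  shows "distinct (concat (map g [0..<A]))"
proof (induction A)
  case (Suc A)
  have "id_of x < A" if x: "x \<in> set (concat (map g [0..<A]))" for x
  proof -
    obtain a where a: "a < A" "x \<in> set (g a)" using x by auto
    then show ?thesis using assms[of a] by auto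
  qed
  then have nin: "(c, A, k) \<notin> set (concat (map g [0..<A]))" for c k by fastforce
  have e: "concat (map g [0..<Suc A]) = concat (map g [0..<A]) @ g A" by simp
  from assms[of A] show ?case unfolding e distinct_append
  proof (elim disjE exE)
    fix c k assume g: "g A = [(c, A, k)]"
    show "distinct (concat (map g [0..<A])) \<and> distinct (g A) \<and> set (concat (map g [0..<A])) \<inter> set (g A) = {}"
      unfolding g using nin[of c k] Suc by simp
  qed (use Suc in simp)
qed simp

lemma set_concat_cond:
  assumes "\<And>a. a < (A :: nat) \<Longrightarrow> g a = (if Q a then [h a] else [])"
  shows "x \<in> set (concat (map g [0..<A])) \<longleftrightarrow> (\<exists>a<A. Q a \<and> x = h a)"
proof -
  have "x \<in> set (concat (map g [0..<A])) \<longleftrightarrow> (\<exists>a<A. x \<in> set (g a))" by auto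
  also have "\<dots> \<longleftrightarrow> (\<exists>a<A. Q a \<and> x = h a)" using assms by auto
  finally show ?thesis .
qed

lemma vertex_items:
  "distinct (map (\<lambda>v. (0 :: nat, v, g v)) [0..<n])" "x \<in> set (map (\<lambda>v. (0 :: nat, v, g v)) [0..<n]) \<Longrightarrow> fst x = 0"
  by (auto simp: distinct_map inj_on_def)

lemma upt_3: "[0..<3] = [0, 1, 2 :: nat]" by (simp add: eval_nat_numeral)

lemma Max_level:
  assumes "finite X" "X \<noteq> {}" "\<And>w. w \<in> X \<Longrightarrow> \<rho> w \<le> B" "\<And>w. w \<in> X \<Longrightarrow> h w = (if w \<in> C then B else \<rho> w)"
  shows "Max (h ` X) = level \<rho> C B X"
proof (cases "X \<inter> C = {}")
  case True
  then have "h ` X = \<rho> ` X" using assms(4) by (intro image_cong) auto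
  then show ?thesis using True unfolding level_def by simp
next
  case False
  then obtain w where "w \<in> X" "w \<in> C" by auto
  then have "B \<in> h ` X" using assms(4)[of w] by (intro image_eqI[of _ _ w]) auto
  moreover have "y \<le> B" if "y \<in> h ` X" for y using that assms(3,4) by auto
  ultimately have "Max (h ` X) = B" using assms(1) by (intro Max_eqI) auto
  then show ?thesis using False unfolding level_def by simp
qed

section \<open>Correctness of the labels and of the listed cells\<close>

locale numbered_walk = outer_walk where M = M for M :: "(nat, nat) pmap" +
  assumes num: "numbered M"
begin

abbreviation table :: "(nat \<Rightarrow> nat) \<Rightarrow> nat \<Rightarrow> nat" where "table f \<equiv> (\<lambda>a. if a \<in> arcs G then f a else 0)"
definition ta where "ta = table (tail G)"
definition rt where "rt = table (edge_rev M)"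
definition st where "st = table (edge_succ M)"
definition A where "A = card (arcs G)"

lemma verts_num: "verts G = {..<nv}" and arcs_num: "arcs G = {..<A}"
  using num unfolding numbered_def A_def G_def[symmetric] card_nv by auto

lemma tables:
  assumes "a \<in> arcs G"
  shows "ta a = tail G a" "rt a = rv a" "st a = edge_succ M a" "st (rt a) = ph a" "ta (rt a) = head G a" "ta (ph a) = head G a"
    "st (rt (ph a)) = ph (ph a)" "ta (ph (ph a)) = head G (ph a)" "ta (rv a) = head G a"
  using assms rv_facts(2,3)[OF assms] ph_arc[OF assms] ph_arc[OF ph_arc[OF assms]] tail_ph[OF assms] tail_ph[OF ph_arc[OF assms]]
    rv_facts(2)[OF ph_arc[OF assms]]
  unfolding ta_def rt_def st_def ph_def rv_def by auto

lemma table_walk: "((\<lambda>a. st (rt a)) ^^ j) a0 = walk j"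
  by (induction j) (use tables(4)[OF walk_arc] in \<open>auto simp: walk_def\<close>)

lemma side_facts:
  assumes sd: "side wv nv ta (\<lambda>a. ta (rt a)) A pos K Pf Rf i1 i2 i3" and pos: "wv pos = r 0"
  shows "\<And>j. j < K \<Longrightarrow> Pf (p j) = Suc j" "\<And>i. i \<le> N \<Longrightarrow> Pf (r i) = 0" "\<And>i. i \<le> N \<Longrightarrow> Rf (r i) = i"
    "i1 = turn 0" "i2 = turn 1" "i3 = turn 2" "K \<le> 4"
proof -
  have N: "nv - K - 1 = N" by simp
  have Pi: "(\<lambda>j. wv (pos + j + 1)) ` {..<K} = p ` {..<K}"
    using wv_p[OF pos] by (intro image_cong) (auto simp: add.commute add.left_commute)
  have a: "K \<le> 4" "\<And>j. j < K \<Longrightarrow> Pf (wv (pos + j + 1)) = Suc j" "\<And>u. u \<notin> p ` {..<K} \<Longrightarrow> Pf u = 0"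
     "\<And>i. i \<le> N \<Longrightarrow> Rf (wv (pos + nv - i)) = i"
    and t: "i1 = (if 1 < K then fan_max Pf Rf ta (\<lambda>a. ta (rt a)) A 1 else N + 2 - K)" "i2 = (if 2 < K then fan_max Pf Rf ta (\<lambda>a. ta (rt a)) A 2 else N + 3 - K)"
      "i3 = (if 3 < K then fan_max Pf Rf ta (\<lambda>a. ta (rt a)) A 3 else N + 4 - K)"
    using sd unfolding side_def Let_def N Pi by auto
  show "K \<le> 4" by (rule a)
  show P: "Pf (p j) = Suc j" if "j < K" for j using a(2)[OF that] wv_p[OF pos that] by simp
  show P0: "Pf (r i) = 0" if "i \<le> N" for i using a(3)[of "r i"] r_neq_p[OF _ that] by auto
  show R: "Rf (r i) = i" if "i \<le> N" for i using a(4)[OF that] wv_r'[OF pos that] by simp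
  \<comment> \<open>\<open>rung\<close> provides an arc that attains \<open>hi j\<close>;
    conversely, an arc from \<open>p j\<close> to an \<open>r\<close>-vertex can only belong to a
    rung.\<close>
  have H: "fan_max Pf Rf ta (\<lambda>a. ta (rt a)) A (Suc j) = hi j" if j: "j < K" for j
  proof (rule antisym)
    obtain t where t: "t \<le> m" "J t = j" "I t = hi j" using hi_in[OF j] by blast
    obtain a where a: "a \<in> arcs G" "tail G a = p j" "head G a = r (hi j)" using rung[OF t(1)] t by auto
    have hN: "hi j \<le> N" using I_le[OF t(1)] t(3) by simp
    have "Rf (ta (rt a)) \<le> fan_max Pf Rf ta (\<lambda>a. ta (rt a)) A (Suc j)"
      by (rule fan_max_ge[where he = "\<lambda>a. ta (rt a)"]) (use a arcs_num tables(1,5)[OF a(1)] P[OF j] P0[OF hN] in auto)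
    then show "hi j \<le> fan_max Pf Rf ta (\<lambda>a. ta (rt a)) A (Suc j)" using tables(5)[OF a(1)] a(3) R[OF hN] by simp
    from fan_max_cases[of Pf Rf ta "\<lambda>a. ta (rt a)" A "Suc j"]
    show "fan_max Pf Rf ta (\<lambda>a. ta (rt a)) A (Suc j) \<le> hi j"
    proof (elim disjE exE conjE)
      fix a assume A: "a < A" and pa: "Pf (ta (rt a)) = 0" "Pf (ta a) = Suc j" and e: "fan_max Pf Rf ta (\<lambda>a. ta (rt a)) A (Suc j) = Rf (ta (rt a))"
      have a: "a \<in> arcs G" using A arcs_num by simp
      note tb = tables(1,5)[OF a]
      have tl: "tail G a = p j"
      proof -
        have "tail G a \<in> p ` {..<K}" using a(1) pa(2) \<open>\<And>u. u \<notin> p ` {..<K} \<Longrightarrow> Pf u = 0\<close>[of "tail G a"] tb by auto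
        then show ?thesis using P pa(2) tb by auto
      qed
      obtain i where i: "i \<le> N" "head G a = r i"
      proof -
        have "head G a \<notin> p ` {..<K}" using pa(1) P tb by auto
        then show thesis using that ends_in(2)[OF a] unfolding verts_eq by auto
      qed
      from arc_ends[OF a] obtain t where t: "t \<le> m" "{p j, r i} = {p (J t), r (I t)}"
        unfolding tl i(2)
      proof (elim disjE exE conjE)
        fix j' assume "Suc j' < K" "{p j, r i} = {p j', p (Suc j')}"
        then show thesis using r_neq_p[OF _ i(1)] by (metis Suc_lessD doubleton_eq_iff)
      next
        fix i' assume "i' < N" "{p j, r i} = {r i', r (Suc i')}"
        then show thesis using p_neq_r[OF j] by (metis Suc_leI doubleton_eq_iff less_imp_le_nat)
      qed blast
      have "p j = p (J t)" "r i = r (I t)" using t(2) p_neq_r[OF j I_le[OF t(1)]] by (auto simp: doubleton_eq_iff)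
      then have "J t = j" "I t = i" using j i(1) J_lt[OF t(1)] I_le[OF t(1)] by auto
      then have "i \<le> hi j" using hi_ge[OF t(1)] by simp
      then show ?thesis using e tb i R by simp
    qed simp
  qed
  show "i1 = turn 0" "i2 = turn 1" "i3 = turn 2"
  proof -
    have h1: "1 < K \<Longrightarrow> fan_max Pf Rf ta (\<lambda>a. ta (rt a)) A 1 = hi 0" using H[of 0] by simp
    have h2: "2 < K \<Longrightarrow> fan_max Pf Rf ta (\<lambda>a. ta (rt a)) A 2 = hi 1" using H[of 1] by (simp add: numeral_2_eq_2)
    have h3: "3 < K \<Longrightarrow> fan_max Pf Rf ta (\<lambda>a. ta (rt a)) A 3 = hi 2" using H[of 2] by simp
    show "i1 = turn 0" "i2 = turn 1" "i3 = turn 2"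
      unfolding t turn_def using h1 h2 h3 by auto
  qed
qed

text \<open>Imagined turns lie beyond \<open>N\<close> and differ from the real ones and from each
  other, so \<open>turn 0 = turn 2\<close> forces all turns to be real, that is
  \<open>K = 4\<close>. Monotonicity of \<open>hi\<close> then squeezes the middle turn.\<close>

lemma turns_eq:
  assumes "K \<le> 4" "turn 0 = turn 2"
  shows "K = 4" "hi 0 = hi 1" "hi 1 = hi 2"
proof -
  have K4: "K = 1 \<or> K = 2 \<or> K = 3 \<or> K = 4" using assms(1) K_pos by auto
  have "K \<noteq> 1" "K \<noteq> 2" "K \<noteq> 3" using assms(2) hi_less(2)[of 0] unfolding turn_def by auto
  then show K: "K = 4" using K4 by auto
  have "hi 0 = hi 2" using assms(2) K unfolding turn_def by simp
  moreover have "hi 0 \<le> hi 1" "hi 1 \<le> hi 2" using hi_mono[of 0] hi_mono[of 1] K by (auto simp: numeral_2_eq_2)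
  ultimately show "hi 0 = hi 1" "hi 1 = hi 2" by auto
qed

text \<open>Items and cells correspond bijectively under \<open>nm\<close>, with equal keys: an edge
  is represented by its smaller arc, a triangle by its smallest arc and the outer face by
  \<open>a0\<close>. Sorting the items therefore sorts the cells.\<close>

lemma ordered_cells:
  assumes o: "ordered \<lparr>regs = (\<lambda>_. 0)(0 := nv, 1 := A, 5 := a0),
      mem = (\<lambda>_ _. 0)(0 := ta, 1 := rt, 2 := st, 11 := \<lambda>a. if a \<in> walk ` {..<2 * nv} then 1 else 0)\<rparr> nv Pf Rf S i1 i2 i3 k s'"
    and P: "\<And>j. j < K \<Longrightarrow> Pf (p j) = Suc j" "\<And>i. i \<le> N \<Longrightarrow> Pf (r i) = 0" "\<And>i. i \<le> N \<Longrightarrow> Rf (r i) = i"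
    and k: "k < 3" and S: "N < S" "i1 < S" "i2 < S" "i3 < S" "K \<le> 4"
  shows "\<exists>\<rho> xs. (\<forall>j<K. \<rho> (p j) = rank_p S k j) \<and> (\<forall>i\<le>N. \<rho> (r i) = rank_r S i1 i2 i3 k i) \<and>
     distinct xs \<and> set xs = cells M \<and> sorted (map (key M \<rho> {p j | j. j < K \<and> j mod 3 = k} (4 * S)) xs) \<and> output_order M s' k = list_order xs"
proof -
  define q where "q = 100 + 20 * k"
  define C where "C = {p j | j. j < K \<and> j mod 3 = k}"
  obtain s0 where s0: "regs s0 0 = nv" "regs s0 1 = A" "regs s0 5 = a0" "regs s0 60 = 4 * S"
      "mem s0 0 = ta" "mem s0 1 = rt" "mem s0 2 = st" "mem s0 11 = (\<lambda>a. if a \<in> walk ` {..<2 * nv} then 1 else 0)"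
    and rk: "\<And>v. v < nv \<Longrightarrow> mem s0 q v = rank_of S i1 i2 i3 k (Pf v) (Rf v)" "\<And>v. v < nv \<Longrightarrow> mem s0 (q + 1) v = high_rank_of S i1 i2 i3 k (Pf v) (Rf v)"
    and ys: "length (buckets (all_items q s0) (3 * (4 * S) + 4)) = length (all_items q s0)"
      "\<And>i. i < length (buckets (all_items q s0) (3 * (4 * S) + 4)) \<Longrightarrow> mem s' (3 + 2 * k) i = kind_of (buckets (all_items q s0) (3 * (4 * S) + 4) ! i) \<and>
         mem s' (4 + 2 * k) i = id_of (buckets (all_items q s0) (3 * (4 * S) + 4) ! i)"
    using o unfolding ordered_def keeps_def q_def Let_def by auto
  define \<rho> where "\<rho> = mem s0 q"
  define h where "h = mem s0 (q + 1)"
  define nm where "nm x = named_cell M (kind_of x) (id_of x)" for x :: item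
  have mark: "mem s0 11 a = (if a \<in> outer_face M then 1 else 0)" for a
    unfolding s0 using outer_image[of "2 * nv"] by simp
  have pv: "p j < nv" if "j < K" for j using that verts_num verts_eq by auto
  have rv': "r i < nv" if "i \<le> N" for i using that verts_num verts_eq by auto
  have rp: "\<rho> (p j) = rank_p S k j" if "j < K" for j
    using rk(1)[OF pv[OF that]] P(1)[OF that] unfolding \<rho>_def rank_of_def by simp
  have rr: "\<rho> (r i) = rank_r S i1 i2 i3 k i" if "i \<le> N" for i
    using rk(1)[OF rv'[OF that]] P(2,3)[OF that] unfolding \<rho>_def rank_of_def by simp
  have vc: "(\<exists>j<K. w = p j) \<or> (\<exists>i\<le>N. w = r i)" if "w \<in> verts G" for w using that unfolding verts_eq by auto
  have hw: "\<rho> w \<le> 4 * S \<and> h w = (if w \<in> C then 4 * S else \<rho> w)" if w: "w \<in> verts G" for w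
  proof -
    have wn: "w < nv" using w verts_num by simp
    have "Pf w \<le> 4 \<and> Rf w < S \<or> Pf w \<noteq> 0 \<and> Pf w \<le> 4"
      using vc[OF w] P S by auto
    moreover have "rank_of S i1 i2 i3 k (Pf w) (Rf w) = rank_of S i1 i2 i3 k (Pf w) 0" if "Pf w \<noteq> 0" using that unfolding rank_of_def by simp
    ultimately have "rank_of S i1 i2 i3 k (Pf w) (Rf w) < 4 * S"
      using rank_of_bounds(1)[OF k, of "Pf w" _ S i1 i2 i3] S by (metis gr_zeroI less_nat_zero_code)
    moreover have "w \<in> C \<longleftrightarrow> Pf w \<noteq> 0 \<and> (Pf w - 1) mod 3 = k"
      using vc[OF w]
    proof (elim disjE exE conjE)
      fix j assume j: "j < K" "w = p j"
      then have "w \<in> C \<longleftrightarrow> j mod 3 = k" unfolding C_def by auto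
      then show ?thesis using P(1)[OF j(1)] j(2) by simp
    next
      fix i assume i: "i \<le> N" "w = r i"
      then have "w \<notin> C" using r_neq_p[OF _ i(1)] unfolding C_def by auto
      then show ?thesis using P(2)[OF i(1)] i(2) by simp
    qed
    ultimately show ?thesis using rk[OF wn] unfolding \<rho>_def h_def high_rank_of_def by auto
  qed
  have lev: "Max (h ` X) = level \<rho> C (4 * S) X" if "finite X" "X \<noteq> {}" "X \<subseteq> verts G" for X
    by (rule Max_level) (use that hw in auto)
  define ke where "ke a = 3 * (if a \<notin> outer_face M \<and> rv a \<notin> outer_face M then max (h (tail G a)) (h (head G a)) else max (\<rho> (tail G a)) (\<rho> (head G a))) + 1" for a
  define kf where "kf a = 3 * max (max (h (tail G a)) (h (head G a))) (h (head G (ph a))) + 2" for a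
  have ei: "edge_items q s0 a = (if a < rv a then [(1, a, ke a)] else [])" if "a \<in> arcs G" for a
    unfolding edge_items_def Let_def mark ke_def \<rho>_def h_def unfolding s0 tables(1,2)[OF that] tables(9)[OF that] by auto
  have fi: "face_items q s0 a = (if a \<notin> outer_face M \<and> a < ph a \<and> a < ph (ph a) then [(2, a, kf a)] else [])" if "a \<in> arcs G" for a
    unfolding face_items_def Let_def mark kf_def h_def unfolding s0 tables(4)[OF that] tables(7)[OF that] tables(1,6,8)[OF that] by auto
  let ?items = "all_items q s0"
  have items: "?items = map (\<lambda>v. (0, v, 3 * \<rho> v)) [0..<nv] @ concat (map (edge_items q s0) [0..<A]) @ concat (map (face_items q s0) [0..<A]) @ [(2, a0, 3 * (4 * S))]"
    unfolding all_items_def \<rho>_def s0 ..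
  have arcA: "a \<in> arcs G \<longleftrightarrow> a < A" for a unfolding arcs_num by simp
  have memE: "x \<in> set (concat (map (edge_items q s0) [0..<A])) \<longleftrightarrow> (\<exists>a\<in>arcs G. a < rv a \<and> x = (1, a, ke a))" for x
    using set_concat_cond[of A "edge_items q s0" "\<lambda>a. a < rv a" "\<lambda>a. (1, a, ke a)" x, OF ei[unfolded arcA]] unfolding Bex_def arcA by simp
  have memF: "x \<in> set (concat (map (face_items q s0) [0..<A])) \<longleftrightarrow> (\<exists>a\<in>arcs G. a \<notin> outer_face M \<and> a < ph a \<and> a < ph (ph a) \<and> x = (2, a, kf a))" for x
    using set_concat_cond[of A "face_items q s0" "\<lambda>a. a \<notin> outer_face M \<and> a < ph a \<and> a < ph (ph a)" "\<lambda>a. (2, a, kf a)" x, OF fi[unfolded arcA]] unfolding Bex_def arcA by simp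
  have mem: "x \<in> set ?items \<longleftrightarrow> (\<exists>v\<in>verts G. x = (0, v, 3 * \<rho> v)) \<or> (\<exists>a\<in>arcs G. a < rv a \<and> x = (1, a, ke a)) \<or>
      (\<exists>a\<in>arcs G. a \<notin> outer_face M \<and> a < ph a \<and> a < ph (ph a) \<and> x = (2, a, kf a)) \<or> x = (2, a0, 3 * (4 * S))" for x
  proof -
    have "set [0..<nv] = verts G" unfolding verts_num set_upt atLeast0LessThan ..
    then have memV: "x \<in> set (map (\<lambda>v. (0, v, 3 * \<rho> v)) [0..<nv]) \<longleftrightarrow> (\<exists>v\<in>verts G. x = (0, v, 3 * \<rho> v))"
      unfolding set_map image_iff by (simp only:)
    have sg: "x \<in> set [(2, a0, 3 * (4 * S))] \<longleftrightarrow> x = (2, a0, 3 * (4 * S))" by simp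
    show ?thesis unfolding items set_append Un_iff memE memF memV sg ..
  qed
  have a0o: "fc a0 = outer_face M" "a0 \<in> arcs G"
    by (rule conjunct1[OF face_fc[OF outer_in a0], symmetric], rule conjunct2[OF face_fc[OF outer_in a0]])
  have tri: "fc a = {a, ph a, ph (ph a)}" "fc a \<noteq> outer_face M" "a \<noteq> ph a" "a \<noteq> ph (ph a)" if "a \<in> arcs G" "a \<notin> outer_face M" for a
  proof -
    have f: "fc a \<in> faces M" "fc a \<noteq> outer_face M" using fc_in_faces[OF that(1)] self_in_fc[of a] that(2) by metis+
    then obtain t where "t < m" "fc a = F t" unfolding faces_eq by blast
    then have "card (fc a) = 3" using card_F by simp
    from triangle[OF f(1) this self_in_fc] show "fc a = {a, ph a, ph (ph a)}" "a \<noteq> ph a" "a \<noteq> ph (ph a)" by auto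
    show "fc a \<noteq> outer_face M" by (rule f)
  qed
  have dist: "distinct ?items"
  proof -
    have dE: "distinct (concat (map (edge_items q s0) [0..<A]))" "distinct (concat (map (face_items q s0) [0..<A]))"
      by (rule distinct_singletons; auto simp: edge_items_def face_items_def Let_def)+
    have dV: "distinct (map (\<lambda>v. (0 :: nat, v, 3 * \<rho> v)) [0..<nv])" by (rule vertex_items(1))
    have k0: "kind_of x = 0" if "x \<in> set (map (\<lambda>v. (0, v, 3 * \<rho> v)) [0..<nv])" for x by (rule vertex_items(2)[OF that])
    have k1: "kind_of x = 1" if "x \<in> set (concat (map (edge_items q s0) [0..<A]))" for x using that unfolding memE by force
    have k2: "kind_of x = 2 \<and> id_of x \<noteq> a0" if "x \<in> set (concat (map (face_items q s0) [0..<A]))" for x using that a0 unfolding memF by force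
    have kl: "kind_of x = 2 \<and> id_of x = a0" if "x \<in> set [(2, a0, 3 * (4 * S))]" for x using that by simp
    have dl: "distinct [(2 :: nat, a0, 3 * (4 * S))]" by simp
    have dj: "set xs \<inter> set ys = {}" if "\<And>x. x \<in> set xs \<Longrightarrow> x \<notin> set ys" for xs ys :: "item list" using that by blast
    have no: "1 \<noteq> (0 :: nat)" "2 \<noteq> (0 :: nat)" "2 \<noteq> (1 :: nat)" by auto
    show ?thesis unfolding items distinct_append
    proof (intro conjI dj dV dE dl)
      show "x \<notin> set (concat (map (edge_items q s0) [0..<A]) @ concat (map (face_items q s0) [0..<A]) @ [(2, a0, 3 * (4 * S))])"
        if "x \<in> set (map (\<lambda>v. (0, v, 3 * \<rho> v)) [0..<nv])" for x
        using k0[OF that] k1[of x] k2[of x] kl[of x] no unfolding set_append Un_iff by metis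
      show "x \<notin> set (concat (map (face_items q s0) [0..<A]) @ [(2, a0, 3 * (4 * S))])"
        if "x \<in> set (concat (map (edge_items q s0) [0..<A]))" for x
        using k1[OF that] k2[of x] kl[of x] no unfolding set_append Un_iff by metis
      show "x \<notin> set [(2, a0, 3 * (4 * S))]" if "x \<in> set (concat (map (face_items q s0) [0..<A]))" for x
        using k2[OF that] kl[of x] by metis
    qed
  qed
  have key: "key_of x = key M \<rho> C (4 * S) (nm x)" and cell: "nm x \<in> cells M" if x: "x \<in> set ?items" for x
  proof -
    from x[unfolded mem] have "key_of x = key M \<rho> C (4 * S) (nm x) \<and> nm x \<in> cells M"
    proof (elim disjE bexE conjE)
      fix v assume "v \<in> verts G" "x = (0, v, 3 * \<rho> v)"
      then show ?thesis unfolding nm_def named_cell_def cells_def G_def by simp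
    next
      fix a assume a: "a \<in> arcs G" "a < rv a" "x = (1, a, ke a)"
      have n: "nm x = Edge {a, rv a}" unfolding nm_def named_cell_def a rv_def by simp
      have tl: "tail (underlying M) ` {a, rv a} = {tail G a, head G a}" using rv_facts(3)[OF a(1)] unfolding G_def by simp
      have v: "{tail G a, head G a} \<subseteq> verts G" using ends_in a(1) by simp
      have "key M \<rho> C (4 * S) (Edge {a, rv a}) = ke a"
        unfolding key.simps tl ke_def using lev[OF _ _ v, symmetric] by auto
      then show ?thesis using n a unfolding cells_def G_def rv_def by auto
    next
      fix a assume a: "a \<in> arcs G" "a \<notin> outer_face M" "x = (2, a, kf a)"
      have n: "nm x = Face (fc a)" unfolding nm_def named_cell_def a by simp
      have tl: "tail (underlying M) ` fc a = {tail G a, head G a, head G (ph a)}"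
        unfolding tri(1)[OF a(1,2)] using tail_ph[OF a(1)] tail_ph[OF ph_arc[OF a(1)]] unfolding G_def by simp
      have v: "{tail G a, head G a, head G (ph a)} \<subseteq> verts G" using ends_in a(1) ph_arc[OF a(1)] by simp
      have "key M \<rho> C (4 * S) (Face (fc a)) = kf a"
        unfolding key.simps tl kf_def using tri(2)[OF a(1,2)] lev[OF _ _ v, symmetric] by (simp add: max.assoc)
      then show ?thesis using n a fc_in_faces[OF a(1)] unfolding cells_def by auto
    next
      assume x: "x = (2, a0, 3 * (4 * S))"
      have "nm x = Face (outer_face M)" unfolding nm_def named_cell_def x using a0o by simp
      then show ?thesis using x outer_in unfolding cells_def by auto
    qed
    then show "key_of x = key M \<rho> C (4 * S) (nm x)" "nm x \<in> cells M" by auto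
  qed
  have inj: "inj_on nm (set ?items)"
  proof (rule inj_onI)
    fix x y assume x: "x \<in> set ?items" and y: "y \<in> set ?items" and e: "nm x = nm y"
    have kd: "kind_of z \<le> 2" if "z \<in> set ?items" for z using that[unfolded mem] by auto
    have kk: "kind_of x = kind_of y" using kd[OF x] kd[OF y] e unfolding nm_def named_cell_def by (auto split: if_splits)
    have mn: "a = b" if "a \<in> arcs G" "b \<in> arcs G" "a \<notin> outer_face M" "b \<notin> outer_face M" "a < ph a" "a < ph (ph a)" "b < ph b" "b < ph (ph b)" "fc a = fc b" for a b
    proof -
      have "a \<in> fc b" "b \<in> fc a" using self_in_fc[of a] self_in_fc[of b] that(9) by metis+
      then have "b \<le> a" "a \<le> b" unfolding tri(1)[OF that(1,3)] tri(1)[OF that(2,4)] using that(5-8) by auto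
      then show ?thesis by simp
    qed
    have oo: "\<not> (a \<notin> outer_face M \<and> fc a = fc a0)" for a using self_in_fc[of a] a0o(1) by metis
    have ee: "a = b" if "a \<in> arcs G" "b \<in> arcs G" "a < rv a" "b < rv b" "{a, rv a} = {b, rv b}" for a b
      using that by (auto simp: doubleton_eq_iff)
    have nv0: "nm (0, v, w) = Vertex v" "nm (1, a, w) = Edge {a, rv a}" "nm (2, a, w) = Face (fc a)" for v a w
      unfolding nm_def named_cell_def rv_def by simp_all
    show "x = y"
      using x[unfolded mem]
    proof (elim disjE bexE conjE)
      fix v assume v: "x = (0, v, 3 * \<rho> v)"
      then show ?thesis using y[unfolded mem] e kk by (auto simp: nv0)
    next
      fix a assume a: "a \<in> arcs G" "a < rv a" "x = (1, a, ke a)"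
      from y[unfolded mem] obtain b where b: "b \<in> arcs G" "b < rv b" "y = (1, b, ke b)" using kk a(3) by auto
      have "a = b" by (rule ee[OF a(1) b(1) a(2) b(2)]) (use e[unfolded a(3) b(3) nv0] in simp)
      then show ?thesis using a(3) b(3) by simp
    next
      fix a assume a: "a \<in> arcs G" "a \<notin> outer_face M" "a < ph a" "a < ph (ph a)" "x = (2, a, kf a)"
      from y[unfolded mem] have "(\<exists>b\<in>arcs G. b \<notin> outer_face M \<and> b < ph b \<and> b < ph (ph b) \<and> y = (2, b, kf b)) \<or> y = (2, a0, 3 * (4 * S))"
        using kk a(5) by auto
      then show ?thesis
      proof (elim disjE bexE conjE)
        fix b assume b: "b \<in> arcs G" "b \<notin> outer_face M" "b < ph b" "b < ph (ph b)" "y = (2, b, kf b)"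
        have "a = b" by (rule mn[OF a(1) b(1) a(2) b(2) a(3,4) b(3,4)]) (use e[unfolded a(5) b(5) nv0] in simp)
        then show ?thesis using a(5) b(5) by simp
      next
        assume "y = (2, a0, 3 * (4 * S))"
        then show ?thesis using e oo[of a] a(2,5) nv0 by simp
      qed
    next
      assume x2: "x = (2, a0, 3 * (4 * S))"
      from y[unfolded mem] have "(\<exists>b\<in>arcs G. b \<notin> outer_face M \<and> b < ph b \<and> b < ph (ph b) \<and> y = (2, b, kf b)) \<or> y = (2, a0, 3 * (4 * S))"
        using kk x2 by auto
      then show ?thesis
      proof (elim disjE bexE conjE)
        fix b assume b: "b \<notin> outer_face M" "y = (2, b, kf b)"
        then show ?thesis using e oo[of b] x2 nv0 by simp
      qed (simp add: x2)
    qed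
  qed
  have surj: "nm ` set ?items = cells M"
  proof
    show "nm ` set ?items \<subseteq> cells M" using cell by auto
    show "cells M \<subseteq> nm ` set ?items"
    proof
      fix c assume "c \<in> cells M"
      then show "c \<in> nm ` set ?items"
      proof (cases rule: cells_cases)
        case (Vertex v)
        then have "(0, v, 3 * \<rho> v) \<in> set ?items" unfolding mem by blast
        then show ?thesis using Vertex by (intro image_eqI[of _ _ "(0, v, 3 * \<rho> v)"]) (auto simp: nm_def named_cell_def)
      next
        case (Edge a)
        have na: "rv a \<noteq> a" using rv_facts(6)[OF Edge(1)] .
        define b where "b = (if a < rv a then a else rv a)"
        have b: "b \<in> arcs G" "b < rv b" "{b, rv b} = {a, rv a}" using na Edge(1) rv_facts(1)[of a] rv_facts(2)[OF Edge(1)] unfolding b_def by auto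
        then have "(1, b, ke b) \<in> set ?items" unfolding mem by blast
        then show ?thesis using Edge b(3) unfolding rv_def by (intro image_eqI[of _ _ "(1, b, ke b)"]) (auto simp: nm_def named_cell_def)
      next
        case (Face t)
        have fF: "F t \<in> faces M" "F t \<noteq> outer_face M" unfolding faces_eq using F_not_outer[OF Face(1)] Face(1) by blast+
        have fin: "finite (F t)" "F t \<noteq> {}" by (rule finite_subset[OF F_arcs[OF Face(1)] finite_arcs], rule face_nonempty[OF fF(1)])
        define b where "b = Min (F t)"
        have bF: "b \<in> F t" unfolding b_def using fin by simp
        have bf: "F t = fc b" "b \<in> arcs G" by (rule conjunct1[OF face_fc[OF fF(1) bF]], rule conjunct2[OF face_fc[OF fF(1) bF]])
        have bo: "b \<notin> outer_face M" using face_fc[OF outer_in, of b] bf fF(2) by metis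
        have "ph b \<in> F t" "ph (ph b) \<in> F t" unfolding bf(1) tri(1)[OF bf(2) bo] by auto
        then have "b \<le> ph b" "b \<le> ph (ph b)" unfolding b_def using fin by auto
        then have "b < ph b" "b < ph (ph b)" using tri(3,4)[OF bf(2) bo] by auto
        then have "(2, b, kf b) \<in> set ?items" unfolding mem using bf bo by blast
        then show ?thesis using Face bf(1) by (intro image_eqI[of _ _ "(2, b, kf b)"]) (auto simp: nm_def named_cell_def)
      next
        case Outer
        then show ?thesis using a0o(1) by (intro image_eqI[of _ _ "(2, a0, 3 * (4 * S))"]) (auto simp: nm_def named_cell_def mem)
      qed
    qed
  qed
  define zs where "zs = buckets ?items (3 * (4 * S) + 4)"
  have zd: "distinct zs" unfolding zs_def by (rule distinct_buckets[OF dist])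
  have zset: "set zs = set ?items"
  proof (rule card_subset_eq)
    show "set zs \<subseteq> set ?items" unfolding zs_def set_buckets by auto
    show "card (set zs) = card (set ?items)" using zd dist ys(1) unfolding zs_def by (simp add: distinct_card)
  qed simp
  define xs where "xs = map nm zs"
  have xd: "distinct xs" unfolding xs_def using zd inj zset by (simp add: distinct_map)
  have xset: "set xs = cells M" unfolding xs_def using zset surj by simp
  have "map (key M \<rho> C (4 * S)) xs = map key_of zs" unfolding xs_def using key zset by simp
  then have xsort: "sorted (map (key M \<rho> C (4 * S)) xs)" unfolding zs_def using sorted_buckets by simp
  have len: "card (cells M) = length xs" using distinct_card[OF xd] xset by simp
  have "map (\<lambda>j. named_cell M (mem s' (3 + 2 * k) j) (mem s' (4 + 2 * k) j)) [0..<card (cells M)] = xs"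
    unfolding len by (rule nth_equalityI) (use ys(2) in \<open>auto simp: xs_def nm_def zs_def\<close>)
  then have "output_order M s' k = list_order xs" unfolding output_order_def by simp
  then show ?thesis using rp rr xd xset xsort unfolding C_def by blast
qed

lemma realizer_of_side:
  assumes sd: "side wv nv ta (\<lambda>a. ta (rt a)) A pos K Pf Rf i1 i2 i3" and pos: "wv pos = r 0" and ne: "i1 \<noteq> i3"
    and o: "\<And>k. k < 3 \<Longrightarrow> ordered \<lparr>regs = (\<lambda>_. 0)(0 := nv, 1 := A, 5 := a0),
      mem = (\<lambda>_ _. 0)(0 := ta, 1 := rt, 2 := st, 11 := \<lambda>a. if a \<in> walk ` {..<2 * nv} then 1 else 0)\<rparr> nv Pf Rf (4 * nv) i1 i2 i3 k s'"
  shows "realizer (cells M) (P_VEF M) (map (output_order M s') [0, 1, 2])"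
proof -
  note f = side_facts[OF sd pos]
  have Kn: "K < nv" by simp
  note b = side_bounds[OF sd Kn]
  have NS: "N < 4 * nv" by simp
  define Q where "Q k \<rho> xs \<longleftrightarrow> (\<forall>j<K. \<rho> (p j) = rank_p (4 * nv) k j) \<and> (\<forall>i\<le>N. \<rho> (r i) = rank_r (4 * nv) i1 i2 i3 k i) \<and>
     distinct xs \<and> set xs = cells M \<and> sorted (map (key M \<rho> {p j | j. j < K \<and> j mod 3 = k} (4 * (4 * nv))) xs) \<and> output_order M s' k = list_order xs" for k \<rho> xs
  have "\<exists>\<rho> xs. Q k \<rho> xs" if k: "k < 3" for k
    unfolding Q_def by (rule ordered_cells[OF o[OF k] f(1-3) k NS b(3-5) f(7)])
  then have "\<forall>k\<in>{..<3}. \<exists>y. Q k (fst y) (snd y)" by fastforce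
  from bchoice[OF this] obtain g where g: "\<And>k. k < 3 \<Longrightarrow> Q k (fst (g k)) (snd (g k))" by blast
  define \<rho> where "\<rho> k = fst (g k)" for k
  define xs where "xs k = snd (g k)" for k
  have X: "(\<forall>j<K. \<rho> k (p j) = rank_p (4 * nv) k j) \<and> (\<forall>i\<le>N. \<rho> k (r i) = rank_r (4 * nv) i1 i2 i3 k i) \<and>
     distinct (xs k) \<and> set (xs k) = cells M \<and> sorted (map (key M (\<rho> k) {p j | j. j < K \<and> j mod 3 = k} (4 * (4 * nv))) (xs k)) \<and> output_order M s' k = list_order (xs k)"
    if "k < 3" for k using g[OF that] unfolding Q_def \<rho>_def xs_def .
  have nt: "turn 0 \<noteq> turn 2" using ne f by simp
  have nh: "\<not> (hi 0 = hi 1 \<and> hi 1 = hi 2)" if "K = 4" using nt that unfolding turn_def by simp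
  have "realizer (cells M) (P_VEF M) (map (\<lambda>k. list_order (xs k)) [0..<3])"
    by (rule good_realizer[where S = "4 * nv" and \<rho> = \<rho> and C = "\<lambda>k. {p j | j. j < K \<and> j mod 3 = k}", OF f(7) nh])
      (use X f(4-6) K_pos N_pos in auto)
  moreover have "map (\<lambda>k. list_order (xs k)) [0..<3] = map (output_order M s') [0, 1, 2]"
  proof -
    have oo: "output_order M s' k = list_order (xs k)" if "k < 3" for k using X[OF that] by blast
    show ?thesis unfolding upt_3 using oo[of 0] oo[of 1] oo[of 2] by simp
  qed
  ultimately show ?thesis by simp
qed

end

section \<open>From the answer of the program to the dimension\<close>

context numbered_walk
begin

abbreviation nn where "nn \<equiv> card (verts G)"

definition good :: "nat \<Rightarrow> nat \<Rightarrow> state \<Rightarrow> bool" where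
  "good pos k s' \<longleftrightarrow> (\<exists>Pf Rf i1 i2 i3. side wv nn ta (\<lambda>a. ta (rt a)) A pos k Pf Rf i1 i2 i3 \<and> i1 \<noteq> i3 \<and>
     (\<forall>k<3. ordered \<lparr>regs = (\<lambda>_. 0)(0 := nn, 1 := A, 5 := a0),
      mem = (\<lambda>_ _. 0)(0 := ta, 1 := rt, 2 := st, 11 := \<lambda>a. if a \<in> walk ` {..<2 * nn} then 1 else 0)\<rparr> nn Pf Rf (4 * nn) i1 i2 i3 k s'))"

definition bad :: "nat \<Rightarrow> nat \<Rightarrow> bool" where
  "bad pos k \<longleftrightarrow> k = 0 \<or> 5 \<le> k \<or> (\<exists>Pf Rf i1 i2 i3. side wv nn ta (\<lambda>a. ta (rt a)) A pos k Pf Rf i1 i2 i3 \<and> i1 = i3)"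

lemma good_realizer_out:
  assumes "wv pos = r 0" "good pos K s'"
  shows "realizer (cells M) (P_VEF M) (map (output_order M s') [0, 1, 2])"
proof -
  from assms(2)[unfolded good_def card_nv] obtain Pf Rf i1 i2 i3 where
    *: "side wv nv ta (\<lambda>a. ta (rt a)) A pos K Pf Rf i1 i2 i3" "i1 \<noteq> i3"
      "\<forall>k<3. ordered \<lparr>regs = (\<lambda>_. 0)(0 := nv, 1 := A, 5 := a0),
      mem = (\<lambda>_ _. 0)(0 := ta, 1 := rt, 2 := st, 11 := \<lambda>a. if a \<in> walk ` {..<2 * nv} then 1 else 0)\<rparr> nv Pf Rf (4 * nv) i1 i2 i3 k s'" by blast
  show ?thesis by (rule realizer_of_side[OF *(1) assms(1) *(2)]) (use *(3) in blast)
qed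

text \<open>If the first and the last turn coincide, all three turns are at the same
  \<open>r\<close>-vertex. The turn from \<open>p j\<close> to \<open>p (j + 1)\<close> is step
  \<open>j + hi j\<close>, so these are three consecutive steps.\<close>

lemma bad_steps:
  assumes pos: "wv pos = r 0" and b: "bad pos K" and K4: "K \<le> 4"
  shows "K = 4" "\<exists>t. Suc (Suc t) < m \<and> \<not> fan_step t \<and> \<not> fan_step (Suc t) \<and> \<not> fan_step (Suc (Suc t))"
proof -
  obtain Pf Rf i1 i2 i3 where "side wv nv ta (\<lambda>a. ta (rt a)) A pos K Pf Rf i1 i2 i3" "i1 = i3"
    using b K4 K_pos unfolding bad_def card_nv by auto
  then have "turn 0 = turn 2" using side_facts(4,6)[OF _ pos] by metis
  note e = turns_eq[OF K4 this]
  show "K = 4" by (rule e)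
  have tn: "\<exists>t<m. t = j + hi j \<and> \<not> fan_step t" if j: "j < 3" for j
  proof -
    obtain t where t: "t < m" "J t = j" "J (Suc t) = Suc j" using J_surj[of j] e(1) j by auto
    then have "hi j = I t" using hi_turn[of t] by simp
    then have "t = j + hi j" using sum_JI[of t] t by simp
    then show ?thesis using t unfolding fan_step_def by auto
  qed
  show "\<exists>t. Suc (Suc t) < m \<and> \<not> fan_step t \<and> \<not> fan_step (Suc t) \<and> \<not> fan_step (Suc (Suc t))"
    using tn[of 0] tn[of 1] tn[of 2] e(2,3) by (intro exI[of _ "hi 0"]) auto
qed

lemma program_runs:
  assumes W: "49 * nn + 2 * A + 20 < W"
    and ears: "filter (\<lambda>j. edge_succ M (edge_succ M (walk j)) = walk j) [0..<nn] = xs @ [e1, e2]"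
  shows "runs W program (input_state M a0) (14000 * nn + 1000 * A + 3000) (\<lambda>s'.
     (regs s' 0 = 0 \<and> (good e1 (e2 - e1 - 1) s' \<or> good e2 (nn - (e2 - e1) - 1) s')) \<or>
     (regs s' 0 = 1 \<and> bad e1 (e2 - e1 - 1) \<and> bad e2 (nn - (e2 - e1) - 1)))"
proof -
  have wk: "((\<lambda>a. st (rt a)) ^^ j) a0 = walk j" for j by (rule table_walk)
  have tv: "ta (walk j) = wv j" for j using tables(1)[OF walk_arc] unfolding wv_def by simp
  have ss: "st (st (walk j)) = edge_succ M (edge_succ M (walk j))" for j
    using walk_arc[of j] permutes_in_image[OF succ_permutes] unfolding st_def by simp
  have "runs W program (input_state M a0) (14000 * nn + 1000 * A + 3000) (\<lambda>s'.
     (regs s' 0 = 0 \<and> ((\<exists>Pf Rf i1 i2 i3. side (\<lambda>j. ta (((\<lambda>a. st (rt a)) ^^ j) a0)) nn ta (\<lambda>a. ta (rt a)) A e1 (e2 - e1 - 1) Pf Rf i1 i2 i3 \<and> i1 \<noteq> i3 \<and>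
        (\<forall>k<3. ordered \<lparr>regs = (\<lambda>_. 0)(0 := nn, 1 := A, 5 := a0),
      mem = (\<lambda>_ _. 0)(0 := ta, 1 := rt, 2 := st, 11 := \<lambda>a. if a \<in> (\<lambda>j. ((\<lambda>a. st (rt a)) ^^ j) a0) ` {..<2 * nn} then 1 else 0)\<rparr> nn Pf Rf (4 * nn) i1 i2 i3 k s')) \<or>
      (\<exists>Pf Rf i1 i2 i3. side (\<lambda>j. ta (((\<lambda>a. st (rt a)) ^^ j) a0)) nn ta (\<lambda>a. ta (rt a)) A e2 (nn - (e2 - e1) - 1) Pf Rf i1 i2 i3 \<and> i1 \<noteq> i3 \<and>
        (\<forall>k<3. ordered \<lparr>regs = (\<lambda>_. 0)(0 := nn, 1 := A, 5 := a0),
      mem = (\<lambda>_ _. 0)(0 := ta, 1 := rt, 2 := st, 11 := \<lambda>a. if a \<in> (\<lambda>j. ((\<lambda>a. st (rt a)) ^^ j) a0) ` {..<2 * nn} then 1 else 0)\<rparr> nn Pf Rf (4 * nn) i1 i2 i3 k s')))) \<or>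
     (regs s' 0 = 1 \<and> (e2 - e1 - 1 = 0 \<or> 5 \<le> e2 - e1 - 1 \<or> (\<exists>Pf Rf i1 i2 i3. side (\<lambda>j. ta (((\<lambda>a. st (rt a)) ^^ j) a0)) nn ta (\<lambda>a. ta (rt a)) A e1 (e2 - e1 - 1) Pf Rf i1 i2 i3 \<and> i1 = i3)) \<and>
        (nn - (e2 - e1) - 1 = 0 \<or> 5 \<le> nn - (e2 - e1) - 1 \<or> (\<exists>Pf Rf i1 i2 i3. side (\<lambda>j. ta (((\<lambda>a. st (rt a)) ^^ j) a0)) nn ta (\<lambda>a. ta (rt a)) A e2 (nn - (e2 - e1) - 1) Pf Rf i1 i2 i3 \<and> i1 = i3))))"
  proof (rule program[where ta = ta and rv = rt and sc = st and ?a0.0 = a0 and n = nn and A = A and xs = xs])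
    show "regs (input_state M a0) = (\<lambda>_. 0)(0 := nn, 1 := A, 2 := a0)" unfolding input_state_def Let_def A_def G_def by simp
    show "mem (input_state M a0) = (\<lambda>_ _. 0)(0 := ta, 1 := rt, 2 := st)"
      unfolding input_state_def Let_def ta_def rt_def st_def G_def by simp
    show "rt a < A \<and> st a < A \<and> ta a < nn" if a: "a < A" for a
    proof -
      have aa: "a \<in> arcs G" using a arcs_num by simp
      have "rv a \<in> arcs G" "edge_succ M a \<in> arcs G" "tail G a \<in> verts G"
        using rv_facts(2)[OF aa] permutes_in_image[OF succ_permutes] aa ends_in(1)[OF aa] by auto
      then show ?thesis using tables(1-3)[OF aa] arcs_num verts_num card_nv by auto
    qed
    show "a0 < A" using a0 outer_arcs arcs_num by auto
    show "49 * nn + 2 * A + 20 < W" by (rule W)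
    show "inj_on (\<lambda>j. ta (((\<lambda>a. st (rt a)) ^^ j) a0)) {..<nn}" unfolding wk tv card_nv by (rule wv_inj)
    show "((\<lambda>a. st (rt a)) ^^ (j + nn)) a0 = ((\<lambda>a. st (rt a)) ^^ j) a0" for j unfolding wk card_nv by (rule walk_period)
    show "filter (\<lambda>j. st (st (((\<lambda>a. st (rt a)) ^^ j) a0)) = ((\<lambda>a. st (rt a)) ^^ j) a0) [0..<nn] = xs @ [e1, e2]"
      unfolding wk ss by (rule ears)
  qed
  then show ?thesis unfolding wk tv good_def bad_def .
qed

lemma turn_interior: assumes "t < m" "\<not> fan_step t" shows "0 < t \<and> Suc t < m"
  using assms(1)
proof (cases rule: tri_cases)
  case Istep then show ?thesis using assms(2) unfolding fan_step_def by blast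
qed simp

lemma N_ge: "2 \<le> m \<Longrightarrow> 2 \<le> N"
proof -
  assume "2 \<le> m"
  then have "I 1 \<le> I (m - 1)" using mono_JI[of 1 "m - 1"] by simp
  then show ?thesis using first_step last_step by linarith
qed

text \<open>The second staircase is the strip read from the other end, as \<open>F'\<close> says;
  its \<open>p\<close>-vertices turn out to be the \<open>r\<close>-vertices between the ears of the
  first. The program tries both readings, and the lower bound leaves two matching alternatives: few
  turns not all consecutive, or the same for the inner fans, which are the turns of the second
  staircase.\<close>

lemma outcome:
  assumes S2: "numbered_walk K' N' J' I' p' r' F' a0 M" and m2: "2 \<le> m" and F': "\<And>t. t < m \<Longrightarrow> F' t = F (m - 1 - t)"
    and W: "49 * nn + 2 * A + 20 < W"
  shows "runs W program (input_state M a0) (14000 * nn + 1000 * A + 3000) (\<lambda>s.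
     if regs s 0 = 0 then realizer (cells M) (P_VEF M) (map (output_order M s) [0, 1, 2]) else order_dim (cells M) (P_VEF M) = 4)"
proof -
  have ow: "outer_walk M K' N' J' I' p' r' F' a0" by (rule numbered_walk.axioms(1)[OF S2])
  have sc: "staircase M K' N' J' I' p' r' F'" by (rule outer_walk.axioms(2)[OF ow])
  have nv': "K' + N' + 1 = nv" using outer_walk.card_nv[OF ow] card_nv unfolding G_def by simp
  have m': "K' + N' - 1 = m" using nv' Km by simp
  have K0: "0 < K'" by (rule staircase.K_pos[OF sc])
  have NN: "2 \<le> N" by (rule N_ge[OF m2])
  have tri': "tail G ` F' t = {p' (J' t), r' (I' t), p' (J' (Suc t)), r' (I' (Suc t))}" if "t < m" for t
    using staircase.tail_F[OF sc, of t] that m' unfolding G_def by simp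
  have rev_tri: "tri (m - 1 - t) = {p' (J' t), r' (I' t), p' (J' (Suc t)), r' (I' (Suc t))}" if t: "t < m" for t
    using tri'[OF t] F'[OF t] tail_F[of "m - 1 - t"] t by simp
  \<comment> \<open>At this point the ears of the two staircases are matched: the tip of the
    reversed strip lies in the last triangle, whose \<open>r\<close>-vertices are
    \<open>r (N - 1)\<close> and \<open>r N\<close>. As \<open>N\<close> is at least 2, neither of
    them is \<open>r 0\<close>.\<close>
  have ne: "r' 0 \<noteq> r 0"
  proof
    assume e: "r' 0 = r 0"
    have "r' 0 \<in> tri (m - 1)" using rev_tri[of 0] m2 staircase.path_start[OF sc] by auto
    then have "0 = I (m - 1) \<or> 0 = I m" using r_in_tri[of "m - 1" 0] e m2 by auto
    then show False using last_step path_end NN by auto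
  qed
  obtain e1 e2 where ears: "filter (\<lambda>j. edge_succ M (edge_succ M (walk j)) = walk j) [0..<nv] = [e1, e2]"
    and alt: "wv e1 = r 0 \<and> wv e2 = r N \<and> e2 - e1 - 1 = K \<or> wv e2 = r 0 \<and> wv e1 = r N \<and> nv - (e2 - e1) - 1 = K"
    and e: "e1 < e2" "e2 < nv" by (rule two_ears[OF m2])
  have m2': "2 \<le> K' + N' - 1" using m2 m' by simp
  have alt': "wv e1 = r' 0 \<and> e2 - e1 - 1 = K' \<or> wv e2 = r' 0 \<and> nv - (e2 - e1) - 1 = K'"
  proof (rule outer_walk.two_ears[OF ow m2'])
    fix d1 d2 assume d: "filter (\<lambda>j. edge_succ M (edge_succ M (walk j)) = walk j) [0..<K' + N' + 1] = [d1, d2]"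
      "wv d1 = r' 0 \<and> wv d2 = r' N' \<and> d2 - d1 - 1 = K' \<or> wv d2 = r' 0 \<and> wv d1 = r' N' \<and> K' + N' + 1 - (d2 - d1) - 1 = K'"
    have "[e1, e2] = [d1, d2]" by (rule d(1)[unfolded nv' ears])
    then have eq: "d1 = e1" "d2 = e2" by simp_all
    show ?thesis using d(2)[unfolded nv' eq] by blast
  qed
  obtain pos pos' where pos: "wv pos = r 0" "wv pos' = r' 0"
    and gb: "\<And>s. good e1 (e2 - e1 - 1) s \<or> good e2 (nv - (e2 - e1) - 1) s \<longleftrightarrow> good pos K s \<or> good pos' K' s"
      "bad e1 (e2 - e1 - 1) \<and> bad e2 (nv - (e2 - e1) - 1) \<longleftrightarrow> bad pos K \<and> bad pos' K'"
    and KK: "K + K' + 2 = nv" and pq: "pos' = pos + K + 1 \<or> pos' + nv = pos + K + 1"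
  proof -
    show thesis
    proof (cases "wv e1 = r 0")
      case True
      have n2: "wv e2 \<noteq> r 0"
      proof
        assume "wv e2 = r 0"
        then have "wv e1 = wv e2" using True by simp
        then have "e1 = e2" by (rule inj_onD[OF wv_inj, unfolded lessThan_iff]) (use e in linarith)+
        then show False using e(1) by (metis less_irrefl)
      qed
      have n1: "wv e1 \<noteq> r' 0" unfolding True using ne by (rule not_sym)
      have K: "e2 - e1 - 1 = K" "wv e2 = r' 0" "nv - (e2 - e1) - 1 = K'" using alt alt' n1 n2 by blast+
      show thesis
      proof (rule that[of e1 e2])
        show "wv e1 = r 0" "wv e2 = r' 0" by (rule True, rule K)
        show "K + K' + 2 = nv" using K(1,3) K0 K_pos e by linarith
        show "e2 = e1 + K + 1 \<or> e2 + nv = e1 + K + 1" using K(1) K_pos by linarith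
        show "good e1 (e2 - e1 - 1) s \<or> good e2 (nv - (e2 - e1) - 1) s \<longleftrightarrow> good e1 K s \<or> good e2 K' s" for s unfolding K ..
        show "bad e1 (e2 - e1 - 1) \<and> bad e2 (nv - (e2 - e1) - 1) \<longleftrightarrow> bad e1 K \<and> bad e2 K'" unfolding K ..
      qed
    next
      case False
      then have a: "wv e2 = r 0" "nv - (e2 - e1) - 1 = K" using alt by blast+
      have n1: "wv e2 \<noteq> r' 0" unfolding a using ne by (rule not_sym)
      have K: "wv e1 = r' 0" "e2 - e1 - 1 = K'" using alt' n1 by blast+
      show thesis
      proof (rule that[of e2 e1])
        show "wv e2 = r 0" "wv e1 = r' 0" by (rule a, rule K)
        show "K + K' + 2 = nv" using K(2) K0 K_pos a(2) e by linarith
        show "e1 = e2 + K + 1 \<or> e1 + nv = e2 + K + 1" using a(2) K_pos e by linarith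
        show "good e1 (e2 - e1 - 1) s \<or> good e2 (nv - (e2 - e1) - 1) s \<longleftrightarrow> good e2 K s \<or> good e1 K' s" for s unfolding K a by (rule disj_commute)
        show "bad e1 (e2 - e1 - 1) \<and> bad e2 (nv - (e2 - e1) - 1) \<longleftrightarrow> bad e2 K \<and> bad e1 K'" unfolding K a by (rule conj_commute)
      qed
    qed
  qed
  \<comment> \<open>The positions after the ear \<open>r N\<close> are read in two ways: as the
    \<open>p'\<close>-side of the reversed strip, and as the \<open>r\<close>-side of the original
    one backwards.\<close>
  have pr: "p' j = r (N - 1 - j)" if j: "j < K'" for j
  proof -
    have "p' j = wv (pos' + 1 + j)" by (rule outer_walk.wv_p[OF ow pos(2) j, symmetric])
    moreover have "r (N - 1 - j) = wv (pos + nv - (N - 1 - j))" by (rule wv_r'[OF pos(1), symmetric]) simp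
    moreover have "pos + nv - (N - 1 - j) = pos + K + 2 + j" using KK j by linarith
    moreover have "wv (pos' + 1 + j) = wv (pos + K + 2 + j)"
      using pq
    proof
      assume "pos' = pos + K + 1" then show ?thesis by simp
    next
      assume q: "pos' + nv = pos + K + 1"
      have "pos' + 1 + j + nv = pos + K + 2 + j" using q by linarith
      then show ?thesis using wv_period[of "pos' + 1 + j"] by (simp only:)
    qed
    ultimately show ?thesis by (simp only:)
  qed
  have bad4: "order_dim (cells M) (P_VEF M) = 4" if b: "bad pos K" "bad pos' K'"
  proof -
    have "\<not> (\<exists>Ls. length Ls = 3 \<and> realizer (cells M) (P_VEF M) Ls)"
    proof
      assume "\<exists>Ls. length Ls = 3 \<and> realizer (cells M) (P_VEF M) Ls"
      then obtain Ls where Ls: "length Ls = 3" "realizer (cells M) (P_VEF M) Ls" by blast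
      from few_turns_or_fans_of_realizer[OF Ls(2,1)] show False
      proof (elim disjE conjE)
        assume "K \<le> 4" and n3: "\<forall>t. Suc (Suc t) < m \<longrightarrow> \<not> fan_step t \<longrightarrow> \<not> fan_step (Suc t) \<longrightarrow> \<not> fan_step (Suc (Suc t)) \<longrightarrow> False"
        from bad_steps(2)[OF pos(1) b(1) this(1)] show False using n3 by blast
      next
        assume N5: "N \<le> 5" and n3: "\<forall>t. 0 < t \<longrightarrow> Suc (Suc (Suc t)) < m \<longrightarrow> fan_step t \<longrightarrow> fan_step (Suc t) \<longrightarrow> fan_step (Suc (Suc t)) \<longrightarrow> False"
        \<comment> \<open>\<open>K'\<close> counts the \<open>r\<close>-vertices between the ears,
          so it equals \<open>N - 1\<close>.\<close>
        have K4: "K' \<le> 4" using KK N5 by linarith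
        from numbered_walk.bad_steps(2)[OF S2 pos(2) b(2) K4]
        obtain t where t: "Suc (Suc t) < m" "\<not> staircase.fan_step J' t" "\<not> staircase.fan_step J' (Suc t)" "\<not> staircase.fan_step J' (Suc (Suc t))"
          unfolding m' by blast
        have inn: "0 < u \<and> Suc u < m" if "u < m" "\<not> staircase.fan_step J' u" for u
          using numbered_walk.turn_interior[OF S2, of u] that m' by simp
        \<comment> \<open>A turn of the reversed strip has two consecutive
          \<open>p'\<close>-vertices, which are two different \<open>r\<close>-vertices of the
          original triangle; a turn there would contain only one \<open>r\<close>-vertex.\<close>
        have fs: "fan_step (m - 1 - u)" if u: "u < m" "\<not> staircase.fan_step J' u" for u
        proof (rule ccontr)
          assume nf: "\<not> fan_step (m - 1 - u)"
          let ?s = "m - 1 - u"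
          have s: "?s < m" using m2 by simp
          have J': "J' (Suc u) = Suc (J' u)" using staircase.not_fan_step[OF sc, of u] u m' by simp
          have jK: "Suc (J' u) < K'" using staircase.J_lt[OF sc, of "Suc u"] u m' J' by simp
          have "r (N - 1 - J' u) \<in> tri ?s" "r (N - 1 - Suc (J' u)) \<in> tri ?s"
            unfolding rev_tri[OF u(1)] J' pr[OF jK, symmetric] pr[OF Suc_lessD[OF jK], symmetric] by blast+
          then have "N - 1 - J' u = I ?s" "N - 1 - Suc (J' u) = I ?s"
            using r_in_tri[OF s, of "N - 1 - J' u"] r_in_tri[OF s, of "N - 1 - Suc (J' u)"] conjunct2[OF not_fan_step[OF s nf]] by simp_all
          moreover have "Suc (J' u) < N" using jK KK by linarith
          ultimately show False by linarith
        qed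
        let ?s = "m - 1 - Suc (Suc t)"
        have t0: "0 < t" "Suc (Suc (Suc t)) < m" using inn[of t] inn[of "Suc (Suc t)"] t by auto
        have eq: "m - 1 - Suc t = Suc ?s" "m - 1 - t = Suc (Suc ?s)" using t0 by linarith+
        have f: "fan_step ?s" by (rule fs[OF t(1,4)])
        have f1: "fan_step (Suc ?s)" unfolding eq(1)[symmetric] by (rule fs[OF Suc_lessD[OF t(1)] t(3)])
        have f2: "fan_step (Suc (Suc ?s))" unfolding eq(2)[symmetric] by (rule fs[OF Suc_lessD[OF Suc_lessD[OF t(1)]] t(2)])
        have "0 < ?s" "Suc (Suc (Suc ?s)) < m" using t0 by linarith+
        then show False using n3 f f1 f2 by blast
      qed
    qed
    moreover have "\<exists>Ls. length Ls = Suc 3 \<and> realizer (cells M) (P_VEF M) Ls" using dim_le_4[OF NN] by simp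
    moreover have "Vertex (r 0) \<in> cells M" "Vertex (r 1) \<in> cells M" unfolding cells_def using verts_eq N_pos unfolding G_def by auto
    moreover have "(Vertex (r 0), Vertex (r 1)) \<notin> P_VEF M" unfolding P_VEF_def using r_eq_iff[of 0 1] N_pos by simp
    ultimately have "order_dim (cells M) (P_VEF M) = Suc 3" by (intro order_dim_eq_Suc) auto
    then show ?thesis by simp
  qed
  have ears': "filter (\<lambda>j. edge_succ M (edge_succ M (walk j)) = walk j) [0..<nn] = [] @ [e1, e2]" using ears unfolding card_nv by simp
  have g2: "good pos' K' s \<Longrightarrow> realizer (cells M) (P_VEF M) (map (output_order M s) [0, 1, 2])" for s
    by (rule numbered_walk.good_realizer_out[OF S2 pos(2)])
  show ?thesis
  proof (rule runs_mono[OF program_runs[OF W ears'] order_refl])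
    fix s assume q: "(regs s 0 = 0 \<and> (good e1 (e2 - e1 - 1) s \<or> good e2 (nn - (e2 - e1) - 1) s)) \<or>
       (regs s 0 = 1 \<and> bad e1 (e2 - e1 - 1) \<and> bad e2 (nn - (e2 - e1) - 1))"
    then have "(regs s 0 = 0 \<and> (good pos K s \<or> good pos' K' s)) \<or> (regs s 0 = 1 \<and> bad pos K \<and> bad pos' K')"
      unfolding card_nv gb .
    then show "if regs s 0 = 0 then realizer (cells M) (P_VEF M) (map (output_order M s) [0, 1, 2]) else order_dim (cells M) (P_VEF M) = 4"
      using good_realizer_out[OF pos(1)] g2 bad4 by auto
  qed
qed

end

context numbered_walk
begin

lemma good_pos: assumes "good pos k s" shows "1 \<le> k"
proof -
  obtain Pf Rf i1 i2 i3 where "side wv nn ta (\<lambda>a. ta (rt a)) A pos k Pf Rf i1 i2 i3"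
    using assms unfolding good_def by blast
  then show ?thesis unfolding side_def by (rule conjunct1)
qed

lemma bad_ge: assumes "wv pos = r 0" "bad pos K" shows "4 \<le> K"
proof (rule ccontr)
  assume n: "\<not> 4 \<le> K"
  then have "K \<le> 4" by linarith
  from bad_steps(1)[OF assms this] show False using n by linarith
qed

text \<open>In a single triangle the rotation has order two everywhere, and the program keeps the
  positions 1 and 2. The first attempt has an empty side and cannot succeed; the second starts at
  position 2 with \<open>K = 1\<close> and cannot fail. Hence \<open>pos\<close> fixes where
  \<open>r 0\<close> lies.\<close>

lemma outcome_triangle:
  assumes m1: "m = 1" and pos: "wv 2 = r 0" and W: "49 * nn + 2 * A + 20 < W"
  shows "runs W program (input_state M a0) (14000 * nn + 1000 * A + 3000) (\<lambda>s.
     if regs s 0 = 0 then realizer (cells M) (P_VEF M) (map (output_order M s) [0, 1, 2]) else order_dim (cells M) (P_VEF M) = 4)"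
proof -
  have KN: "K = 1" "N = 1" using m1 Km K_pos N_pos by auto
  have n3: "nn = 3" using card_nv KN by simp
  have V: "verts G = {p 0, r 0, r 1}" unfolding verts_eq KN by (auto simp: atMost_Suc)
  have two: "edge_succ M (edge_succ M (walk j)) = walk j" for j
  proof -
    let ?v = "tail G (walk j)"
    have h: "head G ` out_arcs G ?v \<subseteq> verts G - {?v}" using ends_in(2) no_loop by fastforce
    have "?v \<in> {p 0, r 0, r 1}" using ends_in(1)[OF walk_arc[of j]] V by simp
    moreover have "{p 0, r 0, r 1} - {p 0} \<subseteq> {r 0, r 1}" "{p 0, r 0, r 1} - {r 0} \<subseteq> {p 0, r 1}" "{p 0, r 0, r 1} - {r 1} \<subseteq> {p 0, r 0}" by blast+
    ultimately have "verts G - {?v} \<subseteq> {r 0, r 1} \<or> verts G - {?v} \<subseteq> {p 0, r 1} \<or> verts G - {?v} \<subseteq> {p 0, r 0}"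
      unfolding V by (elim insertE emptyE) (simp_all only: simp_thms)
    then obtain x y where "verts G - {?v} \<subseteq> {x, y}" by (elim disjE) assumption+
    then show ?thesis by (rule succ_two[OF walk_arc order_trans[OF h]])
  qed
  have ears: "filter (\<lambda>j. edge_succ M (edge_succ M (walk j)) = walk j) [0..<nn] = [0] @ [1, 2]"
    unfolding n3 two upt_3 by simp
  show ?thesis
  proof (rule runs_mono[OF program_runs[OF W ears] order_refl])
    fix s assume h: "(regs s 0 = 0 \<and> (good 1 (2 - 1 - 1) s \<or> good 2 (nn - (2 - 1) - 1) s)) \<or>
       (regs s 0 = 1 \<and> bad 1 (2 - 1 - 1) \<and> bad 2 (nn - (2 - 1) - 1))"
    have e: "nn - (2 - 1) - 1 = K" "2 - 1 - 1 = (0 :: nat)" unfolding n3 KN(1) by simp_all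
    from h[unfolded e] show "if regs s 0 = 0 then realizer (cells M) (P_VEF M) (map (output_order M s) [0, 1, 2]) else order_dim (cells M) (P_VEF M) = 4"
    proof (elim disjE conjE)
      assume "good 1 0 s"
      from good_pos[OF this] have False by simp
      then show ?thesis by (rule FalseE)
    next
      assume z: "regs s 0 = 0" and g: "good 2 K s"
      show ?thesis unfolding if_P[OF z] by (rule good_realizer_out[OF pos g])
    next
      assume "bad 2 K"
      from bad_ge[OF pos this] have False unfolding KN(1) by simp
      then show ?thesis by (rule FalseE)
    qed
  qed
qed

text \<open>There are \<open>m + 2\<close> vertices and at most \<open>m + 1\<close> faces, so
  Euler's formula bounds the number of arcs. This makes a running time in vertices and arcs linear
  in the number of vertices.\<close>

lemma few_arcs: "A \<le> 4 * nn" and three_verts: "3 \<le> nn"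
proof -
  have "card (faces M) \<le> Suc m" unfolding faces_eq
    using card_insert_le_m1[of "Suc m" "F ` {..<m}" "outer_face M"] card_image_le[of "{..<m}" F] by simp
  then have "A div 2 + 2 \<le> nn + Suc m" using euler unfolding A_def by simp
  moreover have "nn = m + 2" using card_nv Km by simp
  ultimately show "A \<le> 4 * nn" "3 \<le> nn" using m_pos by auto
qed

end

text \<open>The path condition on the interior dual, expressed by arcs and their reverses. In this
  form it is symmetric under reversal of the list, which provides the strip read from the other
  end.\<close>

definition strip_list :: "('v, 'a) pmap \<Rightarrow> 'a set list \<Rightarrow> bool" where
  "strip_list M vs \<longleftrightarrow> vs \<noteq> [] \<and> distinct vs \<and> set vs = bounded_faces M \<and>
     (\<forall>i<length vs. \<forall>j<length vs. (\<exists>a\<in>arcs (underlying M). a \<in> vs ! i \<and> edge_rev M a \<in> vs ! j) \<longleftrightarrow> i = Suc j \<or> j = Suc i) \<and>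
     (\<forall>i<length vs. \<forall>j<length vs. \<forall>a\<in>arcs (underlying M). \<forall>b\<in>arcs (underlying M).
        a \<in> vs ! i \<longrightarrow> edge_rev M a \<in> vs ! j \<longrightarrow> b \<in> vs ! i \<longrightarrow> edge_rev M b \<in> vs ! j \<longrightarrow> a = b)"

lemma strip_list_rev: "strip_list M vs \<Longrightarrow> strip_list M (rev vs)"
proof -
  assume s: "strip_list M vs"
  let ?n = "length vs" and ?E = "\<lambda>i j. \<exists>a\<in>arcs (underlying M). a \<in> vs ! i \<and> edge_rev M a \<in> vs ! j"
  have e: "?E i j \<longleftrightarrow> i = Suc j \<or> j = Suc i" if "i < ?n" "j < ?n" for i j
    using s that unfolding strip_list_def by blast
  have u: "a = b" if "i < ?n" "j < ?n" "a \<in> arcs (underlying M)" "b \<in> arcs (underlying M)" "a \<in> vs ! i" "edge_rev M a \<in> vs ! j" "b \<in> vs ! i" "edge_rev M b \<in> vs ! j" for i j a b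
    using s that unfolding strip_list_def by blast
  have r: "rev vs ! i = vs ! (?n - Suc i)" "?n - Suc i < ?n" if "i < ?n" for i using that by (auto simp: rev_nth)
  have sw: "?n - Suc i = Suc (?n - Suc j) \<or> ?n - Suc j = Suc (?n - Suc i) \<longleftrightarrow> i = Suc j \<or> j = Suc i" if "i < ?n" "j < ?n" for i j
    using that by presburger
  show ?thesis unfolding strip_list_def length_rev
  proof (intro conjI allI impI ballI)
    show "rev vs \<noteq> []" "distinct (rev vs)" "set (rev vs) = bounded_faces M" using s unfolding strip_list_def by auto
    show "(\<exists>a\<in>arcs (underlying M). a \<in> rev vs ! i \<and> edge_rev M a \<in> rev vs ! j) = (i = Suc j \<or> j = Suc i)" if "i < ?n" "j < ?n" for i j
      unfolding r(1)[OF that(1)] r(1)[OF that(2)] e[OF r(2)[OF that(1)] r(2)[OF that(2)]] by (rule sw[OF that])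
    show "a = b" if "i < ?n" "j < ?n" "a \<in> arcs (underlying M)" "b \<in> arcs (underlying M)" "a \<in> rev vs ! i" "edge_rev M a \<in> rev vs ! j" "b \<in> rev vs ! i" "edge_rev M b \<in> rev vs ! j" for i j a b
      using u[OF r(2)[OF that(1)] r(2)[OF that(2)] that(3,4)] that(5-8) unfolding r(1)[OF that(1)] r(1)[OF that(2)] by blast
  qed
qed

lemma strip_list_ex:
  assumes "maximal_path_like M"
  shows "simple_pmap M" "\<exists>vs. strip_list M vs"
proof -
  have pl: "planar_map M" "simple_map M" "is_simple_path (interior_dual M)"
    using assms unfolding maximal_path_like_def path_like_def by auto
  show sp: "simple_pmap M" by (rule simple_pmap.intro[OF pl(1,2)])
  let ?D = "interior_dual M" and ?G = "underlying M" and ?f = "face_of (edge_rev M) (edge_succ M)"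
  obtain vs where vs: "vs \<noteq> []" "distinct vs" "set vs = verts ?D"
    "\<And>i j. i < length vs \<Longrightarrow> j < length vs \<Longrightarrow> vs ! i \<rightarrow>\<^bsub>?D\<^esub> vs ! j \<longleftrightarrow> i = Suc j \<or> j = Suc i" and nm: "nomulti_digraph ?D"
    using pl(3) unfolding is_simple_path_def by blast
  have bf: "verts ?D = bounded_faces M"
    unfolding interior_dual_def dual_graph_def induce_subgraph_def by simp
  have arcsD: "arcs ?D = {a \<in> arcs ?G. ?f a \<in> bounded_faces M \<and> ?f (edge_rev M a) \<in> bounded_faces M}"
    unfolding interior_dual_def dual_graph_def induce_subgraph_def by auto
  have endsD: "tail ?D = ?f" "head ?D = ?f \<circ> edge_rev M"
    unfolding interior_dual_def dual_graph_def induce_subgraph_def by auto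
  have inf: "a \<in> vs ! i \<longleftrightarrow> ?f a = vs ! i" if "i < length vs" for a i
  proof -
    have "vs ! i \<in> faces M" using nth_mem[OF that] vs(3) bf unfolding bounded_faces_def by blast
    then show ?thesis using simple_pmap.face_fc[OF sp, of "vs ! i" a] simple_pmap.self_in_fc[OF sp, of a] by metis
  qed
  have vb: "vs ! i \<in> bounded_faces M" if "i < length vs" for i using nth_mem[OF that] vs(3) bf by blast
  have dom: "vs ! i \<rightarrow>\<^bsub>?D\<^esub> vs ! j \<longleftrightarrow> (\<exists>a\<in>arcs ?G. a \<in> vs ! i \<and> edge_rev M a \<in> vs ! j)" if "i < length vs" "j < length vs" for i j
    unfolding arcs_ends_def arc_to_ends_def endsD arcsD inf[OF that(1)] inf[OF that(2)] using vb that by auto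
  have "strip_list M vs" unfolding strip_list_def
  proof (intro conjI allI impI ballI)
    show "vs \<noteq> []" "distinct vs" "set vs = bounded_faces M" using vs bf by auto
    show "(\<exists>a\<in>arcs ?G. a \<in> vs ! i \<and> edge_rev M a \<in> vs ! j) = (i = Suc j \<or> j = Suc i)" if "i < length vs" "j < length vs" for i j
      using dom[OF that] vs(4)[OF that] by blast
    fix i j a b assume h: "i < length vs" "j < length vs" "a \<in> arcs ?G" "b \<in> arcs ?G" "a \<in> vs ! i" "edge_rev M a \<in> vs ! j" "b \<in> vs ! i" "edge_rev M b \<in> vs ! j"
    then have e: "?f a = vs ! i" "?f b = vs ! i" "?f (edge_rev M a) = vs ! j" "?f (edge_rev M b) = vs ! j" using inf by blast+
    show "a = b"
      by (rule nomulti_digraph.no_multi_arcs[OF nm]) (use h e vb in \<open>auto simp: arcsD arc_to_ends_def endsD\<close>)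
  qed
  then show "\<exists>vs. strip_list M vs" by blast
qed

lemma strip_map_of_list:
  fixes M :: "('v, 'a :: linorder) pmap"
  assumes M: "maximal_path_like M" and vs: "strip_list M vs" and b0: "b0 \<in> vs ! 0"
    and next1: "1 < length vs \<Longrightarrow> edge_rev M ((edge_succ M \<circ> edge_rev M) ((edge_succ M \<circ> edge_rev M) b0)) \<in> vs ! 1"
  shows "strip_map M vs b0"
proof -
  have c3: "\<forall>f\<in>bounded_faces M. card f = 3" and two: "two_connected (underlying M)"
    using M unfolding maximal_path_like_def path_like_def by auto
  have v: "vs \<noteq> []" "distinct vs" "set vs = bounded_faces M"
    and ad: "\<And>i j. i < length vs \<Longrightarrow> j < length vs \<Longrightarrow>
      (\<exists>a\<in>arcs (underlying M). a \<in> vs ! i \<and> edge_rev M a \<in> vs ! j) \<longleftrightarrow> i = Suc j \<or> j = Suc i"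
    and un: "\<And>i j a b. i < length vs \<Longrightarrow> j < length vs \<Longrightarrow> a \<in> arcs (underlying M) \<Longrightarrow> b \<in> arcs (underlying M) \<Longrightarrow>
      a \<in> vs ! i \<Longrightarrow> edge_rev M a \<in> vs ! j \<Longrightarrow> b \<in> vs ! i \<Longrightarrow> edge_rev M b \<in> vs ! j \<Longrightarrow> a = b"
    using vs unfolding strip_list_def by blast+
  show ?thesis
  proof (rule strip_map.intro[OF strip_list_ex(1)[OF M] strip_map_axioms.intro])
    show "two_connected (underlying M)" by (rule two)
    show "vs \<noteq> []" "distinct vs" "set vs = bounded_faces M" by (rule v)+
    show "card f = 3" if "f \<in> set vs" for f using c3 that v(3) by blast
    show "i = Suc j \<or> j = Suc i" if "a \<in> arcs (underlying M)" "i < length vs" "j < length vs" "a \<in> vs ! i" "edge_rev M a \<in> vs ! j" for a i j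
      using ad[OF that(2,3)] that(1,4,5) by blast
    show "\<exists>a\<in>arcs (underlying M). a \<in> vs ! i \<and> edge_rev M a \<in> vs ! Suc i" if "Suc i < length vs" for i
      using ad[OF Suc_lessD[OF that] that] by blast
    show "a = b" if "a \<in> arcs (underlying M)" "b \<in> arcs (underlying M)" "i < length vs" "j < length vs"
      "a \<in> vs ! i" "edge_rev M a \<in> vs ! j" "b \<in> vs ! i" "edge_rev M b \<in> vs ! j" for a b i j
      by (rule un[OF that(3,4,1,2,5-8)])
    show "b0 \<in> vs ! 0" by (rule b0)
    show "edge_rev M ((edge_succ M \<circ> edge_rev M) ((edge_succ M \<circ> edge_rev M) b0)) \<in> vs ! 1" if "1 < length vs" by (rule next1[OF that])
  qed
qed

lemma strip_start:
  fixes M :: "('v, 'a :: linorder) pmap"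
  assumes M: "maximal_path_like M" and vs: "strip_list M vs"
  shows "\<exists>b0. strip_map M vs b0"
proof -
  have c3: "\<forall>f\<in>bounded_faces M. card f = 3" using M unfolding maximal_path_like_def by simp
  note sp = strip_list_ex(1)[OF M]
  have v0: "vs ! 0 \<in> bounded_faces M" using vs unfolding strip_list_def by (metis length_greater_0_conv nth_mem)
  have f0: "vs ! 0 \<in> faces M" using v0 unfolding bounded_faces_def by blast
  show ?thesis
  proof (cases "1 < length vs")
    case True
    then obtain x where x: "x \<in> vs ! 0" "edge_rev M x \<in> vs ! 1"
      using vs unfolding strip_list_def by (metis One_nat_def less_trans zero_less_one)
    note t = simple_pmap.triangle[OF sp f0 _ x(1)]
    have c: "card (vs ! 0) = 3" using c3 v0 by blast
    \<comment> \<open>The arc following the shared arc \<open>x\<close> is a suitable start, because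
      three steps around the triangle return to \<open>x\<close>.\<close>
    let ?b = "(edge_succ M \<circ> edge_rev M) x"
    have "strip_map M vs ?b"
    proof (rule strip_map_of_list[OF M vs])
      have "?b \<in> {x, ?b, (edge_succ M \<circ> edge_rev M) ?b}" by blast
      then show "?b \<in> vs ! 0" unfolding t(1)[OF c, symmetric] .
      show "edge_rev M ((edge_succ M \<circ> edge_rev M) ((edge_succ M \<circ> edge_rev M) ?b)) \<in> vs ! 1"
        unfolding t(2)[OF c] by (rule x(2))
    qed
    then show ?thesis by blast
  next
    case False
    obtain b where "b \<in> vs ! 0" using simple_pmap.face_nonempty[OF sp f0] by blast
    then show ?thesis using strip_map_of_list[OF M vs] False by blast
  qed
qed

lemma strip_staircase:
  fixes M :: "(nat, nat) pmap"
  assumes M: "maximal_path_like M" and num: "numbered M" and a0: "a0 \<in> outer_face M" and s: "strip_map M vs b0"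
  shows "\<exists>K N J I p r. numbered_walk K N J I p r ((!) vs) a0 M \<and> K + N - 1 = length vs \<and> r 0 = head (underlying M) b0"
proof -
  note st = strip_map.is_staircase[OF s]
  have mm: "Suc (strip_map.Jx M vs b0 (length vs)) + strip_map.Ix M vs b0 (length vs) - 1 = length vs" using strip_map.sum_m[OF s, of "length vs"] by simp
  have "outer_walk M (Suc (strip_map.Jx M vs b0 (length vs))) (strip_map.Ix M vs b0 (length vs)) (strip_map.Jx M vs b0) (strip_map.Ix M vs b0)
     (strip_map.pp M vs b0) (strip_map.rr M vs b0) ((!) vs) a0"
    by (rule outer_walk.intro[OF strip_list_ex(1)[OF M] st outer_walk_axioms.intro[OF a0]])
      (use strip_map.vs_face(3)[OF s] mm in simp)
  then have "numbered_walk (Suc (strip_map.Jx M vs b0 (length vs))) (strip_map.Ix M vs b0 (length vs)) (strip_map.Jx M vs b0) (strip_map.Ix M vs b0)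
     (strip_map.pp M vs b0) (strip_map.rr M vs b0) ((!) vs) a0 M" by (rule numbered_walk.intro[OF _ numbered_walk_axioms.intro[OF num]])
  then show ?thesis using mm strip_map.rr_0[OF s] by blast
qed

theorem theorem3p16:
  shows "\<exists>(P :: com) (c :: nat) (k :: nat).
    \<forall>(M :: (nat, nat) pmap) (r :: nat) (n :: nat).
      maximal_path_like M \<and> numbered M \<and> r \<in> outer_face M \<and> n = card (verts (underlying M)) \<longrightarrow>
      (\<exists>t s. exec (n ^ k) P (input_state M r) t s \<and> t \<le> c * n \<and>
         (if regs s 0 = 0
          then realizer (cells M) (P_VEF M) (map (output_order M s) [0, 1, 2])
          else order_dim (cells M) (P_VEF M) = 4))"
proof (rule exI[of _ program], rule exI[of _ 19000], rule exI[of _ 10], intro allI impI)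
  fix M :: "(nat, nat) pmap" and r n :: nat
  assume h: "maximal_path_like M \<and> numbered M \<and> r \<in> outer_face M \<and> n = card (verts (underlying M))"
  then have M: "maximal_path_like M" and num: "numbered M" and a0: "r \<in> outer_face M" and n: "n = card (verts (underlying M))" by auto
  obtain vs where vs: "strip_list M vs" using strip_list_ex(2)[OF M] by blast
  obtain b0 where b0: "strip_map M vs b0" using strip_start[OF M vs] by blast
  obtain K N J I p q where S: "numbered_walk K N J I p q ((!) vs) r M" and KN: "K + N - 1 = length vs"
    using strip_staircase[OF M num a0 b0] by blast
  define A where "A = card (arcs (underlying M))"
  have A: "A \<le> 4 * n" "3 \<le> n" using numbered_walk.few_arcs[OF S] numbered_walk.three_verts[OF S] unfolding n A_def numbered_walk.A_def[OF S] by auto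
  \<comment> \<open>The largest numbers computed are bounds for keys, about \<open>48 * n\<close>,
    as the ranks stay below \<open>16 * n\<close>. Since \<open>n \<ge> 3\<close> and
    \<open>3 ^ 9 = 19683\<close>, the tenth power of \<open>n\<close> leaves ample room for
    them.\<close>
  have W: "49 * n + 2 * A + 20 < n ^ 10"
  proof -
    have "3 ^ 9 \<le> n ^ 9" using A(2) by (rule power_mono) simp
    moreover have "3 ^ 9 = (19683 :: nat)" by simp
    ultimately have "19683 \<le> n ^ 9" by (simp only:)
    then have "19683 * n \<le> n ^ 9 * n" by (rule mult_le_mono1)
    moreover have "n ^ 9 * n = n ^ 10" using power_Suc2[of n 9] by simp
    ultimately have "19683 * n \<le> n ^ 10" by (simp only:)
    then show ?thesis using A by linarith
  qed
  have "runs (n ^ 10) program (input_state M r) (14000 * n + 1000 * A + 3000) (\<lambda>s.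
     if regs s 0 = 0 then realizer (cells M) (P_VEF M) (map (output_order M s) [0, 1, 2]) else order_dim (cells M) (P_VEF M) = 4)"
  proof (cases "2 \<le> length vs")
    case True
    have vs': "strip_list M (rev vs)" by (rule strip_list_rev[OF vs])
    obtain b1 where b1: "strip_map M (rev vs) b1" using strip_start[OF M vs'] by blast
    obtain K' N' J' I' p' q' where S': "numbered_walk K' N' J' I' p' q' ((!) (rev vs)) r M"
      using strip_staircase[OF M num a0 b1] by blast
    have "rev vs ! t = vs ! (K + N - 1 - 1 - t)" if "t < K + N - 1" for t using that unfolding KN by (simp add: rev_nth)
    from numbered_walk.outcome[OF S S' _ this] W True show ?thesis
      unfolding KN n A_def numbered_walk.A_def[OF S] by blast
  next
    case False
    moreover have "vs \<noteq> []" using vs unfolding strip_list_def by (rule conjunct1)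
    then have "0 < length vs" by simp
    ultimately have l1: "length vs = 1" by linarith
    \<comment> \<open>Each vertex of a single triangle can serve as \<open>r 0\<close>. The strip is
      set up again from the arc that puts \<open>r 0\<close> at position 2, where the program makes
      its second attempt.\<close>
    let ?o = "outer_walk.walk M r 2"
    have ow: "outer_walk M K N J I p q ((!) vs) r" by (rule numbered_walk.axioms(1)[OF S])
    note sp = strip_list_ex(1)[OF M]
    have o: "?o \<in> outer_face M" "?o \<in> arcs (underlying M)" by (rule outer_walk.walk_outer[OF ow], rule outer_walk.walk_arc[OF ow])
    have ro: "edge_rev M ?o \<notin> outer_face M"
      using strip_map.no_bridges[OF b0] o(1) unfolding strip_map.bridges_def[OF b0] by blast
    have "edge_rev M ?o \<in> vs ! 0"
      using strip_map.arc_cases[OF b0 simple_pmap.rv_facts(2)[OF sp o(2)]] ro l1 by simp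
    then have b1: "strip_map M vs (edge_rev M ?o)" using strip_map_of_list[OF M vs] l1 by simp
    obtain K' N' J' I' p' q' where S': "numbered_walk K' N' J' I' p' q' ((!) vs) r M" and KN': "K' + N' - 1 = length vs"
      and q0: "q' 0 = head (underlying M) (edge_rev M ?o)"
      using strip_staircase[OF M num a0 b1] by blast
    have "outer_walk.wv M r 2 = q' 0"
      unfolding q0 outer_walk.wv_def[OF ow] using simple_pmap.rv_facts(4)[OF sp o(2)] by simp
    from numbered_walk.outcome_triangle[OF S' _ this] W l1 show ?thesis
      unfolding KN' n A_def numbered_walk.A_def[OF S'] by blast
  qed
  then obtain t s where t: "exec (n ^ 10) program (input_state M r) t s" "t \<le> 14000 * n + 1000 * A + 3000"
    "if regs s 0 = 0 then realizer (cells M) (P_VEF M) (map (output_order M s) [0, 1, 2]) else order_dim (cells M) (P_VEF M) = 4"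
    unfolding runs_def by blast
  \<comment> \<open>\<open>1000 * A\<close> is at most \<open>4000 * n\<close>, and the constant
    3000 is at most \<open>1000 * n\<close> because \<open>n \<ge> 3\<close>.\<close>
  have "t \<le> 19000 * n" using t(2) A by linarith
  then show "\<exists>t s. exec (n ^ 10) program (input_state M r) t s \<and> t \<le> 19000 * n \<and>
     (if regs s 0 = 0 then realizer (cells M) (P_VEF M) (map (output_order M s) [0, 1, 2]) else order_dim (cells M) (P_VEF M) = 4)"
    using t by blast
qed

end
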